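(* Suppose that the deficiency indices of the expression $l[y]$ at the end $b$ satisfy $n_{b+}=n_{b-}=0$. Then: 1) the triplet $\Pi=\{H^n,\Gamma_0,\Gamma_1\}$ with $$\Gamma_0y=y^{(2)}(0),\qquad\Gamma_1y=-y^{(1)}(0),\qquad y\in\mathcal D,$$ is a (unique decomposing) boundary triplet for $L$. Moreover the corresponding selfadjoint extension $A_0$ is given by $\mathcal D(A_0)=\{y\in\mathcal D:y^{(2)}(0)=0\}$, $A_0=L\upharpoonright\mathcal D(A_0)$; 2) for every $\lambda\in\rho(A_0)$ there exists a unique operator solution $v_0(\cdot,\lambda)\in L_2'[H^n,H]$ of the equation $l[y]-\lambda y=0$ obeying the condition $v_0^{(2)}(0,\lambda)=I_{H^n}$. Moreover, the $\gamma$-field $\gamma(\lambda)$ of the boundary triplet $\Pi$ is connected with $v_0$ by $$(\gamma(\lambda)\hat h)(t)=v_0(t,\lambda)\hat h,\qquad\hat h\in H^n,\ \lambda\in\rho(A_0);$$ 3) the $m$-function $m(\cdot):\rho(A_0)\to[H^n]$ corresponding to the extension $A_0$ is uniquely defined by the condition $$-c(t,\lambda)m(\lambda)+s(t,\lambda)\in L_2'[H^n,H],\qquad\lambda\in\rho(A_0),$$ which implies the equality $m(\lambda)=-v_0^{(1)}(0,\lambda)$. Moreover, the Weyl function $M(\cdot)$ corresponding to the boundary triplet $\Pi$ is $M(\lambda)=m(\lambda)$, $\lambda\in\rho(A_0)$.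
   Context: **Setting.** $[X,Y]$ is the set of bounded linear operators from a Hilbert space $X$ to a Hilbert space $Y$, $[X]=[X,X]$. $\mathbb C_\pm$ are the open upper/lower half-planes. $\Delta=[0,b\rangle$ with $0<b\le\infty$ (if $b<\infty$, $b$ may or may not belong to $\Delta$), $H$ is a separable complex Hilbert space ($\dim H\le\infty$), $D=d/dt$, and $$l[y]=\sum_{k=1}^n(-1)^k\Big(D^k(p_{n-k}D^ky)-\tfrac i2\big[D^{k-1}(q_{n-k}^*D^ky)+D^k(q_{n-k}D^{k-1}y)\big]\Big)+p_ny$$ with sufficiently smooth coefficients $p_k,q_k:\Delta\to[H]$, $p_k(t)=p_k^*(t)$, $p_0(t)^{-1}\in[H]$. Quasi-derivatives: $y^{[k]}=D^ky$ ($0\le k\le n-1$), $y^{[n]}=p_0D^ny-\frac i2q_0D^{n-1}y$, $y^{[n+k]}=-Dy^{[n+k-1]}+p_kD^{n-k}y+\frac i2(q_{k-1}^*D^{n-k+1}y-q_kD^{n-k-1}y)$ ($1\le k\le n-1$), $y^{[2n]}=-Dy^{[2n-1]}+p_ny+\frac i2q_{n-1}^*Dy=l[y]$; the same formulas apply to operator functions $Y:\Delta\to[\mathcal K,H]$. Put $y^{(1)}(t)=(y^{[0]}(t),\dots,y^{[n-1]}(t))$, $y^{(2)}(t)=(y^{[2n-1]}(t),\dots,y^{[n]}(t))$ (columns, in $H^n$, resp. $[\mathcal K,H^n]$), $\widetilde y(t)=\{y^{(1)}(t),y^{(2)}(t)\}$. An operator solution of $l[y]-\lambda y=0$ is a $[\mathcal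 K,H]$-valued solution; $c(\cdot,\lambda),s(\cdot,\lambda):\Delta\to[H^n,H]$ are the operator solutions with $c^{(1)}(0,\lambda)=I_{H^n}$, $c^{(2)}(0,\lambda)=0$, $s^{(1)}(0,\lambda)=0$, $s^{(2)}(0,\lambda)=I_{H^n}$. $\mathfrak H=L_2(\Delta;H)$; $L_2'[\mathcal K,H]$ is the set of $Y:\Delta\to[\mathcal K,H]$ with $Y(\cdot)h\in\mathfrak H$ for all $h\in\mathcal K$. The maximal operator $L$ has domain $\mathcal D=\{y\in\mathfrak H:\ y^{[k]}\ (0\le k\le2n-2)$ continuously differentiable, $y^{[2n-1]}$ (locally) absolutely continuous, $l[y]\in\mathfrak H\}$ and $Ly=l[y]$. Put $[y,z](t)=(y^{(1)}(t),z^{(2)}(t))-(y^{(2)}(t),z^{(1)}(t))$, $[y,z](b)=\lim_{t\uparrow b}[y,z](t)$. The minimal operator $L_0$ is the restriction of $L$ to $\{y\in\mathcal D:\widetilde y(0)=0,\ [y,z](b)=0\ \forall z\in\mathcal D\}$; it is closed, densely defined, symmetric and $L_0^*=L$. $\mathfrak N_\lambda(L_0)=\mathrm{Ker}(L-\lambda)$. **Deficiency indices at $b$.** For a selfadjoint linear relation $\theta$ in $H^n$ let $L_\theta$ be the restriction of $L$ to $\{y\in\mathcal D:\widetilde y(0)\in\theta,\ [y,z](b)=0\ \forall z\in\mathcal D\}$, a symmetric extension of $L_0$. Its deficiency indices $n_\pm(L_\theta)=\dim\mathrm{Ker}(L_\theta^*-\lambda)$, $\lambda\in\mathbb C_\pm$,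 do not depend on $\theta=\theta^*$; put $n_{b\pm}=n_\pm(L_\theta)$. **Boundary triplets.** $\{\mathcal H,\Gamma_0,\Gamma_1\}$ ($\mathcal H$ a Hilbert space, $\Gamma_j:\mathcal D\to\mathcal H$ linear) is a boundary triplet for $L$ if $(\Gamma_0\;\Gamma_1)^\top:\mathcal D\to\mathcal H\oplus\mathcal H$ is surjective and $(Ly,z)-(y,Lz)=(\Gamma_1y,\Gamma_0z)-(\Gamma_0y,\Gamma_1z)$, $y,z\in\mathcal D$. It is decomposing if $\mathcal H=H^n\oplus\mathcal H'$ for a Hilbert space $\mathcal H'$ and $\Gamma_0y=\{y^{(2)}(0),\Gamma_0'y\}$, $\Gamma_1y=\{-y^{(1)}(0),\Gamma_1'y\}$ with linear $\Gamma_j':\mathcal D\to\mathcal H'$. The corresponding selfadjoint extension is $A_0=L\upharpoonright\mathrm{Ker}\Gamma_0$. For $\lambda\in\rho(A_0)$ the $\gamma$-field is $\gamma(\lambda)=(\Gamma_0\upharpoonright\mathfrak N_\lambda(L_0))^{-1}\in[\mathcal H,\mathfrak H]$ and the Weyl function $M(\lambda)\in[\mathcal H]$ is defined by $\Gamma_1y=M(\lambda)\Gamma_0y$, $y\in\mathfrak N_\lambda(L_0)$. For a decomposing boundary triplet the $m$-function corresponding to $A_0$ is the upper left block $m(\lambda)=P_{H^n}M(\lambda)\upharpoonright H^n$. *)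

theory Defs
  imports "HOL-Analysis.Analysis" "HOL-Library.Extended_Nat"
begin

section \<open>Complex Hilbert spaces\<close>

class complex_normed_vector = real_normed_vector +
  fixes scaleC :: "complex \<Rightarrow> 'a \<Rightarrow> 'a"  (infixr "*\<^sub>C" 75)
  assumes scaleC_add_right: "c *\<^sub>C (x + y) = c *\<^sub>C x + c *\<^sub>C y"
    and scaleC_add_left: "(c + d) *\<^sub>C x = c *\<^sub>C x + d *\<^sub>C x"
    and scaleC_scaleC: "c *\<^sub>C d *\<^sub>C x = (c * d) *\<^sub>C x"
    and scaleR_scaleC: "r *\<^sub>R x = complex_of_real r *\<^sub>C x"
    and norm_scaleC: "norm (c *\<^sub>C x) = cmod c * norm x"

text \<open>
  The inner product is linear in its first argument. The zero space is not excluded.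
\<close>

class complex_hilbert = complex_normed_vector + real_inner + complete_space +
  fixes cinner :: "'a \<Rightarrow> 'a \<Rightarrow> complex"
  assumes cinner_add_left: "cinner (x + y) z = cinner x z + cinner y z"
    and cinner_scaleC_left: "cinner (c *\<^sub>C x) y = c * cinner x y"
    and cinner_commute: "cinner x y = cnj (cinner y x)"
    and inner_eq_Re_cinner: "inner x y = Re (cinner x y)"

instantiation vec :: (complex_normed_vector, finite) complex_normed_vector
begin
definition scaleC_vec_def: "c *\<^sub>C (x :: 'a ^ 'b) = (\<chi> i. c *\<^sub>C (x $ i))"
instance
  by standard
    (auto simp: scaleC_vec_def vec_eq_iff scaleC_add_right scaleC_add_left scaleC_scaleC
      scaleR_scaleC norm_vec_def norm_scaleC L2_set_right_distrib)
end

instantiation vec :: (complex_hilbert, finite) complex_hilbert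
begin
definition cinner_vec_def: "cinner (x :: 'a ^ 'b) y = (\<Sum>i\<in>UNIV. cinner (x $ i) (y $ i))"
instance
  by standard
    (auto simp: cinner_vec_def scaleC_vec_def cinner_add_left sum.distrib cinner_scaleC_left
      sum_distrib_left inner_vec_def inner_eq_Re_cinner intro!: sum.cong simp flip: cinner_commute)
end

instantiation prod :: (complex_normed_vector, complex_normed_vector) complex_normed_vector
begin
definition scaleC_prod_def: "c *\<^sub>C x = (c *\<^sub>C fst x, c *\<^sub>C snd x)"
instance
  by standard
    (auto simp: scaleC_prod_def scaleC_add_right scaleC_add_left scaleC_scaleC scaleR_scaleC
      norm_prod_def norm_scaleC power_mult_distrib real_sqrt_mult simp flip: distrib_left)
end

instantiation prod :: (complex_hilbert, complex_hilbert) complex_hilbert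
begin
definition cinner_prod_def: "cinner x y = cinner (fst x) (fst y) + cinner (snd x) (snd y)"
instance
  by standard
    (auto simp: cinner_prod_def scaleC_prod_def cinner_add_left cinner_scaleC_left algebra_simps
      inner_prod_def inner_eq_Re_cinner simp flip: cinner_commute)
end

lemma scaleC_one [simp]: "1 *\<^sub>C (x :: 'a :: complex_normed_vector) = x"
  using scaleR_scaleC [of 1 x] by simp

lemma bounded_linear_scaleC: "bounded_linear (\<lambda>x :: 'a :: complex_normed_vector. c *\<^sub>C x)"
  by (rule bounded_linear_intro [where K = "cmod c"])
    (auto simp: scaleC_add_right scaleR_scaleC scaleC_scaleC norm_scaleC mult.commute)

instantiation blinfun :: (real_normed_vector, complex_normed_vector) complex_normed_vector
begin
definition scaleC_blinfun_def: "c *\<^sub>C A = Blinfun (\<lambda>x. c *\<^sub>C blinfun_apply A x)"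

lemma blinfun_apply_scaleC [simp]: "blinfun_apply (c *\<^sub>C A) x = c *\<^sub>C blinfun_apply A x"
  unfolding scaleC_blinfun_def
  by (subst bounded_linear_Blinfun_apply)
    (auto intro: bounded_linear_compose [OF bounded_linear_scaleC] blinfun.bounded_linear_right)

instance
proof
  fix c d :: complex and r :: real and x y :: "'a \<Rightarrow>\<^sub>L 'b"
  show "c *\<^sub>C (x + y) = c *\<^sub>C x + c *\<^sub>C y" "(c + d) *\<^sub>C x = c *\<^sub>C x + d *\<^sub>C x"
    "c *\<^sub>C d *\<^sub>C x = (c * d) *\<^sub>C x" "r *\<^sub>R x = complex_of_real r *\<^sub>C x"
    by (auto intro!: blinfun_eqI simp: blinfun.add_left blinfun.scaleR_left scaleC_add_right
        scaleC_add_left scaleC_scaleC scaleR_scaleC)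
  have le: "norm (a *\<^sub>C z) \<le> cmod a * norm z" for a and z :: "'a \<Rightarrow>\<^sub>L 'b"
    by (rule norm_blinfun_bound)
      (auto simp: norm_scaleC mult.assoc intro: mult_left_mono norm_blinfun)
  show "norm (c *\<^sub>C x) = cmod c * norm x"
  proof (cases "c = 0")
    case True
    then show ?thesis using le [of c x] by simp
  next
    case False
    have "inverse c *\<^sub>C c *\<^sub>C x = x"
      using False by (intro blinfun_eqI) (simp add: scaleC_scaleC)
    then have "norm x \<le> inverse (cmod c) * norm (c *\<^sub>C x)"
      using le [of "inverse c" "c *\<^sub>C x"] by (simp add: norm_inverse)
    then have "cmod c * norm x \<le> norm (c *\<^sub>C x)"
      using False by (simp add: field_simps)
    with le show ?thesis by (simp add: antisym)
  qed
qed
end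

text \<open>The zero Hilbert space.\<close>

instantiation unit :: real_inner
begin
definition "(0 :: unit) = ()"
definition "(x :: unit) + y = ()"
definition "r *\<^sub>R (x :: unit) = ()"
definition "norm (x :: unit) = 0"
definition "sgn (x :: unit) = ()"
definition "dist (x :: unit) (y :: unit) = 0"
definition "uniformity = (INF e\<in>{0<..}. principal {(x :: unit, y). dist x y < e})"
definition "open (U :: unit set) \<longleftrightarrow> (\<forall>x\<in>U. \<forall>\<^sub>F (x', y) in uniformity. x' = x \<longrightarrow> y \<in> U)"
definition "inner (x :: unit) (y :: unit) = 0"
instance
  by standard
    (auto simp: zero_unit_def scaleR_unit_def norm_unit_def sgn_unit_def dist_unit_def
      inner_unit_def uniformity_unit_def open_unit_def)
end

instantiation unit :: complex_hilbert
begin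
definition "c *\<^sub>C (x :: unit) = ()"
definition "cinner (x :: unit) (y :: unit) = 0"
instance
proof
  show "convergent X" if "Cauchy X" for X :: "nat \<Rightarrow> unit"
    by (rule convergentI [of _ "()"]) (simp add: tendsto_iff dist_unit_def)
qed (auto simp: scaleC_unit_def norm_unit_def inner_unit_def cinner_unit_def)
end

text \<open>
  The spaces $[X, Y]$: bounded complex linear operators, as elements of the type of bounded real
  linear operators, whose norm is the same.
\<close>

definition clinear_op :: "('a :: complex_normed_vector \<Rightarrow>\<^sub>L 'b :: complex_normed_vector) \<Rightarrow> bool" where
  "clinear_op A \<longleftrightarrow> (\<forall>c x. blinfun_apply A (c *\<^sub>C x) = c *\<^sub>C blinfun_apply A x)"

definition cadjoint :: "('a :: complex_hilbert \<Rightarrow>\<^sub>L 'b :: complex_hilbert) \<Rightarrow> 'b \<Rightarrow>\<^sub>L 'a" where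
  "cadjoint A = (THE B. \<forall>x y. cinner (blinfun_apply A x) y = cinner x (blinfun_apply B y))"

text \<open>
  Linear relations in a Hilbert space. An adjoint relation is closed and linear, so these
  properties need not be demanded separately from a selfadjoint one.
\<close>

definition rel_adjoint :: "('a :: complex_hilbert \<times> 'a) set \<Rightarrow> ('a \<times> 'a) set" where
  "rel_adjoint \<theta> = {(h, k). \<forall>(f, g)\<in>\<theta>. cinner g h = cinner f k}"

definition selfadjoint_rel :: "('a :: complex_hilbert \<times> 'a) set \<Rightarrow> bool" where
  "selfadjoint_rel \<theta> \<longleftrightarrow> rel_adjoint \<theta> = \<theta>"


section \<open>The differential expression\<close>

text \<open>
  Half of the order \<open>n\<close>, the right endpoint \<open>b\<close>, the interval \<open>\<Delta>\<close>, and the coefficients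
  \<open>p\<^sub>0, \<dots>, p\<^sub>n\<close> and \<open>q\<^sub>0, \<dots>, q\<^sub>n\<^sub>-\<^sub>1\<close>; values for other indices or outside \<open>\<Delta>\<close> are irrelevant.
\<close>

record (overloaded) ('h :: real_normed_vector) dexpr =
  half_order :: nat
  endpt :: ereal
  ivl :: "real set"
  pcoef :: "nat \<Rightarrow> real \<Rightarrow> 'h \<Rightarrow>\<^sub>L 'h"
  qcoef :: "nat \<Rightarrow> real \<Rightarrow> 'h \<Rightarrow>\<^sub>L 'h"

definition ddt :: "'h :: complex_hilbert dexpr \<Rightarrow> (real \<Rightarrow> 'v :: real_normed_vector) \<Rightarrow> real \<Rightarrow> 'v" where
  "ddt E f = (\<lambda>t. vector_derivative f (at t within ivl E))"

definition C1 :: "'h :: complex_hilbert dexpr \<Rightarrow> (real \<Rightarrow> 'v :: real_normed_vector) \<Rightarrow> bool" where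
  "C1 E f \<longleftrightarrow> (\<forall>t\<in>ivl E. f differentiable (at t within ivl E)) \<and> continuous_on (ivl E) (ddt E f)"

definition Ck :: "'h :: complex_hilbert dexpr \<Rightarrow> nat \<Rightarrow> (real \<Rightarrow> 'v :: real_normed_vector) \<Rightarrow> bool" where
  "Ck E k f \<longleftrightarrow> continuous_on (ivl E) f \<and> (\<forall>j<k. C1 E ((ddt E ^^ j) f))"

text \<open>
  "Sufficiently smooth" is read as: every coefficient is as often continuously differentiable
  (in operator norm) as it is differentiated in the expression.
\<close>

definition valid_dexpr :: "'h :: complex_hilbert dexpr \<Rightarrow> bool" where
  "valid_dexpr E \<longleftrightarrow>
     0 < half_order E \<and> 0 < endpt E \<and>
     (ivl E = {t. 0 \<le> t \<and> ereal t < endpt E} \<or> ivl E = {t. 0 \<le> t \<and> ereal t \<le> endpt E}) \<and>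
     (\<forall>k\<le>half_order E. Ck E (half_order E - k) (pcoef E k) \<and>
        (\<forall>t\<in>ivl E. clinear_op (pcoef E k t) \<and> cadjoint (pcoef E k t) = pcoef E k t)) \<and>
     (\<forall>k<half_order E. Ck E (half_order E - k) (qcoef E k) \<and>
        (\<forall>t\<in>ivl E. clinear_op (qcoef E k t))) \<and>
     (\<forall>t\<in>ivl E. \<exists>B. clinear_op B \<and>
        B o\<^sub>L pcoef E 0 t = id_blinfun \<and> pcoef E 0 t o\<^sub>L B = id_blinfun)"

text \<open>
  Quasi-derivatives. The argument \<open>act\<close> is the action of operators on the values of \<open>y\<close>:
  application for \<open>H\<close>-valued functions, composition for operator functions.
  \<open>upper_quasi act E y j\<close> is the quasi-derivative of index \<open>n + j\<close>; the conditional in the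
  recursive clause drops the term with the non-existing \<open>q\<^sub>n\<close> in the quasi-derivative of index \<open>2n\<close>.
\<close>

primrec upper_quasi :: "(('h \<Rightarrow>\<^sub>L 'h) \<Rightarrow> 'v \<Rightarrow> 'v) \<Rightarrow> 'h :: complex_hilbert dexpr \<Rightarrow>
    (real \<Rightarrow> 'v :: complex_normed_vector) \<Rightarrow> nat \<Rightarrow> real \<Rightarrow> 'v" where
  "upper_quasi act E y 0 = (\<lambda>t. let n = half_order E in
     act (pcoef E 0 t) ((ddt E ^^ n) y t) - (\<i> / 2) *\<^sub>C act (qcoef E 0 t) ((ddt E ^^ (n - 1)) y t))"
| "upper_quasi act E y (Suc j) = (\<lambda>t. let n = half_order E; k = Suc j in
     - ddt E (upper_quasi act E y j) t + act (pcoef E k t) ((ddt E ^^ (n - k)) y t)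
     + (\<i> / 2) *\<^sub>C (act (cadjoint (qcoef E (k - 1) t)) ((ddt E ^^ (n - k + 1)) y t)
         - (if k < n then act (qcoef E k t) ((ddt E ^^ (n - k - 1)) y t) else 0)))"

definition quasi :: "(('h \<Rightarrow>\<^sub>L 'h) \<Rightarrow> 'v \<Rightarrow> 'v) \<Rightarrow> 'h :: complex_hilbert dexpr \<Rightarrow>
    nat \<Rightarrow> (real \<Rightarrow> 'v :: complex_normed_vector) \<Rightarrow> real \<Rightarrow> 'v" where
  "quasi act E k y =
     (if k < half_order E then (ddt E ^^ k) y else upper_quasi act E y (k - half_order E))"

abbreviation qd :: "'h :: complex_hilbert dexpr \<Rightarrow> nat \<Rightarrow> (real \<Rightarrow> 'h) \<Rightarrow> real \<Rightarrow> 'h" where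
  "qd \<equiv> quasi blinfun_apply"

abbreviation op_qd :: "'h :: complex_hilbert dexpr \<Rightarrow> nat \<Rightarrow>
    (real \<Rightarrow> 'k :: complex_normed_vector \<Rightarrow>\<^sub>L 'h) \<Rightarrow> real \<Rightarrow> 'k \<Rightarrow>\<^sub>L 'h" where
  "op_qd \<equiv> quasi (o\<^sub>L)"

text \<open>
  \<open>l[y]\<close> is taken to be the quasi-derivative of index \<open>2n\<close>; the lemma below shows that this is the
  given expression (\<open>l_formula\<close>) wherever the derivatives in the latter can be taken term by term.
\<close>

definition l_expr :: "'h :: complex_hilbert dexpr \<Rightarrow> (real \<Rightarrow> 'h) \<Rightarrow> real \<Rightarrow> 'h" where
  "l_expr E y = qd E (2 * half_order E) y"

definition l_formula :: "'h :: complex_hilbert dexpr \<Rightarrow> (real \<Rightarrow> 'h) \<Rightarrow> real \<Rightarrow> 'h" where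
  "l_formula E y = (\<lambda>t. let n = half_order E; p = pcoef E; q = qcoef E in
     (\<Sum>k = 1..n. (- 1) ^ k *\<^sub>R
        ((ddt E ^^ k) (\<lambda>s. blinfun_apply (p (n - k) s) ((ddt E ^^ k) y s)) t
         - (\<i> / 2) *\<^sub>C
           ((ddt E ^^ (k - 1)) (\<lambda>s. blinfun_apply (cadjoint (q (n - k) s)) ((ddt E ^^ k) y s)) t
            + (ddt E ^^ k) (\<lambda>s. blinfun_apply (q (n - k) s) ((ddt E ^^ (k - 1)) y s)) t)))
     + blinfun_apply (p n t) (y t))"

lemma has_vector_derivative_ddt:
  assumes "f differentiable (at t within ivl E)"
  shows "(f has_vector_derivative ddt E f t) (at t within ivl E)"
  using assms by (simp add: ddt_def flip: vector_derivative_works)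

lemma ddt_eqI:
  assumes "valid_dexpr E" "t \<in> ivl E" "(f has_vector_derivative d) (at t within ivl E)"
  shows "ddt E f t = d"
proof -
  have ivl: "0 < endpt E"
    "ivl E = {t. 0 \<le> t \<and> ereal t < endpt E} \<or> ivl E = {t. 0 \<le> t \<and> ereal t \<le> endpt E}"
    using assms(1) unfolding valid_dexpr_def by blast+
  obtain x where x: "0 < x" "ereal x < endpt E"
    using ivl(1) ereal_dense2 [of 0 "endpt E"] by (auto simp: zero_ereal_def)
  have lt: "ereal v < c" if "ereal w < c" "v \<le> w" for v w c
    using that(2) by (intro le_less_trans [OF _ that(1)]) simp
  have le: "ereal v \<le> c" if "ereal w \<le> c" "v \<le> w" for v w c
    using that(2) by (intro order.trans [OF _ that(1)]) simp
  have "is_interval (ivl E)"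
    unfolding is_interval_1 using ivl(2) by (elim disjE) (auto intro: lt le)
  then have "connected (ivl E)"
    by (rule is_interval_connected)
  moreover have "0 \<in> ivl E" "x \<in> ivl E"
    using ivl x by (elim disjE; simp add: zero_ereal_def)+
  ultimately have "t islimpt ivl E"
    using connected_imp_perfect [of "ivl E" t] assms(2) x(1) by fastforce
  then have "at t within ivl E \<noteq> bot"
    by (simp add: trivial_limit_within)
  then show ?thesis
    unfolding ddt_def using assms(3) by (rule vector_derivative_within)
qed

lemma has_vector_derivative_cong_ivl:
  assumes "\<And>s. s \<in> ivl E \<Longrightarrow> f s = g s" "t \<in> ivl E"
  shows "(f has_vector_derivative d) (at t within ivl E) \<longleftrightarrow>
    (g has_vector_derivative d) (at t within ivl E)"
  by (rule has_vector_derivative_cong_ev) (use assms in \<open>auto intro!: always_eventually\<close>)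

lemma ddt_cong:
  assumes "\<And>s. s \<in> ivl E \<Longrightarrow> f s = g s" "t \<in> ivl E"
  shows "ddt E f t = ddt E g t"
  unfolding ddt_def vector_derivative_def
  using has_vector_derivative_cong_ivl [of E f g t, OF assms] by simp

lemma has_vector_derivative_scaleC:
  "(f has_vector_derivative d) F \<Longrightarrow>
    ((\<lambda>t. c *\<^sub>C f t) has_vector_derivative c *\<^sub>C (d :: 'v :: complex_normed_vector)) F"
  by (rule bounded_linear.has_vector_derivative [OF bounded_linear_scaleC])

definition kdiff :: "'h :: complex_hilbert dexpr \<Rightarrow> nat \<Rightarrow> (real \<Rightarrow> 'v :: real_normed_vector) \<Rightarrow> bool" where
  "kdiff E k f \<longleftrightarrow> (\<forall>j<k. \<forall>t\<in>ivl E. (ddt E ^^ j) f differentiable (at t within ivl E))"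

lemma Ck_imp_kdiff: "Ck E k f \<Longrightarrow> kdiff E k f"
  by (simp add: Ck_def C1_def kdiff_def)

lemma kdiff_lincomb:
  fixes f g :: "real \<Rightarrow> 'v :: complex_normed_vector"
  assumes "valid_dexpr E" "kdiff E k f" "kdiff E k g"
  shows "kdiff E k (\<lambda>t. a *\<^sub>C f t + b *\<^sub>C g t)"
    and "j \<le> k \<Longrightarrow> t \<in> ivl E \<Longrightarrow> (ddt E ^^ j) (\<lambda>t. a *\<^sub>C f t + b *\<^sub>C g t) t =
      a *\<^sub>C (ddt E ^^ j) f t + b *\<^sub>C (ddt E ^^ j) g t"
proof -
  let ?h = "\<lambda>t. a *\<^sub>C f t + b *\<^sub>C g t"
  have der: "((\<lambda>t. a *\<^sub>C (ddt E ^^ j) f t + b *\<^sub>C (ddt E ^^ j) g t) has_vector_derivative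
      a *\<^sub>C (ddt E ^^ Suc j) f t + b *\<^sub>C (ddt E ^^ Suc j) g t) (at t within ivl E)"
    if "j < k" "t \<in> ivl E" for j t
    using that assms(2,3) unfolding kdiff_def funpow.simps o_apply
    by (intro has_vector_derivative_add has_vector_derivative_scaleC has_vector_derivative_ddt) blast+
  have eq: "\<forall>t\<in>ivl E. (ddt E ^^ j) ?h t = a *\<^sub>C (ddt E ^^ j) f t + b *\<^sub>C (ddt E ^^ j) g t"
    if "j \<le> k" for j
    using that
  proof (induction j)
    case (Suc j)
    then have IH: "\<forall>t\<in>ivl E. (ddt E ^^ j) ?h t = a *\<^sub>C (ddt E ^^ j) f t + b *\<^sub>C (ddt E ^^ j) g t"
      by simp
    have "(ddt E ^^ Suc j) ?h t = ddt E (\<lambda>t. a *\<^sub>C (ddt E ^^ j) f t + b *\<^sub>C (ddt E ^^ j) g t) t"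
      if "t \<in> ivl E" for t
      using that IH ddt_cong [of E "(ddt E ^^ j) ?h"] by simp
    moreover have "ddt E (\<lambda>t. a *\<^sub>C (ddt E ^^ j) f t + b *\<^sub>C (ddt E ^^ j) g t) t =
        a *\<^sub>C (ddt E ^^ Suc j) f t + b *\<^sub>C (ddt E ^^ Suc j) g t" if "t \<in> ivl E" for t
      using der [of j t] Suc.prems that by (intro ddt_eqI [OF assms(1) that]) simp
    ultimately show ?case by presburger
  qed simp
  show "kdiff E k ?h"
    unfolding kdiff_def
  proof (intro allI impI ballI)
    fix j t assume jt: "j < k" "t \<in> ivl E"
    have "((ddt E ^^ j) ?h has_vector_derivative
        a *\<^sub>C (ddt E ^^ Suc j) f t + b *\<^sub>C (ddt E ^^ Suc j) g t) (at t within ivl E)"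
      using der [OF jt] eq [of j] jt
      by (subst has_vector_derivative_cong_ivl
            [where g = "\<lambda>t. a *\<^sub>C (ddt E ^^ j) f t + b *\<^sub>C (ddt E ^^ j) g t"]) auto
    then show "(ddt E ^^ j) ?h differentiable (at t within ivl E)"
      by (rule differentiableI_vector)
  qed
  show "j \<le> k \<Longrightarrow> t \<in> ivl E \<Longrightarrow> (ddt E ^^ j) ?h t =
      a *\<^sub>C (ddt E ^^ j) f t + b *\<^sub>C (ddt E ^^ j) g t"
    using eq by blast
qed

lemma ddt_zero:
  assumes "valid_dexpr (E :: 'h :: complex_hilbert dexpr)"
  shows "kdiff E k (\<lambda>_. 0 :: 'v :: real_normed_vector)" "t \<in> ivl E \<Longrightarrow> (ddt E ^^ j) (\<lambda>_. 0 :: 'v) t = 0"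
proof -
  have eq: "\<forall>t\<in>ivl E. (ddt E ^^ j) (\<lambda>_. 0 :: 'v) t = 0" for j
  proof (induction j)
    case (Suc j)
    have "ddt E ((ddt E ^^ j) (\<lambda>_. 0 :: 'v)) t = 0" if "t \<in> ivl E" for t
    proof -
      have "ddt E ((ddt E ^^ j) (\<lambda>_. 0 :: 'v)) t = ddt E (\<lambda>_. 0 :: 'v) t"
        using Suc that by (intro ddt_cong) blast+
      also have "\<dots> = 0"
        by (rule ddt_eqI [OF assms that has_vector_derivative_const])
      finally show ?thesis .
    qed
    then show ?case by simp
  qed simp
  then show "t \<in> ivl E \<Longrightarrow> (ddt E ^^ j) (\<lambda>_. 0 :: 'v) t = 0" by blast
  show "kdiff E k (\<lambda>_. 0 :: 'v)"
    unfolding kdiff_def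
  proof (intro allI impI ballI)
    fix j t assume "t \<in> ivl E"
    then have "((ddt E ^^ j) (\<lambda>_. 0 :: 'v) has_vector_derivative 0) (at t within ivl E)"
      using eq [of j] by (subst has_vector_derivative_cong_ivl [where g = "\<lambda>_. 0"]) simp_all
    then show "(ddt E ^^ j) (\<lambda>_. 0 :: 'v) differentiable (at t within ivl E)"
      by (rule differentiableI_vector)
  qed
qed

lemma l_expr_eq_l_formula:
  fixes E :: "'h :: complex_hilbert dexpr"
  defines "n \<equiv> half_order E" and "p \<equiv> pcoef E" and "q \<equiv> qcoef E"
  assumes valid: "valid_dexpr E" and t: "t \<in> ivl E"
    and p_term: "\<And>k. k \<le> n \<Longrightarrow> Ck E k (\<lambda>s. blinfun_apply (p (n - k) s) ((ddt E ^^ k) y s))"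
    and q_adj_term: "\<And>k. 1 \<le> k \<Longrightarrow> k \<le> n \<Longrightarrow>
      Ck E (k - 1) (\<lambda>s. blinfun_apply (cadjoint (q (n - k) s)) ((ddt E ^^ k) y s))"
    and q_term: "\<And>k. 1 \<le> k \<Longrightarrow> k \<le> n \<Longrightarrow>
      Ck E k (\<lambda>s. blinfun_apply (q (n - k) s) ((ddt E ^^ (k - 1)) y s))"
  shows "l_expr E y t = l_formula E y t"
proof -
  have n: "0 < n" using valid by (simp add: valid_dexpr_def n_def)
  define P where "P i = (\<lambda>s. blinfun_apply (p i s) ((ddt E ^^ (n - i)) y s))" for i
  define Q where "Q i = (\<lambda>s. if i = 0 then 0 else
    blinfun_apply (cadjoint (q (i - 1) s)) ((ddt E ^^ (n - i + 1)) y s))" for i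
  define R where "R i = (\<lambda>s. if i < n then
    blinfun_apply (q i s) ((ddt E ^^ (n - i - 1)) y s) else 0)" for i
  define G0 where "G0 i = (\<lambda>s. 1 *\<^sub>C Q i s + (- 1) *\<^sub>C R i s)" for i
  define G where "G i = (\<lambda>s. 1 *\<^sub>C P i s + (\<i> / 2) *\<^sub>C G0 i s)" for i
  have neg: "(- 1) *\<^sub>C x = - x" for x :: 'h
    using scaleR_scaleC [of "- 1" x] by simp
  have zero: "c *\<^sub>C (0 :: 'h) = 0" for c
    using scaleC_add_right [of c "0 :: 'h" 0] by simp
  have sub: "c *\<^sub>C (x - y) = c *\<^sub>C x - c *\<^sub>C y" for c and x y :: 'h
    using scaleC_add_right [of c "x - y" y] by simp
  have kP: "kdiff E (n - i) (P i)" if "i \<le> n" for i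
    using Ck_imp_kdiff [OF p_term [of "n - i"]] that by (simp add: P_def)
  have kQ: "kdiff E (n - i) (Q i)" if "i \<le> n" for i
  proof (cases "i = 0")
    case False
    then have "n - (n - i + 1) = i - 1" using that by simp
    then show ?thesis
      using Ck_imp_kdiff [OF q_adj_term [of "n - i + 1"]] that False by (simp add: Q_def)
  qed (simp add: Q_def ddt_zero [OF valid])
  have kR: "kdiff E (n - i) (R i)" if "i \<le> n" for i
  proof (cases "i = n")
    case False
    then show ?thesis
      using Ck_imp_kdiff [OF q_term [of "n - i"]] that by (simp add: R_def)
  qed (simp add: R_def ddt_zero [OF valid])
  have kG0: "kdiff E (n - i) (G0 i)" if "i \<le> n" for i
    unfolding G0_def by (intro kdiff_lincomb valid kQ kR that)
  have kG: "kdiff E (n - i) (G i)" if "i \<le> n" for i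
    unfolding G_def by (intro kdiff_lincomb valid kP kG0 that)
  have DG: "(ddt E ^^ (n - i)) (G i) t = (ddt E ^^ (n - i)) (P i) t
      + (\<i> / 2) *\<^sub>C ((ddt E ^^ (n - i)) (Q i) t - (ddt E ^^ (n - i)) (R i) t)" if "i \<le> n" for i
    unfolding G_def kdiff_lincomb(2) [OF valid kP [OF that] kG0 [OF that] order.refl t]
    unfolding G0_def kdiff_lincomb(2) [OF valid kQ [OF that] kR [OF that] order.refl t]
    by (simp add: neg)
  have upper: "\<forall>s\<in>ivl E. upper_quasi blinfun_apply E y j s =
      (\<Sum>i\<le>j. (- 1) ^ (j - i) *\<^sub>R (ddt E ^^ (j - i)) (G i) s)" if "j \<le> n" for j
    using that
  proof (induction j)
    case 0
    then show ?case
      using n by (simp add: G_def G0_def P_def Q_def R_def Let_def n_def p_def q_def neg sub zero)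
        (metis (no_types, lifting) diff_0 neg scaleC_scaleC mult.commute)
  next
    case (Suc j)
    have der: "(upper_quasi blinfun_apply E y j has_vector_derivative
        (\<Sum>i\<le>j. (- 1) ^ (j - i) *\<^sub>R (ddt E ^^ Suc (j - i)) (G i) s)) (at s within ivl E)"
      if s: "s \<in> ivl E" for s
    proof -
      have "((\<lambda>s. \<Sum>i\<le>j. (- 1) ^ (j - i) *\<^sub>R (ddt E ^^ (j - i)) (G i) s) has_vector_derivative
          (\<Sum>i\<le>j. (- 1) ^ (j - i) *\<^sub>R (ddt E ^^ Suc (j - i)) (G i) s)) (at s within ivl E)"
      proof (intro has_vector_derivative_sum
          bounded_linear.has_vector_derivative [OF bounded_linear_scaleR_right])
        fix i assume "i \<in> {..j}"
        then have "(ddt E ^^ (j - i)) (G i) differentiable (at s within ivl E)"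
          using kG [of i] Suc.prems s by (auto simp: kdiff_def)
        then show "((ddt E ^^ (j - i)) (G i) has_vector_derivative
            (ddt E ^^ Suc (j - i)) (G i) s) (at s within ivl E)"
          using has_vector_derivative_ddt by fastforce
      qed
      then show ?thesis
        using has_vector_derivative_cong_ivl
          [of E "upper_quasi blinfun_apply E y j" "\<lambda>s. \<Sum>i\<le>j. (- 1) ^ (j - i) *\<^sub>R (ddt E ^^ (j - i)) (G i) s"]
          Suc s by simp
    qed
    have "upper_quasi blinfun_apply E y (Suc j) s =
        - (\<Sum>i\<le>j. (- 1) ^ (j - i) *\<^sub>R (ddt E ^^ Suc (j - i)) (G i) s) + G (Suc j) s"
      if s: "s \<in> ivl E" for s
      using ddt_eqI [OF valid s der [OF s]]
      by (simp add: G_def G0_def P_def Q_def R_def Let_def n_def p_def q_def neg del: funpow.simps)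
    then show ?case
      by (auto simp: Suc_diff_le sum_negf simp del: funpow.simps upper_quasi.simps
          simp flip: sum_negf intro!: sum.cong)
  qed
  have "l_expr E y t = upper_quasi blinfun_apply E y n t"
    by (simp add: l_expr_def quasi_def n_def mult_2)
  also have "\<dots> = (\<Sum>i\<le>n. (- 1) ^ (n - i) *\<^sub>R (ddt E ^^ (n - i)) (G i) t)"
    using upper t by blast
  also have "\<dots> = (\<Sum>i\<le>n. (- 1) ^ (n - i) *\<^sub>R ((ddt E ^^ (n - i)) (P i) t
      + (\<i> / 2) *\<^sub>C ((ddt E ^^ (n - i)) (Q i) t - (ddt E ^^ (n - i)) (R i) t)))"
    using DG by (intro sum.cong) auto
  also have "\<dots> = (\<Sum>k\<le>n. (- 1) ^ k *\<^sub>R ((ddt E ^^ k) (P (n - k)) t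
      + (\<i> / 2) *\<^sub>C ((ddt E ^^ k) (Q (n - k)) t - (ddt E ^^ k) (R (n - k)) t)))"
    by (rule sum.reindex_bij_witness [where i = "\<lambda>k. n - k" and j = "\<lambda>k. n - k"]) auto
  also have "\<dots> = (\<Sum>k\<le>n. (- 1) ^ k *\<^sub>R ((ddt E ^^ k) (P (n - k)) t - (\<i> / 2) *\<^sub>C (ddt E ^^ k) (R (n - k)) t))
      + (\<Sum>k\<le>n. (- 1) ^ k *\<^sub>R (\<i> / 2) *\<^sub>C (ddt E ^^ k) (Q (n - k)) t)"
    unfolding sum.distrib [symmetric]
    by (intro sum.cong) (auto simp: sub scaleR_add_right scaleR_diff_right)
  also have "(\<Sum>k\<le>n. (- 1) ^ k *\<^sub>R ((ddt E ^^ k) (P (n - k)) t - (\<i> / 2) *\<^sub>C (ddt E ^^ k) (R (n - k)) t)) =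
      P n t + (\<Sum>k = 1..n. (- 1) ^ k *\<^sub>R ((ddt E ^^ k) (P (n - k)) t - (\<i> / 2) *\<^sub>C (ddt E ^^ k) (R (n - k)) t))"
    by (subst sum.atMost_shift) (simp add: R_def zero sum.atLeast1_atMost_eq lessThan_atLeast0)
  also have "(\<Sum>k\<le>n. (- 1) ^ k *\<^sub>R (\<i> / 2) *\<^sub>C (ddt E ^^ k) (Q (n - k)) t) =
      (\<Sum>k<n. (- 1) ^ k *\<^sub>R (\<i> / 2) *\<^sub>C (ddt E ^^ k) (Q (n - k)) t)"
    using t by (simp add: lessThan_Suc_atMost [symmetric] Q_def ddt_zero [OF valid] zero)
  also have "\<dots> = (\<Sum>k = 1..n. (- 1) ^ (k - 1) *\<^sub>R (\<i> / 2) *\<^sub>C (ddt E ^^ (k - 1)) (Q (n - (k - 1))) t)"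
    by (simp add: sum.atLeast1_atMost_eq)
  also have "\<dots> = (\<Sum>k = 1..n. (- 1) ^ k *\<^sub>R (- ((\<i> / 2) *\<^sub>C (ddt E ^^ (k - 1)) (Q (n - (k - 1))) t)))"
    by (intro sum.cong) (auto simp: power_eq_if)
  finally have main: "l_expr E y t = P n t
      + (\<Sum>k = 1..n. (- 1) ^ k *\<^sub>R ((ddt E ^^ k) (P (n - k)) t - (\<i> / 2) *\<^sub>C (ddt E ^^ k) (R (n - k)) t))
      + (\<Sum>k = 1..n. (- 1) ^ k *\<^sub>R (- ((\<i> / 2) *\<^sub>C (ddt E ^^ (k - 1)) (Q (n - (k - 1))) t)))" .
  have Pk: "P (n - k) = (\<lambda>s. blinfun_apply (p (n - k) s) ((ddt E ^^ k) y s))" if "k \<le> n" for k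
    using that by (simp add: P_def)
  have Rk: "R (n - k) = (\<lambda>s. blinfun_apply (q (n - k) s) ((ddt E ^^ (k - 1)) y s))"
    if "1 \<le> k" "k \<le> n" for k
    using that by (simp add: R_def)
  have Qk: "Q (Suc n - k) = (\<lambda>s. blinfun_apply (cadjoint (q (n - k) s)) ((ddt E ^^ k) y s))"
    if "1 \<le> k" "k \<le> n" for k
  proof -
    have "Suc n - k \<noteq> 0" "Suc n - k - 1 = n - k" "n - (Suc n - k) + 1 = k"
      using that by auto
    then show ?thesis unfolding Q_def by simp
  qed
  show ?thesis
    unfolding main l_formula_def Let_def
    unfolding n_def [symmetric] p_def [symmetric] q_def [symmetric]
    by (simp add: P_def add.assoc add.commute [of "blinfun_apply _ _"] flip: sum.distrib)
      (auto simp: Pk Qk Rk scaleC_add_right algebra_simps intro!: sum.cong)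
qed

text \<open>
  \<open>y\<^sup>(\<^sup>1\<^sup>)\<close> and \<open>y\<^sup>(\<^sup>2\<^sup>)\<close>. The space \<open>H\<^sup>n\<close> is \<open>'h ^ 'n\<close> with \<open>CARD('n) = n\<close>; the order of the index
  type \<open>'n\<close> serves to enumerate the components, and \<open>pos_of i \<in> {0, \<dots>, n - 1}\<close> is the position of \<open>i\<close>.
\<close>

definition pos_of :: "'n :: {finite, linorder} \<Rightarrow> nat" where
  "pos_of i = card {j. j < i}"

definition bv1 :: "'h :: complex_hilbert dexpr \<Rightarrow> (real \<Rightarrow> 'h) \<Rightarrow> real \<Rightarrow> ('h, 'n :: {finite, linorder}) vec" where
  "bv1 E y t = (\<chi> i. qd E (pos_of i) y t)"

definition bv2 :: "'h :: complex_hilbert dexpr \<Rightarrow> (real \<Rightarrow> 'h) \<Rightarrow> real \<Rightarrow> ('h, 'n :: {finite, linorder}) vec" where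
  "bv2 E y t = (\<chi> i. qd E (2 * half_order E - 1 - pos_of i) y t)"

definition column :: "('n \<Rightarrow> 'k :: complex_normed_vector \<Rightarrow>\<^sub>L 'h :: complex_normed_vector) \<Rightarrow>
    'k \<Rightarrow>\<^sub>L ('h, 'n :: finite) vec" where
  "column A = Blinfun (\<lambda>x. \<chi> i. blinfun_apply (A i) x)"

definition op_bv1 :: "'h :: complex_hilbert dexpr \<Rightarrow>
    (real \<Rightarrow> 'k :: complex_normed_vector \<Rightarrow>\<^sub>L 'h) \<Rightarrow> real \<Rightarrow> 'k \<Rightarrow>\<^sub>L ('h, 'n :: {finite, linorder}) vec" where
  "op_bv1 E Y t = column (\<lambda>i. op_qd E (pos_of i) Y t)"

definition op_bv2 :: "'h :: complex_hilbert dexpr \<Rightarrow>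
    (real \<Rightarrow> 'k :: complex_normed_vector \<Rightarrow>\<^sub>L 'h) \<Rightarrow> real \<Rightarrow> 'k \<Rightarrow>\<^sub>L ('h, 'n :: {finite, linorder}) vec" where
  "op_bv2 E Y t = column (\<lambda>i. op_qd E (2 * half_order E - 1 - pos_of i) Y t)"

text \<open>
  \<open>(y\<^sup>(\<^sup>1\<^sup>)(t), z\<^sup>(\<^sup>2\<^sup>)(t)) - (y\<^sup>(\<^sup>2\<^sup>)(t), z\<^sup>(\<^sup>1\<^sup>)(t))\<close> with the inner products of \<open>H\<^sup>n\<close> written out.
\<close>

definition bracket :: "'h :: complex_hilbert dexpr \<Rightarrow> (real \<Rightarrow> 'h) \<Rightarrow> (real \<Rightarrow> 'h) \<Rightarrow> real \<Rightarrow> complex" where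
  "bracket E y z t = (let n = half_order E in
     (\<Sum>k<n. cinner (qd E k y t) (qd E (2 * n - 1 - k) z t))
     - (\<Sum>k<n. cinner (qd E (2 * n - 1 - k) y t) (qd E k z t)))"

definition bracket_vanishes_b :: "'h :: complex_hilbert dexpr \<Rightarrow> (real \<Rightarrow> 'h) \<Rightarrow> (real \<Rightarrow> 'h) \<Rightarrow> bool" where
  "bracket_vanishes_b E y z \<longleftrightarrow>
     ((\<lambda>x. bracket E y z (real_of_ereal x)) \<longlongrightarrow> 0) (at_left (endpt E))"


section \<open>The space of square integrable functions and the maximal operator\<close>

text \<open>
  Elements of $L_2(\Delta; H)$ are represented by functions, equality of which means equality almost
  everywhere on \<open>\<Delta>\<close>. For a separable \<open>H\<close> Borel measurability is the same as strong measurability.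
\<close>

abbreviation leb :: "'h :: complex_hilbert dexpr \<Rightarrow> real measure" where
  "leb E \<equiv> lebesgue_on (ivl E)"

definition L2 :: "'h :: complex_hilbert dexpr \<Rightarrow> (real \<Rightarrow> 'h) set" where
  "L2 E = {f. f \<in> borel_measurable (leb E) \<and> integrable (leb E) (\<lambda>t. (norm (f t))\<^sup>2)}"

definition l2_inner :: "'h :: complex_hilbert dexpr \<Rightarrow> (real \<Rightarrow> 'h) \<Rightarrow> (real \<Rightarrow> 'h) \<Rightarrow> complex" where
  "l2_inner E f g = (LINT t|leb E. cinner (f t) (g t))"

definition l2_norm :: "'h :: complex_hilbert dexpr \<Rightarrow> (real \<Rightarrow> 'h) \<Rightarrow> real" where
  "l2_norm E f = sqrt (LINT t|leb E. (norm (f t))\<^sup>2)"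

definition op_L2 :: "'h :: complex_hilbert dexpr \<Rightarrow> (real \<Rightarrow> 'k :: complex_normed_vector \<Rightarrow>\<^sub>L 'h) set" where
  "op_L2 E = {Y. (\<forall>t\<in>ivl E. clinear_op (Y t)) \<and> (\<forall>x. (\<lambda>t. blinfun_apply (Y t) x) \<in> L2 E)}"

text \<open>
  The dimension (a natural number or \<open>\<infinity>\<close>) of a closed subspace of the separable space
  $L_2(\Delta; H)$, given by its set of representatives.
\<close>

definition l2_dim :: "'h :: complex_hilbert dexpr \<Rightarrow> (real \<Rightarrow> 'h) set \<Rightarrow> enat" where
  "l2_dim E S = Sup {enat (card F) | F. finite F \<and> F \<subseteq> S \<and>
     (\<forall>f\<in>F. \<forall>g\<in>F. l2_inner E f g = (if f = g then 1 else 0))}"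

text \<open>
  Operators in $L_2(\Delta; H)$ are given by their graphs, which are closed under changing
  representatives.
\<close>

type_synonym 'h l2_op = "((real \<Rightarrow> 'h) \<times> (real \<Rightarrow> 'h)) set"

definition l2_adjoint :: "'h :: complex_hilbert dexpr \<Rightarrow> 'h l2_op \<Rightarrow> 'h l2_op" where
  "l2_adjoint E A = {(z, w). z \<in> L2 E \<and> w \<in> L2 E \<and>
     (\<forall>(u, f)\<in>A. l2_inner E f z = l2_inner E u w)}"

definition l2_selfadjoint :: "'h :: complex_hilbert dexpr \<Rightarrow> 'h l2_op \<Rightarrow> bool" where
  "l2_selfadjoint E A \<longleftrightarrow> l2_adjoint E A = A"

definition l2_kernel :: "'h :: complex_hilbert dexpr \<Rightarrow> 'h l2_op \<Rightarrow> complex \<Rightarrow> (real \<Rightarrow> 'h) set" where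
  "l2_kernel E A \<zeta> = {u. (u, \<lambda>t. \<zeta> *\<^sub>C u t) \<in> A}"

text \<open>
  The first condition says that \<open>A - \<zeta>\<close> is injective with bounded inverse, the second one that it
  is onto.
\<close>

definition l2_resolvent_set :: "'h :: complex_hilbert dexpr \<Rightarrow> 'h l2_op \<Rightarrow> complex set" where
  "l2_resolvent_set E A = {\<zeta>.
     (\<exists>C. \<forall>(u, f)\<in>A. l2_norm E u \<le> C * l2_norm E (\<lambda>t. f t - \<zeta> *\<^sub>C u t)) \<and>
     (\<forall>g\<in>L2 E. \<exists>(u, f)\<in>A. AE t in leb E. f t - \<zeta> *\<^sub>C u t = g t)}"

definition abs_continuous_on :: "real \<Rightarrow> real \<Rightarrow> (real \<Rightarrow> 'v :: real_normed_vector) \<Rightarrow> bool" where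
  "abs_continuous_on a c f \<longleftrightarrow> (\<forall>\<epsilon>>0. \<exists>\<delta>>0. \<forall>d S.
     d division_of S \<and> S \<subseteq> {a..c} \<and> (\<Sum>K\<in>d. Sup K - Inf K) < \<delta> \<longrightarrow>
     (\<Sum>K\<in>d. norm (f (Sup K) - f (Inf K))) < \<epsilon>)"

definition loc_abs_continuous :: "'h :: complex_hilbert dexpr \<Rightarrow> (real \<Rightarrow> 'v :: real_normed_vector) \<Rightarrow> bool" where
  "loc_abs_continuous E f \<longleftrightarrow> (\<forall>c\<in>ivl E. abs_continuous_on 0 c f)"

text \<open>
  The domain \<open>\<D>\<close> of the maximal operator. A function on \<open>\<Delta>\<close> is represented by its extension by
  zero, so that equality in \<open>maxdom E\<close> is equality on \<open>\<Delta>\<close>. Since \<^const>\<open>vector_derivative\<close> is total,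
  it is stated explicitly that the derivative entering \<open>l[y]\<close> exists almost everywhere (which
  follows from the absolute continuity).
\<close>

definition maxdom :: "'h :: complex_hilbert dexpr \<Rightarrow> (real \<Rightarrow> 'h) set" where
  "maxdom E = {y. let n = half_order E in
     (\<forall>t. t \<notin> ivl E \<longrightarrow> y t = 0) \<and>
     y \<in> L2 E \<and>
     (\<forall>k\<le>2 * n - 2. C1 E (qd E k y)) \<and>
     loc_abs_continuous E (qd E (2 * n - 1) y) \<and>
     (AE t in leb E. qd E (2 * n - 1) y differentiable (at t within ivl E)) \<and>
     l_expr E y \<in> L2 E}"

text \<open>The graph of the restriction of the maximal operator \<open>L\<close> to \<open>S \<subseteq> maxdom E\<close>.\<close>

definition L_restr :: "'h :: complex_hilbert dexpr \<Rightarrow> (real \<Rightarrow> 'h) set \<Rightarrow> 'h l2_op" where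
  "L_restr E S = {(u, f). u \<in> L2 E \<and> f \<in> L2 E \<and>
     (\<exists>y\<in>S. (AE t in leb E. u t = y t) \<and> (AE t in leb E. f t = l_expr E y t))}"

text \<open>The kernel of \<open>L - \<zeta>\<close>.\<close>

definition defect_space :: "'h :: complex_hilbert dexpr \<Rightarrow> complex \<Rightarrow> (real \<Rightarrow> 'h) set" where
  "defect_space E \<zeta> = {y \<in> maxdom E. AE t in leb E. l_expr E y t = \<zeta> *\<^sub>C y t}"


section \<open>Deficiency indices at the endpoint\<close>

definition L_theta :: "'h :: complex_hilbert dexpr \<Rightarrow>
    (('h, 'n :: {finite, linorder}) vec \<times> ('h, 'n) vec) set \<Rightarrow> 'h l2_op" where
  "L_theta E \<theta> = L_restr E
     {y \<in> maxdom E. (bv1 E y 0, bv2 E y 0) \<in> \<theta> \<and> (\<forall>z\<in>maxdom E. bracket_vanishes_b E y z)}"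

text \<open>
  The indices \<open>n\<^sub>b\<^sub>+\<close> and \<open>n\<^sub>b\<^sub>-\<close>. They depend neither on the selfadjoint relation \<open>\<theta>\<close> nor on the points
  of the half-planes, so any choice of these may be used to determine them. The first argument
  provides the index type of \<open>H\<^sup>n\<close>.
\<close>

definition deficiency_indices_b :: "'n :: {finite, linorder} itself \<Rightarrow>
    'h :: complex_hilbert dexpr \<Rightarrow> enat \<Rightarrow> enat \<Rightarrow> bool" where
  "deficiency_indices_b (_ :: 'n itself) E np nm \<longleftrightarrow>
     (\<exists>(\<theta> :: (('h, 'n) vec \<times> ('h, 'n) vec) set) \<zeta>p \<zeta>m. selfadjoint_rel \<theta> \<and> 0 < Im \<zeta>p \<and> Im \<zeta>m < 0 \<and>
        l2_dim E (l2_kernel E (l2_adjoint E (L_theta E \<theta>)) \<zeta>p) = np \<and>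
        l2_dim E (l2_kernel E (l2_adjoint E (L_theta E \<theta>)) \<zeta>m) = nm)"


section \<open>Operator solutions\<close>

text \<open>\<open>[\<K>, H]\<close>-valued solutions of \<open>l[y] - \<zeta>y = 0\<close>, again extended by zero.\<close>

definition op_solution :: "'h :: complex_hilbert dexpr \<Rightarrow> complex \<Rightarrow>
    (real \<Rightarrow> 'k :: complex_normed_vector \<Rightarrow>\<^sub>L 'h) \<Rightarrow> bool" where
  "op_solution E \<zeta> Y \<longleftrightarrow>
     (\<forall>t. t \<notin> ivl E \<longrightarrow> Y t = 0) \<and>
     (\<forall>t\<in>ivl E. clinear_op (Y t)) \<and>
     (\<forall>k\<le>2 * half_order E - 1. C1 E (op_qd E k Y)) \<and>
     (\<forall>t\<in>ivl E. op_qd E (2 * half_order E) Y t = \<zeta> *\<^sub>C Y t)"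

definition c_sol :: "'h :: complex_hilbert dexpr \<Rightarrow> complex \<Rightarrow>
    real \<Rightarrow> ('h, 'n :: {finite, linorder}) vec \<Rightarrow>\<^sub>L 'h" where
  "c_sol E \<zeta> = (THE Y. op_solution E \<zeta> Y \<and>
     op_bv1 E Y 0 = (id_blinfun :: ('h, 'n) vec \<Rightarrow>\<^sub>L ('h, 'n) vec) \<and>
     op_bv2 E Y 0 = (0 :: ('h, 'n) vec \<Rightarrow>\<^sub>L ('h, 'n) vec))"

definition s_sol :: "'h :: complex_hilbert dexpr \<Rightarrow> complex \<Rightarrow>
    real \<Rightarrow> ('h, 'n :: {finite, linorder}) vec \<Rightarrow>\<^sub>L 'h" where
  "s_sol E \<zeta> = (THE Y. op_solution E \<zeta> Y \<and>
     op_bv1 E Y 0 = (0 :: ('h, 'n) vec \<Rightarrow>\<^sub>L ('h, 'n) vec) \<and>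
     op_bv2 E Y 0 = (id_blinfun :: ('h, 'n) vec \<Rightarrow>\<^sub>L ('h, 'n) vec))"


section \<open>Boundary triplets\<close>

definition clinear_on_maxdom :: "'h :: complex_hilbert dexpr \<Rightarrow>
    ((real \<Rightarrow> 'h) \<Rightarrow> 'g :: complex_normed_vector) \<Rightarrow> bool" where
  "clinear_on_maxdom E \<Gamma> \<longleftrightarrow>
     (\<forall>y\<in>maxdom E. \<forall>z\<in>maxdom E. \<forall>a b. \<Gamma> (\<lambda>t. a *\<^sub>C y t + b *\<^sub>C z t) = a *\<^sub>C \<Gamma> y + b *\<^sub>C \<Gamma> z)"

definition boundary_triplet :: "'h :: complex_hilbert dexpr \<Rightarrow>
    ((real \<Rightarrow> 'h) \<Rightarrow> 'g :: complex_hilbert) \<Rightarrow> ((real \<Rightarrow> 'h) \<Rightarrow> 'g) \<Rightarrow> bool" where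
  "boundary_triplet E \<Gamma>0 \<Gamma>1 \<longleftrightarrow>
     clinear_on_maxdom E \<Gamma>0 \<and> clinear_on_maxdom E \<Gamma>1 \<and>
     (\<lambda>y. (\<Gamma>0 y, \<Gamma>1 y)) ` maxdom E = UNIV \<and>
     (\<forall>y\<in>maxdom E. \<forall>z\<in>maxdom E.
        l2_inner E (l_expr E y) z - l2_inner E y (l_expr E z) =
        cinner (\<Gamma>1 y) (\<Gamma>0 z) - cinner (\<Gamma>0 y) (\<Gamma>1 z))"

text \<open>
  Decomposing boundary triplets: the boundary space is \<open>H\<^sup>n \<oplus> \<H>'\<close>, with \<open>'k\<close> for \<open>\<H>'\<close>. The maps
  \<open>\<Gamma>\<^sub>j'\<close> are the second components of \<open>\<Gamma>\<^sub>j\<close>, hence linear.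
\<close>

definition decomposing_triplet :: "'h :: complex_hilbert dexpr \<Rightarrow>
    ((real \<Rightarrow> 'h) \<Rightarrow> ('h, 'n :: {finite, linorder}) vec \<times> 'k :: complex_hilbert) \<Rightarrow>
    ((real \<Rightarrow> 'h) \<Rightarrow> ('h, 'n) vec \<times> 'k) \<Rightarrow> bool" where
  "decomposing_triplet E \<Gamma>0 \<Gamma>1 \<longleftrightarrow>
     boundary_triplet E \<Gamma>0 \<Gamma>1 \<and>
     (\<forall>y\<in>maxdom E. fst (\<Gamma>0 y) = bv2 E y 0 \<and> fst (\<Gamma>1 y) = - bv1 E y 0)"

definition A_zero :: "'h :: complex_hilbert dexpr \<Rightarrow>
    ((real \<Rightarrow> 'h) \<Rightarrow> 'g :: complex_hilbert) \<Rightarrow> 'h l2_op" where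
  "A_zero E \<Gamma>0 = L_restr E {y \<in> maxdom E. \<Gamma>0 y = 0}"

definition gamma_field :: "'h :: complex_hilbert dexpr \<Rightarrow>
    ((real \<Rightarrow> 'h) \<Rightarrow> 'g :: complex_hilbert) \<Rightarrow> complex \<Rightarrow> 'g \<Rightarrow> real \<Rightarrow> 'h" where
  "gamma_field E \<Gamma>0 \<zeta> = the_inv_into (defect_space E \<zeta>) \<Gamma>0"

definition weyl_function :: "'h :: complex_hilbert dexpr \<Rightarrow>
    ((real \<Rightarrow> 'h) \<Rightarrow> 'g :: complex_hilbert) \<Rightarrow> ((real \<Rightarrow> 'h) \<Rightarrow> 'g) \<Rightarrow> complex \<Rightarrow> 'g \<Rightarrow>\<^sub>L 'g" where
  "weyl_function E \<Gamma>0 \<Gamma>1 \<zeta> = (THE M. clinear_op M \<and>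
     (\<forall>y\<in>defect_space E \<zeta>. \<Gamma>1 y = blinfun_apply M (\<Gamma>0 y)))"

text \<open>The upper left block of the Weyl function of a decomposing boundary triplet.\<close>

definition m_function :: "'h :: complex_hilbert dexpr \<Rightarrow>
    ((real \<Rightarrow> 'h) \<Rightarrow> ('h, 'n :: {finite, linorder}) vec \<times> 'k :: complex_hilbert) \<Rightarrow>
    ((real \<Rightarrow> 'h) \<Rightarrow> ('h, 'n) vec \<times> 'k) \<Rightarrow> complex \<Rightarrow> ('h, 'n) vec \<Rightarrow>\<^sub>L ('h, 'n) vec" where
  "m_function E \<Gamma>0 \<Gamma>1 \<zeta> =
     Blinfun (\<lambda>x. fst (blinfun_apply (weyl_function E \<Gamma>0 \<Gamma>1 \<zeta>) (x, 0)))"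

end

(* The equation l[y] = f is equivalent to a first order system Y' = A Y - J f for the vector Y of
   quasi-derivatives, and the indefinite form [y,x] = (y1,x2) - (y2,x1) satisfies the Lagrange
   identity for it.  A solution z of l[z] = 0 is controlled by its L2 norm on a short interval
   [0,c]: the integral of |z|^2 is at least eps |Z(0)|^2.  Hence the Gram operator of these
   solutions is invertible, and for every initial vector there is an element of the maximal domain
   with this initial vector that vanishes beyond c and depends boundedly on it.  The functions f
   whose solutions with zero initial data vanish beyond c are those orthogonal to the solutions of
   l[z] = 0 on [0,c], which identifies adjoints of restrictions of L.

   If both deficiency indices at b vanish, the adjoint of the symmetric relation L_theta is
   symmetric.  It contains every element of the maximal domain with zero initial data, so together
   with the compactly supported elements above this gives [y,x](b) = 0 for all y and x.  Green's
   formula then has no contribution at b, so the initial values of y alone form a boundary triplet,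
   and A_0 is selfadjoint.

   For lambda in the resolvent set of A_0, correcting a lift of the value y2(0) = h by the
   resolvent yields the unique square integrable solution gamma(lambda) h of l[y] = lambda y with
   y2(0) = h; it is v_0 h with v_0 = s - c m. *)
theory Submission
  imports Defs
begin

text \<open>\<open>'h\<close> may be infinite dimensional, so the unit sphere of initial vectors is
  not compact and the lower bound for the Gram form cannot be read off from a minimising vector. It
  is proved along a sequence of unit vectors whose solutions tend to 0 in L2: the fundamental
  solution is uniformly continuous in operator norm, which makes this convergence uniform and
  carries it to derivatives, hence through all 2n quasi-derivatives to the unit vectors themselves.

  From the indices only the triviality of two kernels is known, for one \<theta> and one point of
  each half-plane. It gives dense ranges; the estimate
  \<open>\<bar>Im \<nu>\<bar> * |u| \<le> |f - \<nu> u|\<close> moves density to i and -i in small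
  steps. As the ranges are merely dense, symmetry of the adjoint is obtained up to every epsilon.

  The right side f is only square integrable. Solutions are therefore meant almost everywhere, with
  absolute continuity carried along, and the state components below the last are shown to be
  continuously differentiable afterwards, because their equations do not contain f.\<close>

instance complex_hilbert \<subseteq> banach ..

section \<open>Algebra of the complex inner product\<close>

lemma scaleC_zero_right [simp]: "c *\<^sub>C (0 :: 'a :: complex_normed_vector) = 0"
  using scaleC_add_right [of c "0 :: 'a" 0] by simp

lemma scaleC_zero_left [simp]: "0 *\<^sub>C (x :: 'a :: complex_normed_vector) = 0"
  using scaleC_add_left [of 0 0 x] by simp

lemma scaleC_minus_right: "c *\<^sub>C (- x) = - (c *\<^sub>C (x :: 'a :: complex_normed_vector))"
  using scaleC_add_right [of c x "- x"] by (simp add: eq_neg_iff_add_eq_0 add.commute)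

lemma scaleC_minus_left: "(- c) *\<^sub>C x = - (c *\<^sub>C (x :: 'a :: complex_normed_vector))"
  using scaleC_add_left [of c "- c" x] by (simp add: eq_neg_iff_add_eq_0 add.commute)

lemma scaleC_diff_right: "c *\<^sub>C (x - y) = c *\<^sub>C x - c *\<^sub>C (y :: 'a :: complex_normed_vector)"
  using scaleC_add_right [of c x "- y"] by (simp add: scaleC_minus_right)

lemma cinner_add_right: "cinner x (y + z) = cinner x y + cinner x (z :: 'a :: complex_hilbert)"
  using cinner_add_left [of y z x] cinner_commute [of x "y + z"] cinner_commute [of x y]
    cinner_commute [of x z] by simp

lemma cinner_scaleC_right: "cinner x (c *\<^sub>C y) = cnj c * cinner x (y :: 'a :: complex_hilbert)"
  using cinner_scaleC_left [of c y x] cinner_commute [of x "c *\<^sub>C y"] cinner_commute [of x y] by simp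

lemma cinner_zero_left [simp]: "cinner 0 (x :: 'a :: complex_hilbert) = 0"
  using cinner_add_left [of 0 0 x] by simp

lemma cinner_zero_right [simp]: "cinner x (0 :: 'a :: complex_hilbert) = 0"
  using cinner_add_right [of x 0 0] by simp

lemma cinner_minus_left: "cinner (- x) y = - cinner x (y :: 'a :: complex_hilbert)"
  using cinner_add_left [of x "- x" y] by (simp add: eq_neg_iff_add_eq_0 add.commute)

lemma cinner_minus_right: "cinner x (- y) = - cinner x (y :: 'a :: complex_hilbert)"
  using cinner_add_right [of x y "- y"] by (simp add: eq_neg_iff_add_eq_0 add.commute)

lemma cinner_diff_left: "cinner (x - y) z = cinner x z - cinner y (z :: 'a :: complex_hilbert)"
  using cinner_add_left [of x "- y" z] by (simp add: cinner_minus_left)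

lemma cinner_diff_right: "cinner x (y - z) = cinner x y - cinner x (z :: 'a :: complex_hilbert)"
  using cinner_add_right [of x y "- z"] by (simp add: cinner_minus_right)

lemmas cinner_algebra = cinner_add_left cinner_add_right cinner_diff_left cinner_diff_right
  cinner_minus_left cinner_minus_right cinner_scaleC_left cinner_scaleC_right

lemma cinner_self: "cinner x (x :: 'a :: complex_hilbert) = complex_of_real ((norm x)\<^sup>2)"
proof (rule complex_eqI)
  show "Re (cinner x x) = Re (complex_of_real ((norm x)\<^sup>2))"
    by (simp add: power2_norm_eq_inner inner_eq_Re_cinner)
  have "cnj (cinner x x) = cinner x x"
    using cinner_commute [of x x] by simp
  then show "Im (cinner x x) = Im (complex_of_real ((norm x)\<^sup>2))"
    by (simp add: complex_eq_iff)
qed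

text \<open>The phase \<open>c\<close> turns the complex product into its modulus without
  lengthening \<open>x\<close>; the Cauchy-Schwarz inequality of the underlying real inner product
  then applies.\<close>

lemma norm_cinner_le: "norm (cinner x y) \<le> norm x * norm (y :: 'a :: complex_hilbert)"
proof -
  define c where "c = cnj (sgn (cinner x y))"
  have c: "cmod c \<le> 1" by (simp add: c_def norm_sgn)
  have "c * cinner x y = complex_of_real (cmod (cinner x y))"
  proof (cases "cinner x y = 0")
    case False
    have "c * cinner x y = complex_of_real ((cmod (cinner x y))\<^sup>2) / complex_of_real (cmod (cinner x y))"
      by (simp add: c_def sgn_eq mult.commute complex_norm_square [symmetric])
    then show ?thesis using False by (simp add: power2_eq_square)
  qed simp
  then have "cmod (cinner x y) = Re (cinner (c *\<^sub>C x) y)"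
    by (simp add: cinner_scaleC_left)
  also have "\<dots> = inner (c *\<^sub>C x) y" by (simp add: inner_eq_Re_cinner)
  also have "\<dots> \<le> norm (c *\<^sub>C x) * norm y"
    by (rule norm_cauchy_schwarz)
  also have "\<dots> \<le> 1 * norm x * norm y"
    unfolding norm_scaleC by (intro mult_right_mono c norm_ge_zero)
  finally show ?thesis by simp
qed

lemma bounded_bilinear_cinner: "bounded_bilinear (cinner :: 'a :: complex_hilbert \<Rightarrow> 'a \<Rightarrow> complex)"
proof
  show "\<exists>K. \<forall>a b :: 'a. norm (cinner a b) \<le> norm a * norm b * K"
    by (rule exI [of _ 1]) (simp add: norm_cinner_le)
qed (simp_all add: cinner_add_left cinner_add_right scaleR_scaleC cinner_scaleC_left
    cinner_scaleC_right scaleR_conv_of_real)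

lemmas continuous_on_cinner [continuous_intros] =
  bounded_bilinear.continuous_on [OF bounded_bilinear_cinner]

section \<open>Representation of functionals and existence of adjoints\<close>

lemma cinner_eq_zeroI:
  assumes "\<And>y. Re (cinner x y) = 0"
  shows "x = (0 :: 'a :: complex_hilbert)"
  using assms [of x] by (simp add: cinner_self)

lemma cinner_eqI:
  assumes "\<And>z. cinner x z = cinner y (z :: 'a :: complex_hilbert)"
  shows "x = y"
  using cinner_eq_zeroI [of "x - y"] assms by (simp add: cinner_diff_left)

text \<open>The minimum of \<open>a x x - 2 \<phi> x\<close> is attained: minimising sequences are Cauchy by the
  parallelogram law.\<close>

lemma coercive_real_form_represents:
  fixes a :: "'v :: banach \<Rightarrow> 'v \<Rightarrow> real" and \<phi> :: "'v \<Rightarrow> real"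
  assumes a: "bounded_bilinear a" and sym: "\<And>x y. a x y = a y x"
    and coercive: "\<And>x. \<epsilon> * (norm x)\<^sup>2 \<le> a x x" "0 < \<epsilon>" and \<phi>: "bounded_linear \<phi>"
  shows "\<exists>k. \<forall>x. a k x = \<phi> x"
proof -
  interpret a: bounded_bilinear a by fact
  interpret \<phi>: bounded_linear \<phi> by fact
  define I where "I x = a x x - 2 * \<phi> x" for x
  obtain C where C: "\<And>x. norm (\<phi> x) \<le> norm x * C" "0 \<le> C"
    using \<phi>.nonneg_bounded by blast
  have low: "- (C\<^sup>2 / \<epsilon>) \<le> I x" for x
  proof -
    have "0 \<le> (\<epsilon> * norm x - C)\<^sup>2 / \<epsilon>" using coercive(2) by simp
    also have "\<dots> = \<epsilon> * (norm x)\<^sup>2 - 2 * (norm x * C) + C\<^sup>2 / \<epsilon>"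
      using coercive(2) by (simp add: power2_eq_square field_simps)
    finally show ?thesis using coercive(1) [of x] C(1) [of x] by (simp add: I_def)
  qed
  then have bdd: "bdd_below (range I)" by (intro bdd_belowI [of _ "- (C\<^sup>2 / \<epsilon>)"]) auto
  define d where "d = Inf (range I)"
  have d: "d \<le> I x" for x unfolding d_def by (rule cInf_lower [OF _ bdd]) simp
  have "\<exists>x. I x < d + 1 / real (Suc m)" for m
    using cInf_lessD [of "range I" "d + 1 / real (Suc m)"] by (auto simp: d_def)
  then obtain X where X: "\<And>m. I (X m) < d + 1 / real (Suc m)" by metis
  \<comment> \<open>The parallelogram law for \<open>a\<close>; the linear part of \<open>I\<close>
    cancels. As the midpoint costs at least \<open>d\<close>, two near-minimisers must be close to
    each other.\<close>
  have para: "a (x - y) (x - y) = 2 * I x + 2 * I y - 4 * I ((1/2) *\<^sub>R (x + y))" for x y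
    unfolding I_def by (simp add: a.add_left a.add_right a.diff_left a.diff_right a.scaleR_left
        a.scaleR_right \<phi>.add \<phi>.scale algebra_simps sym [of y x])
  have dist: "\<epsilon> * (norm (X m - X l))\<^sup>2 \<le> 2 / real (Suc m) + 2 / real (Suc l)" for m l
    using coercive(1) [of "X m - X l"] para [of "X m" "X l"] X [of m] X [of l]
      d [of "(1/2) *\<^sub>R (X m + X l)"] by simp
  have "Cauchy X"
  proof (rule metric_CauchyI)
    fix e :: real assume e: "0 < e"
    obtain N :: nat where N: "4 / (\<epsilon> * e\<^sup>2) < N" using reals_Archimedean2 by blast
    have "dist (X m) (X l) < e" if ml: "m \<ge> N" "l \<ge> N" for m l
    proof -
      have pos: "0 < \<epsilon> * e\<^sup>2" using e coercive(2) by simp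
      have N0: "0 < real N" by (rule less_trans [OF _ N]) (use pos in simp)
      have "2 / real (Suc m) \<le> 2 / real N" "2 / real (Suc l) \<le> 2 / real N"
        using ml N0 by (auto intro!: divide_left_mono mult_pos_pos)
      then have "\<epsilon> * (norm (X m - X l))\<^sup>2 \<le> 4 / real N"
        using dist [of m l] by linarith
      also have "\<dots> < \<epsilon> * e\<^sup>2" using N N0 pos by (simp add: divide_simps mult.commute)
      finally have "(norm (X m - X l))\<^sup>2 < e\<^sup>2" using coercive(2) by simp
      then show ?thesis using e by (simp add: dist_norm power2_less_imp_less)
    qed
    then show "\<exists>M. \<forall>m\<ge>M. \<forall>n\<ge>M. dist (X m) (X n) < e" by blast
  qed
  then obtain k where k: "X \<longlonglongrightarrow> k" using Cauchy_convergent convergent_def by blast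
  have "(\<lambda>m. I (X m)) \<longlonglongrightarrow> I k"
    unfolding I_def by (intro tendsto_intros a.tendsto \<phi>.tendsto k)
  moreover have "(\<lambda>m. d + 1 / real (Suc m)) \<longlonglongrightarrow> d + 0"
    by (intro tendsto_intros LIMSEQ_inverse_real_of_nat [unfolded inverse_eq_divide])
  ultimately have "I k \<le> d + 0"
    by (rule LIMSEQ_le) (intro exI allI impI less_imp_le X)
  then have Ik: "I k \<le> d" by simp
  have "a k x = \<phi> x" for x
  proof (rule ccontr)
    define r where "r = a k x - \<phi> x"
    assume "a k x \<noteq> \<phi> x"
    then have r: "r \<noteq> 0" by (simp add: r_def)
    have quad: "0 \<le> 2 * t * r + t\<^sup>2 * a x x" for t
    proof -
      have "I (k + t *\<^sub>R x) = I k + 2 * t * r + t\<^sup>2 * a x x"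
        unfolding I_def r_def by (simp add: a.add_left a.add_right a.scaleR_left a.scaleR_right
            \<phi>.add \<phi>.scale power2_eq_square algebra_simps sym [of x k])
      then show ?thesis using Ik d [of "k + t *\<^sub>R x"] by linarith
    qed
    have axx: "0 \<le> a x x" 
      by (rule order_trans [OF _ coercive(1)]) (simp add: coercive(2) less_imp_le)
    \<comment> \<open>\<open>t = - r / w\<close> is nearly the minimiser of the quadratic in
      \<open>t\<close>; the added 1 keeps the denominator positive when \<open>a x x = 0\<close> and
      still leaves a negative value.\<close>
    define w where "w = a x x + 1"
    have w: "1 \<le> w" "a x x = w - 1" using axx by (simp_all add: w_def)
    have "2 * (- r / w) * r + (- r / w)\<^sup>2 * a x x = - (r\<^sup>2 / w) * (1 + 1 / w)"
      unfolding w(2) using w(1) by (simp add: power2_eq_square field_simps)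
    moreover have "0 < (r\<^sup>2 / w) * (1 + 1 / w)"
      using w r by (intro mult_pos_pos add_pos_pos divide_pos_pos) simp_all
    ultimately show False using quad [of "- r / w"] by simp
  qed
  then show ?thesis by blast
qed

text \<open>The real part determines such a functional, since
  \<open>Im (f x) = Re (f (\<i> *\<^sub>C x))\<close>.\<close>

lemma conj_linear_eqI:
  assumes "\<And>x. Re (f x) = Re (g x)" "\<And>x. f (\<i> *\<^sub>C x) = - \<i> * f x" "\<And>x. g (\<i> *\<^sub>C x) = - \<i> * g x"
  shows "f (x :: 'a :: complex_normed_vector) = g x"
  using assms(1) [of x] assms(1) [of "\<i> *\<^sub>C x", unfolded assms(2,3)] by (simp add: complex_eq_iff)

text \<open>The real theorem is applied to the real parts of form and functional; conjugate
  linearity of both sides then restores the imaginary parts.\<close>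

lemma coercive_form_represents:
  fixes a :: "'v :: {complex_normed_vector, banach} \<Rightarrow> 'v \<Rightarrow> complex" and \<phi> :: "'v \<Rightarrow> complex"
  assumes a: "bounded_bilinear a" and herm: "\<And>x y. a x y = cnj (a y x)"
    and cl: "\<And>x y. a x (\<i> *\<^sub>C y) = - \<i> * a x y"
    and coercive: "\<And>x. \<epsilon> * (norm x)\<^sup>2 \<le> Re (a x x)" "0 < \<epsilon>"
    and \<phi>: "bounded_linear \<phi>" "\<And>x. \<phi> (\<i> *\<^sub>C x) = - \<i> * \<phi> x"
  shows "\<exists>k. \<forall>x. a k x = \<phi> x"
proof -
  have "\<exists>k. \<forall>x. Re (a k x) = Re (\<phi> x)"
  proof (rule coercive_real_form_represents)
    show "bounded_bilinear (\<lambda>x y. Re (a x y))"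
    proof
      obtain K where "\<And>x y. norm (a x y) \<le> norm x * norm y * K"
        using bounded_bilinear.bounded [OF a] by blast
      then show "\<exists>K. \<forall>x y. norm (Re (a x y)) \<le> norm x * norm y * K"
        using order_trans [OF abs_Re_le_cmod] by (intro exI [of _ K]) auto
    qed (simp_all add: bounded_bilinear.add_left [OF a] bounded_bilinear.add_right [OF a]
        bounded_bilinear.scaleR_left [OF a] bounded_bilinear.scaleR_right [OF a])
    show "Re (a x y) = Re (a y x)" for x y using herm [of x y] by simp
    show "\<epsilon> * (norm x)\<^sup>2 \<le> Re (a x x)" "0 < \<epsilon>" for x by fact+
    show "bounded_linear (\<lambda>x. Re (\<phi> x))"
      by (rule bounded_linear_compose [OF bounded_linear_Re \<phi>(1)])
  qed
  then obtain k where "\<And>x. Re (a k x) = Re (\<phi> x)" by blast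
  then have "a k x = \<phi> x" for x
    by (rule conj_linear_eqI [where f = "a k" and g = \<phi>]) (rule cl \<phi>(2))+
  then show ?thesis by blast
qed

text \<open>The coercive case of the inner product itself. The functionals are conjugate linear
  because the representing vector stands in the first slot.\<close>

lemma riesz_representation:
  fixes \<phi> :: "'v :: complex_hilbert \<Rightarrow> complex"
  assumes "bounded_linear \<phi>" "\<And>x. \<phi> (\<i> *\<^sub>C x) = - \<i> * \<phi> x"
  shows "\<exists>k. \<forall>x. cinner k x = \<phi> x"
proof (rule coercive_form_represents [where \<epsilon> = 1 and a = cinner and \<phi> = \<phi>])
  show "cinner x y = cnj (cinner y x)" for x y :: 'v by (rule cinner_commute)
qed (use assms in \<open>simp_all add: bounded_bilinear_cinner cinner_scaleC_right cinner_self\<close>)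

lemma clinear_op_scaleC: "clinear_op A \<Longrightarrow> blinfun_apply A (c *\<^sub>C x) = c *\<^sub>C blinfun_apply A x"
  by (simp add: clinear_op_def)

text \<open>\<open>cadjoint\<close> is a definite description and has meaning only once an adjoint
  is exhibited: \<open>B y\<close> represents the conjugate linear functional
  \<open>\<lambda>x. cinner y (blinfun_apply A x)\<close>.\<close>

lemma adjoint_exists:
  fixes A :: "'a :: complex_hilbert \<Rightarrow>\<^sub>L 'b :: complex_hilbert"
  assumes "clinear_op A"
  shows "\<exists>B. \<forall>x y. cinner (blinfun_apply A x) y = cinner x (blinfun_apply B y)"
proof -
  have "\<exists>k. \<forall>x. cinner k x = cinner y (blinfun_apply A x)" for y
    by (rule riesz_representation, rule bounded_linear_compose
        [OF bounded_bilinear.bounded_linear_right [OF bounded_bilinear_cinner]])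
      (auto intro: blinfun.bounded_linear_right simp: clinear_op_scaleC [OF assms] cinner_scaleC_right)
  then obtain B where B: "\<And>x y. cinner (B y) x = cinner y (blinfun_apply A x)" by metis
  have bl: "bounded_linear B"
  proof (rule bounded_linear_intro [where K = "norm A"])
    show "B (x + y) = B x + B y" for x y
      by (rule cinner_eqI) (simp add: B cinner_add_left)
    show "B (r *\<^sub>R x) = r *\<^sub>R B x" for r x
      by (rule cinner_eqI) (simp add: B cinner_scaleC_left scaleR_scaleC)
    show "norm (B x) \<le> norm x * norm A" for x
    proof (cases "B x = 0")
      case False
      have "(norm (B x))\<^sup>2 = norm (cinner (B x) (B x))" by (simp add: cinner_self norm_power)
      also have "\<dots> \<le> norm x * norm (blinfun_apply A (B x))" by (simp add: B norm_cinner_le)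
      also have "\<dots> \<le> norm x * (norm A * norm (B x))"
        by (intro mult_left_mono norm_blinfun norm_ge_zero)
      finally show ?thesis using False by (simp add: power2_eq_square mult.assoc [symmetric])
    qed simp
  qed
  have "cinner (blinfun_apply A x) y = cinner x (B y)" for x y
    by (metis B cinner_commute)
  then show ?thesis
    using bl by (intro exI [of _ "Blinfun B"]) (simp add: bounded_linear_Blinfun_apply)
qed

lemma adjoint_unique:
  fixes A :: "'a :: complex_hilbert \<Rightarrow>\<^sub>L 'b :: complex_hilbert"
  assumes "\<And>x y. cinner (blinfun_apply A x) y = cinner x (blinfun_apply B y)"
  shows "cadjoint A = B"
  unfolding cadjoint_def
proof (rule the_equality)
  fix B' assume B': "\<forall>x y. cinner (blinfun_apply A x) y = cinner x (blinfun_apply B' y)"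
  show "B' = B"
  proof (rule blinfun_eqI, rule cinner_eqI)
    fix y z
    have "cinner z (blinfun_apply B' y) = cinner z (blinfun_apply B y)"
      using assms B' by simp
    then show "cinner (blinfun_apply B' y) z = cinner (blinfun_apply B y) z"
      by (metis cinner_commute)
  qed
qed (use assms in simp)

lemma cadjoint_right:
  assumes "clinear_op A"
  shows "cinner (blinfun_apply A x) y = cinner x (blinfun_apply (cadjoint A) y)"
proof -
  obtain B where B: "\<And>x y. cinner (blinfun_apply A x) y = cinner x (blinfun_apply B y)"
    using adjoint_exists [OF assms] by blast
  then show ?thesis using adjoint_unique [of A B] by simp
qed

lemma cadjoint_left:
  assumes "clinear_op A"
  shows "cinner x (blinfun_apply A y) = cinner (blinfun_apply (cadjoint A) x) y"
  using cadjoint_right [OF assms, of y x] cinner_commute [of x "blinfun_apply A y"]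
    cinner_commute [of "blinfun_apply (cadjoint A) x" y] by simp

lemma clinear_op_cadjoint:
  assumes "clinear_op A"
  shows "clinear_op (cadjoint A)"
  unfolding clinear_op_def
proof (intro allI cinner_eqI)
  fix c x z
  show "cinner (blinfun_apply (cadjoint A) (c *\<^sub>C x)) z = cinner (c *\<^sub>C blinfun_apply (cadjoint A) x) z"
    unfolding cinner_scaleC_left cadjoint_left [OF assms, symmetric] by simp
qed

text \<open>The difference is tested on its own value \<open>w\<close>, where
  \<open>cinner w w = cinner y (blinfun_apply (A - B) w)\<close>. This makes the adjoint
  coefficients of the expression continuous in norm.\<close>

lemma norm_cadjoint_diff_le:
  fixes A B :: "'a :: complex_hilbert \<Rightarrow>\<^sub>L 'b :: complex_hilbert"
  assumes "clinear_op A" "clinear_op B"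
  shows "norm (cadjoint A - cadjoint B) \<le> norm (A - B)"
proof (rule norm_blinfun_bound)
  fix y
  define w where "w = blinfun_apply (cadjoint A - cadjoint B) y"
  show "norm w \<le> norm (A - B) * norm y"
  proof (cases "w = 0")
    case False
    have "(norm w)\<^sup>2 = norm (cinner w w)" by (simp add: cinner_self norm_power)
    also have "cinner w w = cinner y (blinfun_apply (A - B) w)"
      by (subst (1) w_def) (simp add: blinfun.diff_left cinner_diff_left cinner_diff_right
          cadjoint_left assms)
    also have "norm \<dots> \<le> norm y * norm (blinfun_apply (A - B) w)" by (rule norm_cinner_le)
    also have "\<dots> \<le> norm y * (norm (A - B) * norm w)"
      by (intro mult_left_mono norm_blinfun norm_ge_zero)
    also have "\<dots> = (norm (A - B) * norm y) * norm w" by simp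
    finally show ?thesis using False by (simp add: power2_eq_square)
  qed simp
qed simp

lemma continuous_on_cadjoint:
  fixes f :: "real \<Rightarrow> 'a :: complex_hilbert \<Rightarrow>\<^sub>L 'b :: complex_hilbert"
  assumes "continuous_on S f" "\<And>t. t \<in> S \<Longrightarrow> clinear_op (f t)"
  shows "continuous_on S (\<lambda>t. cadjoint (f t))"
  unfolding continuous_on_iff
proof (intro ballI allI impI)
  fix x e assume "x \<in> S" "0 < (e :: real)"
  then obtain d where "0 < d" "\<And>x'. x' \<in> S \<Longrightarrow> dist x' x < d \<Longrightarrow> dist (f x') (f x) < e"
    using assms(1) unfolding continuous_on_iff by blast
  then show "\<exists>d>0. \<forall>x'\<in>S. dist x' x < d \<longrightarrow> dist (cadjoint (f x')) (cadjoint (f x)) < e"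
    using norm_cadjoint_diff_le assms(2) \<open>x \<in> S\<close> unfolding dist_norm by (meson le_less_trans)
qed

text \<open>Rests on the identity \<open>B t - B s = B t o (P s - P t) o B s\<close>. For the
  leading coefficient it yields the continuous inverse with which the expression is turned into a
  first order system.\<close>

lemma continuous_on_inverse_blinfun:
  fixes P B :: "real \<Rightarrow> 'a :: real_normed_vector \<Rightarrow>\<^sub>L 'a"
  assumes P: "continuous_on S P"
    and inv: "\<And>t. t \<in> S \<Longrightarrow> B t o\<^sub>L P t = id_blinfun" "\<And>t. t \<in> S \<Longrightarrow> P t o\<^sub>L B t = id_blinfun"
  shows "continuous_on S B"
  unfolding continuous_on_iff
proof (intro ballI allI impI)
  fix s e assume s: "s \<in> S" and e: "0 < (e :: real)"
  define b where "b = norm (B s) + 1"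
  have b: "b > 0" "norm (B s) \<le> b" by (simp_all add: b_def add_nonneg_pos)
  \<comment> \<open>\<open>B t\<close> occurs on both sides of the estimate. The first bound absorbs
    half of \<open>norm (B t)\<close> and gives \<open>norm (B t) \<le> 2 * b\<close>; with that
    known, the second bound leaves \<open>e / 2\<close>.\<close>
  define \<eta> where "\<eta> = min (1 / (2 * b)) (e / (4 * b\<^sup>2))"
  have \<eta>: "0 < \<eta>" "\<eta> \<le> 1 / (2 * b)" "\<eta> \<le> e / (4 * b\<^sup>2)" using b e by (simp_all add: \<eta>_def)
  obtain d where d: "0 < d" "\<And>t. t \<in> S \<Longrightarrow> dist t s < d \<Longrightarrow> dist (P t) (P s) < \<eta>"
    using P s \<eta>(1) unfolding continuous_on_iff by blast
  have "dist (B t) (B s) < e" if t: "t \<in> S" "dist t s < d" for t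
  proof -
    have eq: "B t - B s = (B t o\<^sub>L (P s - P t)) o\<^sub>L B s"
    proof (rule blinfun_eqI)
      fix x
      have "blinfun_apply (P s) (blinfun_apply (B s) x) = x"
        using arg_cong [OF inv(2) [OF s], of "\<lambda>F. blinfun_apply F x"] by simp
      moreover have "blinfun_apply (B t) (blinfun_apply (P t) y) = y" for y
        using arg_cong [OF inv(1) [OF t(1)], of "\<lambda>F. blinfun_apply F y"] by simp
      ultimately show "blinfun_apply (B t - B s) x = blinfun_apply ((B t o\<^sub>L (P s - P t)) o\<^sub>L B s) x"
        by (simp add: blinfun.diff_left blinfun.diff_right)
    qed
    have P': "norm (P s - P t) \<le> \<eta>" using d(2) [OF t] by (simp add: dist_norm norm_minus_commute)
    have "norm (B t - B s) \<le> norm (B t o\<^sub>L (P s - P t)) * norm (B s)"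
      unfolding eq by (rule norm_blinfun_compose)
    also have "\<dots> \<le> (norm (B t) * norm (P s - P t)) * b"
      using b(2) by (intro mult_mono norm_blinfun_compose) simp_all
    also have "\<dots> \<le> norm (B t) * \<eta> * b"
      using b P' by (intro mult_right_mono mult_left_mono) simp_all
    finally have le: "norm (B t - B s) \<le> norm (B t) * \<eta> * b" .
    have "norm (B t) * \<eta> * b \<le> norm (B t) * (1 / (2 * b)) * b"
      using \<eta> b by (intro mult_right_mono mult_left_mono) auto
    also have "\<dots> = norm (B t) / 2" using b by simp
    finally have "norm (B t) \<le> 2 * b"
      using le b norm_triangle_ineq2 [of "B t" "B s"] by linarith
    then have "norm (B t) * \<eta> * b \<le> 2 * b * (e / (4 * b\<^sup>2)) * b"
      using \<eta> b e by (intro mult_mono mult_nonneg_nonneg) simp_all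
    with le have "norm (B t - B s) \<le> 2 * b * (e / (4 * b\<^sup>2)) * b" by linarith
    also have "\<dots> = e / 2" using b by (simp add: power2_eq_square)
    finally show ?thesis using e by (simp add: dist_norm)
  qed
  then show "\<exists>d>0. \<forall>x'\<in>S. dist x' s < d \<longrightarrow> dist (B x') (B s) < e" using d(1) by blast
qed

section \<open>Absolutely continuous functions and the fundamental theorem\<close>

lemma division_interval_Inf_Sup:
  fixes d :: "real set set"
  assumes "d division_of S" "K \<in> d"
  shows "Inf K \<le> Sup K" "K = {Inf K..Sup K}" "Inf K \<in> S" "Sup K \<in> S"
proof -
  obtain a b where K: "K = cbox a b" "K \<noteq> {}" "K \<subseteq> S"
    using division_ofD(2-4) [OF assms(1)] assms(2) by metis
  then have "a \<le> b" by auto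
  with K show "Inf K \<le> Sup K" "K = {Inf K..Sup K}" "Inf K \<in> S" "Sup K \<in> S" by auto
qed

lemma abs_continuous_on_dominated:
  assumes f: "abs_continuous_on a c f" and g: "abs_continuous_on a c g" and C: "0 \<le> C"
    and le: "\<And>u v. a \<le> u \<Longrightarrow> u \<le> v \<Longrightarrow> v \<le> c \<Longrightarrow>
      norm (h v - h u) \<le> C * (norm (f v - f u) + norm (g v - g u))"
  shows "abs_continuous_on a c h"
  unfolding abs_continuous_on_def
proof (intro allI impI)
  fix e :: real assume e: "0 < e"
  define e' where "e' = e / (2 * (C + 1))"
  have e': "0 < e'" using e C by (simp add: e'_def)
  obtain d1 where d1: "d1 > 0" "\<And>d S. d division_of S \<and> S \<subseteq> {a..c} \<and> (\<Sum>K\<in>d. Sup K - Inf K) < d1 \<Longrightarrow>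
     (\<Sum>K\<in>d. norm (f (Sup K) - f (Inf K))) < e'"
    using f e' unfolding abs_continuous_on_def by blast
  obtain d2 where d2: "d2 > 0" "\<And>d S. d division_of S \<and> S \<subseteq> {a..c} \<and> (\<Sum>K\<in>d. Sup K - Inf K) < d2 \<Longrightarrow>
     (\<Sum>K\<in>d. norm (g (Sup K) - g (Inf K))) < e'"
    using g e' unfolding abs_continuous_on_def by blast
  have "(\<Sum>K\<in>d. norm (h (Sup K) - h (Inf K))) < e"
    if d: "d division_of S \<and> S \<subseteq> {a..c} \<and> (\<Sum>K\<in>d. Sup K - Inf K) < min d1 d2" for d S
  proof -
    have "(\<Sum>K\<in>d. norm (h (Sup K) - h (Inf K))) \<le>
      (\<Sum>K\<in>d. C * (norm (f (Sup K) - f (Inf K)) + norm (g (Sup K) - g (Inf K))))"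
    proof (rule sum_mono)
      fix K assume "K \<in> d"
      then show "norm (h (Sup K) - h (Inf K)) \<le> C * (norm (f (Sup K) - f (Inf K)) + norm (g (Sup K) - g (Inf K)))"
        using division_interval_Inf_Sup [of d S K] d by (intro le) auto
    qed
    also have "\<dots> = C * ((\<Sum>K\<in>d. norm (f (Sup K) - f (Inf K))) + (\<Sum>K\<in>d. norm (g (Sup K) - g (Inf K))))"
      by (simp add: sum_distrib_left sum.distrib ring_distribs)
    also have "\<dots> \<le> C * (e' + e')"
      using d1(2) [of d S] d2(2) [of d S] d C by (intro mult_left_mono add_mono) (auto intro: less_imp_le)
    also have "\<dots> < (C + 1) * (e' + e')" using e' by simp
    also have "\<dots> = 2 * (C + 1) * e'" by (simp add: algebra_simps)
    also have "\<dots> = e" using C unfolding e'_def by simp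
    finally show ?thesis .
  qed
  then show "\<exists>\<delta>>0. \<forall>d S. d division_of S \<and> S \<subseteq> {a..c} \<and> (\<Sum>K\<in>d. Sup K - Inf K) < \<delta> \<longrightarrow>
     (\<Sum>K\<in>d. norm (h (Sup K) - h (Inf K))) < e"
    using d1(1) d2(1) by (intro exI [of _ "min d1 d2"]) auto
qed

lemma abs_continuous_on_ident: "abs_continuous_on a c (\<lambda>t :: real. t)"
  unfolding abs_continuous_on_def
proof (intro allI impI exI conjI)
  fix e :: real and d S
  assume e: "0 < e" and d: "d division_of S \<and> S \<subseteq> {a..c} \<and> (\<Sum>K\<in>d. Sup K - Inf K) < e"
  have "(\<Sum>K\<in>d. norm (Sup K - Inf K)) = (\<Sum>K\<in>d. Sup K - Inf K)"
    using division_interval_Inf_Sup(1) [of d S] d by (intro sum.cong) auto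
  then show "(\<Sum>K\<in>d. norm (Sup K - Inf K)) < e" using d by simp
qed

lemma abs_continuous_on_lipschitz:
  assumes "\<And>u v. a \<le> u \<Longrightarrow> u \<le> v \<Longrightarrow> v \<le> c \<Longrightarrow> norm (h v - h u) \<le> C * (v - u)" "0 \<le> C"
  shows "abs_continuous_on a c h"
proof (rule abs_continuous_on_dominated [OF abs_continuous_on_ident abs_continuous_on_ident assms(2)])
  fix u v assume uv: "a \<le> u" "u \<le> v" "v \<le> c"
  have "0 \<le> C * (v - u)" using uv assms(2) by simp
  moreover have "C * (norm (v - u) + norm (v - u)) = C * (v - u) + C * (v - u)"
    using uv by (simp add: ring_distribs)
  ultimately show "norm (h v - h u) \<le> C * (norm (v - u) + norm (v - u))"
    using assms(1) [OF uv] by linarith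
qed

lemma abs_continuous_on_C1:
  assumes f': "\<And>t. t \<in> {a..c} \<Longrightarrow> (f has_vector_derivative f' t) (at t within {a..c})"
    and "continuous_on {a..c} f'"
  shows "abs_continuous_on a c f"
proof -
  have "bounded (f' ` {a..c})" using assms(2) by (intro compact_imp_bounded compact_continuous_image) auto
  then obtain B where B: "\<And>t. t \<in> {a..c} \<Longrightarrow> norm (f' t) \<le> B" "B > 0"
    unfolding bounded_pos by (metis imageI)
  show ?thesis
  proof (rule abs_continuous_on_lipschitz [of _ _ _ B])
    fix u v assume uv: "a \<le> u" "u \<le> v" "v \<le> c"
    have "norm (f v - f u) \<le> B * norm (v - u)"
    proof (rule differentiable_bound [of "{a..c}" f "\<lambda>x h. h *\<^sub>R f' x"])
      show "(f has_derivative (\<lambda>h. h *\<^sub>R f' x)) (at x within {a..c})" if "x \<in> {a..c}" for x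
        using f' [OF that] by (simp add: has_vector_derivative_def)
      show "onorm (\<lambda>h. h *\<^sub>R f' x) \<le> B" if "x \<in> {a..c}" for x
        by (rule onorm_le) (use mult_right_mono [OF B(1) [OF that] abs_ge_zero] in \<open>simp add: mult.commute\<close>)
    qed (use uv in auto)
    then show "norm (f v - f u) \<le> B * (v - u)" using uv by simp
  qed (use B in simp)
qed

lemma abs_continuous_on_imp_continuous_on:
  assumes "abs_continuous_on a c f"
  shows "continuous_on {a..c} f"
  unfolding continuous_on_iff
proof (intro ballI allI impI)
  fix x e assume x: "x \<in> {a..c}" and e: "0 < (e :: real)"
  obtain \<delta> where \<delta>: "\<delta> > 0" "\<And>d S. d division_of S \<and> S \<subseteq> {a..c} \<and> (\<Sum>K\<in>d. Sup K - Inf K) < \<delta> \<Longrightarrow>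
     (\<Sum>K\<in>d. norm (f (Sup K) - f (Inf K))) < e"
    using assms e unfolding abs_continuous_on_def by blast
  have *: "norm (f v - f u) < e" if "u \<in> {a..c}" "v \<in> {a..c}" "u \<le> v" "v - u < \<delta>" for u v
    using \<delta>(2) [of "{{u..v}}" "{u..v}"] division_of_self [of u v] that by auto
  have "dist (f y) (f x) < e" if "y \<in> {a..c}" "dist y x < \<delta>" for y
  proof (cases "x \<le> y")
    case True
    then show ?thesis using * [of x y] x that by (simp add: dist_norm)
  next
    case False
    then show ?thesis using * [of y x] x that by (simp add: dist_norm norm_minus_commute)
  qed
  then show "\<exists>d>0. \<forall>x'\<in>{a..c}. dist x' x < d \<longrightarrow> dist (f x') (f x) < e" using \<delta>(1) by blast
qed

lemma abs_continuous_on_add: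
  assumes "abs_continuous_on a c f" "abs_continuous_on a c g"
  shows "abs_continuous_on a c (\<lambda>t. f t + g t)"
proof (rule abs_continuous_on_dominated [OF assms, of 1])
  fix u v
  show "norm (f v + g v - (f u + g u)) \<le> 1 * (norm (f v - f u) + norm (g v - g u))"
    using norm_triangle_ineq [of "f v - f u" "g v - g u"] by (simp add: algebra_simps)
qed simp

lemma abs_continuous_on_const: "abs_continuous_on a c (\<lambda>t. k)"
  by (rule abs_continuous_on_lipschitz [of _ _ _ 0]) auto

lemma abs_continuous_on_bounded_linear:
  assumes "bounded_linear T" "abs_continuous_on a c f"
  shows "abs_continuous_on a c (\<lambda>t. T (f t))"
proof -
  interpret T: bounded_linear T by fact
  obtain K where K: "0 \<le> K" "\<And>x. norm (T x) \<le> norm x * K" using T.nonneg_bounded by blast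
  show ?thesis
  proof (rule abs_continuous_on_dominated [OF assms(2) abs_continuous_on_const [of _ _ 0] K(1)])
    fix u v
    show "norm (T (f v) - T (f u)) \<le> K * (norm (f v - f u) + norm (0 - 0 :: real))"
      using K(2) [of "f v - f u"] by (simp add: T.diff mult.commute)
  qed
qed

lemma abs_continuous_on_sum:
  assumes "\<And>i. i \<in> I \<Longrightarrow> abs_continuous_on a c (f i)"
  shows "abs_continuous_on a c (\<lambda>t. \<Sum>i\<in>I. f i t)"
  using assms by (induction I rule: infinite_finite_induct)
    (simp_all add: abs_continuous_on_add abs_continuous_on_const)

lemma abs_continuous_on_bilinear:
  assumes B: "bounded_bilinear B" and f: "abs_continuous_on a c f" and g: "abs_continuous_on a c g"
  shows "abs_continuous_on a c (\<lambda>t. B (f t) (g t))"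
proof -
  interpret bounded_bilinear B by fact
  obtain K where K: "0 \<le> K" "\<And>x y. norm (B x y) \<le> norm x * norm y * K" using nonneg_bounded by blast
  have bdd: "\<exists>M>0. \<forall>t\<in>{a..c}. norm (h t) \<le> M"
    if "abs_continuous_on a c h" for h :: "real \<Rightarrow> 'z :: real_normed_vector"
  proof -
    have "bounded (h ` {a..c})"
      using abs_continuous_on_imp_continuous_on [OF that] by (intro compact_imp_bounded compact_continuous_image) auto
    then show ?thesis unfolding bounded_pos by auto
  qed
  obtain M1 where M1: "M1 > 0" "\<forall>t\<in>{a..c}. norm (f t) \<le> M1" using bdd [OF f] by blast
  obtain M2 where M2: "M2 > 0" "\<forall>t\<in>{a..c}. norm (g t) \<le> M2" using bdd [OF g] by blast
  define M where "M = max M1 M2"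
  have M: "0 \<le> M" "\<And>t. t \<in> {a..c} \<Longrightarrow> norm (f t) \<le> M" "\<And>t. t \<in> {a..c} \<Longrightarrow> norm (g t) \<le> M"
    using M1 M2 unfolding M_def by (auto simp: le_max_iff_disj)
  show ?thesis
  proof (rule abs_continuous_on_dominated [OF f g, of "M * K"])
    fix u v assume uv: "a \<le> u" "u \<le> v" "v \<le> c"
    have "B (f v) (g v) - B (f u) (g u) = B (f v) (g v - g u) + B (f v - f u) (g u)"
      by (simp add: diff_left diff_right)
    also have "norm \<dots> \<le> norm (f v) * norm (g v - g u) * K + norm (f v - f u) * norm (g u) * K"
      by (intro norm_triangle_mono K)
    also have "\<dots> \<le> M * norm (g v - g u) * K + norm (f v - f u) * M * K"
      using uv K(1) M(1) by (intro add_mono mult_right_mono mult_left_mono M) auto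
    also have "\<dots> = M * K * (norm (f v - f u) + norm (g v - g u))" by (simp add: algebra_simps)
    finally show "norm (B (f v) (g v) - B (f u) (g u)) \<le> M * K * (norm (f v - f u) + norm (g v - g u))" .
  qed (use M K in simp)
qed

lemma negligible_outer_open:
  assumes "negligible N" "0 < e"
  shows "\<exists>U. open U \<and> N \<subseteq> U \<and> U \<in> lmeasurable \<and> measure lebesgue U < e"
proof -
  have N: "N \<in> lmeasurable" "N \<in> null_sets lebesgue" "N \<in> sets lebesgue"
    using assms(1) negligible_imp_measurable by (auto simp: negligible_iff_null_sets fmeasurableD)
  obtain U where U: "open U" "N \<subseteq> U" "U - N \<in> lmeasurable" "emeasure lebesgue (U - N) < ennreal e"
    using sets_lebesgue_outer_open [OF N(3) assms(2)] by blast
  have "U = N \<union> (U - N)" using U(2) by blast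
  then have Um: "U \<in> lmeasurable" using fmeasurable.Un [OF N(1) U(3)] by simp
  have "measure lebesgue (U - N) = measure lebesgue U"
    by (rule measure_Diff_null_set [OF _ N(2)]) (use Um in \<open>simp add: fmeasurableD\<close>)
  moreover have "measure lebesgue (U - N) < e"
    using U(3,4) assms(2) by (simp add: emeasure_eq_measure2 ennreal_less_iff)
  ultimately show ?thesis using U(1,2) Um by auto
qed

text \<open>In a fine tagged division the intervals tagged outside the exceptional set are controlled by
  the derivative, the others have small total length and are controlled by absolute continuity.\<close>

theorem abs_continuous_on_has_integral:
  fixes f :: "real \<Rightarrow> 'v :: real_normed_vector"
  assumes ac: "abs_continuous_on a c f" and ab: "a \<le> c" and N: "negligible N"
    and f': "\<And>t. t \<in> {a..c} - N \<Longrightarrow> (f has_vector_derivative g t) (at t within {a..c})"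
  shows "(g has_integral f c - f a) {a..c}"
proof (rule has_integral_spike [OF N])
  \<comment> \<open>With the value 0 on \<open>N\<close>, a tag in the exceptional set contributes
    only the increment of \<open>f\<close>.\<close>
  define g0 where "g0 t = (if t \<in> N then 0 else g t)" for t
  show "g t = g0 t" if "t \<in> {a..c} - N" for t using that by (simp add: g0_def)
  show "(g0 has_integral f c - f a) {a..c}"
  proof (cases "a = c")
    case True
    then show ?thesis using has_integral_refl(2) [of g0 a] by simp
  next
    case False
    with ab have ac': "a < c" by simp
    show ?thesis
      unfolding has_integral_factor_content_real
    proof (intro allI impI)
      fix e :: real assume e: "0 < e"
      \<comment> \<open>One half of the admissible error \<open>e * (c - a)\<close>; the estimate by
        the derivative uses the other half.\<close>
      define e' where "e' = e * (c - a) / 2"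
      have e': "0 < e'" using e ac' by (simp add: e'_def)
      obtain \<delta> where \<delta>: "\<delta> > 0" "\<And>d S. d division_of S \<and> S \<subseteq> {a..c} \<and> (\<Sum>K\<in>d. Sup K - Inf K) < \<delta> \<Longrightarrow>
         (\<Sum>K\<in>d. norm (f (Sup K) - f (Inf K))) < e'"
        using ac e' unfolding abs_continuous_on_def by blast
      obtain U where U: "open U" "N \<subseteq> U" "U \<in> lmeasurable" "measure lebesgue U < \<delta>"
        using negligible_outer_open [OF N \<delta>(1)] by blast
      have "\<exists>r>0. \<forall>y\<in>{a..c}. \<bar>y - x\<bar> < r \<longrightarrow> norm (f y - f x - (y - x) *\<^sub>R g x) \<le> e / 2 * \<bar>y - x\<bar>"
        if "x \<in> {a..c} - N" for x
        using f' [OF that] e unfolding has_vector_derivative_def has_derivative_within_alt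
        by (auto dest!: spec [of _ "e / 2"])
      then obtain r where r: "\<And>x. x \<in> {a..c} - N \<Longrightarrow> r x > 0"
        "\<And>x y. x \<in> {a..c} - N \<Longrightarrow> y \<in> {a..c} \<Longrightarrow> \<bar>y - x\<bar> < r x \<Longrightarrow> norm (f y - f x - (y - x) *\<^sub>R g x) \<le> e / 2 * \<bar>y - x\<bar>"
        by metis
      \<comment> \<open>At a good tag the gauge enforces the linear approximation; at an exceptional
        tag it confines the interval to the open set \<open>U\<close> of measure below
        \<open>\<delta>\<close>. Points outside \<open>{a..c}\<close> are never tags.\<close>
      define D where "D x = (if x \<in> N then U else if x \<in> {a..c} then ball x (r x) else UNIV)" for x
      have gauge: "gauge D"
        unfolding gauge_def D_def using U(1,2) r(1) by auto
      have est: "norm ((\<Sum>(x, k)\<in>p. measure lborel k *\<^sub>R g0 x) - (f c - f a)) \<le> e * measure lborel {a..c}"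
        if p: "p tagged_division_of {a..c}" and fine: "D fine p" for p
      proof -
        have fin: "finite p" using p by blast
        define p2 where "p2 = {xk\<in>p. fst xk \<in> N}"
        \<comment> \<open>\<open>Sup\<close> and \<open>Inf\<close> of the empty set carry no
          information; the value 0 makes \<open>Df\<close> vanish on every degenerate box, as the
          passage from tagged to plain divisions requires.\<close>
        define Df where "Df k = (if k = {} then 0 else f (Sup k) - f (Inf k))" for k
        have intv: "\<exists>u v. k = {u..v} \<and> u \<le> x \<and> x \<le> v \<and> a \<le> u \<and> v \<le> c" if xk: "(x, k) \<in> p" for x k
        proof -
          obtain u v where "k = cbox u v" "x \<in> k" "k \<subseteq> {a..c}"
            using tagged_division_ofD(2-4) [OF p xk] by blast
          then show ?thesis by (intro exI [of _ u] exI [of _ v]) auto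
        qed
        have Df: "(\<Sum>(x, k)\<in>p. Df k) = f c - f a"
        proof (subst additive_tagged_division_1 [OF ab p, symmetric], intro sum.cong refl, clarify)
          fix x k assume "(x, k) \<in> p"
          then have "k \<noteq> {}" using intv by fastforce
          then show "Df k = f (Sup k) - f (Inf k)" by (simp add: Df_def)
        qed
        have le1: "norm (measure lborel k *\<^sub>R g0 x - Df k) \<le> e / 2 * measure lborel k + (if x \<in> N then norm (Df k) else 0)"
          if xk: "(x, k) \<in> p" for x k
        proof -
          obtain u v where uv: "k = {u..v}" "u \<le> x" "x \<le> v" "a \<le> u" "v \<le> c" using intv [OF xk] by blast
          have sub: "k \<subseteq> D x" using fine xk by (auto simp: fine_def)
          show ?thesis
          proof (cases "x \<in> N")
            case True
            then show ?thesis using e uv by (simp add: g0_def)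
          next
            case False
            with uv have x: "x \<in> {a..c} - N" by auto
            have "u \<in> k" "v \<in> k" using uv by auto
            then have "dist x u < r x" "dist x v < r x" using sub False x by (auto simp: D_def)
            then have b: "norm (f v - f x - (v - x) *\<^sub>R g x) \<le> e / 2 * \<bar>v - x\<bar>"
              "norm (f u - f x - (u - x) *\<^sub>R g x) \<le> e / 2 * \<bar>u - x\<bar>"
              using uv r(2) [OF x, of v] r(2) [OF x, of u] by (auto simp: dist_real_def abs_minus_commute)
            have "measure lborel k *\<^sub>R g0 x - Df k = (f u - f x - (u - x) *\<^sub>R g x) - (f v - f x - (v - x) *\<^sub>R g x)"
              using uv False by (simp add: Df_def g0_def algebra_simps)
            also have "norm \<dots> \<le> e / 2 * \<bar>u - x\<bar> + e / 2 * \<bar>v - x\<bar>"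
              by (rule order_trans [OF norm_triangle_ineq4 add_mono [OF b(2) b(1)]])
            also have "\<dots> = e / 2 * measure lborel k" using uv by (simp add: field_simps)
            finally show ?thesis using False by simp
          qed
        qed
        have part: "p2 tagged_partial_division_of {a..c}"
          using p unfolding tagged_division_of_def
          by (auto intro: tagged_partial_division_subset [of p] simp: p2_def)
        have tagU: "p2 tagged_division_of \<Union>(snd ` p2)"
          by (rule tagged_partial_division_of_Union_self [OF part])
        have div2: "snd ` p2 division_of \<Union>(snd ` p2)"
          by (rule division_of_tagged_division [OF tagU])
        have subU: "\<Union>(snd ` p2) \<subseteq> U"
          using fine by (force simp: p2_def fine_def D_def)
        have subac: "\<Union>(snd ` p2) \<subseteq> {a..c}"
          using tagged_division_ofD(3) [OF p] by (fastforce simp: p2_def)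
        have "(\<Sum>K\<in>snd ` p2. Sup K - Inf K) = (\<Sum>K\<in>snd ` p2. measure lebesgue K)"
        proof (rule sum.cong [OF refl])
          fix K assume K: "K \<in> snd ` p2"
          then have "measure lebesgue {Inf K..Sup K} = Sup K - Inf K"
            using division_interval_Inf_Sup(1) [OF div2 K] by simp
          then show "Sup K - Inf K = measure lebesgue K"
            unfolding division_interval_Inf_Sup(2) [OF div2 K, symmetric] by simp
        qed
        also have "\<dots> = measure lebesgue (\<Union>(snd ` p2))"
          by (rule content_division [OF div2])
        also have "\<dots> \<le> measure lebesgue U"
          using U(3) lmeasurable_division [OF div2] subU by (intro measure_mono_fmeasurable) auto
        finally have "(\<Sum>K\<in>snd ` p2. Sup K - Inf K) < \<delta>" using U(4) by simp
        then have "(\<Sum>K\<in>snd ` p2. norm (f (Sup K) - f (Inf K))) < e'"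
          using div2 subac by (intro \<delta>(2)) auto
        \<comment> \<open>Absolute continuity speaks of plain divisions. An interval that occurs
          with two tags is degenerate and has increment 0, so dropping the tags does not change the
          sum.\<close>
        moreover have "(\<Sum>(x, k)\<in>p2. norm (Df k)) = (\<Sum>K\<in>snd ` p2. norm (Df K))"
        proof (rule sum.over_tagged_division_lemma [OF tagU])
          fix u v :: real assume "box u v = {}"
          then have uv: "v \<le> u" by (simp add: box_real(1))
          show "norm (Df (cbox u v)) = 0"
            using uv by (cases "u = v") (auto simp: Df_def cbox_interval)
        qed
        moreover have "(\<Sum>K\<in>snd ` p2. norm (Df K)) = (\<Sum>K\<in>snd ` p2. norm (f (Sup K) - f (Inf K)))"
          using division_ofD(3) [OF div2] by (intro sum.cong) (auto simp: Df_def)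
        ultimately have s2: "(\<Sum>(x, k)\<in>p2. norm (Df k)) < e'" by simp
        have "(\<Sum>(x, k)\<in>p. measure lborel k *\<^sub>R g0 x) - (f c - f a) = (\<Sum>(x, k)\<in>p. measure lborel k *\<^sub>R g0 x - Df k)"
          unfolding Df [symmetric] by (simp add: sum_subtractf case_prod_unfold)
        also have "norm \<dots> \<le> (\<Sum>(x, k)\<in>p. e / 2 * measure lborel k + (if x \<in> N then norm (Df k) else 0))"
        proof (rule sum_norm_le)
          fix z assume "z \<in> p"
          then show "norm (case z of (x, k) \<Rightarrow> measure lborel k *\<^sub>R g0 x - Df k)
              \<le> (case z of (x, k) \<Rightarrow> e / 2 * measure lborel k + (if x \<in> N then norm (Df k) else 0))"
            using le1 [of "fst z" "snd z"] unfolding case_prod_unfold by simp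
        qed
        also have "\<dots> = e / 2 * (\<Sum>(x, k)\<in>p. measure lborel k) + (\<Sum>(x, k)\<in>p. if x \<in> N then norm (Df k) else 0)"
          by (simp add: sum.distrib sum_distrib_left case_prod_unfold)
        also have "(\<Sum>(x, k)\<in>p. measure lborel k) = c - a"
          using additive_content_tagged_division [of p a c] p ab by simp
        also have "(\<Sum>(x, k)\<in>p. if x \<in> N then norm (Df k) else 0) = (\<Sum>(x, k)\<in>p2. norm (Df k))"
          unfolding p2_def case_prod_unfold by (rule sum.inter_filter [symmetric, OF fin])
        finally show ?thesis using s2 ac' unfolding e'_def by simp
      qed
      show "\<exists>d. gauge d \<and> (\<forall>p. p tagged_division_of {a..c} \<and> d fine p \<longrightarrow>
          norm ((\<Sum>(x, k)\<in>p. measure lborel k *\<^sub>R g0 x) - (f c - f a)) \<le> e * measure lborel {a..c})"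
        by (intro exI [of _ D] conjI allI impI gauge, elim conjE) (rule est)
    qed
  qed
qed

section \<open>Primitives of square integrable functions\<close>

definition sq_integrable :: "(real \<Rightarrow> 'v :: real_normed_vector) \<Rightarrow> bool" where
  "sq_integrable f \<longleftrightarrow> f \<in> borel_measurable lebesgue \<and> integrable lebesgue (\<lambda>t. (norm (f t))\<^sup>2)"

text \<open>The half open interval makes consecutive intervals disjoint, so that increments of the
  primitive are again integrals.\<close>

definition primitive :: "(real \<Rightarrow> 'v :: {banach, second_countable_topology}) \<Rightarrow> real \<Rightarrow> 'v" where
  "primitive f t = (LINT s:{0<..t}|lebesgue. f s)"

text \<open>On a bounded interval L2 lies in L1, because \<open>norm x \<le> 1 + (norm x)^2\<close>.
  The constant \<open>k\<close> is carried along for the later study of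
  \<open>norm (f s - k)\<close>.\<close>

lemma sq_integrable_set_integrable:
  fixes f :: "real \<Rightarrow> 'v :: {banach, second_countable_topology}"
  assumes f: "sq_integrable f"
  shows "set_integrable lebesgue {a..b} (\<lambda>s. f s - k)" "set_integrable lebesgue {a<..b} (\<lambda>s. f s - k)"
proof -
  have m: "f \<in> borel_measurable lebesgue" and i: "integrable lebesgue (\<lambda>t. (norm (f t))\<^sup>2)"
    using f by (auto simp: sq_integrable_def)
  have "integrable lebesgue (\<lambda>s. indicat_real {a..b} s * (1 + norm k) + (norm (f s))\<^sup>2)"
    using i by (intro Bochner_Integration.integrable_add integrable_mult_left)
      (auto simp: integrable_indicator_iff emeasure_lborel_cbox_finite [of a b, simplified])
  then show *: "set_integrable lebesgue {a..b} (\<lambda>s. f s - k)"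
    unfolding set_integrable_def
  proof (rule Bochner_Integration.integrable_bound)
    show "(\<lambda>x. indicat_real {a..b} x *\<^sub>R (f x - k)) \<in> borel_measurable lebesgue"
      by (intro borel_measurable_scaleR borel_measurable_indicator borel_measurable_diff m) auto
    have "norm (f x - k) \<le> 1 + norm k + (norm (f x))\<^sup>2" for x
      using norm_triangle_ineq4 [of "f x" k] zero_le_power2 [of "norm (f x) - 1/2"]
      by (simp add: power2_eq_square algebra_simps)
    then show "AE x in lebesgue. norm (indicat_real {a..b} x *\<^sub>R (f x - k))
        \<le> norm (indicat_real {a..b} x * (1 + norm k) + (norm (f x))\<^sup>2)"
      by (auto simp: indicator_def abs_of_nonneg)
  qed
  show "set_integrable lebesgue {a<..b} (\<lambda>s. f s - k)"
    by (rule set_integrable_subset [OF *]) auto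
qed

text \<open>\<open>k = 0\<close> bounds the increments for absolute continuity; a constant
  \<open>k\<close> close to \<open>f x\<close> leads to the derivative at \<open>x\<close>.\<close>

lemma primitive_diff_le:
  fixes f :: "real \<Rightarrow> 'v :: {banach, second_countable_topology}"
  assumes f: "sq_integrable f" and uv: "0 \<le> u" "u \<le> v"
  shows "norm (primitive f v - primitive f u - (v - u) *\<^sub>R k) \<le> integral {u..v} (\<lambda>s. norm (f s - k))"
proof -
  have int: "set_integrable lebesgue {a<..b} f" for a b
    using sq_integrable_set_integrable(2) [OF f, of a b 0] by simp
  have "{0<..v} = {0<..u} \<union> {u<..v}" using uv by auto
  then have "primitive f v = primitive f u + (LINT s:{u<..v}|lebesgue. f s)"
    unfolding primitive_def using int by (simp add: set_integral_Un)
  moreover have "(LINT s:{u<..v}|lebesgue. f s - k) = (LINT s:{u<..v}|lebesgue. f s) - (v - u) *\<^sub>R k"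
    using uv by (subst set_integral_diff(2) [OF int]) (simp_all add: set_integrable_def set_lebesgue_integral_def)
  ultimately have "primitive f v - primitive f u - (v - u) *\<^sub>R k = (LINT s:{u<..v}|lebesgue. f s - k)"
    by simp
  also have "norm \<dots> \<le> (LINT s:{u<..v}|lebesgue. norm (f s - k))"
    by (rule set_integral_norm_bound [OF sq_integrable_set_integrable(2) [OF f]])
  also have "\<dots> = integral {u<..v} (\<lambda>s. norm (f s - k))"
    by (rule set_lebesgue_integral_eq_integral(2) [OF set_integrable_norm [OF sq_integrable_set_integrable(2) [OF f]]])
  also have "\<dots> = integral {u..v} (\<lambda>s. norm (f s - k))"
    by (rule integral_spike_set) (auto intro!: negligible_subset [OF negligible_sing [of u]])
  finally show ?thesis .
qed

lemma sq_integrable_norm_integrable_on: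
  fixes f :: "real \<Rightarrow> 'v :: {banach, second_countable_topology}"
  assumes "sq_integrable f"
  shows "(\<lambda>s. norm (f s - k)) integrable_on {a..b}"
  by (rule set_lebesgue_integral_eq_integral(1) [OF set_integrable_norm [OF sq_integrable_set_integrable(1) [OF assms]]])

lemma sq_integrable_norm2_integrable_on:
  assumes "sq_integrable f"
  shows "(\<lambda>s. (norm (f s))\<^sup>2) integrable_on {a..b}"
proof -
  have "(\<lambda>s. (norm (f s))\<^sup>2) integrable_on UNIV"
    using assms by (intro integrable_on_lebesgue) (simp add: sq_integrable_def)
  then show ?thesis by (rule integrable_on_subcbox [where a = a and b = b, simplified]) simp
qed

text \<open>By \<open>norm x \<le> \<eta> * (norm x)^2 + 1 / (4 * \<eta>)\<close> the increments
  over a division add up to at most \<open>\<eta> * I\<close> plus the total length divided by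
  \<open>4 * \<eta>\<close>. The choice of \<open>\<eta>\<close> makes the first part at most
  \<open>e / 2\<close>; a total length below \<open>2 * \<eta> * e\<close> makes the second smaller
  than \<open>e / 2\<close>.\<close>

lemma abs_continuous_on_primitive:
  fixes f :: "real \<Rightarrow> 'v :: {banach, second_countable_topology}"
  assumes f: "sq_integrable f"
  shows "abs_continuous_on 0 c (primitive f)"
  unfolding abs_continuous_on_def
proof (intro allI impI)
  fix e :: real assume e: "0 < e"
  define I where "I = integral {0..c} (\<lambda>s. (norm (f s))\<^sup>2)"
  have I: "0 \<le> I" unfolding I_def by (rule integral_nonneg [OF sq_integrable_norm2_integrable_on [OF f]]) simp
  define \<eta> where "\<eta> = e / (2 * (I + 1))"
  have \<eta>: "0 < \<eta>" using e I by (simp add: \<eta>_def)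
  have i1: "(\<lambda>s. norm (f s)) integrable_on {u..v}" for u v
    using sq_integrable_norm_integrable_on [OF f, of 0] by simp
  have i2: "(\<lambda>s. (norm (f s))\<^sup>2) integrable_on {u..v}" for u v
    by (rule sq_integrable_norm2_integrable_on [OF f])
  have "(\<Sum>K\<in>d. norm (primitive f (Sup K) - primitive f (Inf K))) < e"
    if d: "d division_of S \<and> S \<subseteq> {0..c} \<and> (\<Sum>K\<in>d. Sup K - Inf K) < 2 * \<eta> * e" for d S
  proof -
    have le: "norm (primitive f (Sup K) - primitive f (Inf K)) \<le>
        \<eta> * integral K (\<lambda>s. (norm (f s))\<^sup>2) + (Sup K - Inf K) / (4 * \<eta>)" if "K \<in> d" for K
    proof -
      note K = division_interval_Inf_Sup [OF conjunct1 [OF d] that]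
      define u v where "u = Inf K" and "v = Sup K"
      have uv: "0 \<le> u" "u \<le> v" "K = {u..v}" using K d unfolding u_def v_def by auto
      have "norm (primitive f v - primitive f u) \<le> integral {u..v} (\<lambda>s. norm (f s))"
        using primitive_diff_le [OF f uv(1,2), of 0] by simp
      also have "\<dots> \<le> integral {u..v} (\<lambda>s. \<eta> * (norm (f s))\<^sup>2 + 1 / (4 * \<eta>))"
      proof (rule integral_le [OF i1])
        show "(\<lambda>s. \<eta> * (norm (f s))\<^sup>2 + 1 / (4 * \<eta>)) integrable_on {u..v}"
          by (intro integrable_add integrable_on_mult_right i2) auto
        fix s
        have "0 \<le> (2 * \<eta> * norm (f s) - 1)\<^sup>2 / (4 * \<eta>)" using \<eta> by simp
        also have "\<dots> = \<eta> * (norm (f s))\<^sup>2 + 1 / (4 * \<eta>) - norm (f s)"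
          using \<eta> by (simp add: power2_eq_square field_simps)
        finally show "norm (f s) \<le> \<eta> * (norm (f s))\<^sup>2 + 1 / (4 * \<eta>)" by simp
      qed
      also have "\<dots> = \<eta> * integral {u..v} (\<lambda>s. (norm (f s))\<^sup>2) + (v - u) / (4 * \<eta>)"
        using uv by (subst integral_add) (auto intro!: integrable_on_mult_right i2)
      finally show ?thesis unfolding uv(3) [symmetric] by (simp only: u_def v_def)
    qed
    have dv: "d division_of S" "S \<subseteq> {0..c}" using d by auto
    have "(\<Sum>K\<in>d. norm (primitive f (Sup K) - primitive f (Inf K))) \<le>
        (\<Sum>K\<in>d. \<eta> * integral K (\<lambda>s. (norm (f s))\<^sup>2) + (Sup K - Inf K) / (4 * \<eta>))"
      by (rule sum_mono [OF le])
    also have "\<dots> = \<eta> * (\<Sum>K\<in>d. integral K (\<lambda>s. (norm (f s))\<^sup>2)) + (\<Sum>K\<in>d. Sup K - Inf K) / (4 * \<eta>)"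
      by (simp add: sum.distrib sum_distrib_left sum_divide_distrib)
    also have "(\<Sum>K\<in>d. integral K (\<lambda>s. (norm (f s))\<^sup>2)) = integral S (\<lambda>s. (norm (f s))\<^sup>2)"
      by (rule integral_combine_division_topdown [OF integrable_on_subdivision [OF dv(1) i2 dv(2)] dv(1), symmetric])
    also have "\<dots> \<le> I"
      unfolding I_def by (rule integral_subset_le [OF dv(2) integrable_on_subdivision [OF dv(1) i2 dv(2)] i2]) simp
    also have "\<eta> * I + (\<Sum>K\<in>d. Sup K - Inf K) / (4 * \<eta>) < e / 2 + (2 * \<eta> * e) / (4 * \<eta>)"
    proof (rule add_le_less_mono)
      show "\<eta> * I \<le> e / 2" using e I by (simp add: \<eta>_def field_simps)
      show "(\<Sum>K\<in>d. Sup K - Inf K) / (4 * \<eta>) < (2 * \<eta> * e) / (4 * \<eta>)"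
        using d \<eta> by (intro divide_strict_right_mono) auto
    qed
    also have "\<dots> = e" using \<eta> by (simp add: field_simps)
    finally show ?thesis using \<eta> by (simp add: mult_left_mono)
  qed
  then show "\<exists>\<delta>>0. \<forall>d S. d division_of S \<and> S \<subseteq> {0..c} \<and> (\<Sum>K\<in>d. Sup K - Inf K) < \<delta> \<longrightarrow>
     (\<Sum>K\<in>d. norm (primitive f (Sup K) - primitive f (Inf K))) < e"
    using e \<eta> by (intro exI [of _ "2 * \<eta> * e"]) auto
qed

text \<open>Averages to the left of a point are averages to the right for the reflected function, so
  the one-sided theorem is used twice.\<close>

lemma lebesgue_points_real:
  fixes \<phi> :: "real \<Rightarrow> real"
  assumes "\<And>a b. \<phi> integrable_on {a..b}"
  obtains N where "negligible N"
    "\<And>x e. x \<notin> N \<Longrightarrow> 0 < e \<Longrightarrow> \<exists>d>0. \<forall>h. 0 < h \<and> h < d \<longrightarrow>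
      \<bar>integral {x..x+h} \<phi> / h - \<phi> x\<bar> < e \<and> \<bar>integral {x-h..x} \<phi> / h - \<phi> x\<bar> < e"
proof -
  obtain N1 where N1: "negligible N1" "\<And>x e. x \<notin> N1 \<Longrightarrow> 0 < e \<Longrightarrow> \<exists>d>0. \<forall>h. 0 < h \<and> h < d \<longrightarrow>
      norm (integral (cbox x (x + h *\<^sub>R One)) \<phi> /\<^sub>R h ^ DIM(real) - \<phi> x) < e"
    by (rule integrable_ccontinuous_explicit [of \<phi>]) (use assms in auto)
  have "(\<lambda>x. \<phi> (- x)) integrable_on cbox a b" for a b
    using assms [of "- b" "- a"] Henstock_Kurzweil_Integration.integrable_reflect_real [where f = \<phi> and a = "- b" and b = "- a"] by simp
  then obtain N2 where N2: "negligible N2" "\<And>x e. x \<notin> N2 \<Longrightarrow> 0 < e \<Longrightarrow> \<exists>d>0. \<forall>h. 0 < h \<and> h < d \<longrightarrow>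
      norm (integral (cbox x (x + h *\<^sub>R One)) (\<lambda>x. \<phi> (- x)) /\<^sub>R h ^ DIM(real) - \<phi> (- x)) < e"
    by (rule integrable_ccontinuous_explicit [of "\<lambda>x. \<phi> (- x)"]) auto
  show ?thesis
  proof
    have "negligible (uminus ` N2)"
      by (rule negligible_differentiable_image_negligible [OF _ N2(1)])
        (auto intro!: differentiable_on_minus differentiable_on_id [unfolded id_def])
    then show "negligible (N1 \<union> uminus ` N2)" using N1(1) by (rule negligible_Un [rotated])
    fix x e :: real assume x: "x \<notin> N1 \<union> uminus ` N2" and e: "0 < e"
    then have x2: "- x \<notin> N2" by (auto simp: image_iff)
    obtain d1 where d1: "d1 > 0" "\<And>h. 0 < h \<and> h < d1 \<Longrightarrow> \<bar>integral {x..x+h} \<phi> / h - \<phi> x\<bar> < e"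
      using N1(2) [of x e] x e by (auto simp: divide_inverse mult.commute)
    obtain d2 where d2: "d2 > 0" "\<And>h. 0 < h \<and> h < d2 \<Longrightarrow> \<bar>integral {-x..-x+h} (\<lambda>x. \<phi> (- x)) / h - \<phi> x\<bar> < e"
      using N2(2) [OF x2 e] by (auto simp: divide_inverse mult.commute)
    have "integral {-x..-x+h} (\<lambda>x. \<phi> (- x)) = integral {x-h..x} \<phi>" for h
      using Henstock_Kurzweil_Integration.integral_reflect_real [of x "x - h" \<phi>] by simp
    then show "\<exists>d>0. \<forall>h. 0 < h \<and> h < d \<longrightarrow>
      \<bar>integral {x..x+h} \<phi> / h - \<phi> x\<bar> < e \<and> \<bar>integral {x-h..x} \<phi> / h - \<phi> x\<bar> < e"
      using d1 d2 by (intro exI [of _ "min d1 d2"]) auto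
  qed
qed

text \<open>The vector valued function is compared with constants from a countable dense set
  \<open>Q\<close>: outside one null set all scalar functions \<open>norm (f s - q)\<close> have
  good averages, and a \<open>q\<close> close to \<open>f x\<close> leaves the relative error
  \<open>2 * norm (f x - q) + e / 3\<close>.\<close>

lemma primitive_has_vector_derivative_AE:
  fixes f :: "real \<Rightarrow> 'v :: {banach, second_countable_topology}"
  assumes f: "sq_integrable f"
  obtains N where "negligible N"
    "\<And>t. 0 \<le> t \<Longrightarrow> t \<notin> N \<Longrightarrow> (primitive f has_vector_derivative f t) (at t within {0..})"
proof -
  obtain Q :: "'v set" where Q: "countable Q" "\<And>X. open X \<Longrightarrow> X \<noteq> {} \<Longrightarrow> \<exists>q\<in>Q. q \<in> X"
    using countable_dense_exists by blast
  have "\<exists>N. negligible N \<and> (\<forall>x e. x \<notin> N \<longrightarrow> 0 < e \<longrightarrow> (\<exists>d>0. \<forall>h. 0 < h \<and> h < d \<longrightarrow>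
      \<bar>integral {x..x+h} (\<lambda>s. norm (f s - q)) / h - norm (f x - q)\<bar> < e \<and>
      \<bar>integral {x-h..x} (\<lambda>s. norm (f s - q)) / h - norm (f x - q)\<bar> < e))" for q
    by (rule lebesgue_points_real [OF sq_integrable_norm_integrable_on [OF f, of q]]) blast
  then obtain N where N: "\<And>q. negligible (N q)" "\<And>q x e. x \<notin> N q \<Longrightarrow> 0 < e \<Longrightarrow> \<exists>d>0. \<forall>h. 0 < h \<and> h < d \<longrightarrow>
      \<bar>integral {x..x+h} (\<lambda>s. norm (f s - q)) / h - norm (f x - q)\<bar> < e \<and>
      \<bar>integral {x-h..x} (\<lambda>s. norm (f s - q)) / h - norm (f x - q)\<bar> < e"
    by metis
  show ?thesis
  proof
    show "negligible (\<Union>q\<in>Q. N q)" using Q(1) N(1) by (intro negligible_countable_Union) auto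
    fix x :: real assume x0: "0 \<le> x" and x: "x \<notin> (\<Union>q\<in>Q. N q)"
    show "(primitive f has_vector_derivative f x) (at x within {0..})"
      unfolding has_vector_derivative_def has_derivative_within_alt
    proof (intro conjI allI impI bounded_linear_scaleR_left)
      fix e :: real assume e: "0 < e"
      obtain q where q: "q \<in> Q" "dist (f x) q < e / 3"
        using Q(2) [of "ball (f x) (e / 3)"] e by auto
      have "x \<notin> N q" using x q(1) by blast
      then obtain d where d: "d > 0" "\<And>h. 0 < h \<and> h < d \<Longrightarrow>
          \<bar>integral {x..x+h} (\<lambda>s. norm (f s - q)) / h - norm (f x - q)\<bar> < e / 3 \<and>
          \<bar>integral {x-h..x} (\<lambda>s. norm (f s - q)) / h - norm (f x - q)\<bar> < e / 3"
        using N(2) [of x q "e / 3"] e by auto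
      have est: "norm (primitive f v - primitive f u - (v - u) *\<^sub>R f x) \<le> e * (v - u)"
        if uv: "0 \<le> u" "u < v" and I: "integral {u..v} (\<lambda>s. norm (f s - q)) \<le> (v - u) * (norm (f x - q) + e / 3)" for u v
      proof -
        have "primitive f v - primitive f u - (v - u) *\<^sub>R f x =
            (primitive f v - primitive f u - (v - u) *\<^sub>R q) - (v - u) *\<^sub>R (f x - q)"
          by (simp add: algebra_simps)
        also have "norm \<dots> \<le> integral {u..v} (\<lambda>s. norm (f s - q)) + (v - u) * norm (f x - q)"
          using uv by (intro order_trans [OF norm_triangle_ineq4] add_mono primitive_diff_le [OF f]) auto
        also have "\<dots> \<le> (v - u) * (norm (f x - q) + e / 3) + (v - u) * norm (f x - q)"
          using I by simp
        also have "\<dots> = (v - u) * (2 * norm (f x - q) + e / 3)" by (simp add: algebra_simps)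
        also have "\<dots> \<le> (v - u) * e" using q(2) uv by (intro mult_left_mono) (auto simp: dist_norm)
        finally show ?thesis by (simp add: mult.commute)
      qed
      have "norm (primitive f y - primitive f x - (y - x) *\<^sub>R f x) \<le> e * norm (y - x)"
        if y: "y \<in> {0..}" "norm (y - x) < d" for y
      proof -
        consider "y = x" | "x < y" | "y < x" by linarith
        then show ?thesis
        proof cases
          case 2
          then have "\<bar>integral {x..y} (\<lambda>s. norm (f s - q)) / (y - x) - norm (f x - q)\<bar> < e / 3"
            using d(2) [of "y - x"] y by simp
          then have "integral {x..y} (\<lambda>s. norm (f s - q)) / (y - x) \<le> norm (f x - q) + e / 3" by linarith
          then have "integral {x..y} (\<lambda>s. norm (f s - q)) \<le> (y - x) * (norm (f x - q) + e / 3)"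
            using 2 by (simp add: pos_divide_le_eq mult.commute)
          then show ?thesis using est [of x y] x0 2 by simp
        next
          case 3
          then have "\<bar>integral {y..x} (\<lambda>s. norm (f s - q)) / (x - y) - norm (f x - q)\<bar> < e / 3"
            using d(2) [of "x - y"] y by simp
          then have "integral {y..x} (\<lambda>s. norm (f s - q)) / (x - y) \<le> norm (f x - q) + e / 3" by linarith
          then have "integral {y..x} (\<lambda>s. norm (f s - q)) \<le> (x - y) * (norm (f x - q) + e / 3)"
            using 3 by (simp add: pos_divide_le_eq mult.commute)
          then have "norm (primitive f x - primitive f y - (x - y) *\<^sub>R f x) \<le> e * (x - y)"
            using est [of y x] y 3 by simp
          moreover have "primitive f y - primitive f x - (y - x) *\<^sub>R f x =
              - (primitive f x - primitive f y - (x - y) *\<^sub>R f x)" by (simp add: algebra_simps)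
          ultimately show ?thesis using 3 by (simp only: norm_minus_cancel) simp
        qed simp
      qed
      then show "\<exists>d>0. \<forall>y\<in>{0..}. norm (y - x) < d \<longrightarrow>
          norm (primitive f y - primitive f x - (y - x) *\<^sub>R f x) \<le> e * norm (y - x)"
        using d(1) by blast
    qed
  qed
qed

section \<open>Linear differential equations\<close>

text \<open>Covers the interval of the expression with or without its right end, and its compact
  initial pieces, in one notion.\<close>

definition initial_interval :: "real set \<Rightarrow> bool" where
  "initial_interval S \<longleftrightarrow> 0 \<in> S \<and> S \<subseteq> {0..} \<and> (\<forall>d\<in>S. {0..d} \<subseteq> S)"

text \<open>Reduces local statements on \<open>S\<close> to compact intervals: take \<open>d\<close>
  beyond \<open>t\<close> if there is one in \<open>S\<close>; otherwise \<open>t\<close> is the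
  right end and \<open>d = t\<close>.\<close>

lemma at_within_initial_interval:
  assumes S: "initial_interval S" and t: "t \<in> S"
  obtains d where "d \<in> S" "t \<le> d" "at t within S = at t within {0..d}"
proof (cases "\<exists>d\<in>S. t < d")
  case True
  then obtain d where d: "d \<in> S" "t < d" by blast
  have sub: "{0..d} \<subseteq> S" "S \<subseteq> {0..}" using S d(1) by (simp_all add: initial_interval_def)
  then have "S \<inter> {..<d} = {0..d} \<inter> {..<d}" by auto
  then have "at t within S = at t within {0..d}"
    by (intro at_within_nhd [of _ "{..<d}"]) (use d in simp_all)
  then show ?thesis using d by (intro that) auto
next
  case False
  have "{0..t} \<subseteq> S" "S \<subseteq> {0..}" using S t by (simp_all add: initial_interval_def)
  with False have "S = {0..t}" by fastforce
  then show ?thesis using t by (intro that [of t]) auto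
qed

lemma has_vector_derivative_initial_interval:
  assumes "initial_interval S" "t \<in> S"
    and "\<And>d. d \<in> S \<Longrightarrow> t \<le> d \<Longrightarrow> (f has_vector_derivative f') (at t within {0..d})"
  shows "(f has_vector_derivative f') (at t within S)"
  by (rule at_within_initial_interval [OF assms(1,2)]) (use assms(3) in simp)

lemma continuous_on_initial_interval:
  assumes "initial_interval S" "\<And>d. d \<in> S \<Longrightarrow> continuous_on {0..d} f"
  shows "continuous_on S f"
  unfolding continuous_on_eq_continuous_within
proof
  fix t assume t: "t \<in> S"
  then have t0: "0 \<le> t" using assms(1) by (auto simp: initial_interval_def)
  obtain d where d: "d \<in> S" "t \<le> d" "at t within S = at t within {0..d}"
    by (rule at_within_initial_interval [OF assms(1) t])
  then have "continuous (at t within {0..d}) f"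
    using assms(2) [OF d(1)] t0 by (auto simp: continuous_on_eq_continuous_within)
  then show "continuous (at t within S) f" using d(3) by simp
qed

lemma initial_interval_subset: "initial_interval S \<Longrightarrow> d \<in> S \<Longrightarrow> {0..d} \<subseteq> S"
  by (auto simp: initial_interval_def)

lemma initial_interval_nonneg: "initial_interval S \<Longrightarrow> d \<in> S \<Longrightarrow> 0 \<le> d"
  by (auto simp: initial_interval_def)

text \<open>\<open>norm X\<close> need not be differentiable, so the differential inequality is
  integrated for its majorant \<open>w\<close> instead: the derivative of
  \<open>w s * exp (- (K * s))\<close> is at most \<open>m\<close>.\<close>

lemma gronwall:
  fixes X :: "real \<Rightarrow> 'v :: banach"
  assumes X: "\<And>t. t \<in> {0..d} \<Longrightarrow> (X has_vector_derivative X' t) (at t within {0..d})"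
    and le: "\<And>t. t \<in> {0..d} \<Longrightarrow> norm (X' t) \<le> K * norm (X t) + m"
    and K: "0 \<le> K" "0 \<le> m" and t: "t \<in> {0..d}"
  shows "norm (X t) \<le> (norm (X 0) + m * t) * exp (K * t)"
proof -
  define w where "w s = norm (X 0) + m * s + K * integral {0..s} (\<lambda>s. norm (X s))" for s
  have Xc: "continuous_on {0..d} X"
    unfolding continuous_on_eq_continuous_within by (blast intro: has_vector_derivative_continuous X)
  have Xi: "(\<lambda>s. norm (X s)) integrable_on {0..s}" if "s \<in> {0..d}" for s
    using that by (intro integrable_continuous_interval continuous_on_norm continuous_on_subset [OF Xc]) auto
  have Xw: "norm (X s) \<le> w s" if s: "s \<in> {0..d}" for s
  proof -
    have int: "(X' has_integral X s - X 0) {0..s}"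
      by (rule fundamental_theorem_of_calculus)
        (use s in \<open>auto intro!: has_vector_derivative_within_subset [OF X]\<close>)
    then have "norm (X s - X 0) = norm (integral {0..s} X')" by (simp add: integral_unique)
    also have "\<dots> \<le> integral {0..s} (\<lambda>s. K * norm (X s) + m)"
      by (rule integral_norm_bound_integral)
        (use int le s Xi [OF s] in \<open>auto intro!: integrable_add integrable_on_mult_right\<close>)
    also have "\<dots> = K * integral {0..s} (\<lambda>s. norm (X s)) + m * s"
      using Xi [OF s] s by (subst integral_add) (auto intro!: integrable_on_mult_right)
    finally show ?thesis using norm_triangle_ineq2 [of "X s" "X 0"] by (simp add: w_def)
  qed
  have wd: "(w has_vector_derivative m + K * norm (X s)) (at s within {0..t})" if "s \<in> {0..t}" for s
  proof -
    have c: "continuous_on {0..t} (\<lambda>s. norm (X s))"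
      using t by (intro continuous_on_norm continuous_on_subset [OF Xc]) auto
    show ?thesis
      unfolding w_def using integral_has_vector_derivative [OF c that]
      by (auto intro!: derivative_eq_intros simp: has_real_derivative_iff_has_vector_derivative [symmetric])
  qed
  have "((\<lambda>s. exp (- (K * s)) * (m + K * norm (X s) - K * w s)) has_integral
      w t * exp (- (K * t)) - w 0 * exp (- (K * 0))) {0..t}"
  proof (rule fundamental_theorem_of_calculus)
    fix s assume "s \<in> {0..t}"
    then show "((\<lambda>s. w s * exp (- (K * s))) has_vector_derivative
        exp (- (K * s)) * (m + K * norm (X s) - K * w s)) (at s within {0..t})"
      using wd [of s] unfolding has_real_derivative_iff_has_vector_derivative [symmetric]
      by (auto intro!: derivative_eq_intros simp: algebra_simps)
  qed (use t in auto)
  moreover have "((\<lambda>s. m) has_integral m * t) {0..t}"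
    using has_integral_const_real [of m 0 t] t by (simp add: mult.commute)
  ultimately have "w t * exp (- (K * t)) - w 0 * exp (- (K * 0)) \<le> m * t"
  proof (rule has_integral_le)
    fix s assume s: "s \<in> {0..t}"
    then have "K * norm (X s) \<le> K * w s" using t K by (intro mult_left_mono Xw) auto
    then have "exp (- (K * s)) * (m + K * norm (X s) - K * w s) \<le> exp (- (K * s)) * m"
      by (intro mult_left_mono) auto
    also have "\<dots> \<le> 1 * m" using s K by (intro mult_right_mono) auto
    finally show "exp (- (K * s)) * (m + K * norm (X s) - K * w s) \<le> m" by simp
  qed
  then have "w t * exp (- (K * t)) \<le> norm (X 0) + m * t" by (simp add: w_def)
  then have "w t * exp (- (K * t)) * exp (K * t) \<le> (norm (X 0) + m * t) * exp (K * t)"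
    by (rule mult_right_mono) simp
  then have "w t \<le> (norm (X 0) + m * t) * exp (K * t)"
    by (simp add: exp_minus field_simps)
  then show ?thesis using Xw [OF t] by linarith
qed

lemma bounded_on_compact_interval:
  fixes f :: "real \<Rightarrow> 'v :: real_normed_vector"
  assumes "continuous_on {a..b} f"
  shows "\<exists>B. 0 \<le> B \<and> (\<forall>t\<in>{a..b}. norm (f t) \<le> B)"
proof -
  have "bounded (f ` {a..b})" using assms by (intro compact_imp_bounded compact_continuous_image) auto
  then obtain B where "0 < B" "\<And>x. x \<in> f ` {a..b} \<Longrightarrow> norm x \<le> B" unfolding bounded_pos by blast
  then show ?thesis by (intro exI [of _ B]) auto
qed

lemma linear_ode_unique:
  fixes A :: "real \<Rightarrow> 'v :: banach \<Rightarrow>\<^sub>L 'v"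
  assumes S: "initial_interval S" and A: "continuous_on S A"
    and X: "\<And>t. t \<in> S \<Longrightarrow> (X has_vector_derivative blinfun_apply (A t) (X t) + g t) (at t within S)"
    and Y: "\<And>t. t \<in> S \<Longrightarrow> (Y has_vector_derivative blinfun_apply (A t) (Y t) + g t) (at t within S)"
    and eq: "X 0 = Y 0" and t: "t \<in> S"
  shows "X t = Y t"
proof -
  note sub = initial_interval_subset [OF S t]
  obtain K where K: "0 \<le> K" "\<And>s. s \<in> {0..t} \<Longrightarrow> norm (A s) \<le> K"
    using bounded_on_compact_interval [OF continuous_on_subset [OF A sub]] by blast
  have "norm (X t - Y t) \<le> (norm (X 0 - Y 0) + 0 * t) * exp (K * t)"
  proof (rule gronwall)
    fix s assume s: "s \<in> {0..t}"
    then have sS: "s \<in> S" using sub by blast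
    show "((\<lambda>t. X t - Y t) has_vector_derivative blinfun_apply (A s) (X s - Y s)) (at s within {0..t})"
      using has_vector_derivative_diff [OF has_vector_derivative_within_subset [OF X [OF sS] sub]
          has_vector_derivative_within_subset [OF Y [OF sS] sub]] by (simp add: blinfun.diff_right)
    show "norm (blinfun_apply (A s) (X s - Y s)) \<le> K * norm (X s - Y s) + 0"
      using norm_blinfun [of "A s" "X s - Y s"] mult_right_mono [OF K(2) [OF s], of "norm (X s - Y s)"] by simp
  qed (use K t S in \<open>auto simp: initial_interval_def\<close>)
  then show ?thesis using eq by simp
qed

text \<open>These are the differences of successive Picard iterates (the terms of the Peano-Baker
  series), not the iterates: the solution is their sum, and the data \<open>x\<close> and
  \<open>g\<close> enter only the term of index 0.\<close>

primrec picard :: "(real \<Rightarrow> 'v :: banach \<Rightarrow>\<^sub>L 'v) \<Rightarrow> (real \<Rightarrow> 'v) \<Rightarrow> 'v \<Rightarrow> nat \<Rightarrow> real \<Rightarrow> 'v" where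
  "picard A g x 0 = (\<lambda>t. x + integral {0..t} g)"
| "picard A g x (Suc n) = (\<lambda>t. integral {0..t} (\<lambda>s. blinfun_apply (A s) (picard A g x n s)))"

text \<open>The series has the bound \<open>M * (K * t) ^ n / fact n\<close> on every
  \<open>{0..d}\<close>. Its sum \<open>X\<close> is defined without reference to \<open>d\<close>,
  so the solutions on compact pieces need no gluing even when \<open>A\<close> is unbounded near the
  right end.\<close>

theorem linear_ode_exists:
  fixes A :: "real \<Rightarrow> 'v :: banach \<Rightarrow>\<^sub>L 'v"
  assumes S: "initial_interval S" and A: "continuous_on S A" and g: "continuous_on S g"
  shows "\<exists>X. X 0 = x0 \<and> (\<forall>t\<in>S. (X has_vector_derivative blinfun_apply (A t) (X t) + g t) (at t within S))"
proof -
  define P where "P = picard A g x0"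
  \<comment> \<open>The derivatives of the terms: that of index 0 gives \<open>g\<close>, that of
    index \<open>Suc n\<close> should be \<open>A\<close> applied to the preceding term. The case
    \<open>Suc n\<close> binds a new \<open>n\<close>, hence the shift in the index.\<close>
  define P' where "P' n t = (case n of 0 \<Rightarrow> g t | Suc n \<Rightarrow> blinfun_apply (A t) (P n t))" for n t
  have "continuous_on S (P' n) \<and> (\<forall>d\<in>S. \<forall>t\<in>{0..d}. (P n has_vector_derivative P' n t) (at t within {0..d}))" for n
  proof -
    have step: "(\<forall>d\<in>S. \<forall>t\<in>{0..d}. (P n has_vector_derivative P' n t) (at t within {0..d}))"
      if c: "continuous_on S (P' n)" for n
    proof (intro ballI)
      fix d t assume d: "d \<in> S" "t \<in> {0..d}"
      have "continuous_on {0..d} (P' n)"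
        by (rule continuous_on_subset [OF c initial_interval_subset [OF S d(1)]])
      note der = integral_has_vector_derivative [OF this d(2)]
      show "(P n has_vector_derivative P' n t) (at t within {0..d})"
      proof (cases n)
        case 0
        have "P' 0 = g" by (rule ext) (simp add: P'_def)
        then show ?thesis
          using has_vector_derivative_add [OF has_vector_derivative_const der, of x0] 0 by (simp add: P_def)
      next
        case (Suc k)
        have "P' (Suc k) = (\<lambda>s. blinfun_apply (A s) (P k s))" by (rule ext) (simp add: P'_def)
        then show ?thesis using der Suc by (simp add: P_def)
      qed
    qed
    have "continuous_on S (P' n)"
    proof (induction n)
      case 0
      then show ?case using g by (simp add: P'_def [abs_def])
    next
      case (Suc n)
      have "continuous_on {0..d} (P n)" if "d \<in> S" for d
        using step [OF Suc] that unfolding continuous_on_eq_continuous_within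
        by (blast intro: has_vector_derivative_continuous)
      then have "continuous_on S (P n)" by (rule continuous_on_initial_interval [OF S])
      then show ?case using A by (auto simp: P'_def intro!: continuous_intros)
    qed
    then show ?thesis using step by blast
  qed
  then have P'c: "\<And>n. continuous_on S (P' n)"
    and Pd: "\<And>n d t. d \<in> S \<Longrightarrow> t \<in> {0..d} \<Longrightarrow> (P n has_vector_derivative P' n t) (at t within {0..d})"
    by blast+
  define X where "X t = (\<Sum>n. P n t)" for t
  have main: "X 0 = x0 \<and> (\<forall>t\<in>{0..d}. (X has_vector_derivative blinfun_apply (A t) (X t) + g t) (at t within {0..d}))"
    if d: "d \<in> S" for d
  proof -
    note sub = initial_interval_subset [OF S d]
    have d0: "0 \<le> d" using S d by (rule initial_interval_nonneg)
    obtain K where K: "0 \<le> K" "\<And>s. s \<in> {0..d} \<Longrightarrow> norm (A s) \<le> K"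
      using bounded_on_compact_interval [OF continuous_on_subset [OF A sub]] by blast
    obtain G where G: "0 \<le> G" "\<And>s. s \<in> {0..d} \<Longrightarrow> norm (g s) \<le> G"
      using bounded_on_compact_interval [OF continuous_on_subset [OF g sub]] by blast
    have Pc: "continuous_on {0..d} (P n)" for n
      using Pd [OF d] unfolding continuous_on_eq_continuous_within
      by (blast intro: has_vector_derivative_continuous)
    obtain M where M: "0 \<le> M" "\<And>s. s \<in> {0..d} \<Longrightarrow> norm (P 0 s) \<le> M"
      using bounded_on_compact_interval [OF Pc] by blast
    have bound: "norm (P n t) \<le> M * (K * t) ^ n / fact n" if "t \<in> {0..d}" for n t
      using that
    proof (induction n arbitrary: t)
      case 0
      then show ?case using M(2) by simp
    next
      case (Suc n)
      have c: "continuous_on {0..t} (\<lambda>s. blinfun_apply (A s) (P n s))"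
        using Suc.prems sub by (intro continuous_intros continuous_on_subset [OF A] continuous_on_subset [OF Pc]) auto
      have i: "((\<lambda>s. M * K ^ Suc n / fact n * s ^ n) has_integral M * (K * t) ^ Suc n / fact (Suc n) - 0) {0..t}"
      proof -
        have "((\<lambda>s. M * K ^ Suc n / fact n * s ^ n) has_integral
            M * (K * t) ^ Suc n / fact (Suc n) - M * (K * 0) ^ Suc n / fact (Suc n)) {0..t}"
        proof (rule fundamental_theorem_of_calculus)
          fix s assume "s \<in> {0..t}"
          have "((\<lambda>s. M * (K * s) ^ Suc n / fact (Suc n)) has_real_derivative
              M * (real (Suc n) * K * (K * s) ^ n) / fact (Suc n)) (at s within {0..t})"
            by (rule derivative_eq_intros refl | simp)+
          also have "M * (real (Suc n) * K * (K * s) ^ n) / fact (Suc n) = M * K ^ Suc n / fact n * s ^ n"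
            by (simp add: power_mult_distrib divide_simps)
          finally show "((\<lambda>s. M * (K * s) ^ Suc n / fact (Suc n)) has_vector_derivative
              M * K ^ Suc n / fact n * s ^ n) (at s within {0..t})"
            by (simp add: has_real_derivative_iff_has_vector_derivative)
        qed (use Suc.prems in auto)
        then show ?thesis by simp
      qed
      have "norm (P (Suc n) t) = norm (integral {0..t} (\<lambda>s. blinfun_apply (A s) (P n s)))"
        by (simp add: P_def)
      also have "\<dots> \<le> integral {0..t} (\<lambda>s. M * K ^ Suc n / fact n * s ^ n)"
      proof (rule integral_norm_bound_integral [OF integrable_continuous_interval [OF c]])
        show "(\<lambda>s. M * K ^ Suc n / fact n * s ^ n) integrable_on {0..t}" using i by blast
        fix s assume s: "s \<in> {0..t}"
        then have sd: "s \<in> {0..d}" using Suc.prems by auto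
        have "norm (blinfun_apply (A s) (P n s)) \<le> norm (A s) * norm (P n s)" by (rule norm_blinfun)
        also have "\<dots> \<le> K * (M * (K * s) ^ n / fact n)"
          using K(1) by (intro mult_mono K(2) Suc.IH sd) auto
        also have "\<dots> = M * K ^ Suc n / fact n * s ^ n" by (simp add: power_mult_distrib)
        finally show "norm (blinfun_apply (A s) (P n s)) \<le> M * K ^ Suc n / fact n * s ^ n" .
      qed
      also have "\<dots> = M * (K * t) ^ Suc n / fact (Suc n)" unfolding integral_unique [OF i] by simp
      finally show ?case .
    qed
    have bound': "norm (P n t) \<le> M * (inverse (fact n) * (K * d) ^ n)" if t: "t \<in> {0..d}" for n t
    proof -
      have "M * (K * t) ^ n / fact n \<le> M * (K * d) ^ n / fact n"
        using t K(1) M(1) by (intro divide_right_mono mult_left_mono power_mono) auto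
      then show ?thesis using bound [OF t, of n] by (simp add: divide_inverse algebra_simps)
    qed
    have sumK: "summable (\<lambda>n. inverse (fact n) * (K * d) ^ n)" by (rule summable_exp)
    have sumP: "summable (\<lambda>n. P n t)" if "t \<in> {0..d}" for t
      by (rule summable_comparison_test' [OF summable_mult [OF sumK, of M]]) (use bound' [OF that] in auto)
    \<comment> \<open>Differentiation term by term needs uniform convergence of the derivatives.
      Apart from the first term they are \<open>A\<close> applied to the previous terms, so the same
      exponential series dominates them with the index shifted by one.\<close>
    have unif: "uniform_limit {0..d} (\<lambda>n t. \<Sum>i<n. P' i t) (\<lambda>t. \<Sum>i. P' i t) sequentially"
    proof (rule Weierstrass_m_test)
      define M' where "M' n = (case n of 0 \<Rightarrow> G | Suc n \<Rightarrow> K * M * (inverse (fact n) * (K * d) ^ n))" for n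
      have "summable (\<lambda>n. M' (Suc n))" using summable_mult [OF sumK, of "K * M"] by (simp add: M'_def)
      then show "summable M'" by (rule iffD1 [OF summable_Suc_iff])
      fix n t assume t: "t \<in> {0..d}"
      show "norm (P' n t) \<le> M' n"
      proof (cases n)
        case 0
        then show ?thesis using G(2) [OF t] by (simp add: P'_def M'_def)
      next
        case (Suc k)
        have "norm (blinfun_apply (A t) (P k t)) \<le> norm (A t) * norm (P k t)" by (rule norm_blinfun)
        also have "\<dots> \<le> K * (M * (inverse (fact k) * (K * d) ^ k))"
          using K(1) by (intro mult_mono K(2) bound' t) auto
        finally show ?thesis using Suc by (simp add: P'_def M'_def)
      qed
    qed
    have sumP': "summable (\<lambda>n. P' n t)" "(\<Sum>i. P' i t) = blinfun_apply (A t) (X t) + g t" if t: "t \<in> {0..d}" for t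
    proof -
      have s: "(\<lambda>n. blinfun_apply (A t) (P n t)) sums blinfun_apply (A t) (X t)"
        unfolding X_def by (rule bounded_linear.sums [OF blinfun.bounded_linear_right summable_sums [OF sumP [OF t]]])
      then have "(\<lambda>n. P' (Suc n) t) sums blinfun_apply (A t) (X t)" by (simp add: P'_def)
      then have "(\<lambda>n. P' n t) sums (blinfun_apply (A t) (X t) + P' 0 t)" by (rule iffD1 [OF sums_Suc_iff])
      then show "summable (\<lambda>n. P' n t)" "(\<Sum>i. P' i t) = blinfun_apply (A t) (X t) + g t"
        by (auto simp: sums_iff P'_def)
    qed
    have "\<exists>Z. \<forall>x\<in>{0..d}. (\<lambda>n. P n x) sums Z x \<and>
        (Z has_derivative (\<lambda>h. h *\<^sub>R (\<Sum>i. P' i x))) (at x within {0..d})"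
    proof (rule has_derivative_series)
      show "(P n has_derivative (\<lambda>h. h *\<^sub>R P' n x)) (at x within {0..d})" if "x \<in> {0..d}" for n x
        using Pd [OF d that, of n] by (simp add: has_vector_derivative_def)
      show "\<forall>\<^sub>F n in sequentially. \<forall>x\<in>{0..d}. \<forall>h. norm ((\<Sum>i<n. h *\<^sub>R P' i x) - h *\<^sub>R (\<Sum>i. P' i x)) \<le> e * norm h"
        if "0 < e" for e :: real
        using uniform_limitD [OF unif that]
      proof eventually_elim
        case (elim n)
        have "norm ((\<Sum>i<n. h *\<^sub>R P' i x) - h *\<^sub>R (\<Sum>i. P' i x)) \<le> e * norm h" if "x \<in> {0..d}" for x h
        proof -
          have "(\<Sum>i<n. h *\<^sub>R P' i x) - h *\<^sub>R (\<Sum>i. P' i x) = h *\<^sub>R ((\<Sum>i<n. P' i x) - (\<Sum>i. P' i x))"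
            by (simp add: scaleR_sum_right scaleR_diff_right)
          moreover have "norm ((\<Sum>i<n. P' i x) - (\<Sum>i. P' i x)) \<le> e"
            using elim that by (auto simp: dist_norm intro: less_imp_le)
          ultimately show ?thesis
            using mult_right_mono [of "norm ((\<Sum>i<n. P' i x) - (\<Sum>i. P' i x))" e "\<bar>h\<bar>"]
            by (simp add: mult.commute [of "\<bar>h\<bar>"])
        qed
        then show ?case by blast
      qed
      show "(\<lambda>n. P n 0) sums X 0" unfolding X_def using d0 by (intro summable_sums sumP) auto
    qed (use d0 in auto)
    then obtain Z where Z: "\<And>x. x \<in> {0..d} \<Longrightarrow> (\<lambda>n. P n x) sums Z x"
      "\<And>x. x \<in> {0..d} \<Longrightarrow> (Z has_derivative (\<lambda>h. h *\<^sub>R (\<Sum>i. P' i x))) (at x within {0..d})" by blast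
    have ZX: "Z x = X x" if "x \<in> {0..d}" for x using Z(1) [OF that] by (simp add: X_def sums_iff)
    have "(X has_vector_derivative blinfun_apply (A t) (X t) + g t) (at t within {0..d})" if t: "t \<in> {0..d}" for t
    proof (rule has_vector_derivative_transform [OF t ZX [symmetric]])
      show "(Z has_vector_derivative blinfun_apply (A t) (X t) + g t) (at t within {0..d})"
        using Z(2) [OF t] sumP'(2) [OF t] by (simp add: has_vector_derivative_def)
    qed auto
    moreover have "X 0 = x0"
    proof -
      have "P (Suc n) 0 = 0" for n by (simp add: P_def)
      then have "P m 0 = 0" if "m \<notin> {0}" for m using that by (cases m) auto
      then have "X 0 = (\<Sum>m\<in>{0}. P m 0)" unfolding X_def by (intro suminf_finite) auto
      then show ?thesis by (simp add: P_def)
    qed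
    ultimately show ?thesis by blast
  qed
  have "(X has_vector_derivative blinfun_apply (A t) (X t) + g t) (at t within S)" if t: "t \<in> S" for t
  proof (rule has_vector_derivative_initial_interval [OF S t])
    fix d assume "d \<in> S" "t \<le> d"
    then show "(X has_vector_derivative blinfun_apply (A t) (X t) + g t) (at t within {0..d})"
      using main [of d] initial_interval_nonneg [OF S t] by auto
  qed
  moreover have "X 0 = x0" using main [of 0] S by (auto simp: initial_interval_def)
  ultimately show ?thesis by blast
qed

text \<open>Surjectivity needs a right inverse; a left inverse would not suffice in infinite
  dimension. With \<open>\<Psi>' = - \<Psi> A\<close> the product \<open>Z = \<Phi> \<Psi>\<close>
  solves \<open>Z' = A Z - Z A\<close>, \<open>Z 0 = id\<close>, an equation in the space of
  operators that the constant \<open>id_blinfun\<close> solves too.\<close>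

lemma fundamental_solution_exists:
  fixes A :: "real \<Rightarrow> 'v :: banach \<Rightarrow>\<^sub>L 'v"
  assumes S: "initial_interval S" and A: "continuous_on S A"
  shows "\<exists>\<Phi>. \<Phi> 0 = id_blinfun \<and> (\<forall>t\<in>S. (\<Phi> has_vector_derivative A t o\<^sub>L \<Phi> t) (at t within S)) \<and>
    (\<forall>t\<in>S. surj (blinfun_apply (\<Phi> t)))"
proof -
  interpret bc: bounded_bilinear "(o\<^sub>L) :: ('v \<Rightarrow>\<^sub>L 'v) \<Rightarrow> ('v \<Rightarrow>\<^sub>L 'v) \<Rightarrow> 'v \<Rightarrow>\<^sub>L 'v"
    by (rule bounded_bilinear_blinfun_compose)
  have r: "continuous_on S (\<lambda>t. bc.prod_right (A t))"
    by (rule bounded_linear.continuous_on [OF bc.bounded_linear_prod_right A])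
  have l: "continuous_on S (\<lambda>t. bc.prod_left (A t))"
    by (rule bounded_linear.continuous_on [OF bc.bounded_linear_prod_left A])
  obtain \<Phi> where \<Phi>: "\<Phi> 0 = id_blinfun"
    "\<And>t. t \<in> S \<Longrightarrow> (\<Phi> has_vector_derivative A t o\<^sub>L \<Phi> t) (at t within S)"
    using linear_ode_exists [OF S r continuous_on_const [of _ 0], of id_blinfun] by auto
  obtain \<Psi> where \<Psi>: "\<Psi> 0 = id_blinfun"
    "\<And>t. t \<in> S \<Longrightarrow> (\<Psi> has_vector_derivative - (\<Psi> t o\<^sub>L A t)) (at t within S)"
    using linear_ode_exists [OF S continuous_on_minus [OF l] continuous_on_const [of _ 0], of id_blinfun]
    by (auto simp: blinfun.minus_left)
  have "\<Phi> t o\<^sub>L \<Psi> t = id_blinfun" if t: "t \<in> S" for t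
  proof (rule linear_ode_unique [OF S continuous_on_diff [OF r l], where g = "\<lambda>_. 0", OF _ _ _ t])
    fix t assume t: "t \<in> S"
    have "((\<lambda>t. \<Phi> t o\<^sub>L \<Psi> t) has_vector_derivative
        (\<Phi> t o\<^sub>L (- (\<Psi> t o\<^sub>L A t))) + ((A t o\<^sub>L \<Phi> t) o\<^sub>L \<Psi> t)) (at t within S)"
      by (rule bc.has_vector_derivative [OF \<Phi>(2) [OF t] \<Psi>(2) [OF t]])
    also have "(\<Phi> t o\<^sub>L (- (\<Psi> t o\<^sub>L A t))) + ((A t o\<^sub>L \<Phi> t) o\<^sub>L \<Psi> t) =
        blinfun_apply (bc.prod_right (A t) - bc.prod_left (A t)) (\<Phi> t o\<^sub>L \<Psi> t) + 0"
      by (rule blinfun_eqI) (simp add: blinfun.diff_left blinfun.add_left blinfun.minus_left blinfun.minus_right)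
    finally show "((\<lambda>t. \<Phi> t o\<^sub>L \<Psi> t) has_vector_derivative
        blinfun_apply (bc.prod_right (A t) - bc.prod_left (A t)) (\<Phi> t o\<^sub>L \<Psi> t) + 0) (at t within S)" .
    have "blinfun_apply (bc.prod_right (A t) - bc.prod_left (A t)) id_blinfun + 0 = 0"
      by (rule blinfun_eqI) (simp add: blinfun.diff_left)
    then show "((\<lambda>t. id_blinfun) has_vector_derivative
        blinfun_apply (bc.prod_right (A t) - bc.prod_left (A t)) id_blinfun + 0) (at t within S)"
      using has_vector_derivative_const by metis
  next
    show "\<Phi> 0 o\<^sub>L \<Psi> 0 = id_blinfun" using \<Phi>(1) \<Psi>(1) by (intro blinfun_eqI) simp
  qed
  then have "blinfun_apply (\<Phi> t) (blinfun_apply (\<Psi> t) w) = w" if "t \<in> S" for t w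
    using arg_cong [OF \<open>\<And>t. t \<in> S \<Longrightarrow> \<Phi> t o\<^sub>L \<Psi> t = id_blinfun\<close> [OF that], of "\<lambda>F. blinfun_apply F w"] by simp
  then have "surj (blinfun_apply (\<Phi> t))" if "t \<in> S" for t
    using that by (intro surjI [of _ "blinfun_apply (\<Psi> t)"]) blast
  then show ?thesis using \<Phi> by blast
qed

section \<open>The equivalent Hamiltonian system\<close>

type_synonym ('h, 'n) state = "('h, 'n) vec \<times> ('h, 'n) vec"

locale regular_expr =
  fixes E :: "'h :: {complex_hilbert, second_countable_topology} dexpr"
    and N :: "'n :: {finite, linorder} itself"
  assumes valid: "valid_dexpr E" and order: "half_order E = CARD('n)"
begin

abbreviation n where "n \<equiv> half_order E"
abbreviation p where "p \<equiv> pcoef E"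
abbreviation q where "q \<equiv> qcoef E"

lemma n_pos: "0 < n" using valid by (simp add: valid_dexpr_def)

lemma ivl_cases:
  "0 < endpt E" "ivl E = {t. 0 \<le> t \<and> ereal t < endpt E} \<or> ivl E = {t. 0 \<le> t \<and> ereal t \<le> endpt E}"
  using valid unfolding valid_dexpr_def by blast+

lemma ivl_initial: "initial_interval (ivl E)"
proof -
  have "{0..d} \<subseteq> ivl E" if "d \<in> ivl E" for d
  proof
    fix s assume "s \<in> {0..d}"
    then have s: "0 \<le> s" "ereal s \<le> ereal d" by auto
    show "s \<in> ivl E"
      using ivl_cases(2) that s(1) le_less_trans [OF s(2), of "endpt E"] order_trans [OF s(2), of "endpt E"] by auto
  qed
  then show ?thesis
    using ivl_cases unfolding initial_interval_def by (auto simp: zero_ereal_def [symmetric] less_imp_le)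
qed

lemmas ivl_subset = initial_interval_subset [OF ivl_initial]
lemmas ivl_nonneg = initial_interval_nonneg [OF ivl_initial]

lemma zero_in_ivl: "0 \<in> ivl E" using ivl_initial by (simp add: initial_interval_def)

lemma ivl_positive: "\<exists>c. 0 < c \<and> c \<in> ivl E \<and> ereal c < endpt E"
proof -
  obtain x where "0 < x" "ereal x < endpt E"
    using ivl_cases(1) ereal_dense2 [of 0 "endpt E"] by (auto simp: zero_ereal_def)
  then have "x \<in> ivl E" using ivl_cases(2) by (elim disjE) simp_all
  then show ?thesis using \<open>0 < x\<close> \<open>ereal x < endpt E\<close> by blast
qed

lemma p_continuous: "k \<le> n \<Longrightarrow> continuous_on (ivl E) (p k)"
  and p_adjoint: "k \<le> n \<Longrightarrow> t \<in> ivl E \<Longrightarrow> cadjoint (p k t) = p k t"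
  and p_clinear: "k \<le> n \<Longrightarrow> t \<in> ivl E \<Longrightarrow> clinear_op (p k t)"
  and q_continuous: "k < n \<Longrightarrow> continuous_on (ivl E) (q k)"
  and q_clinear: "k < n \<Longrightarrow> t \<in> ivl E \<Longrightarrow> clinear_op (q k t)"
  using valid unfolding valid_dexpr_def Ck_def by simp_all

section \<open>The first order system of the quasi-derivatives\<close>

definition p0inv :: "real \<Rightarrow> 'h \<Rightarrow>\<^sub>L 'h" where
  "p0inv t = (SOME B. clinear_op B \<and> B o\<^sub>L p 0 t = id_blinfun \<and> p 0 t o\<^sub>L B = id_blinfun)"

lemma p0inv:
  assumes "t \<in> ivl E"
  shows "clinear_op (p0inv t)" "p0inv t o\<^sub>L p 0 t = id_blinfun" "p 0 t o\<^sub>L p0inv t = id_blinfun"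
proof -
  have "\<exists>B. clinear_op B \<and> B o\<^sub>L p 0 t = id_blinfun \<and> p 0 t o\<^sub>L B = id_blinfun"
    using valid assms unfolding valid_dexpr_def by blast
  from someI_ex [OF this]
  show "clinear_op (p0inv t)" "p0inv t o\<^sub>L p 0 t = id_blinfun" "p 0 t o\<^sub>L p0inv t = id_blinfun"
    unfolding p0inv_def by blast+
qed

lemma p0inv_continuous: "continuous_on (ivl E) p0inv"
  by (rule continuous_on_inverse_blinfun [OF p_continuous [of 0]]) (use p0inv in simp_all)

text \<open>\<open>dcomp act t x i\<close> is the derivative \<open>D\<^sup>i y\<close> for \<open>i \<le> n\<close>, and \<open>rhs act t k x\<close> the derivative of
  the quasi-derivative of index \<open>k\<close>, in terms of the quasi-derivatives \<open>x\<close>.\<close>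

definition dcomp :: "(('h \<Rightarrow>\<^sub>L 'h) \<Rightarrow> 'v \<Rightarrow> 'v) \<Rightarrow> real \<Rightarrow> (nat \<Rightarrow> 'v :: complex_normed_vector) \<Rightarrow> nat \<Rightarrow> 'v" where
  "dcomp act t x i = (if i < n then x i else act (p0inv t) (x n + (\<i> / 2) *\<^sub>C act (q 0 t) (x (n - 1))))"

definition rhs :: "(('h \<Rightarrow>\<^sub>L 'h) \<Rightarrow> 'v \<Rightarrow> 'v) \<Rightarrow> real \<Rightarrow> nat \<Rightarrow> (nat \<Rightarrow> 'v :: complex_normed_vector) \<Rightarrow> 'v" where
  "rhs act t k x = (if k < n then dcomp act t x (Suc k) else
     - x (Suc k) + act (p (Suc k - n) t) (x (2 * n - 1 - k))
     + (\<i> / 2) *\<^sub>C (act (cadjoint (q (k - n) t)) (dcomp act t x (2 * n - k))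
        - (if Suc k < 2 * n then act (q (Suc k - n) t) (x (2 * n - 2 - k)) else 0)))"

text \<open>What application and composition have in common and what inverting the leading
  coefficient needs; one computation then serves vector solutions and operator solutions.\<close>

definition action :: "(('h \<Rightarrow>\<^sub>L 'h) \<Rightarrow> 'v \<Rightarrow> 'v :: complex_normed_vector) \<Rightarrow> bool" where
  "action act \<longleftrightarrow> (\<forall>v. act id_blinfun v = v) \<and> (\<forall>A B v. act (A o\<^sub>L B) v = act A (act B v))"

lemma action_apply: "action blinfun_apply" by (simp add: action_def)

lemma action_compose: "action (o\<^sub>L)"
  unfolding action_def by (intro conjI allI blinfun_eqI) simp_all

lemma action_p0inv:
  assumes "action act" "t \<in> ivl E"
  shows "act (p0inv t) (act (p 0 t) v) = v" "act (p 0 t) (act (p0inv t) v) = v"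
  using assms(1) p0inv(2,3) [OF assms(2)] unfolding action_def by metis+

text \<open>The only case with content is \<open>i = n\<close>: the definition of the n-th
  quasi-derivative is solved for the n-th derivative by the inverse of \<open>p 0 t\<close>.\<close>

lemma ddt_power_eq_dcomp:
  assumes act: "action act" and t: "t \<in> ivl E" and i: "i \<le> n"
  shows "(ddt E ^^ i) y t = dcomp act t (\<lambda>i. quasi act E i y t) i"
proof (cases "i < n")
  case False
  with i have "i = n" by simp
  moreover have "quasi act E n y t + (\<i> / 2) *\<^sub>C act (q 0 t) (quasi act E (n - 1) y t) = act (p 0 t) ((ddt E ^^ n) y t)"
    using n_pos by (simp add: quasi_def Let_def)
  ultimately show ?thesis by (simp add: dcomp_def action_p0inv [OF act t])
qed (simp add: dcomp_def quasi_def)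

text \<open>A rearrangement of the recursion that defines the quasi-derivatives, \<open>ddt\<close>
  being total; actual differentiability enters when the system is formed.\<close>

lemma ddt_quasi:
  assumes act: "action act" and t: "t \<in> ivl E" and k: "k < 2 * n"
  shows "ddt E (quasi act E k y) t = rhs act t k (\<lambda>i. quasi act E i y t)"
proof (cases "k < n")
  case True
  then show ?thesis
    using ddt_power_eq_dcomp [OF act t, of "Suc k" y] by (simp add: rhs_def quasi_def)
next
  case False
  define j where "j = k - n"
  have k': "k = n + j" "j < n" using False k by (auto simp: j_def)
  have q1: "quasi act E (Suc k) y t = upper_quasi act E y (Suc j) t" "quasi act E k y = upper_quasi act E y j"
    using k' by (simp_all add: quasi_def)
  have D1: "quasi act E (2 * n - 1 - k) y t = (ddt E ^^ (n - Suc j)) y t"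
    using k' by (simp add: quasi_def)
  have D2: "dcomp act t (\<lambda>i. quasi act E i y t) (2 * n - k) = (ddt E ^^ (n - Suc j + 1)) y t"
    using k' by (subst ddt_power_eq_dcomp [OF act t]) (auto simp: Suc_diff_Suc)
  have D3: "quasi act E (2 * n - 2 - k) y t = (ddt E ^^ (n - Suc j - 1)) y t"
    using k' by (simp add: quasi_def)
  have "quasi act E (Suc k) y t = - ddt E (quasi act E k y) t + act (p (Suc j) t) (quasi act E (2 * n - 1 - k) y t)
     + (\<i> / 2) *\<^sub>C (act (cadjoint (q j t)) (dcomp act t (\<lambda>i. quasi act E i y t) (2 * n - k))
       - (if Suc j < n then act (q (Suc j) t) (quasi act E (2 * n - 2 - k) y t) else 0))"
    unfolding q1 D1 D2 D3 by (simp add: Let_def)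
  moreover have "Suc k - n = Suc j" "k - n = j" "Suc k < 2 * n \<longleftrightarrow> Suc j < n" using k' by auto
  ultimately show ?thesis using False by (simp add: rhs_def)
qed

text \<open>The system is triangular: its equation of index \<open>k\<close> contains the component
  \<open>k + 1\<close> and otherwise only components up to \<open>k\<close>. Where the two halves
  meet, the inverse of \<open>p 0 t\<close> has to be cancelled.\<close>

lemma rhs_determines:
  assumes act: "action act" and t: "t \<in> ivl E" and k: "Suc k < 2 * n"
    and le: "\<And>i. i \<le> k \<Longrightarrow> x i = x' i" and eq: "rhs act t k x = rhs act t k x'"
  shows "x (Suc k) = x' (Suc k)"
proof -
  consider "Suc k < n" | "Suc k = n" | "n \<le> k" by linarith
  then show ?thesis
  proof cases
    case 1
    then show ?thesis using eq by (simp add: rhs_def dcomp_def)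
  next
    case 2
    then have k: "n - 1 = k" by simp
    then have "act (p0inv t) (x n + (\<i> / 2) *\<^sub>C act (q 0 t) (x k)) = act (p0inv t) (x' n + (\<i> / 2) *\<^sub>C act (q 0 t) (x' k))"
      using eq 2 unfolding rhs_def dcomp_def k by simp
    then have "x n + (\<i> / 2) *\<^sub>C act (q 0 t) (x k) = x' n + (\<i> / 2) *\<^sub>C act (q 0 t) (x' k)"
      by (metis action_p0inv(2) [OF act t])
    then show ?thesis using 2 le [of k] by simp
  next
    case 3
    have d1: "dcomp act t x (2 * n - k) = dcomp act t x' (2 * n - k)"
      using 3 le by (simp add: dcomp_def)
    have d2: "x (2 * n - 1 - k) = x' (2 * n - 1 - k)" and d3: "x (2 * n - 2 - k) = x' (2 * n - 2 - k)"
      using 3 by (auto intro!: le)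
    from 3 eq show ?thesis unfolding rhs_def d1 d2 d3 by simp
  qed
qed

lemma rhs_cong:
  assumes "\<And>i. i \<le> 2 * n \<Longrightarrow> x i = x' i" and "k < 2 * n"
  shows "rhs act t k x = rhs act t k x'"
proof -
  have d: "dcomp act t x i = dcomp act t x' i" for i using assms(1) by (simp add: dcomp_def)
  show ?thesis unfolding rhs_def d using assms by simp
qed

text \<open>The quasi-derivative of index 2n is the value of the expression; it occurs in the last
  equation only additively, which is how it becomes the inhomogeneity.\<close>

lemma rhs_last:
  "rhs act t (2 * n - 1) x = rhs act t (2 * n - 1) (x(2 * n := 0)) - x (2 * n)"
proof -
  have "dcomp act t (x(2 * n := 0)) i = dcomp act t x i" for i
  proof -
    have "n - 1 \<noteq> 2 * n" "n \<noteq> 2 * n" using n_pos by auto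
    then show ?thesis by (simp add: dcomp_def)
  qed
  moreover have "(2 * n - 1 < n) = False" "Suc (2 * n - 1) = 2 * n" "2 * n - 1 - (2 * n - 1) = 0" "\<not> 2 * n < 2 * n"
    "(0 :: nat) \<noteq> 2 * n"
    using n_pos by auto
  ultimately show ?thesis unfolding rhs_def by simp
qed

text \<open>Both families have the same derivative at index \<open>j\<close>, hence equal right
  sides there, and the triangular form yields equality at \<open>j + 1\<close>.\<close>

lemma quasi_of_system:
  assumes act: "action act"
    and x: "\<And>k t. Suc k < 2 * n \<Longrightarrow> t \<in> ivl E \<Longrightarrow>
      (x k has_vector_derivative rhs act t k (\<lambda>i. x i t)) (at t within ivl E)"
  shows "k < 2 * n \<Longrightarrow> t \<in> ivl E \<Longrightarrow> quasi act E k (x 0) t = x k t"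
proof (induction k arbitrary: t rule: less_induct)
  case (less k)
  show ?case
  proof (cases k)
    case 0
    then show ?thesis using n_pos by (simp add: quasi_def)
  next
    case (Suc j)
    have "rhs act t j (\<lambda>i. quasi act E i (x 0) t) = ddt E (quasi act E j (x 0)) t"
      using Suc less.prems by (intro ddt_quasi [OF act, symmetric]) auto
    also have "\<dots> = ddt E (x j) t"
      using Suc less by (intro ddt_cong) auto
    also have "\<dots> = rhs act t j (\<lambda>i. x i t)"
      using Suc less.prems by (intro ddt_eqI [OF valid] x) auto
    finally have eq: "rhs act t j (\<lambda>i. quasi act E i (x 0) t) = rhs act t j (\<lambda>i. x i t)" .
    have IH: "quasi act E i (x 0) t = x i t" if "i \<le> j" for i
      using less.prems that Suc by (intro less.IH) auto
    show ?thesis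
      unfolding Suc
      by (rule rhs_determines [OF act less.prems(2), where x = "\<lambda>i. quasi act E i (x 0) t" and x' = "\<lambda>i. x i t"])
        (use Suc less.prems IH eq in simp_all)
  qed
qed

text \<open>The last equation is required at the single point \<open>t\<close> only, since for
  square integrable \<open>f\<close> it holds just almost everywhere.\<close>

lemma quasi_last_of_system:
  assumes act: "action act"
    and x: "\<And>k t. Suc k < 2 * n \<Longrightarrow> t \<in> ivl E \<Longrightarrow>
      (x k has_vector_derivative rhs act t k (\<lambda>i. x i t)) (at t within ivl E)"
    and t: "t \<in> ivl E"
    and last: "(x (2 * n - 1) has_vector_derivative
      rhs act t (2 * n - 1) ((\<lambda>i. x i t)(2 * n := 0)) - f) (at t within ivl E)"
  shows "quasi act E (2 * n) (x 0) t = f"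
proof -
  have q: "quasi act E k (x 0) s = x k s" if "k < 2 * n" "s \<in> ivl E" for k s
    by (rule quasi_of_system [OF act x that])
  define A where "A = rhs act t (2 * n - 1) ((\<lambda>i. quasi act E i (x 0) t)(2 * n := 0))"
  have "rhs act t (2 * n - 1) ((\<lambda>i. quasi act E i (x 0) t)(2 * n := 0)) - quasi act E (2 * n) (x 0) t
      = rhs act t (2 * n - 1) (\<lambda>i. quasi act E i (x 0) t)"
    by (rule rhs_last [symmetric])
  also have "\<dots> = ddt E (quasi act E (2 * n - 1) (x 0)) t"
    using n_pos by (intro ddt_quasi [OF act t, symmetric]) auto
  also have "\<dots> = ddt E (x (2 * n - 1)) t"
    using q n_pos by (intro ddt_cong t) auto
  also have "\<dots> = rhs act t (2 * n - 1) ((\<lambda>i. x i t)(2 * n := 0)) - f"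
    by (rule ddt_eqI [OF valid t last])
  also have "rhs act t (2 * n - 1) ((\<lambda>i. x i t)(2 * n := 0)) =
      rhs act t (2 * n - 1) ((\<lambda>i. quasi act E i (x 0) t)(2 * n := 0))"
    using n_pos q [OF _ t] by (intro rhs_cong) auto
  finally show ?thesis unfolding A_def [symmetric] by simp
qed

lemma rhs_apply:
  "blinfun_apply (rhs (o\<^sub>L) t k X) u = rhs blinfun_apply t k (\<lambda>i. blinfun_apply (X i) u)"
  by (simp add: rhs_def dcomp_def blinfun.add_left blinfun.diff_left blinfun.minus_left)

text \<open>The system matrix is assembled by composition of operators, so continuity in operator
  norm is obtained at this level.\<close>

lemma rhs_continuous:
  fixes X :: "nat \<Rightarrow> 'w :: complex_normed_vector \<Rightarrow>\<^sub>L 'h"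
  assumes "k < 2 * n"
  shows "continuous_on (ivl E) (\<lambda>t. rhs (o\<^sub>L) t k X)"
proof -
  have sc: "continuous_on (ivl E) (\<lambda>t. c *\<^sub>C f t)" if "continuous_on (ivl E) f" for c and f :: "real \<Rightarrow> 'w \<Rightarrow>\<^sub>L 'h"
    by (rule bounded_linear.continuous_on [OF bounded_linear_scaleC that])
  have co: "continuous_on (ivl E) (\<lambda>t. A t o\<^sub>L f t)"
    if "continuous_on (ivl E) A" "continuous_on (ivl E) f" for A :: "real \<Rightarrow> 'h \<Rightarrow>\<^sub>L 'h" and f :: "real \<Rightarrow> 'w \<Rightarrow>\<^sub>L 'h"
    by (rule bounded_bilinear.continuous_on [OF bounded_bilinear_blinfun_compose that])
  have d: "continuous_on (ivl E) (\<lambda>t. dcomp (o\<^sub>L) t X i)" for i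
    unfolding dcomp_def using n_pos
    by (cases "i < n") (auto intro!: sc co continuous_intros p0inv_continuous q_continuous)
  show ?thesis
  proof (cases "k < n")
    case True
    then show ?thesis by (simp add: rhs_def d)
  next
    case False
    have q': "continuous_on (ivl E) (\<lambda>t. cadjoint (q (k - n) t))"
      using False assms by (intro continuous_on_cadjoint q_continuous q_clinear) auto
    have last: "continuous_on (ivl E) (\<lambda>t. if Suc k < 2 * n then q (Suc k - n) t o\<^sub>L X (2 * n - 2 - k) else 0)"
      using False assms by (cases "Suc k < 2 * n") (auto intro!: co q_continuous continuous_intros)
    show ?thesis
      unfolding rhs_def using False assms
      by (auto intro!: sc co continuous_intros p_continuous q' d last simp del: if_split)
  qed
qed

section \<open>Coordinates of the state space\<close>

lemma bij_pos_of: "bij_betw (pos_of :: 'n \<Rightarrow> nat) UNIV {..<n}"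
proof -
  have less: "pos_of i < pos_of j" if "i < j" for i j :: 'n
    unfolding pos_of_def using that by (intro psubset_card_mono) auto
  have inj: "inj (pos_of :: 'n \<Rightarrow> nat)"
    by (rule injI) (metis less less_irrefl linorder_neqE)
  have "pos_of i < n" for i :: 'n
    unfolding pos_of_def order by (rule psubset_card_mono) auto
  then have "range (pos_of :: 'n \<Rightarrow> nat) \<subseteq> {..<n}" by auto
  moreover have "card (range (pos_of :: 'n \<Rightarrow> nat)) = n" using card_image [OF inj] order by simp
  ultimately have "range (pos_of :: 'n \<Rightarrow> nat) = {..<n}" by (intro card_subset_eq) auto
  then show ?thesis using inj by (simp add: bij_betw_def)
qed

definition idx :: "nat \<Rightarrow> 'n" where "idx = inv_into UNIV pos_of"

lemma pos_of_less: "pos_of (i :: 'n) < n" using bij_pos_of by (auto simp: bij_betw_def)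
lemma pos_idx [simp]: "k < n \<Longrightarrow> pos_of (idx k) = k"
  unfolding idx_def using bij_pos_of by (intro f_inv_into_f) (auto simp: bij_betw_def)
lemma idx_pos [simp]: "idx (pos_of i) = i"
  unfolding idx_def using bij_pos_of by (intro inv_into_f_f) (auto simp: bij_betw_def)

text \<open>The second vector of a state lists its quasi-derivatives in decreasing order, so index
  \<open>k \<ge> n\<close> sits at position \<open>2 * n - 1 - k\<close>. For
  \<open>k \<ge> 2 * n\<close> truncated subtraction makes the value meaningless.\<close>

definition prj :: "nat \<Rightarrow> ('h, 'n) state \<Rightarrow>\<^sub>L 'h" where
  "prj k = (if k < n then Blinfun (\<lambda>u. fst u $ idx k) else Blinfun (\<lambda>u. snd u $ idx (2 * n - 1 - k)))"

lemma prj_apply: "blinfun_apply (prj k) u = (if k < n then fst u $ idx k else snd u $ idx (2 * n - 1 - k))"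
proof -
  have "bounded_linear (\<lambda>u :: ('h, 'n) state. fst u $ i)" "bounded_linear (\<lambda>u :: ('h, 'n) state. snd u $ i)" for i
    by (auto intro: bounded_linear_compose [OF bounded_linear_vec_nth] bounded_linear_fst bounded_linear_snd)
  then show ?thesis by (simp add: prj_def bounded_linear_Blinfun_apply)
qed

definition inc :: "nat \<Rightarrow> 'h \<Rightarrow>\<^sub>L ('h, 'n) state" where
  "inc k = Blinfun (\<lambda>h. (\<chi> i. if pos_of i = k then h else 0, \<chi> i. if 2 * n - 1 - pos_of i = k then h else 0))"

lemma inc_apply: "blinfun_apply (inc k) h =
  (\<chi> i. if pos_of i = k then h else 0, \<chi> i. if 2 * n - 1 - pos_of i = k then h else 0)"
proof -
  have v: "bounded_linear (\<lambda>h :: 'h. \<chi> i :: 'n. if P i then h else 0)" for P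
  proof (rule bounded_linear_intro [where K = "real CARD('n)"])
    fix x :: 'h
    have "norm (\<chi> i :: 'n. if P i then x else 0) \<le> (\<Sum>i\<in>(UNIV :: 'n set). norm ((\<chi> i :: 'n. if P i then x else 0) $ i))"
      unfolding norm_vec_def by (rule L2_set_le_sum) simp
    also have "\<dots> \<le> (\<Sum>i\<in>(UNIV :: 'n set). norm x)" by (rule sum_mono) simp
    finally show "norm (\<chi> i :: 'n. if P i then x else 0) \<le> norm x * real CARD('n)" by (simp add: mult.commute)
  qed (auto simp: vec_eq_iff)
  show ?thesis
    unfolding inc_def by (subst bounded_linear_Blinfun_apply) (auto intro!: bounded_linear_Pair v)
qed

lemma prj_inc: "j < 2 * n \<Longrightarrow> k < 2 * n \<Longrightarrow> blinfun_apply (prj j) (blinfun_apply (inc k) h) = (if j = k then h else 0)"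
  by (auto simp: prj_apply inc_apply)

lemma state_eqI:
  assumes "\<And>k. k < 2 * n \<Longrightarrow> blinfun_apply (prj k) u = blinfun_apply (prj k) v"
  shows "u = v"
proof (rule prod_eqI)
  have "fst u $ i = fst v $ i" for i
    using assms [of "pos_of i"] pos_of_less [of i] by (simp add: prj_apply)
  then show "fst u = fst v" by (simp add: vec_eq_iff)
  have "snd u $ i = snd v $ i" for i
  proof -
    have e: "(2 * n - 1 - pos_of i < n) = False" "2 * n - 1 - (2 * n - 1 - pos_of i) = pos_of i"
      using pos_of_less [of i] by auto
    show ?thesis
      using assms [of "2 * n - 1 - pos_of i"] n_pos unfolding prj_apply e if_False idx_pos by simp
  qed
  then show "snd u = snd v" by (simp add: vec_eq_iff)
qed

lemma prj_sum_inc: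
  assumes "k < 2 * n"
  shows "blinfun_apply (prj k) (\<Sum>j<2 * n. blinfun_apply (inc j) (f j)) = f k"
proof -
  have "blinfun_apply (prj k) (\<Sum>j<2 * n. blinfun_apply (inc j) (f j)) = (\<Sum>j<2 * n. if k = j then f j else 0)"
    unfolding blinfun.sum_right using assms by (intro sum.cong) (auto simp: prj_inc)
  then show ?thesis using assms by simp
qed

lemma sum_inc_prj: "(\<Sum>j<2 * n. blinfun_apply (inc j) (blinfun_apply (prj j) u)) = u"
  by (rule state_eqI) (simp add: prj_sum_inc)

lemma prj_clinear: "blinfun_apply (prj k) (c *\<^sub>C u) = c *\<^sub>C blinfun_apply (prj k) u"
  by (simp add: prj_apply scaleC_prod_def scaleC_vec_def)

text \<open>The slot of index 2n, which belongs to the value of the expression, is filled with 0, so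
  this is the homogeneous part; the inhomogeneity is subtracted separately in the last
  coordinate.\<close>

definition sysA :: "real \<Rightarrow> ('h, 'n) state \<Rightarrow>\<^sub>L ('h, 'n) state" where
  "sysA t = (\<Sum>k<2 * n. inc k o\<^sub>L rhs (o\<^sub>L) t k (\<lambda>i. if i < 2 * n then prj i else 0))"

lemma prj_sysA:
  assumes "k < 2 * n"
  shows "blinfun_apply (prj k) (blinfun_apply (sysA t) u) =
    rhs blinfun_apply t k (\<lambda>i. if i < 2 * n then blinfun_apply (prj i) u else 0)"
proof -
  have "blinfun_apply (sysA t) u = (\<Sum>k<2 * n. blinfun_apply (inc k)
      (rhs blinfun_apply t k (\<lambda>i. if i < 2 * n then blinfun_apply (prj i) u else 0)))"
    by (simp add: sysA_def blinfun.sum_left rhs_apply if_distrib [of "\<lambda>F. blinfun_apply F u"] cong: if_cong)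
  then show ?thesis by (simp add: prj_sum_inc assms)
qed

lemma sysA_continuous: "continuous_on (ivl E) sysA"
  unfolding sysA_def [abs_def]
  by (intro continuous_on_sum bounded_bilinear.continuous_on [OF bounded_bilinear_blinfun_compose]
      continuous_on_const rhs_continuous) auto

lemma rhs_clinear:
  assumes t: "t \<in> ivl E" and k: "k < 2 * n"
  shows "rhs blinfun_apply t k (\<lambda>i. c *\<^sub>C x i) = c *\<^sub>C rhs blinfun_apply t k x"
proof -
  have comm: "(\<i> / 2) *\<^sub>C c *\<^sub>C v = c *\<^sub>C (\<i> / 2) *\<^sub>C v" for v :: 'h by (simp add: scaleC_scaleC mult.commute)
  have d: "dcomp blinfun_apply t (\<lambda>i. c *\<^sub>C x i) i = c *\<^sub>C dcomp blinfun_apply t x i" for i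
    using n_pos clinear_op_scaleC [OF p0inv(1) [OF t]] clinear_op_scaleC [OF q_clinear [OF _ t, of 0]]
    by (simp add: dcomp_def comm flip: scaleC_add_right)
  show ?thesis
  proof (cases "k < n")
    case False
    then have "clinear_op (p (Suc k - n) t)" "clinear_op (cadjoint (q (k - n) t))"
      "Suc k < 2 * n \<Longrightarrow> clinear_op (q (Suc k - n) t)"
      using k t by (auto intro!: p_clinear q_clinear clinear_op_cadjoint)
    then show ?thesis
      using False by (simp add: rhs_def d clinear_op_scaleC comm scaleC_add_right scaleC_diff_right scaleC_minus_right)
  qed (simp add: rhs_def d)
qed

lemma sysA_clinear:
  assumes "t \<in> ivl E"
  shows "blinfun_apply (sysA t) (c *\<^sub>C u) = c *\<^sub>C blinfun_apply (sysA t) u"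
proof (rule state_eqI)
  fix k assume k: "k < 2 * n"
  have eq: "(\<lambda>i. if i < 2 * n then c *\<^sub>C blinfun_apply (prj i) u else 0) =
    (\<lambda>i. c *\<^sub>C (if i < 2 * n then blinfun_apply (prj i) u else 0))" by auto
  show "blinfun_apply (prj k) (blinfun_apply (sysA t) (c *\<^sub>C u)) = blinfun_apply (prj k) (c *\<^sub>C blinfun_apply (sysA t) u)"
    unfolding prj_clinear prj_sysA [OF k] eq by (rule rhs_clinear [OF assms k])
qed

text \<open>The skew-Hermitian form whose value on two states is [y, z](t).\<close>

definition bform :: "('h, 'n) state \<Rightarrow> ('h, 'n) state \<Rightarrow> complex" where
  "bform u v = cinner (fst u) (snd v) - cinner (snd u) (fst v)"

lemma bform_prj: "bform u v = (\<Sum>k<n. cinner (blinfun_apply (prj k) u) (blinfun_apply (prj (2 * n - 1 - k)) v)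
    - cinner (blinfun_apply (prj (2 * n - 1 - k)) u) (blinfun_apply (prj k) v))"
proof -
  have "bform u v = (\<Sum>i\<in>UNIV. cinner (fst u $ i) (snd v $ i) - cinner (snd u $ i) (fst v $ i))"
    by (simp add: bform_def cinner_vec_def sum_subtractf)
  also have "\<dots> = (\<Sum>k<n. cinner (fst u $ idx k) (snd v $ idx k) - cinner (snd u $ idx k) (fst v $ idx k))"
    by (rule sum.reindex_bij_betw [OF bij_pos_of, of "\<lambda>k. cinner (fst u $ idx k) (snd v $ idx k) - cinner (snd u $ idx k) (fst v $ idx k)", simplified])
  also have "\<dots> = (\<Sum>k<n. cinner (blinfun_apply (prj k) u) (blinfun_apply (prj (2 * n - 1 - k)) v)
    - cinner (blinfun_apply (prj (2 * n - 1 - k)) u) (blinfun_apply (prj k) v))"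
    by (intro sum.cong) (auto simp: prj_apply)
  finally show ?thesis .
qed

text \<open>Written out in components, the sum telescopes with the terms \<open>g k\<close>, and \<open>g 0 = g n = 0\<close>.\<close>

lemma bform_sysA:
  assumes t: "t \<in> ivl E"
  shows "bform (blinfun_apply (sysA t) u) v + bform u (blinfun_apply (sysA t) v) = 0"
proof -
  define x where "x i = (if i < 2 * n then blinfun_apply (prj i) u else 0)" for i
  define y where "y i = (if i < 2 * n then blinfun_apply (prj i) v else 0)" for i
  define dx where "dx = dcomp blinfun_apply t x"
  define dy where "dy = dcomp blinfun_apply t y"
  \<comment> \<open>The case \<open>k = 0\<close> mirrors the absence of a coefficient
    \<open>q n\<close> in the quasi-derivative of index 2n.\<close>
  define g where "g k = (if k = 0 then 0 else cinner (dx k) (y (2 * n - k)) - cinner (x (2 * n - k)) (dy k)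
    - \<i> / 2 * (cinner (dx k) (blinfun_apply (q (n - k) t) (y (k - 1)))
      + cinner (blinfun_apply (q (n - k) t) (x (k - 1))) (dy k)))" for k
  have rx: "blinfun_apply (prj k) (blinfun_apply (sysA t) u) = rhs blinfun_apply t k x"
    "blinfun_apply (prj k) (blinfun_apply (sysA t) v) = rhs blinfun_apply t k y"
    "blinfun_apply (prj k) u = x k" "blinfun_apply (prj k) v = y k" if "k < 2 * n" for k
    using prj_sysA [OF that] that by (simp_all add: x_def [abs_def] y_def [abs_def])
  have i2: "cnj (\<i> / 2) = - \<i> / 2" by simp
  have step: "cinner (rhs blinfun_apply t k x) (y (2 * n - 1 - k)) - cinner (rhs blinfun_apply t (2 * n - 1 - k) x) (y k)
      + (cinner (x k) (rhs blinfun_apply t (2 * n - 1 - k) y) - cinner (x (2 * n - 1 - k)) (rhs blinfun_apply t k y))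
      = g (Suc k) - g k" if k: "k < n" for k
  proof -
    have a: "rhs blinfun_apply t k x = dx (Suc k)" "rhs blinfun_apply t k y = dy (Suc k)"
      using k by (simp_all add: rhs_def dx_def dy_def)
    have ar: "(2 * n - 1 - k < n) = False" "Suc (2 * n - 1 - k) = 2 * n - k" "2 * n - k - n = n - k"
      "2 * n - 1 - (2 * n - 1 - k) = k" "2 * n - 1 - k - n = n - Suc k" "2 * n - (2 * n - 1 - k) = Suc k"
      "2 * n - k < 2 * n \<longleftrightarrow> k \<noteq> 0" "2 * n - 2 - (2 * n - 1 - k) = k - 1"
      using k by auto
    have b: "rhs blinfun_apply t (2 * n - 1 - k) x = - x (2 * n - k) + blinfun_apply (p (n - k) t) (x k)
      + (\<i> / 2) *\<^sub>C (blinfun_apply (cadjoint (q (n - Suc k) t)) (dx (Suc k)) - (if k \<noteq> 0 then blinfun_apply (q (n - k) t) (x (k - 1)) else 0))"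
      "rhs blinfun_apply t (2 * n - 1 - k) y = - y (2 * n - k) + blinfun_apply (p (n - k) t) (y k)
      + (\<i> / 2) *\<^sub>C (blinfun_apply (cadjoint (q (n - Suc k) t)) (dy (Suc k)) - (if k \<noteq> 0 then blinfun_apply (q (n - k) t) (y (k - 1)) else 0))"
      unfolding rhs_def ar dx_def dy_def if_False by simp_all
    have pp: "cinner (x k) (blinfun_apply (p (n - k) t) (y k)) = cinner (blinfun_apply (p (n - k) t) (x k)) (y k)"
      using cadjoint_left [OF p_clinear [OF _ t, of "n - k"]] p_adjoint [OF _ t, of "n - k"] by simp
    have qc: "clinear_op (q (n - Suc k) t)" using k t by (intro q_clinear) auto
    have qq: "cinner (x k) (blinfun_apply (cadjoint (q (n - Suc k) t)) (dy (Suc k))) = cinner (blinfun_apply (q (n - Suc k) t) (x k)) (dy (Suc k))"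
      "cinner (blinfun_apply (cadjoint (q (n - Suc k) t)) (dx (Suc k))) (y k) = cinner (dx (Suc k)) (blinfun_apply (q (n - Suc k) t) (y k))"
      by (simp_all add: cadjoint_right [OF qc] cadjoint_left [OF qc])
    have z: "x (2 * n) = 0" "y (2 * n) = 0" by (simp_all add: x_def y_def)
    have dk: "dx k = x k" "dy k = y k" using k by (simp_all add: dx_def dy_def dcomp_def)
    show ?thesis
    proof (cases "k = 0")
      case True
      with pp qq z show ?thesis
        unfolding a b by (simp add: g_def dk cinner_algebra i2) (simp add: algebra_simps)
    next
      case False
      then show ?thesis unfolding a b by (simp add: g_def dk cinner_algebra pp qq algebra_simps i2)
    qed
  qed
  \<comment> \<open>Inserting \<open>x n = p 0 dx n - (\<i> / 2) q 0 x (n - 1)\<close>, and the same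
    for \<open>y\<close>, the terms with \<open>q 0\<close> cancel, and those with
    \<open>p 0\<close> cancel by its selfadjointness.\<close>
  have "g n = 0"
  proof -
    have q0: "clinear_op (q 0 t)" and p0: "clinear_op (p 0 t)" "cadjoint (p 0 t) = p 0 t"
      using t n_pos by (auto intro: q_clinear p_clinear p_adjoint)
    have X: "x n = blinfun_apply (p 0 t) (dx n) - (\<i> / 2) *\<^sub>C blinfun_apply (q 0 t) (x (n - 1))"
      "y n = blinfun_apply (p 0 t) (dy n) - (\<i> / 2) *\<^sub>C blinfun_apply (q 0 t) (y (n - 1))"
      by (simp_all add: dx_def dy_def dcomp_def action_p0inv [OF action_apply t])
    have pp: "cinner (dx n) (blinfun_apply (p 0 t) (dy n)) = cinner (blinfun_apply (p 0 t) (dx n)) (dy n)"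
      using cadjoint_left [OF p0(1)] p0(2) by simp
    have "2 * n - n = n" by simp
    then show ?thesis
      using n_pos by (simp add: g_def X cinner_algebra pp i2 algebra_simps)
  qed
  have "bform (blinfun_apply (sysA t) u) v + bform u (blinfun_apply (sysA t) v) = (\<Sum>k<n. g (Suc k) - g k)"
    unfolding bform_prj sum.distrib [symmetric]
    by (rule sum.cong [OF refl]) (use step in \<open>simp add: rx\<close>)
  also have "\<dots> = g n - g 0" by (rule sum_lessThan_telescope)
  finally show ?thesis using \<open>g n = 0\<close> by (simp add: g_def)
qed

text \<open>\<open>inc (2 * n - 1)\<close> is the direction in which the inhomogeneity acts. Paired
  with a state it sees only the component of index 0, that is, the solution itself; this is where
  the L2 products in Green's formula come from.\<close>

lemma bform_inc_right: "bform u (blinfun_apply (inc (2 * n - 1)) h) = cinner (blinfun_apply (prj 0) u) h"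
  and bform_inc_left: "bform (blinfun_apply (inc (2 * n - 1)) h) u = - cinner h (blinfun_apply (prj 0) u)"
proof -
  have e: "(pos_of i = 2 * n - 1) = False" "(2 * n - 1 - pos_of i = 2 * n - 1) = (i = idx 0)" for i :: 'n
  proof -
    have "pos_of i = 0 \<longleftrightarrow> i = idx 0" using n_pos by (metis idx_pos pos_idx)
    then show "(pos_of i = 2 * n - 1) = False" "(2 * n - 1 - pos_of i = 2 * n - 1) = (i = idx 0)"
      using pos_of_less [of i] n_pos by auto
  qed
  show "bform u (blinfun_apply (inc (2 * n - 1)) h) = cinner (blinfun_apply (prj 0) u) h"
    "bform (blinfun_apply (inc (2 * n - 1)) h) u = - cinner h (blinfun_apply (prj 0) u)"
    unfolding bform_def inc_apply e prj_apply cinner_vec_def using n_pos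
    by (simp_all add: if_distrib [of "\<lambda>z. cinner z _"] if_distrib [of "\<lambda>z. cinner _ z"] cong: if_cong)
qed

lemma bounded_bilinear_bform: "bounded_bilinear bform"
proof
  show "\<exists>K. \<forall>a b. norm (bform a b) \<le> norm a * norm b * K"
  proof (intro exI allI)
    fix a b
    have "norm (bform a b) \<le> norm (fst a) * norm (snd b) + norm (snd a) * norm (fst b)"
      unfolding bform_def by (intro order_trans [OF norm_triangle_ineq4] add_mono norm_cinner_le)
    also have "\<dots> \<le> norm a * norm b + norm a * norm b"
      using norm_fst_le [of "fst a" "snd a"] norm_snd_le [of "snd b" "fst b"]
        norm_snd_le [of "snd a" "fst a"] norm_fst_le [of "fst b" "snd b"]
      by (intro add_mono mult_mono norm_ge_zero) simp_all
    finally show "norm (bform a b) \<le> norm a * norm b * 2" by simp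
  qed
qed (simp_all add: bform_def cinner_algebra scaleR_scaleC scaleC_prod_def fst_add snd_add
    scaleR_conv_of_real algebra_simps)

lemma bform_scaleC_right: "bform u (c *\<^sub>C v) = cnj c * bform u v"
  by (simp add: bform_def scaleC_prod_def cinner_scaleC_right algebra_simps)

lemma bform_nondegenerate:
  assumes "\<And>v. bform u v = 0"
  shows "u = 0"
proof (rule prod_eqI)
  show "fst u = fst 0" using assms [of "(0, fst u)"] by (simp add: bform_def cinner_self)
  show "snd u = snd 0" using assms [of "(snd u, 0)"] by (simp add: bform_def cinner_self)
qed

definition st :: "(real \<Rightarrow> 'h) \<Rightarrow> real \<Rightarrow> ('h, 'n) state" where
  "st y t = (bv1 E y t, bv2 E y t)"

lemma prj_st: "k < 2 * n \<Longrightarrow> blinfun_apply (prj k) (st y t) = qd E k y t"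
  by (auto simp: prj_apply st_def bv1_def bv2_def)

lemma bracket_eq_bform: "bracket E y z t = bform (st y t) (st z t)"
  unfolding bracket_def bform_prj Let_def sum_subtractf [symmetric]
  using n_pos by (intro sum.cong) (auto simp: prj_st)

end

section \<open>Square integrable functions\<close>

lemma L2_measurable: "f \<in> L2 E \<Longrightarrow> f \<in> borel_measurable (leb E)"
  and L2_integrable: "f \<in> L2 E \<Longrightarrow> integrable (leb E) (\<lambda>t. (norm (f t))\<^sup>2)"
  by (auto simp: L2_def)

context
  fixes E :: "'h :: {complex_hilbert, second_countable_topology} dexpr"
begin

lemma L2_add:
  assumes f: "f \<in> L2 E" and g: "g \<in> L2 E"
  shows "(\<lambda>t. f t + g t) \<in> L2 E"
  unfolding L2_def
proof (intro CollectI conjI)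
  show m: "(\<lambda>t. f t + g t) \<in> borel_measurable (leb E)"
    using L2_measurable [OF f] L2_measurable [OF g] by simp
  have "integrable (leb E) (\<lambda>t. 2 * (norm (f t))\<^sup>2 + 2 * (norm (g t))\<^sup>2)"
    using L2_integrable [OF f] L2_integrable [OF g] by simp
  then show "integrable (leb E) (\<lambda>t. (norm (f t + g t))\<^sup>2)"
  proof (rule Bochner_Integration.integrable_bound)
    show "(\<lambda>t. (norm (f t + g t))\<^sup>2) \<in> borel_measurable (leb E)" using m by measurable
    have "(norm (x + y))\<^sup>2 \<le> 2 * (norm x)\<^sup>2 + 2 * (norm y)\<^sup>2" for x y :: 'h
    proof -
      have "(norm (x + y))\<^sup>2 \<le> (norm x + norm y)\<^sup>2" by (intro power_mono norm_triangle_ineq norm_ge_zero)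
      also have "\<dots> \<le> 2 * (norm x)\<^sup>2 + 2 * (norm y)\<^sup>2"
        using zero_le_power2 [of "norm x - norm y"] by (simp add: power2_eq_square algebra_simps)
      finally show ?thesis .
    qed
    then show "AE t in leb E. norm ((norm (f t + g t))\<^sup>2) \<le> norm (2 * (norm (f t))\<^sup>2 + 2 * (norm (g t))\<^sup>2)"
      by simp
  qed
qed

lemma measurable_scaleC: "f \<in> borel_measurable M \<Longrightarrow> (\<lambda>t. c *\<^sub>C f t :: 'h) \<in> borel_measurable M"
  by (rule borel_measurable_continuous_on [OF linear_continuous_on [OF bounded_linear_scaleC]])

lemma L2_scaleC:
  assumes f: "f \<in> L2 E"
  shows "(\<lambda>t. c *\<^sub>C f t) \<in> L2 E"
  using measurable_scaleC [OF L2_measurable [OF f], of c] L2_integrable [OF f]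
  by (simp add: L2_def norm_scaleC power_mult_distrib)

lemma L2_zero: "(\<lambda>t. 0) \<in> L2 E" by (simp add: L2_def)

lemma L2_lincomb:
  assumes "f \<in> L2 E" "g \<in> L2 E"
  shows "(\<lambda>t. a *\<^sub>C f t + b *\<^sub>C g t) \<in> L2 E"
  by (intro L2_add L2_scaleC assms)

lemma L2_diff_scaleC:
  assumes "f \<in> L2 E" "g \<in> L2 E"
  shows "(\<lambda>t. f t - c *\<^sub>C g t) \<in> L2 E"
  using L2_lincomb [OF assms, of 1 "- c"] by (simp add: scaleC_minus_left)

lemma L2_diff:
  assumes "f \<in> L2 E" "g \<in> L2 E"
  shows "(\<lambda>t. f t - g t) \<in> L2 E"
  using L2_diff_scaleC [OF assms, of 1] by simp

lemma L2_cong_AE: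
  assumes "f \<in> L2 E" "g \<in> borel_measurable (leb E)" "AE t in leb E. f t = g t"
  shows "g \<in> L2 E"
proof -
  have "integrable (leb E) (\<lambda>t. (norm (f t))\<^sup>2) \<longleftrightarrow> integrable (leb E) (\<lambda>t. (norm (g t))\<^sup>2)"
    using L2_measurable [OF assms(1)] assms(2,3) by (intro integrable_cong_AE) auto
  then show ?thesis using assms by (simp add: L2_def)
qed

lemma measurable_cinner:
  assumes "f \<in> borel_measurable M" "g \<in> borel_measurable M"
  shows "(\<lambda>t. cinner (f t) (g t :: 'h)) \<in> borel_measurable M"
  by (rule borel_measurable_continuous_Pair [OF assms])
    (intro continuous_intros)

lemma integrable_cinner:
  assumes f: "f \<in> L2 E" and g: "g \<in> L2 E"
  shows "integrable (leb E) (\<lambda>t. cinner (f t) (g t))"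
proof -
  have "integrable (leb E) (\<lambda>t. (norm (f t))\<^sup>2 + (norm (g t))\<^sup>2)"
    using L2_integrable [OF f] L2_integrable [OF g] by simp
  then show ?thesis
  proof (rule Bochner_Integration.integrable_bound)
    show "(\<lambda>t. cinner (f t) (g t)) \<in> borel_measurable (leb E)"
      by (rule measurable_cinner [OF L2_measurable [OF f] L2_measurable [OF g]])
    have "norm (cinner x y) \<le> (norm x)\<^sup>2 + (norm y)\<^sup>2" for x y :: 'h
    proof -
      have "0 \<le> norm x * norm y" by simp
      moreover have "2 * (norm x * norm y) \<le> (norm x)\<^sup>2 + (norm y)\<^sup>2"
        using zero_le_power2 [of "norm x - norm y"] by (simp add: power2_eq_square algebra_simps)
      ultimately show ?thesis using norm_cinner_le [of x y] by linarith
    qed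
    then show "AE t in leb E. norm (cinner (f t) (g t)) \<le> norm ((norm (f t))\<^sup>2 + (norm (g t))\<^sup>2)" by simp
  qed
qed

section \<open>Inner product, norm and completeness on representatives\<close>

lemma l2_inner_commute: "l2_inner E f g = cnj (l2_inner E g f)"
proof -
  have "l2_inner E f g = (LINT t|leb E. cnj (cinner (g t) (f t)))"
    unfolding l2_inner_def using cinner_commute by (intro Bochner_Integration.integral_cong) auto
  then show ?thesis by (simp add: l2_inner_def)
qed

lemma l2_inner_lincomb_left:
  assumes "f \<in> L2 E" "g \<in> L2 E" "h \<in> L2 E"
  shows "l2_inner E (\<lambda>t. a *\<^sub>C f t + b *\<^sub>C g t) h = a * l2_inner E f h + b * l2_inner E g h"
  using integrable_cinner [OF assms(1,3)] integrable_cinner [OF assms(2,3)]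
  by (simp add: l2_inner_def cinner_add_left cinner_scaleC_left)

lemma l2_inner_diff_left:
  assumes "f \<in> L2 E" "g \<in> L2 E" "h \<in> L2 E"
  shows "l2_inner E (\<lambda>t. f t - c *\<^sub>C g t) h = l2_inner E f h - c * l2_inner E g h"
  using l2_inner_lincomb_left [OF assms, of 1 "- c"] by (simp add: scaleC_minus_left)

lemma l2_inner_diff_right:
  assumes "f \<in> L2 E" "g \<in> L2 E" "h \<in> L2 E"
  shows "l2_inner E h (\<lambda>t. f t - c *\<^sub>C g t) = l2_inner E h f - cnj c * l2_inner E h g"
  using l2_inner_diff_left [OF assms, of c] l2_inner_commute [of h "\<lambda>t. f t - c *\<^sub>C g t"]
    l2_inner_commute [of h f] l2_inner_commute [of h g] by simp

lemma l2_inner_lincomb_right: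
  assumes "f \<in> L2 E" "g \<in> L2 E" "h \<in> L2 E"
  shows "l2_inner E h (\<lambda>t. a *\<^sub>C f t + b *\<^sub>C g t) = cnj a * l2_inner E h f + cnj b * l2_inner E h g"
  using l2_inner_lincomb_left [OF assms, of a b] l2_inner_commute [of h "\<lambda>t. a *\<^sub>C f t + b *\<^sub>C g t"]
    l2_inner_commute [of h f] l2_inner_commute [of h g] by simp

lemma l2_inner_cong_AE:
  assumes "AE t in leb E. f t = f' t" "AE t in leb E. g t = g' t"
    "f \<in> L2 E" "g \<in> L2 E" "f' \<in> L2 E" "g' \<in> L2 E"
  shows "l2_inner E f g = l2_inner E f' g'"
  unfolding l2_inner_def
  by (rule integral_cong_AE)
    (use assms in \<open>auto intro!: measurable_cinner L2_measurable\<close>)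

lemma l2_norm_nonneg: "0 \<le> l2_norm E f"
  unfolding l2_norm_def by simp

lemma l2_norm_squared: "(l2_norm E f)\<^sup>2 = (LINT t|leb E. (norm (f t))\<^sup>2)"
  unfolding l2_norm_def by simp

lemma l2_inner_self: "l2_inner E f f = complex_of_real ((l2_norm E f)\<^sup>2)"
  unfolding l2_norm_squared l2_inner_def cinner_self by (rule integral_complex_of_real)

lemma l2_norm_cong_AE:
  assumes "AE t in leb E. f t = g t" "f \<in> L2 E" "g \<in> L2 E"
  shows "l2_norm E f = l2_norm E g"
proof -
  have "(LINT t|leb E. (norm (f t))\<^sup>2) = (LINT t|leb E. (norm (g t))\<^sup>2)"
    using assms L2_measurable [OF assms(2)] L2_measurable [OF assms(3)] by (intro integral_cong_AE) auto
  then show ?thesis by (simp add: l2_norm_def)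
qed

lemma l2_norm_eq_zero_iff:
  assumes "f \<in> L2 E"
  shows "l2_norm E f = 0 \<longleftrightarrow> (AE t in leb E. f t = 0)"
proof -
  have "l2_norm E f = 0 \<longleftrightarrow> (LINT t|leb E. (norm (f t))\<^sup>2) = 0" by (simp add: l2_norm_def)
  also have "\<dots> \<longleftrightarrow> (AE t in leb E. (norm (f t))\<^sup>2 = 0)"
    by (rule integral_nonneg_eq_0_iff_AE [OF L2_integrable [OF assms]]) simp
  finally show ?thesis by simp
qed

lemma l2_norm_diff_scaleC_squared:
  assumes "f \<in> L2 E" "g \<in> L2 E"
  shows "(l2_norm E (\<lambda>t. f t - c *\<^sub>C g t))\<^sup>2 =
    (l2_norm E f)\<^sup>2 - 2 * Re (cnj c * l2_inner E f g) + (cmod c)\<^sup>2 * (l2_norm E g)\<^sup>2"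
proof -
  have "complex_of_real ((l2_norm E (\<lambda>t. f t - c *\<^sub>C g t))\<^sup>2) =
      l2_inner E (\<lambda>t. f t - c *\<^sub>C g t) (\<lambda>t. f t - c *\<^sub>C g t)"
    by (rule l2_inner_self [symmetric])
  also have "\<dots> = l2_inner E f f - cnj c * l2_inner E f g - c * (l2_inner E g f - cnj c * l2_inner E g g)"
    using assms by (simp add: l2_inner_diff_left l2_inner_diff_right L2_diff_scaleC)
  also have "\<dots> = l2_inner E f f - (cnj c * l2_inner E f g + cnj (cnj c * l2_inner E f g)) + (c * cnj c) * l2_inner E g g"
    using l2_inner_commute [of g f] by (simp add: algebra_simps)
  finally have "complex_of_real ((l2_norm E (\<lambda>t. f t - c *\<^sub>C g t))\<^sup>2) = complex_of_real
      ((l2_norm E f)\<^sup>2 - 2 * Re (cnj c * l2_inner E f g) + (cmod c)\<^sup>2 * (l2_norm E g)\<^sup>2)"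
    unfolding complex_add_cnj complex_norm_square [symmetric] l2_inner_self by simp
  then show ?thesis by (simp only: of_real_eq_iff)
qed

text \<open>A quadratic in a real parameter, after the phase has been aligned with \<open>c\<close>.
  The form is only semidefinite on representatives, which makes the case \<open>b = 0\<close>
  separate.\<close>

lemma l2_cauchy_schwarz:
  assumes f: "f \<in> L2 E" and g: "g \<in> L2 E"
  shows "cmod (l2_inner E f g) \<le> l2_norm E f * l2_norm E g"
proof -
  define c where "c = l2_inner E f g"
  define a where "a = (l2_norm E f)\<^sup>2"
  define b where "b = (l2_norm E g)\<^sup>2"
  have quad: "0 \<le> a - 2 * r * (cmod c)\<^sup>2 + r\<^sup>2 * (cmod c)\<^sup>2 * b" for r :: real
  proof -
    have "0 \<le> (l2_norm E (\<lambda>t. f t - (of_real r * c) *\<^sub>C g t))\<^sup>2" by simp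
    also have "\<dots> = a - 2 * Re (cnj (of_real r * c) * c) + (cmod (of_real r * c))\<^sup>2 * b"
      by (simp add: l2_norm_diff_scaleC_squared [OF f g] a_def b_def c_def)
    also have "cnj (of_real r * c) * c = of_real (r * (cmod c)\<^sup>2)"
      using complex_norm_square [of c] by (simp add: mult.commute mult.left_commute)
    also have "(cmod (of_real r * c))\<^sup>2 = r\<^sup>2 * (cmod c)\<^sup>2" by (simp add: norm_mult power_mult_distrib)
    finally show ?thesis by simp
  qed
  have "(cmod c)\<^sup>2 \<le> a * b"
  proof (cases "b = 0")
    case True
    have "c = 0"
    proof (rule ccontr)
      assume "c \<noteq> 0"
      then have "0 < (cmod c)\<^sup>2" by simp
      \<comment> \<open>With \<open>b = 0\<close> the quadratic is linear in \<open>r\<close>, and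
        this \<open>r\<close> gives it the value -1.\<close>
      then show False using quad [of "(a + 1) / (2 * (cmod c)\<^sup>2)"] True a_def by simp
    qed
    then show ?thesis using True by simp
  next
    case False
    then have b: "0 < b" by (simp add: b_def)
    have "0 \<le> a - (cmod c)\<^sup>2 / b" using quad [of "1 / b"] b by (simp add: power2_eq_square field_simps)
    then show ?thesis using b by (simp add: field_simps)
  qed
  then have "(cmod c)\<^sup>2 \<le> (l2_norm E f * l2_norm E g)\<^sup>2" by (simp add: a_def b_def power_mult_distrib)
  then show ?thesis unfolding c_def by (rule power2_le_imp_le) (simp add: l2_norm_nonneg)
qed

lemma l2_norm_scaleC: "l2_norm E (\<lambda>t. c *\<^sub>C f t) = cmod c * l2_norm E f"
  by (simp add: l2_norm_def norm_scaleC power_mult_distrib real_sqrt_mult)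

lemma l2_norm_triangle_diff:
  assumes f: "f \<in> L2 E" and g: "g \<in> L2 E"
  shows "l2_norm E (\<lambda>t. f t - g t) \<le> l2_norm E f + l2_norm E g"
proof -
  have "(l2_norm E (\<lambda>t. f t - g t))\<^sup>2 = (l2_norm E f)\<^sup>2 - 2 * Re (l2_inner E f g) + (l2_norm E g)\<^sup>2"
    using l2_norm_diff_scaleC_squared [OF assms, of 1] by simp
  also have "\<dots> \<le> (l2_norm E f + l2_norm E g)\<^sup>2"
    using l2_cauchy_schwarz [OF assms] abs_Re_le_cmod [of "l2_inner E f g"] by (simp add: power2_sum)
  finally show ?thesis by (rule power2_le_imp_le) (simp add: l2_norm_nonneg)
qed

lemma l2_norm_uminus: "l2_norm E (\<lambda>t. - f t) = l2_norm E f"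
  by (simp add: l2_norm_def)

lemma l2_norm_triangle:
  assumes f: "f \<in> L2 E" and g: "g \<in> L2 E"
  shows "l2_norm E (\<lambda>t. f t + g t) \<le> l2_norm E f + l2_norm E g"
  using l2_norm_triangle_diff [OF f L2_scaleC [OF g, of "- 1"]] l2_norm_scaleC [of "- 1" g]
  by (simp add: scaleC_minus_left)

lemma l2_norm_diff_triangle:
  assumes "f \<in> L2 E" "g \<in> L2 E" "h \<in> L2 E"
  shows "l2_norm E (\<lambda>t. f t - h t) \<le> l2_norm E (\<lambda>t. f t - g t) + l2_norm E (\<lambda>t. g t - h t)"
  using l2_norm_triangle [OF L2_diff [OF assms(1,2)] L2_diff [OF assms(2,3)]] by simp

text \<open>If \<open>h\<^sub>m\<close> are the norms of the increments, then \<open>G = \<Sum> 2\<^sup>m h\<^sub>m\<^sup>2\<close> is integrable and dominates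
  the tails pointwise: \<open>h\<^sub>m \<le> \<surd>G 2\<^sup>-\<^sup>m\<^sup>/\<^sup>2\<close>.\<close>

lemma L2_complete:
  assumes F: "\<And>m. F m \<in> L2 E" and C: "\<And>m. l2_norm E (\<lambda>t. F (Suc m) t - F m t) \<le> C * (1 / 2) ^ m"
  shows "\<exists>f\<in>L2 E. (\<lambda>m. l2_norm E (\<lambda>t. F m t - f t)) \<longlonglongrightarrow> 0"
proof -
  define h where "h m t = norm (F (Suc m) t - F m t)" for m t
  \<comment> \<open>Where the sequence diverges \<open>lim\<close> is some unspecified value;
    \<open>f\<close> is measurable all the same, and the estimates are needed only almost
    everywhere.\<close>
  define f where "f t = lim (\<lambda>m. F m t)" for t
  define \<rho> :: real where "\<rho> = 1 / sqrt 2"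
  have \<rho>: "0 < \<rho>" "\<rho> < 1" "\<rho>\<^sup>2 = 1 / 2" by (simp_all add: \<rho>_def power_divide)
  have Fd: "(\<lambda>t. F (Suc m) t - F m t) \<in> L2 E" for m by (rule L2_diff [OF F F])
  have h2: "integrable (leb E) (\<lambda>t. 2 ^ m * (h m t)\<^sup>2)" for m
    using L2_integrable [OF Fd, of m] by (simp add: h_def)
  \<comment> \<open>The weight \<open>2 ^ m\<close> lies between 1 and \<open>4 ^ m\<close>, the
    inverse of the squared rate: the weighted integrals still decay geometrically, while a finite
    weighted sum forces geometric decay of \<open>h m t\<close>.\<close>
  have Ih: "(LINT t|leb E. 2 ^ m * (h m t)\<^sup>2) \<le> C\<^sup>2 * (1 / 2) ^ m" for m
  proof -
    have "(LINT t|leb E. 2 ^ m * (h m t)\<^sup>2) = 2 ^ m * (l2_norm E (\<lambda>t. F (Suc m) t - F m t))\<^sup>2"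
      by (simp add: l2_norm_squared h_def)
    also have "\<dots> \<le> 2 ^ m * (C * (1 / 2) ^ m)\<^sup>2"
      by (intro mult_left_mono power_mono C l2_norm_nonneg) simp
    also have "\<dots> = C\<^sup>2 * (1 / 2) ^ m" by (simp add: power_mult_distrib power_divide power2_eq_square field_simps flip: power_add)
    finally show ?thesis .
  qed
  have sumI: "summable (\<lambda>m. LINT t|leb E. 2 ^ m * (h m t)\<^sup>2)"
  proof (rule summable_comparison_test')
    show "summable (\<lambda>m. C\<^sup>2 * (1 / 2 :: real) ^ m)" by (intro summable_mult summable_geometric) simp
    fix m show "norm (LINT t|leb E. 2 ^ m * (h m t)\<^sup>2) \<le> C\<^sup>2 * (1 / 2) ^ m"
      using Ih [of m] by simp
  qed
  have AEs: "AE t in leb E. summable (\<lambda>m. 2 ^ m * (h m t)\<^sup>2)"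
  proof -
    have meas: "(\<lambda>t. ennreal (2 ^ m * (h m t)\<^sup>2)) \<in> borel_measurable (leb E)" for m
      using borel_measurable_integrable [OF h2 [of m]] by simp
    have "(\<integral>\<^sup>+t. (\<Sum>m. ennreal (2 ^ m * (h m t)\<^sup>2)) \<partial>leb E) = (\<Sum>m. \<integral>\<^sup>+t. ennreal (2 ^ m * (h m t)\<^sup>2) \<partial>leb E)"
      by (rule nn_integral_suminf [OF meas])
    also have "\<dots> = (\<Sum>m. ennreal (LINT t|leb E. 2 ^ m * (h m t)\<^sup>2))"
      by (intro suminf_cong nn_integral_eq_integral h2) simp
    also have "\<dots> \<noteq> top" by (rule ennreal_suminf_neq_top [OF sumI]) simp
    finally have "AE t in leb E. (\<Sum>m. ennreal (2 ^ m * (h m t)\<^sup>2)) \<noteq> \<infinity>"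
      using meas by (intro nn_integral_PInf_AE) auto
    then show ?thesis
      by eventually_elim (rule summable_suminf_not_top, auto)
  qed
  define G where "G t = (\<Sum>m. 2 ^ m * (h m t)\<^sup>2)" for t
  have Gi: "integrable (leb E) G"
    unfolding G_def using h2 AEs sumI by (intro integrable_suminf) auto
  have point: "norm (F m t - f t) \<le> sqrt (G t) * \<rho> ^ m / (1 - \<rho>)"
    if s: "summable (\<lambda>m. 2 ^ m * (h m t)\<^sup>2)" for m t
  proof -
    have hG: "h k t \<le> sqrt (G t) * \<rho> ^ k" for k
    proof -
      have "2 ^ k * (h k t)\<^sup>2 = (\<Sum>m\<in>{k}. 2 ^ m * (h m t)\<^sup>2)" by simp
      also have "\<dots> \<le> G t" unfolding G_def by (rule sum_le_suminf [OF s]) auto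
      finally have "(h k t)\<^sup>2 \<le> G t * (1 / 2) ^ k" by (simp add: field_simps power_divide)
      also have "\<dots> = G t * (\<rho> ^ k)\<^sup>2" unfolding \<rho>(3) [symmetric] by (simp add: power_mult [symmetric] mult.commute)
      finally have "sqrt ((h k t)\<^sup>2) \<le> sqrt (G t * (\<rho> ^ k)\<^sup>2)" by (rule real_sqrt_le_mono)
      then show ?thesis using \<rho> by (simp add: real_sqrt_mult h_def)
    qed
    have sg: "summable (\<lambda>k. sqrt (G t) * \<rho> ^ k)" using \<rho> by (intro summable_mult summable_geometric) simp
    have sh: "summable (\<lambda>k. norm (F (Suc k) t - F k t))"
      by (rule summable_comparison_test' [OF sg]) (use hG in \<open>simp add: h_def\<close>)
    have tele: "F m t = F 0 t + (\<Sum>k<m. F (Suc k) t - F k t)" for m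
      by (simp add: sum_lessThan_telescope [of "\<lambda>k. F k t"])
    have "(\<lambda>m. F 0 t + (\<Sum>k<m. F (Suc k) t - F k t)) \<longlonglongrightarrow> F 0 t + (\<Sum>k. F (Suc k) t - F k t)"
      by (intro tendsto_intros summable_LIMSEQ summable_norm_cancel [OF sh])
    then have Ff: "(\<lambda>m. F m t) \<longlonglongrightarrow> f t"
      unfolding f_def tele [symmetric] using convergent_def convergent_LIMSEQ_iff by blast
    have "norm (F m t - F (m + k) t) \<le> sqrt (G t) * \<rho> ^ m / (1 - \<rho>)" for k
    proof -
      have "F (m + k) t - F m t = (\<Sum>j<k. F (Suc (m + j)) t - F (m + j) t)"
        using sum_lessThan_telescope [of "\<lambda>j. F (m + j) t" k] by simp
      also have "norm \<dots> \<le> (\<Sum>j<k. sqrt (G t) * \<rho> ^ (m + j))"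
        by (rule sum_norm_le) (use hG in \<open>simp add: h_def\<close>)
      also have "\<dots> = sqrt (G t) * \<rho> ^ m * (\<Sum>j<k. \<rho> ^ j)"
        by (simp add: sum_distrib_left power_add mult.assoc)
      also have "\<dots> \<le> sqrt (G t) * \<rho> ^ m * (1 / (1 - \<rho>))"
      proof (rule mult_left_mono)
        have "(\<Sum>j<k. \<rho> ^ j) = (1 - \<rho> ^ k) / (1 - \<rho>)" using \<rho> by (simp add: sum_gp_strict)
        also have "\<dots> \<le> 1 / (1 - \<rho>)" using \<rho> by (intro divide_right_mono) auto
        finally show "(\<Sum>j<k. \<rho> ^ j) \<le> 1 / (1 - \<rho>)" .
        show "0 \<le> sqrt (G t) * \<rho> ^ m"
          unfolding G_def using \<rho> s by (intro mult_nonneg_nonneg real_sqrt_ge_zero suminf_nonneg) auto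
      qed
      finally show ?thesis by (simp add: norm_minus_commute)
    qed
    moreover have "(\<lambda>k. norm (F m t - F (m + k) t)) \<longlonglongrightarrow> norm (F m t - f t)"
      using LIMSEQ_ignore_initial_segment [OF Ff, of m] by (intro tendsto_intros) (simp add: add.commute)
    ultimately show ?thesis by (intro LIMSEQ_le_const2) auto
  qed
  define c where "c = (1 / (1 - \<rho>))\<^sup>2"
  have point2: "(norm (F m t - f t))\<^sup>2 \<le> c * (1 / 2) ^ m * G t"
    if s: "summable (\<lambda>m. 2 ^ m * (h m t)\<^sup>2)" for m t
  proof -
    have G0: "0 \<le> G t" unfolding G_def using s by (intro suminf_nonneg) auto
    have "(norm (F m t - f t))\<^sup>2 \<le> (sqrt (G t) * \<rho> ^ m / (1 - \<rho>))\<^sup>2"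
      by (intro power_mono point [OF s] norm_ge_zero)
    also have "\<dots> = c * (\<rho>\<^sup>2) ^ m * G t"
      using G0 by (simp add: c_def power_mult_distrib power_divide power_mult [symmetric] mult.commute)
    finally show ?thesis unfolding \<rho>(3) .
  qed
  have fm: "f \<in> borel_measurable (leb E)"
    unfolding f_def using L2_measurable [OF F] by (intro borel_measurable_lim_metric)
  have FfL2: "(\<lambda>t. F m t - f t) \<in> L2 E" for m
    unfolding L2_def
  proof (intro CollectI conjI)
    show m: "(\<lambda>t. F m t - f t) \<in> borel_measurable (leb E)" using L2_measurable [OF F] fm by simp
    show "integrable (leb E) (\<lambda>t. (norm (F m t - f t))\<^sup>2)"
    proof (rule Bochner_Integration.integrable_bound)
      show "integrable (leb E) (\<lambda>t. c * (1 / 2) ^ m * G t)" using Gi by simp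
      show "(\<lambda>t. (norm (F m t - f t))\<^sup>2) \<in> borel_measurable (leb E)" using m by measurable
      show "AE t in leb E. norm ((norm (F m t - f t))\<^sup>2) \<le> norm (c * (1 / 2) ^ m * G t)"
        using AEs by eventually_elim (use point2 [of _ m] in fastforce)
    qed
  qed
  have "f \<in> L2 E" using L2_diff [OF F [of 0] FfL2 [of 0]] by simp
  moreover have "(\<lambda>m. l2_norm E (\<lambda>t. F m t - f t)) \<longlonglongrightarrow> 0"
  proof -
    have "(\<lambda>m. sqrt (c * (LINT t|leb E. G t) * (1 / 2) ^ m)) \<longlonglongrightarrow> sqrt (c * (LINT t|leb E. G t) * 0)"
      by (intro tendsto_intros LIMSEQ_power_zero) simp
    then have lim0: "(\<lambda>m. sqrt (c * (LINT t|leb E. G t) * (1 / 2) ^ m)) \<longlonglongrightarrow> 0" by simp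
    have "l2_norm E (\<lambda>t. F m t - f t) \<le> sqrt (c * (LINT t|leb E. G t) * (1 / 2) ^ m)" for m
    proof -
      have "(LINT t|leb E. (norm (F m t - f t))\<^sup>2) \<le> (LINT t|leb E. c * (1 / 2) ^ m * G t)"
      proof (rule integral_mono_AE [OF L2_integrable [OF FfL2]])
        show "integrable (leb E) (\<lambda>t. c * (1 / 2) ^ m * G t)" using Gi by simp
        show "AE t in leb E. (norm (F m t - f t))\<^sup>2 \<le> c * (1 / 2) ^ m * G t"
          using AEs by eventually_elim (rule point2)
      qed
      then show ?thesis by (simp add: l2_norm_def mult.commute mult.left_commute)
    qed
    then show ?thesis
      by (intro tendsto_sandwich [OF _ _ tendsto_const lim0]) (auto simp: l2_norm_nonneg)
  qed
  ultimately show ?thesis by blast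
qed

text \<open>The projection argument for a subspace that need not be closed: a minimising sequence in
  \<open>V\<close> has a limit \<open>f\<close> in L2, possibly outside \<open>V\<close>, and
  \<open>w = g - f\<close> is orthogonal to \<open>V\<close>, hence null.\<close>

lemma L2_dense_of_orthogonal_trivial:
  assumes V: "V \<subseteq> L2 E" "V \<noteq> {}"
    and lin: "\<And>u v a b. u \<in> V \<Longrightarrow> v \<in> V \<Longrightarrow> (\<lambda>t. a *\<^sub>C u t + b *\<^sub>C v t) \<in> V"
    and orth: "\<And>w. w \<in> L2 E \<Longrightarrow> (\<And>v. v \<in> V \<Longrightarrow> l2_inner E v w = 0) \<Longrightarrow> l2_norm E w = 0"
    and g: "g \<in> L2 E" and e: "0 < e"
  shows "\<exists>v\<in>V. l2_norm E (\<lambda>t. g t - v t) < e"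
proof -
  define D where "D v = (l2_norm E (\<lambda>t. g t - v t))\<^sup>2" for v
  define d where "d = Inf (D ` V)"
  have bdd: "bdd_below (D ` V)" unfolding D_def by (intro bdd_belowI [of _ 0]) auto
  have d: "d \<le> D v" if "v \<in> V" for v unfolding d_def using that by (intro cInf_lower bdd) auto
  have d0: "0 \<le> d" unfolding d_def using V(2) by (intro cInf_greatest) (auto simp: D_def)
  \<comment> \<open>By the parallelogram law the gap \<open>(1 / 4) ^ m\<close> makes consecutive
    members differ by at most \<open>2 * (1 / 2) ^ m\<close>, the rate that
    \<open>L2_complete\<close> asks for.\<close>
  have "\<exists>v\<in>V. D v < d + (1 / 4) ^ m" for m
    using cInf_lessD [of "D ` V" "d + (1 / 4) ^ m"] V(2) by (auto simp: d_def)
  then obtain v where v: "\<And>m. v m \<in> V" "\<And>m. D (v m) < d + (1 / 4) ^ m" by metis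
  have vL: "v m \<in> L2 E" for m using v(1) V(1) by blast
  have step: "l2_norm E (\<lambda>t. v (Suc m) t - v m t) \<le> 2 * (1 / 2) ^ m" for m
  proof -
    define x where "x t = g t - v m t" for t
    define y where "y t = g t - v (Suc m) t" for t
    have xy: "x \<in> L2 E" "y \<in> L2 E" unfolding x_def y_def by (intro L2_diff g vL)+
    have "(\<lambda>t. (1 / 2) *\<^sub>C v m t + (1 / 2) *\<^sub>C v (Suc m) t) \<in> V" by (intro lin v)
    from d [OF this] have "4 * d \<le> 4 * (l2_norm E (\<lambda>t. g t - ((1 / 2) *\<^sub>C v m t + (1 / 2) *\<^sub>C v (Suc m) t)))\<^sup>2"
      by (simp add: D_def)
    also have "\<dots> = (l2_norm E (\<lambda>t. 2 *\<^sub>C (g t - ((1 / 2) *\<^sub>C v m t + (1 / 2) *\<^sub>C v (Suc m) t))))\<^sup>2"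
      by (simp add: l2_norm_scaleC power_mult_distrib)
    also have "(\<lambda>t. 2 *\<^sub>C (g t - ((1 / 2) *\<^sub>C v m t + (1 / 2) *\<^sub>C v (Suc m) t))) = (\<lambda>t. x t - (- 1) *\<^sub>C y t)"
    proof
      fix t
      have "2 *\<^sub>C (g t) = g t + g t" using scaleC_add_left [of 1 1 "g t"] by simp
      then show "2 *\<^sub>C (g t - ((1 / 2) *\<^sub>C v m t + (1 / 2) *\<^sub>C v (Suc m) t)) = x t - (- 1) *\<^sub>C y t"
        by (simp add: x_def y_def scaleC_diff_right scaleC_add_right scaleC_scaleC scaleC_minus_left)
    qed
    finally have "4 * d \<le> D (v m) + 2 * Re (l2_inner E x y) + D (v (Suc m))"
      unfolding l2_norm_diff_scaleC_squared [OF xy] by (simp add: D_def x_def [abs_def] y_def [abs_def])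
    moreover have "(l2_norm E (\<lambda>t. v (Suc m) t - v m t))\<^sup>2 = D (v m) - 2 * Re (l2_inner E x y) + D (v (Suc m))"
      using l2_norm_diff_scaleC_squared [OF xy, of 1] by (simp add: D_def x_def [abs_def] y_def [abs_def])
    ultimately have "(l2_norm E (\<lambda>t. v (Suc m) t - v m t))\<^sup>2 \<le> 2 * D (v m) + 2 * D (v (Suc m)) - 4 * d" by linarith
    also have "\<dots> \<le> 2 * (1 / 4) ^ m + 2 * (1 / 4) ^ Suc m" using v(2) [of m] v(2) [of "Suc m"] by simp
    also have "\<dots> \<le> 4 * (1 / 4) ^ m" by simp
    also have "\<dots> = (2 * (1 / 2) ^ m)\<^sup>2" by (simp add: power_mult_distrib power_divide power2_eq_square flip: power_mult_distrib)
    finally show ?thesis by (rule power2_le_imp_le) simp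
  qed
  obtain f where f: "f \<in> L2 E" "(\<lambda>m. l2_norm E (\<lambda>t. v m t - f t)) \<longlonglongrightarrow> 0"
    using L2_complete [OF vL step] by blast
  define w where "w t = g t - f t" for t
  have w: "w \<in> L2 E" unfolding w_def by (rule L2_diff [OF g f(1)])
  have sqd: "(\<lambda>m. sqrt (d + (1 / 4) ^ m)) \<longlonglongrightarrow> sqrt (d + 0)"
    by (intro tendsto_intros LIMSEQ_power_zero) simp
  have wd: "l2_norm E w \<le> sqrt d"
  proof (rule LIMSEQ_le_const)
    show "(\<lambda>m. sqrt (d + (1 / 4) ^ m) + l2_norm E (\<lambda>t. v m t - f t)) \<longlonglongrightarrow> sqrt d"
      using tendsto_add [OF sqd f(2)] by simp
    have "l2_norm E w \<le> sqrt (d + (1 / 4) ^ m) + l2_norm E (\<lambda>t. v m t - f t)" for m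
    proof -
      have "l2_norm E (\<lambda>t. g t - v m t) \<le> sqrt (d + (1 / 4) ^ m)"
        using v(2) [of m] by (intro real_le_rsqrt) (simp add: D_def)
      then show ?thesis using l2_norm_diff_triangle [OF g vL f(1), of m] by (simp add: w_def [abs_def])
    qed
    then show "\<exists>N. \<forall>m\<ge>N. l2_norm E w \<le> sqrt (d + (1 / 4) ^ m) + l2_norm E (\<lambda>t. v m t - f t)" by blast
  qed
  \<comment> \<open>\<open>v m + c u\<close> stays in \<open>V\<close>, so moving the limit
    \<open>w\<close> along a vector of \<open>V\<close> cannot bring its norm below the infimum.
    Minimality along every line is orthogonality.\<close>
  have wmin: "sqrt d \<le> l2_norm E (\<lambda>t. w t - c *\<^sub>C u t)" if u: "u \<in> V" for u c
  proof (rule LIMSEQ_le_const)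
    have uL: "u \<in> L2 E" using u V(1) by blast
    show "(\<lambda>m. l2_norm E (\<lambda>t. w t - c *\<^sub>C u t) + l2_norm E (\<lambda>t. v m t - f t)) \<longlonglongrightarrow> l2_norm E (\<lambda>t. w t - c *\<^sub>C u t)"
      using tendsto_add [OF tendsto_const f(2)] by simp
    have "sqrt d \<le> l2_norm E (\<lambda>t. w t - c *\<^sub>C u t) + l2_norm E (\<lambda>t. v m t - f t)" for m
    proof -
      have "(\<lambda>t. 1 *\<^sub>C v m t + c *\<^sub>C u t) \<in> V" by (intro lin v u)
      from d [OF this] have "sqrt d \<le> l2_norm E (\<lambda>t. g t - (v m t + c *\<^sub>C u t))"
        by (intro real_le_lsqrt) (simp_all add: D_def l2_norm_nonneg)
      also have "(\<lambda>t. g t - (v m t + c *\<^sub>C u t)) = (\<lambda>t. (w t - c *\<^sub>C u t) - (v m t - f t))"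
        by (simp add: w_def fun_eq_iff)
      also have "l2_norm E \<dots> \<le> l2_norm E (\<lambda>t. w t - c *\<^sub>C u t) + l2_norm E (\<lambda>t. v m t - f t)"
        by (intro l2_norm_triangle_diff L2_diff_scaleC w uL L2_diff vL f)
      finally show ?thesis .
    qed
    then show "\<exists>N. \<forall>m\<ge>N. sqrt d \<le> l2_norm E (\<lambda>t. w t - c *\<^sub>C u t) + l2_norm E (\<lambda>t. v m t - f t)" by blast
  qed
  have "l2_inner E u w = 0" if u: "u \<in> V" for u
  proof -
    have uL: "u \<in> L2 E" using u V(1) by blast
    define c where "c = l2_inner E w u"
    have quad: "2 * r * (cmod c)\<^sup>2 \<le> r\<^sup>2 * (cmod c)\<^sup>2 * (l2_norm E u)\<^sup>2" for r :: real
    proof -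
      have "(l2_norm E w)\<^sup>2 \<le> (l2_norm E (\<lambda>t. w t - (of_real r * c) *\<^sub>C u t))\<^sup>2"
        using wd wmin [OF u, of "of_real r * c"] by (intro power_mono l2_norm_nonneg) linarith
      also have "\<dots> = (l2_norm E w)\<^sup>2 - 2 * Re (cnj (of_real r * c) * c) + (cmod (of_real r * c))\<^sup>2 * (l2_norm E u)\<^sup>2"
        by (simp add: l2_norm_diff_scaleC_squared [OF w uL] c_def)
      also have "cnj (of_real r * c) * c = of_real (r * (cmod c)\<^sup>2)"
        using complex_norm_square [of c] by (simp add: mult.commute mult.left_commute)
      also have "(cmod (of_real r * c))\<^sup>2 = r\<^sup>2 * (cmod c)\<^sup>2" by (simp add: norm_mult power_mult_distrib)
      finally show ?thesis by simp
    qed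
    have "c = 0"
    proof (rule ccontr)
      assume "c \<noteq> 0"
      then have c2: "0 < (cmod c)\<^sup>2" by simp
      define b where "b = (l2_norm E u)\<^sup>2 + 1"
      have b: "1 \<le> b" "(l2_norm E u)\<^sup>2 = b - 1" by (simp_all add: b_def)
      have "2 * (1 / b) * (cmod c)\<^sup>2 \<le> ((1 / b)\<^sup>2 * (b - 1)) * (cmod c)\<^sup>2"
        using quad [of "1 / b"] b by (simp add: mult.commute mult.left_commute)
      then have "2 * (1 / b) \<le> (1 / b)\<^sup>2 * (b - 1)" using c2 by (rule mult_right_le_imp_le)
      then have "2 * b \<le> b - 1" using b by (simp add: power2_eq_square field_simps)
      then show False using b by simp
    qed
    then show ?thesis using l2_inner_commute [of u w] by (simp add: c_def)
  qed
  then have w0: "l2_norm E w = 0" by (intro orth w)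
  obtain m where m: "l2_norm E (\<lambda>t. v m t - f t) < e"
    using order_tendstoD(2) [OF f(2) e] by (auto simp: eventually_sequentially)
  have "l2_norm E (\<lambda>t. g t - v m t) \<le> l2_norm E (\<lambda>t. g t - f t) + l2_norm E (\<lambda>t. f t - v m t)"
    by (rule l2_norm_diff_triangle [OF g f(1) vL])
  also have "l2_norm E (\<lambda>t. f t - v m t) = l2_norm E (\<lambda>t. v m t - f t)"
    using l2_norm_uminus [of "\<lambda>t. v m t - f t"] by simp
  finally have "l2_norm E (\<lambda>t. g t - v m t) < e" using w0 m unfolding w_def [abs_def] by simp
  then show ?thesis using v(1) [of m] by (rule bexI)
qed

text \<open>Ranges of \<open>T - \<lambda>\<close> for a symmetric operator \<open>T\<close>: if one of them is dense for some \<open>\<lambda>\<close> in a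
  half-plane, then all are.\<close>

context
  fixes T :: "'h l2_op"
  assumes T: "T \<subseteq> L2 E \<times> L2 E" "T \<noteq> {}"
    and lin: "\<And>u f v g a b. (u, f) \<in> T \<Longrightarrow> (v, g) \<in> T \<Longrightarrow>
      ((\<lambda>t. a *\<^sub>C u t + b *\<^sub>C v t), (\<lambda>t. a *\<^sub>C f t + b *\<^sub>C g t)) \<in> T"
    and sym: "\<And>u f v g. (u, f) \<in> T \<Longrightarrow> (v, g) \<in> T \<Longrightarrow> l2_inner E f v = l2_inner E u g"
begin

definition dense_range :: "complex \<Rightarrow> bool" where
  "dense_range \<nu> \<longleftrightarrow> (\<forall>g\<in>L2 E. \<forall>e>0. \<exists>u f. (u, f) \<in> T \<and> l2_norm E (\<lambda>t. g t - (f t - \<nu> *\<^sub>C u t)) < e)"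

lemma T_L2: "(u, f) \<in> T \<Longrightarrow> u \<in> L2 E" "(u, f) \<in> T \<Longrightarrow> f \<in> L2 E" using T by auto

lemma dense_rangeI:
  assumes "\<And>w. w \<in> L2 E \<Longrightarrow> (\<And>u f. (u, f) \<in> T \<Longrightarrow> l2_inner E f w = \<nu> * l2_inner E u w) \<Longrightarrow> l2_norm E w = 0"
  shows "dense_range \<nu>"
  unfolding dense_range_def
proof (intro ballI allI impI)
  fix g :: "real \<Rightarrow> 'h" and e :: real assume g: "g \<in> L2 E" and e: "0 < e"
  define V where "V = (\<lambda>(u, f) t. f t - \<nu> *\<^sub>C u t) ` T"
  have "\<exists>v\<in>V. l2_norm E (\<lambda>t. g t - v t) < e"
  proof (rule L2_dense_of_orthogonal_trivial [OF _ _ _ _ g e])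
    show "V \<subseteq> L2 E" unfolding V_def using T_L2 by (auto intro!: L2_diff_scaleC)
    show "V \<noteq> {}" using T(2) by (simp add: V_def)
    show "(\<lambda>t. a *\<^sub>C u t + b *\<^sub>C v t) \<in> V" if uv: "u \<in> V" "v \<in> V" for u v a b
    proof -
      obtain u1 f1 u2 f2 where *: "(u1, f1) \<in> T" "u = (\<lambda>t. f1 t - \<nu> *\<^sub>C u1 t)" "(u2, f2) \<in> T" "v = (\<lambda>t. f2 t - \<nu> *\<^sub>C u2 t)"
        using uv by (auto simp: V_def)
      have "(\<lambda>t. a *\<^sub>C u t + b *\<^sub>C v t) = (\<lambda>t. (a *\<^sub>C f1 t + b *\<^sub>C f2 t) - \<nu> *\<^sub>C (a *\<^sub>C u1 t + b *\<^sub>C u2 t))"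
        by (simp add: * scaleC_diff_right scaleC_add_right scaleC_scaleC mult.commute algebra_simps)
      then show ?thesis unfolding V_def using lin [OF *(1,3), of a b] by force
    qed
    show "l2_norm E w = 0" if w: "w \<in> L2 E" "\<And>v. v \<in> V \<Longrightarrow> l2_inner E v w = 0" for w
    proof (rule assms [OF w(1)])
      fix u f assume uf: "(u, f) \<in> T"
      then have "(\<lambda>t. f t - \<nu> *\<^sub>C u t) \<in> V" unfolding V_def by force
      from w(2) [OF this] show "l2_inner E f w = \<nu> * l2_inner E u w"
        using T_L2 [OF uf] w(1) by (simp add: l2_inner_diff_left)
    qed
  qed
  then show "\<exists>u f. (u, f) \<in> T \<and> l2_norm E (\<lambda>t. g t - (f t - \<nu> *\<^sub>C u t)) < e"
    unfolding V_def by auto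
qed

text \<open>By symmetry \<open>l2_inner E f u\<close> is real, so the imaginary part of the product
  of \<open>f - \<nu> u\<close> with \<open>u\<close> is \<open>- Im \<nu>\<close> times the squared
  norm of \<open>u\<close>.\<close>

lemma norm_le_range:
  assumes uf: "(u, f) \<in> T"
  shows "\<bar>Im \<nu>\<bar> * l2_norm E u \<le> l2_norm E (\<lambda>t. f t - \<nu> *\<^sub>C u t)"
proof (cases "l2_norm E u = 0")
  case True
  then show ?thesis by (simp add: l2_norm_nonneg)
next
  case False
  then have pos: "0 < l2_norm E u" using l2_norm_nonneg [of u] by linarith
  note L = T_L2 [OF uf]
  have "l2_inner E f u = cnj (l2_inner E f u)"
    using sym [OF uf uf] l2_inner_commute [of f u] by simp
  then have "Im (l2_inner E f u) = 0" by (simp add: complex_eq_iff)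
  then have "Im (l2_inner E (\<lambda>t. f t - \<nu> *\<^sub>C u t) u) = - Im \<nu> * (l2_norm E u)\<^sup>2"
    by (simp add: l2_inner_diff_left L l2_inner_self flip: of_real_power)
  then have "\<bar>Im \<nu>\<bar> * (l2_norm E u)\<^sup>2 \<le> cmod (l2_inner E (\<lambda>t. f t - \<nu> *\<^sub>C u t) u)"
    using abs_Im_le_cmod [of "l2_inner E (\<lambda>t. f t - \<nu> *\<^sub>C u t) u"] by (simp add: abs_mult)
  also have "\<dots> \<le> l2_norm E (\<lambda>t. f t - \<nu> *\<^sub>C u t) * l2_norm E u"
    by (intro l2_cauchy_schwarz L2_diff_scaleC L)
  finally show ?thesis using pos by (simp add: power2_eq_square)
qed

text \<open>A \<open>w\<close> orthogonal to the range for \<open>\<nu>\<close> is approximated by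
  \<open>v = f - \<mu> u\<close>. Then \<open>(v, w) = (\<nu> - \<mu>) (u, w)\<close> has modulus at
  most \<open>\<kappa> |v| |w|\<close> with \<open>\<kappa> < 1\<close>, too small for a vector
  close to \<open>w\<close>. The tolerance \<open>(1 - \<kappa>) * W / 4\<close> is half of what
  would break the final inequality.\<close>

lemma dense_range_near:
  assumes \<mu>: "dense_range \<mu>" and near: "cmod (\<nu> - \<mu>) < \<bar>Im \<mu>\<bar>"
  shows "dense_range \<nu>"
proof (rule dense_rangeI, rule ccontr)
  fix w assume w: "w \<in> L2 E" and orth: "\<And>u f. (u, f) \<in> T \<Longrightarrow> l2_inner E f w = \<nu> * l2_inner E u w"
    and w0: "l2_norm E w \<noteq> 0"
  define W where "W = l2_norm E w"
  have W: "0 < W" using w0 l2_norm_nonneg [of w] by (simp add: W_def)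
  define \<kappa> where "\<kappa> = cmod (\<nu> - \<mu>) / \<bar>Im \<mu>\<bar>"
  have I: "0 < \<bar>Im \<mu>\<bar>" using near norm_ge_zero [of "\<nu> - \<mu>"] by linarith
  have \<kappa>: "0 \<le> \<kappa>" "\<kappa> < 1" using near I by (simp_all add: \<kappa>_def)
  define e where "e = (1 - \<kappa>) * W / 4"
  have e: "0 < e" using \<kappa> W by (simp add: e_def)
  obtain u f where uf: "(u, f) \<in> T" and le: "l2_norm E (\<lambda>t. w t - (f t - \<mu> *\<^sub>C u t)) < e"
    using \<mu> w e unfolding dense_range_def by blast
  note L = T_L2 [OF uf]
  define v where "v t = f t - \<mu> *\<^sub>C u t" for t
  have v: "v \<in> L2 E" unfolding v_def by (rule L2_diff_scaleC [OF L(2,1)])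
  have "l2_inner E v w = (\<nu> - \<mu>) * l2_inner E u w"
    unfolding v_def using orth [OF uf] by (simp add: l2_inner_diff_left L w algebra_simps)
  then have "cmod (l2_inner E v w) \<le> cmod (\<nu> - \<mu>) * (l2_norm E u * W)"
    unfolding W_def by (simp add: norm_mult mult_left_mono l2_cauchy_schwarz L w)
  also have "\<dots> = \<kappa> * (\<bar>Im \<mu>\<bar> * l2_norm E u) * W" using I by (simp add: \<kappa>_def)
  also have "\<dots> \<le> \<kappa> * l2_norm E v * W"
    unfolding v_def using \<kappa> W by (intro mult_right_mono mult_left_mono norm_le_range [OF uf]) auto
  also have "\<dots> \<le> \<kappa> * (W + e) * W"
  proof -
    have "l2_norm E v \<le> l2_norm E w + l2_norm E (\<lambda>t. w t - v t)"
      using l2_norm_triangle_diff [OF w L2_diff [OF w v]] by simp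
    then have "l2_norm E v \<le> W + e" using le by (simp add: W_def v_def)
    then show ?thesis using \<kappa> W by (intro mult_right_mono mult_left_mono) auto
  qed
  finally have 1: "cmod (l2_inner E v w) \<le> \<kappa> * (W + e) * W" .
  have "l2_inner E (\<lambda>t. w t - v t) w = l2_inner E w w - l2_inner E v w"
    using l2_inner_diff_left [OF w v w, of 1] by simp
  then have "l2_inner E w w = l2_inner E (\<lambda>t. w t - v t) w + l2_inner E v w" by simp
  then have "cmod (l2_inner E w w) \<le> cmod (l2_inner E (\<lambda>t. w t - v t) w) + cmod (l2_inner E v w)"
    by (metis norm_triangle_ineq)
  also have "cmod (l2_inner E (\<lambda>t. w t - v t) w) \<le> e * W"
    using l2_cauchy_schwarz [OF L2_diff [OF w v] w] le W
    by (intro order_trans [OF l2_cauchy_schwarz [OF L2_diff [OF w v] w]]) (auto simp: v_def W_def intro!: mult_right_mono)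
  finally have "W\<^sup>2 \<le> e * W + \<kappa> * (W + e) * W"
    using 1 by (simp add: l2_inner_self W_def norm_power)
  then have "W * W \<le> (e + \<kappa> * (W + e)) * W" by (simp add: power2_eq_square algebra_simps)
  then have "W \<le> e + \<kappa> * (W + e)" using W by simp
  moreover have "\<kappa> * e \<le> e" using \<kappa> e by (simp add: mult_le_cancel_right1)
  ultimately have "(1 - \<kappa>) * W \<le> 2 * e" by (simp add: algebra_simps)
  moreover have "(1 - \<kappa>) * W = 4 * e" by (simp add: e_def)
  ultimately show False using e by linarith
qed

text \<open>The segment from \<open>\<mu>\<close> to \<open>\<nu>\<close> is divided into steps
  shorter than \<open>m\<close>. Since both ends lie in the same half-plane, all imaginary parts on
  the segment have modulus at least \<open>m\<close>, so every step is admissible for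
  \<open>dense_range_near\<close>.\<close>

lemma dense_range_half_plane:
  assumes \<mu>: "dense_range \<mu>" and same: "0 < Im \<mu> * Im \<nu>"
  shows "dense_range \<nu>"
proof -
  define m where "m = min \<bar>Im \<mu>\<bar> \<bar>Im \<nu>\<bar>"
  have m: "0 < m" using same unfolding m_def by auto
  obtain K :: nat where K: "cmod (\<nu> - \<mu>) / m < real K" using reals_Archimedean2 by blast
  have K0: "0 < real K" by (rule le_less_trans [OF _ K]) (use m in simp)
  define z where "z j = \<mu> + of_real (real j / real K) * (\<nu> - \<mu>)" for j :: nat
  have Imz: "m \<le> \<bar>Im (z j)\<bar>" if "j \<le> K" for j
  proof -
    define s where "s = real j / real K"
    have s: "0 \<le> s" "s \<le> 1" using that K0 by (simp_all add: s_def)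
    have eq: "Im (z j) = (1 - s) * Im \<mu> + s * Im \<nu>" by (simp add: z_def s_def [symmetric] algebra_simps)
    have m': "m \<le> \<bar>Im \<mu>\<bar>" "m \<le> \<bar>Im \<nu>\<bar>" by (simp_all add: m_def)
    have "m = (1 - s) * m + s * m" by (simp add: algebra_simps)
    also have "\<dots> \<le> (1 - s) * \<bar>Im \<mu>\<bar> + s * \<bar>Im \<nu>\<bar>" using s m' by (intro add_mono mult_left_mono) auto
    also have "\<dots> = \<bar>Im (z j)\<bar>"
    proof (cases "0 < Im \<mu>")
      case True
      then have "0 < Im \<nu>" using same by (simp add: zero_less_mult_iff)
      with True s show ?thesis unfolding eq by (subst abs_of_nonneg) (auto intro!: add_nonneg_nonneg)
    next
      case False
      then have *: "Im \<mu> < 0" "Im \<nu> < 0" using same by (auto simp: zero_less_mult_iff)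
      with s have "(1 - s) * Im \<mu> + s * Im \<nu> \<le> 0" by (intro add_nonpos_nonpos mult_nonneg_nonpos) auto
      with * show ?thesis unfolding eq by (simp add: algebra_simps)
    qed
    finally show ?thesis .
  qed
  have "dense_range (z j)" if "j \<le> K" for j
    using that
  proof (induction j)
    case 0
    then show ?case using \<mu> by (simp add: z_def)
  next
    case (Suc j)
    have "z (Suc j) - z j = of_real (1 / real K) * (\<nu> - \<mu>)"
      by (simp add: z_def add_divide_distrib algebra_simps)
    then have "cmod (z (Suc j) - z j) = cmod (\<nu> - \<mu>) / real K" by (simp add: norm_mult norm_divide)
    also have "\<dots> < m" using K K0 m by (simp add: field_simps)
    also have "m \<le> \<bar>Im (z j)\<bar>" using Suc.prems by (intro Imz) simp
    finally have near: "cmod (z (Suc j) - z j) < \<bar>Im (z j)\<bar>" .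
    show ?case by (rule dense_range_near [OF Suc.IH near]) (use Suc.prems in simp)
  qed
  from this [of K] show ?thesis using K0 by (simp add: z_def)
qed

text \<open>The orthogonal complement of the range for \<open>cnj \<zeta>\<close> is the kernel of
  the adjoint minus \<open>\<zeta>\<close>. The conjugation crosses the half-planes: the kernel at
  \<open>\<zeta>m\<close> controls the range at \<i>.\<close>

lemma dense_range_of_kernel:
  assumes ker: "\<And>u. u \<in> l2_kernel E (l2_adjoint E T) \<zeta> \<Longrightarrow> l2_norm E u = 0"
  shows "dense_range (cnj \<zeta>)"
proof (rule dense_rangeI)
  fix w assume w: "w \<in> L2 E" and *: "\<And>u f. (u, f) \<in> T \<Longrightarrow> l2_inner E f w = cnj \<zeta> * l2_inner E u w"
  have "l2_inner E u (\<lambda>t. \<zeta> *\<^sub>C w t) = cnj \<zeta> * l2_inner E u w" if "(u, f) \<in> T" for u f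
    using l2_inner_lincomb_right [OF w w T_L2(1) [OF that], of \<zeta> 0] by simp
  with * have "w \<in> l2_kernel E (l2_adjoint E T) \<zeta>"
    using w L2_scaleC [OF w] by (auto simp: l2_kernel_def l2_adjoint_def)
  then show "l2_norm E w = 0" by (rule ker)
qed

text \<open>An element of the adjoint is compared with elements of \<open>T\<close> that match it in
  \<open>y - \<i> x\<close>, the other one with elements matching in \<open>y' + \<i> x'\<close>.
  The form \<open>(y, x') - (x, y')\<close> vanishes as soon as one of the pairs lies in
  \<open>T\<close>, so only the errors of the two matchings remain.\<close>

theorem adjoint_symmetric:
  assumes \<zeta>: "0 < Im \<zeta>p" "Im \<zeta>m < 0"
    and ker: "\<And>u. u \<in> l2_kernel E (l2_adjoint E T) \<zeta>p \<Longrightarrow> l2_norm E u = 0"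
      "\<And>u. u \<in> l2_kernel E (l2_adjoint E T) \<zeta>m \<Longrightarrow> l2_norm E u = 0"
    and xy: "(x, y) \<in> l2_adjoint E T" and xy': "(x', y') \<in> l2_adjoint E T"
  shows "l2_inner E y x' = l2_inner E x y'"
proof -
  have d1: "dense_range \<i>"
    by (rule dense_range_half_plane [OF dense_range_of_kernel [OF ker(2)]]) (use \<zeta> in simp_all)
  have d2: "dense_range (- \<i>)"
    by (rule dense_range_half_plane [OF dense_range_of_kernel [OF ker(1)]]) (use \<zeta> in simp_all)
  note d = d1 d2
  have L: "x \<in> L2 E" "y \<in> L2 E" "x' \<in> L2 E" "y' \<in> L2 E"
    using xy xy' by (auto simp: l2_adjoint_def)
  have adj: "l2_inner E f x = l2_inner E u y" "l2_inner E f x' = l2_inner E u y'" if "(u, f) \<in> T" for u f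
    using xy xy' that by (auto simp: l2_adjoint_def)
  define z where "z t = y t - \<i> *\<^sub>C x t" for t
  define z' where "z' t = y' t - (- \<i>) *\<^sub>C x' t" for t
  have z: "z \<in> L2 E" "z' \<in> L2 E" unfolding z_def z'_def by (intro L2_diff_scaleC L)+
  \<comment> \<open>Bounds \<open>dx\<close> for every approximation with error at most 1, because
    \<open>|u| \<le> |f - \<i> u|\<close>; it can therefore be fixed before the approximations are
    chosen.\<close>
  define B where "B = l2_norm E x + l2_norm E z + 1"
  have B: "0 < B" using l2_norm_nonneg [of x] l2_norm_nonneg [of z] by (simp add: B_def)
  have "cmod (l2_inner E y x' - l2_inner E x y') \<le> e" if e0: "0 < e" for e :: real
  proof -
    define e1 where "e1 = e / (2 * B)"
    have e1: "0 < e1" using e0 B by (simp add: e1_def)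
    obtain u' f' where uf': "(u', f') \<in> T" "l2_norm E (\<lambda>t. z' t - (f' t - (- \<i>) *\<^sub>C u' t)) < e1"
      using d(2) z(2) e1 unfolding dense_range_def by blast
    note L' = T_L2 [OF uf'(1)]
    \<comment> \<open>\<open>u'\<close> is chosen first, because the tolerance \<open>e2\<close> of
      the second approximation is divided by a bound that involves its norm.\<close>
    define c where "c = l2_norm E x' + l2_norm E u' + 1"
    have c: "0 < c" using l2_norm_nonneg [of x'] l2_norm_nonneg [of u'] by (simp add: c_def)
    define e2 where "e2 = min 1 (e / (2 * c))"
    have e2: "0 < e2" "e2 \<le> 1" "e2 \<le> e / (2 * c)" using e0 c by (simp_all add: e2_def)
    obtain u f where uf: "(u, f) \<in> T" "l2_norm E (\<lambda>t. z t - (f t - \<i> *\<^sub>C u t)) < e2"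
      using d(1) z(1) e2(1) unfolding dense_range_def by blast
    note Lu = T_L2 [OF uf(1)]
    define s where "s t = z t - (f t - \<i> *\<^sub>C u t)" for t
    define dx where "dx t = x t - u t" for t
    define dy where "dy t = y t - f t" for t
    define r where "r t = z' t - (f' t - (- \<i>) *\<^sub>C u' t)" for t
    have M: "s \<in> L2 E" "dx \<in> L2 E" "dy \<in> L2 E" "r \<in> L2 E"
      unfolding s_def dx_def dy_def r_def by (intro L2_diff L2_diff_scaleC z L Lu L')+
    have sdef: "s = (\<lambda>t. dy t - \<i> *\<^sub>C dx t)"
      by (simp add: s_def dy_def dx_def z_def fun_eq_iff scaleC_diff_right)
    have inner1: "l2_inner E dx v = l2_inner E x v - l2_inner E u v" "l2_inner E dy v = l2_inner E y v - l2_inner E f v"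
      if "v \<in> L2 E" for v
      using l2_inner_diff_left [OF L(1) Lu(1) that, of 1] l2_inner_diff_left [OF L(2) Lu(2) that, of 1]
      by (simp_all add: dx_def [abs_def] dy_def [abs_def])
    have a1: "l2_inner E y x' - l2_inner E x y' = l2_inner E dy x' - l2_inner E dx y'"
      using adj(2) [OF uf(1)] by (simp add: inner1 L)
    have a2: "l2_inner E dy u' = l2_inner E dx f'"
    proof -
      have "l2_inner E y u' = l2_inner E x f'"
        using adj(1) [OF uf'(1)] l2_inner_commute [of y u'] l2_inner_commute [of x f'] by simp
      then show ?thesis using sym [OF uf(1) uf'(1)] by (simp add: inner1 L')
    qed
    have sv: "l2_inner E s v = l2_inner E dy v - \<i> * l2_inner E dx v" if "v \<in> L2 E" for v
      unfolding sdef by (rule l2_inner_diff_left [OF M(3,2) that])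
    have rr: "l2_inner E dx r = l2_inner E dx y' - \<i> * l2_inner E dx x' - (l2_inner E dx f' - \<i> * l2_inner E dx u')"
    proof -
      have "l2_inner E dx r = l2_inner E dx z' - l2_inner E dx (\<lambda>t. f' t - (- \<i>) *\<^sub>C u' t)"
        using l2_inner_diff_right [OF z(2) L2_diff_scaleC [OF L'(2,1), of "- \<i>"] M(2), of 1]
        by (simp add: r_def [abs_def])
      then show ?thesis
        by (simp add: z'_def [abs_def] l2_inner_diff_right L L' M del: minus_diff_eq)
    qed
    \<comment> \<open>After subtracting the elements of \<open>T\<close> the expression regroups so
      that every term contains one of the small errors \<open>s\<close> and \<open>r\<close>;
      \<open>dx\<close> is merely bounded, and \<open>u'\<close> is already fixed.\<close>
    have "l2_inner E y x' - l2_inner E x y' = l2_inner E s x' - l2_inner E dx r - l2_inner E s u'"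
      unfolding a1 rr by (simp add: sv L L' a2)
    also have "cmod \<dots> \<le> cmod (l2_inner E s x') + cmod (l2_inner E dx r) + cmod (l2_inner E s u')"
      by (intro order_trans [OF norm_triangle_ineq4] add_mono norm_triangle_ineq4 order_refl)
    also have "\<dots> \<le> l2_norm E s * l2_norm E x' + l2_norm E dx * l2_norm E r + l2_norm E s * l2_norm E u'"
      by (intro add_mono l2_cauchy_schwarz M L L')
    also have "\<dots> = l2_norm E s * (l2_norm E x' + l2_norm E u') + l2_norm E dx * l2_norm E r"
      by (simp add: algebra_simps)
    also have "\<dots> \<le> e2 * c + B * e1"
    proof (intro add_mono mult_mono)
      show "l2_norm E s \<le> e2" using uf(2) by (simp add: s_def [abs_def])
      show "l2_norm E r \<le> e1" using uf'(2) by (simp add: r_def [abs_def])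
      have "l2_norm E u \<le> l2_norm E (\<lambda>t. f t - \<i> *\<^sub>C u t)" using norm_le_range [OF uf(1), of \<i>] by simp
      also have "(\<lambda>t. f t - \<i> *\<^sub>C u t) = (\<lambda>t. z t - s t)" by (simp add: s_def fun_eq_iff)
      also have "l2_norm E \<dots> \<le> l2_norm E z + l2_norm E s" by (rule l2_norm_triangle_diff [OF z(1) M(1)])
      also have "l2_norm E s \<le> 1" using uf(2) e2(2) by (simp add: s_def [abs_def])
      finally have "l2_norm E u \<le> l2_norm E z + 1" by simp
      then show "l2_norm E dx \<le> B"
        using l2_norm_triangle_diff [OF L(1) Lu(1)] by (simp add: dx_def [abs_def] B_def)
    qed (use e2 e1 B in \<open>simp_all add: c_def l2_norm_nonneg add_nonneg_nonneg\<close>)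
    also have "\<dots> \<le> e / (2 * c) * c + B * (e / (2 * B))"
      unfolding e1_def using e2 c by (intro add_mono mult_right_mono order_refl) auto
    also have "\<dots> = e" using B c by simp
    finally show ?thesis .
  qed
  then have "cmod (l2_inner E y x' - l2_inner E x y') \<le> 0" by (rule field_le_epsilon) simp
  then show ?thesis by simp
qed

end

end

section \<open>Solutions of the inhomogeneous system\<close>

lemma AE_lebesgue_on_iff_negligible:
  assumes "S \<in> sets lebesgue"
  shows "(AE t in lebesgue_on S. P t) \<longleftrightarrow> (\<exists>N. negligible N \<and> (\<forall>t\<in>S - N. P t))"
proof -
  have "(AE t in lebesgue_on S. P t) \<longleftrightarrow> (AE t in lebesgue. t \<in> S \<longrightarrow> P t)"
    using assms by (subst AE_restrict_space_iff) auto
  also have "\<dots> \<longleftrightarrow> (\<exists>N\<in>null_sets lebesgue. {t. \<not> (t \<in> S \<longrightarrow> P t)} \<subseteq> N)"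
    by (simp add: eventually_ae_filter)
  also have "\<dots> \<longleftrightarrow> (\<exists>N. negligible N \<and> (\<forall>t\<in>S - N. P t))"
    unfolding negligible_iff_null_sets by blast
  finally show ?thesis .
qed

lemma measurable_lebesgue_on_spike:
  fixes f g :: "real \<Rightarrow> 'b :: topological_space"
  assumes S: "S \<in> sets lebesgue" and f: "f \<in> borel_measurable (lebesgue_on S)"
    and N: "negligible N" and eq: "\<And>t. t \<in> S - N \<Longrightarrow> g t = f t"
  shows "g \<in> borel_measurable (lebesgue_on S)"
proof (rule measurableI)
  fix T :: "'b set" assume T: "T \<in> sets borel"
  have rs: "A \<in> sets (lebesgue_on S) \<longleftrightarrow> A \<subseteq> S \<and> A \<in> sets lebesgue" for A
    using S by (subst sets_restrict_space_iff) auto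
  have "f -` T \<inter> S \<in> sets (lebesgue_on S)" using measurable_sets [OF f T] by simp
  then have 1: "f -` T \<inter> S \<in> sets lebesgue" using rs by blast
  have 2: "N \<in> sets lebesgue" "g -` T \<inter> S \<inter> N \<in> sets lebesgue"
    using negligible_imp_sets [OF N] negligible_imp_sets [OF negligible_subset [OF N, of "g -` T \<inter> S \<inter> N"]] by auto
  have "g -` T \<inter> S = (f -` T \<inter> S - N) \<union> (g -` T \<inter> S \<inter> N)" using eq by auto
  also have "\<dots> \<in> sets lebesgue" by (intro sets.Un sets.Diff 1 2)
  finally have "g -` T \<inter> S \<in> sets lebesgue" .
  then show "g -` T \<inter> space (lebesgue_on S) \<in> sets (lebesgue_on S)" using rs by auto
qed simp

text \<open>\<open>Z\<close> is the integral of its derivative, which agrees almost everywhere with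
  the continuous \<open>g\<close>; the integral of \<open>g\<close> is differentiable everywhere.
  This upgrades the equations that do not contain the inhomogeneity.\<close>

lemma abs_continuous_everywhere_derivative:
  fixes Z :: "real \<Rightarrow> 'v :: banach"
  assumes S: "initial_interval S" and ac: "\<And>d. d \<in> S \<Longrightarrow> abs_continuous_on 0 d Z"
    and N: "negligible N" and der: "\<And>t. t \<in> S - N \<Longrightarrow> (Z has_vector_derivative g t) (at t within S)"
    and g: "continuous_on S g" and t: "t \<in> S"
  shows "(Z has_vector_derivative g t) (at t within S)"
proof (rule has_vector_derivative_initial_interval [OF S t])
  fix d assume d: "d \<in> S" "t \<le> d"
  have t0: "t \<in> {0..d}" using d(2) initial_interval_nonneg [OF S t] by simp
  have int: "(g has_integral Z s - Z 0) {0..s}" if s: "s \<in> {0..d}" for s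
  proof (rule abs_continuous_on_has_integral [OF _ _ N])
    have sS: "s \<in> S" using s initial_interval_subset [OF S d(1)] by blast
    show "abs_continuous_on 0 s Z" by (rule ac [OF sS])
    show "0 \<le> s" using s by simp
    show "(Z has_vector_derivative g t) (at t within {0..s})" if "t \<in> {0..s} - N" for t
      using that initial_interval_subset [OF S sS]
      by (intro has_vector_derivative_within_subset [OF der]) auto
  qed
  have "((\<lambda>s. integral {0..s} g) has_vector_derivative g t) (at t within {0..d})"
    by (rule integral_has_vector_derivative [OF continuous_on_subset [OF g initial_interval_subset [OF S d(1)]] t0])
  from has_vector_derivative_add [OF has_vector_derivative_const this, of "Z 0"]
  have "((\<lambda>s. Z 0 + integral {0..s} g) has_vector_derivative g t) (at t within {0..d})" by simp
  then show "(Z has_vector_derivative g t) (at t within {0..d})"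
    by (rule has_vector_derivative_transform [OF t0, rotated]) (simp add: integral_unique [OF int])
qed

declare One_nat_def [simp del]

context regular_expr
begin

abbreviation J where "J \<equiv> inc (2 * n - 1)"
abbreviation prj0 where "prj0 u \<equiv> blinfun_apply (prj 0) u"

lemma ivl_sets: "ivl E \<in> sets lebesgue"
proof -
  have "{t. ereal t < endpt E} \<in> sets borel" "{t. ereal t \<le> endpt E} \<in> sets borel" by measurable
  then have "{0..} \<inter> {t. ereal t < endpt E} \<in> sets borel" "{0..} \<inter> {t. ereal t \<le> endpt E} \<in> sets borel" by auto
  moreover have "ivl E = {0..} \<inter> {t. ereal t < endpt E} \<or> ivl E = {0..} \<inter> {t. ereal t \<le> endpt E}"
    using ivl_cases(2) by (auto simp: atLeast_def Collect_conj_eq [symmetric])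
  ultimately show ?thesis by (metis sets_completionI_sets sets_lborel)
qed

lemmas AE_ivl = AE_lebesgue_on_iff_negligible [OF ivl_sets]

text \<open>Solutions in the sense of Caratheodory, since \<open>f\<close> is only square
  integrable; absolute continuity excludes singular parts.\<close>

definition sys_solution :: "(real \<Rightarrow> ('h, 'n) state) \<Rightarrow> (real \<Rightarrow> 'h) \<Rightarrow> bool" where
  "sys_solution Y f \<longleftrightarrow> (\<forall>d\<in>ivl E. abs_continuous_on 0 d Y) \<and> (\<exists>N. negligible N \<and>
     (\<forall>t\<in>ivl E - N. (Y has_vector_derivative blinfun_apply (sysA t) (Y t) - blinfun_apply J (f t)) (at t within ivl E)))"

lemma rhs_cong_less:
  assumes "\<And>i. i < 2 * n \<Longrightarrow> x i = x' i" and k: "Suc k < 2 * n"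
  shows "rhs act t k x = rhs act t k x'"
proof -
  have d: "dcomp act t x i = dcomp act t x' i" for i using assms(1) n_pos by (simp add: dcomp_def)
  show ?thesis unfolding rhs_def d using assms(1) k by simp
qed

text \<open>The inhomogeneity takes the slot of index 2n, the place of the value of the expression,
  so that the homogeneous and inhomogeneous equations share one formula.\<close>

lemma prj_system:
  assumes k: "k < 2 * n"
  shows "blinfun_apply (prj k) (blinfun_apply (sysA t) u - blinfun_apply J f) =
    rhs blinfun_apply t k ((\<lambda>i. blinfun_apply (prj i) u)(2 * n := f))"
proof (cases "Suc k < 2 * n")
  case True
  then have "rhs blinfun_apply t k (\<lambda>i. if i < 2 * n then blinfun_apply (prj i) u else 0) =
      rhs blinfun_apply t k ((\<lambda>i. blinfun_apply (prj i) u)(2 * n := f))"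
    by (intro rhs_cong_less) auto
  moreover have "k \<noteq> 2 * n - 1" using True by simp
  ultimately show ?thesis using True by (simp add: blinfun.diff_right prj_sysA prj_inc)
next
  case False
  with k have k: "k = 2 * n - 1" by simp
  have "rhs blinfun_apply t (2 * n - 1) (\<lambda>i. if i < 2 * n then blinfun_apply (prj i) u else 0) =
      rhs blinfun_apply t (2 * n - 1) (((\<lambda>i. blinfun_apply (prj i) u)(2 * n := f))(2 * n := 0))"
    using n_pos by (intro rhs_cong) auto
  then show ?thesis
    using n_pos rhs_last [of blinfun_apply t "(\<lambda>i. blinfun_apply (prj i) u)(2 * n := f)"]
    by (simp add: k blinfun.diff_right prj_sysA prj_inc)
qed

lemma st_eq_sum: "st y t = (\<Sum>k<2 * n. blinfun_apply (inc k) (qd E k y t))"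
  by (rule state_eqI) (simp add: prj_st prj_sum_inc)

lemma system_eq_sum:
  assumes t: "t \<in> ivl E"
  shows "blinfun_apply (sysA t) (st y t) - blinfun_apply J (l_expr E y t) =
    (\<Sum>k<2 * n. blinfun_apply (inc k) (ddt E (qd E k y) t))"
proof (rule state_eqI)
  fix k assume k: "k < 2 * n"
  have "rhs blinfun_apply t k ((\<lambda>i. blinfun_apply (prj i) (st y t))(2 * n := l_expr E y t)) =
      rhs blinfun_apply t k (\<lambda>i. qd E i y t)"
    using k by (intro rhs_cong) (auto simp: prj_st l_expr_def)
  then show "blinfun_apply (prj k) (blinfun_apply (sysA t) (st y t) - blinfun_apply J (l_expr E y t)) =
      blinfun_apply (prj k) (\<Sum>k<2 * n. blinfun_apply (inc k) (ddt E (qd E k y) t))"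
    using ddt_quasi [OF action_apply t k, of y] by (simp add: prj_system k prj_sum_inc)
qed

lemma abs_continuous_on_C1_ivl:
  assumes "C1 E f" "d \<in> ivl E"
  shows "abs_continuous_on 0 d f"
proof (rule abs_continuous_on_C1)
  fix t assume "t \<in> {0..d}"
  then show "(f has_vector_derivative ddt E f t) (at t within {0..d})"
    using assms ivl_subset [OF assms(2)] unfolding C1_def
    by (intro has_vector_derivative_within_subset [OF has_vector_derivative_ddt]) auto
next
  show "continuous_on {0..d} (ddt E f)"
    by (rule continuous_on_subset [OF _ ivl_subset [OF assms(2)]]) (use assms(1) in \<open>simp add: C1_def\<close>)
qed

lemma sys_solution_maxdom:
  assumes y: "y \<in> maxdom E"
  shows "sys_solution (st y) (l_expr E y)"
proof -
  have C1: "C1 E (qd E k y)" if "k \<le> 2 * n - 2" for k using y that by (simp add: maxdom_def Let_def)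
  have ac: "abs_continuous_on 0 d (qd E k y)" if "k < 2 * n" "d \<in> ivl E" for k d
  proof (cases "k \<le> 2 * n - 2")
    case True
    then show ?thesis by (rule abs_continuous_on_C1_ivl [OF C1 that(2)])
  next
    case False
    with that have "k = 2 * n - 1" by simp
    then show ?thesis using y that by (simp add: maxdom_def Let_def loc_abs_continuous_def)
  qed
  have "AE t in leb E. qd E (2 * n - 1) y differentiable (at t within ivl E)"
    using y by (simp add: maxdom_def Let_def)
  then obtain N where N: "negligible N" "\<And>t. t \<in> ivl E - N \<Longrightarrow> qd E (2 * n - 1) y differentiable (at t within ivl E)"
    unfolding AE_ivl by blast
  have der: "(qd E k y has_vector_derivative ddt E (qd E k y) t) (at t within ivl E)"
    if "k < 2 * n" "t \<in> ivl E - N" for k t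
  proof (rule has_vector_derivative_ddt)
    show "qd E k y differentiable (at t within ivl E)"
    proof (cases "k \<le> 2 * n - 2")
      case True
      then show ?thesis using C1 that by (simp add: C1_def)
    next
      case False
      with that have "k = 2 * n - 1" by simp
      then show ?thesis using N(2) that by simp
    qed
  qed
  show ?thesis
    unfolding sys_solution_def
  proof (intro conjI ballI exI [of _ N] N(1))
    fix d assume "d \<in> ivl E"
    then show "abs_continuous_on 0 d (st y)"
      unfolding st_eq_sum [abs_def]
      by (intro abs_continuous_on_sum abs_continuous_on_bounded_linear [OF blinfun.bounded_linear_right] ac) auto
  next
    fix t assume t: "t \<in> ivl E - N"
    then have *: "((\<lambda>t. \<Sum>k<2 * n. blinfun_apply (inc k) (qd E k y t)) has_vector_derivative
        (\<Sum>k<2 * n. blinfun_apply (inc k) (ddt E (qd E k y) t))) (at t within ivl E)"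
      by (intro has_vector_derivative_sum bounded_linear.has_vector_derivative [OF blinfun.bounded_linear_right] der) auto
    show "(st y has_vector_derivative blinfun_apply (sysA t) (st y t) - blinfun_apply J (l_expr E y t)) (at t within ivl E)"
    proof -
      have eq: "st y = (\<lambda>t. \<Sum>k<2 * n. blinfun_apply (inc k) (qd E k y t))" by (rule ext) (rule st_eq_sum)
      have tE: "t \<in> ivl E" using t by blast
      show ?thesis unfolding system_eq_sum [OF tE] by (subst eq) (rule *)
    qed
  qed
qed

lemma sys_solution_continuous:
  assumes "sys_solution Y f"
  shows "continuous_on (ivl E) Y"
  using assms unfolding sys_solution_def
  by (intro continuous_on_initial_interval [OF ivl_initial] abs_continuous_on_imp_continuous_on) blast

text \<open>Converse of \<open>sys_solution_maxdom\<close> and the way in which elements of the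
  domain are produced. The triangular form makes the components of \<open>Y\<close> the
  quasi-derivatives of \<open>z\<close>; only the last equation contains \<open>f\<close>, so only
  the last component stays merely absolutely continuous.\<close>

lemma maxdom_of_sys_solution:
  assumes Y: "sys_solution Y f" and f: "f \<in> L2 E" and y: "(\<lambda>t. prj0 (Y t)) \<in> L2 E"
  defines "z \<equiv> \<lambda>t. if t \<in> ivl E then prj0 (Y t) else 0"
  shows "z \<in> maxdom E" "t \<in> ivl E \<Longrightarrow> st z t = Y t" "AE t in leb E. l_expr E z t = f t"
proof -
  obtain N where N: "negligible N" "\<And>t. t \<in> ivl E - N \<Longrightarrow>
      (Y has_vector_derivative blinfun_apply (sysA t) (Y t) - blinfun_apply J (f t)) (at t within ivl E)"
    using Y unfolding sys_solution_def by blast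
  have acY: "abs_continuous_on 0 d Y" if "d \<in> ivl E" for d using Y that unfolding sys_solution_def by blast
  note Yc = sys_solution_continuous [OF Y]
  define x where "x k t = (if t \<in> ivl E then blinfun_apply (prj k) (Y t) else 0)" for k t
  have z: "z = x 0" by (simp add: z_def x_def fun_eq_iff)
  have cong: "(x k has_vector_derivative v) (at t within ivl E) \<longleftrightarrow>
      ((\<lambda>t. blinfun_apply (prj k) (Y t)) has_vector_derivative v) (at t within ivl E)" if "t \<in> ivl E" for k t v
    by (rule has_vector_derivative_cong_ivl) (use that in \<open>simp_all add: x_def\<close>)
  have prjsys: "blinfun_apply (prj k) (blinfun_apply (sysA t) (Y t) - blinfun_apply J v) =
      rhs blinfun_apply t k ((\<lambda>i. x i t)(2 * n := v))" if "k < 2 * n" "t \<in> ivl E" for k t v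
    using that by (simp add: prj_system x_def)
  \<comment> \<open>Below the last index the direction \<open>J\<close> does not contribute, so the
    right side is continuous and the equation, known almost everywhere, holds everywhere.\<close>
  have xder0: "(x k has_vector_derivative blinfun_apply (prj k) (blinfun_apply (sysA t) (Y t))) (at t within ivl E)"
    if k: "Suc k < 2 * n" and t: "t \<in> ivl E" for k t
    unfolding cong [OF t]
  proof (rule abs_continuous_everywhere_derivative [OF ivl_initial _ N(1) _ _ t])
    show "abs_continuous_on 0 d (\<lambda>t. blinfun_apply (prj k) (Y t))" if "d \<in> ivl E" for d
      by (rule abs_continuous_on_bounded_linear [OF blinfun.bounded_linear_right acY [OF that]])
    show "((\<lambda>t. blinfun_apply (prj k) (Y t)) has_vector_derivative blinfun_apply (prj k) (blinfun_apply (sysA t) (Y t))) (at t within ivl E)"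
      if "t \<in> ivl E - N" for t
      using bounded_linear.has_vector_derivative [OF blinfun.bounded_linear_right N(2) [OF that], of "prj k"] k
        less_imp_neq [of k "2 * n - 1"] by (simp add: blinfun.diff_right prj_inc)
    show "continuous_on (ivl E) (\<lambda>t. blinfun_apply (prj k) (blinfun_apply (sysA t) (Y t)))"
      by (intro continuous_intros sysA_continuous Yc)
  qed
  have xder: "(x k has_vector_derivative rhs blinfun_apply t k (\<lambda>i. x i t)) (at t within ivl E)"
    if k: "Suc k < 2 * n" and t: "t \<in> ivl E" for k t
  proof -
    have "blinfun_apply (prj k) (blinfun_apply (sysA t) (Y t)) = rhs blinfun_apply t k ((\<lambda>i. x i t)(2 * n := 0))"
      using prjsys [of k t 0] k t by simp
    also have "\<dots> = rhs blinfun_apply t k (\<lambda>i. x i t)" using k by (intro rhs_cong_less) auto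
    finally show ?thesis using xder0 [OF k t] by simp
  qed
  have qx: "qd E k z t = x k t" if "k < 2 * n" "t \<in> ivl E" for k t
    unfolding z by (rule quasi_of_system [OF action_apply xder that])
  show st: "st z t = Y t" if "t \<in> ivl E" for t
    by (rule state_eqI) (simp add: prj_st qx that x_def)
  have lf: "l_expr E z t = f t" if t: "t \<in> ivl E - N" for t
    unfolding l_expr_def z
  proof (rule quasi_last_of_system [OF action_apply xder])
    show tE: "t \<in> ivl E" using t by blast
    have "blinfun_apply (prj (2 * n - 1)) (blinfun_apply (sysA t) (Y t) - blinfun_apply J (f t)) =
        rhs blinfun_apply t (2 * n - 1) ((\<lambda>i. x i t)(2 * n := 0)) - f t"
      using prjsys [of "2 * n - 1" t "f t"] rhs_last [of blinfun_apply t "(\<lambda>i. x i t)(2 * n := f t)"] n_pos tE by simp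
    then show "(x (2 * n - 1) has_vector_derivative rhs blinfun_apply t (2 * n - 1) ((\<lambda>i. x i t)(2 * n := 0)) - f t) (at t within ivl E)"
      unfolding cong [OF tE]
      using bounded_linear.has_vector_derivative [OF blinfun.bounded_linear_right N(2) [OF t], of "prj (2 * n - 1)"] by simp
  qed
  then show AE: "AE t in leb E. l_expr E z t = f t" unfolding AE_ivl using N(1) by blast
  have xz: "x 0 \<in> L2 E"
  proof (rule L2_cong_AE [OF y])
    show "x 0 \<in> borel_measurable (leb E)"
      by (rule measurable_lebesgue_on_spike [OF ivl_sets L2_measurable [OF y] negligible_empty]) (simp add: x_def)
    show "AE t in leb E. prj0 (Y t) = x 0 t" by (rule AE_I2) (simp add: x_def)
  qed
  show "z \<in> maxdom E"
    unfolding maxdom_def Let_def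
  proof (intro CollectI conjI allI impI)
    show "z t = 0" if "t \<notin> ivl E" for t using that by (simp add: z_def)
    show "z \<in> L2 E" using xz z by simp
    have congq: "(qd E k z has_vector_derivative v) (at t within ivl E) \<longleftrightarrow>
        (x k has_vector_derivative v) (at t within ivl E)" if "k < 2 * n" "t \<in> ivl E" for k t v
      by (rule has_vector_derivative_cong_ivl) (use that qx in simp_all)
    show "C1 E (qd E k z)" if k: "k \<le> 2 * n - 2" for k
    proof -
      have k': "Suc k < 2 * n" using k n_pos by simp
      have d: "(qd E k z has_vector_derivative blinfun_apply (prj k) (blinfun_apply (sysA t) (Y t))) (at t within ivl E)"
        if "t \<in> ivl E" for t
        using congq [of k t] xder0 [OF k' that] k' that by simp
      have "continuous_on (ivl E) (\<lambda>t. blinfun_apply (prj k) (blinfun_apply (sysA t) (Y t)))"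
        by (intro continuous_intros sysA_continuous Yc)
      moreover have "ddt E (qd E k z) t = blinfun_apply (prj k) (blinfun_apply (sysA t) (Y t))" if "t \<in> ivl E" for t
        by (rule ddt_eqI [OF valid that d [OF that]])
      ultimately have "continuous_on (ivl E) (ddt E (qd E k z))"
        by (simp cong: continuous_on_cong)
      then show ?thesis using d unfolding C1_def by (blast intro: differentiableI_vector)
    qed
    have last: "2 * n - 1 < 2 * n" using n_pos by simp
    show "loc_abs_continuous E (qd E (2 * n - 1) z)"
      unfolding loc_abs_continuous_def
    proof
      fix d assume d: "d \<in> ivl E"
      show "abs_continuous_on 0 d (qd E (2 * n - 1) z)"
      proof (rule abs_continuous_on_dominated [OF abs_continuous_on_bounded_linear [OF blinfun.bounded_linear_right acY [OF d], of "prj (2 * n - 1)"] abs_continuous_on_const [of _ _ 0], of 1])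
        fix u v assume "0 \<le> u" "u \<le> v" "v \<le> d"
        then have "u \<in> ivl E" "v \<in> ivl E" using ivl_subset [OF d] by auto
        then show "norm (qd E (2 * n - 1) z v - qd E (2 * n - 1) z u) \<le>
            1 * (norm (blinfun_apply (prj (2 * n - 1)) (Y v) - blinfun_apply (prj (2 * n - 1)) (Y u)) + norm (0 - 0 :: real))"
          using qx [OF last] by (simp add: x_def)
      qed simp
    qed
    have "qd E (2 * n - 1) z differentiable (at t within ivl E)" if t: "t \<in> ivl E - N" for t
    proof -
      have "(qd E (2 * n - 1) z has_vector_derivative blinfun_apply (prj (2 * n - 1)) (blinfun_apply (sysA t) (Y t) - blinfun_apply J (f t))) (at t within ivl E)"
        using bounded_linear.has_vector_derivative [OF blinfun.bounded_linear_right N(2) [OF t], of "prj (2 * n - 1)"]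
          congq [OF last, of t] cong [of t "2 * n - 1"] t by simp
      then show ?thesis by (rule differentiableI_vector)
    qed
    then show "AE t in leb E. qd E (2 * n - 1) z differentiable (at t within ivl E)"
      unfolding AE_ivl using N(1) by blast
    have "l_expr E z \<in> borel_measurable (leb E)"
      by (rule measurable_lebesgue_on_spike [OF ivl_sets L2_measurable [OF f] N(1) lf])
    moreover have "AE t in leb E. f t = l_expr E z t" using AE by (auto elim: eventually_mono)
    ultimately show "l_expr E z \<in> L2 E" by (intro L2_cong_AE [OF f])
  qed
qed

text \<open>In the derivative of \<open>bform (Y t) (Z t)\<close> the matrix drops out by
  \<open>bform_sysA\<close>, and the two terms with \<open>J\<close> become the integrand by
  \<open>bform_inc_left\<close> and \<open>bform_inc_right\<close>.\<close>

lemma green_local: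
  assumes Y: "sys_solution Y f" and Z: "sys_solution Z g" and d: "d \<in> ivl E"
  shows "((\<lambda>t. cinner (f t) (prj0 (Z t)) - cinner (prj0 (Y t)) (g t)) has_integral
    bform (Y d) (Z d) - bform (Y 0) (Z 0)) {0..d}"
proof -
  obtain N1 where N1: "negligible N1" "\<And>t. t \<in> ivl E - N1 \<Longrightarrow>
      (Y has_vector_derivative blinfun_apply (sysA t) (Y t) - blinfun_apply J (f t)) (at t within ivl E)"
    using Y unfolding sys_solution_def by blast
  obtain N2 where N2: "negligible N2" "\<And>t. t \<in> ivl E - N2 \<Longrightarrow>
      (Z has_vector_derivative blinfun_apply (sysA t) (Z t) - blinfun_apply J (g t)) (at t within ivl E)"
    using Z unfolding sys_solution_def by blast
  show ?thesis
  proof (rule abs_continuous_on_has_integral [OF _ _ negligible_Un [OF N1(1) N2(1)]])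
    show "abs_continuous_on 0 d (\<lambda>t. bform (Y t) (Z t))"
      using Y Z d unfolding sys_solution_def by (blast intro: abs_continuous_on_bilinear [OF bounded_bilinear_bform])
    show "0 \<le> d" by (rule ivl_nonneg [OF d])
    fix t assume t: "t \<in> {0..d} - (N1 \<union> N2)"
    then have tE: "t \<in> ivl E" "t \<in> ivl E - N1" "t \<in> ivl E - N2" using ivl_subset [OF d] by auto
    have "((\<lambda>t. bform (Y t) (Z t)) has_vector_derivative
        bform (Y t) (blinfun_apply (sysA t) (Z t) - blinfun_apply J (g t))
        + bform (blinfun_apply (sysA t) (Y t) - blinfun_apply J (f t)) (Z t)) (at t within ivl E)"
      by (rule bounded_bilinear.has_vector_derivative [OF bounded_bilinear_bform N1(2) [OF tE(2)] N2(2) [OF tE(3)]])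
    also have "bform (Y t) (blinfun_apply (sysA t) (Z t) - blinfun_apply J (g t))
        + bform (blinfun_apply (sysA t) (Y t) - blinfun_apply J (f t)) (Z t) =
        (bform (blinfun_apply (sysA t) (Y t)) (Z t) + bform (Y t) (blinfun_apply (sysA t) (Z t)))
        + cinner (f t) (prj0 (Z t)) - cinner (prj0 (Y t)) (g t)"
      by (simp add: bounded_bilinear.diff_left [OF bounded_bilinear_bform]
          bounded_bilinear.diff_right [OF bounded_bilinear_bform] bform_inc_left bform_inc_right del: One_nat_def)
    also have "\<dots> = cinner (f t) (prj0 (Z t)) - cinner (prj0 (Y t)) (g t)"
      by (simp add: bform_sysA [OF tE(1)])
    finally show "((\<lambda>t. bform (Y t) (Z t)) has_vector_derivative
        cinner (f t) (prj0 (Z t)) - cinner (prj0 (Y t)) (g t)) (at t within {0..d})"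
      by (rule has_vector_derivative_within_subset [OF _ ivl_subset [OF d]])
  qed
qed

section \<open>Passage to the right endpoint\<close>

lemma integrable_lebesgue_on_subinterval:
  fixes \<psi> :: "real \<Rightarrow> 'v :: {banach, second_countable_topology}"
  assumes \<psi>: "integrable (leb E) \<psi>" and d: "d \<in> ivl E"
  shows "integrable (lebesgue_on {0..d}) \<psi>"
    "(LINT t|lebesgue_on {0..d}. \<psi> t) = (LINT t|leb E. indicat_real {0..d} t *\<^sub>R \<psi> t)"
    "integrable (leb E) (\<lambda>t. indicat_real {0..d} t *\<^sub>R \<psi> t)"
proof -
  have eq: "indicat_real (ivl E) t *\<^sub>R indicat_real {0..d} t *\<^sub>R \<psi> t = indicat_real {0..d} t *\<^sub>R \<psi> t" for t
    using ivl_subset [OF d] by (auto simp: indicator_def)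
  have m: "{0..d} \<inter> ivl E \<in> sets (leb E)"
    using ivl_sets by (auto simp: sets_restrict_space_iff)
  show "integrable (leb E) (\<lambda>t. indicat_real {0..d} t *\<^sub>R \<psi> t)"
  proof -
    have "integrable (leb E) (\<lambda>t. indicat_real ({0..d} \<inter> ivl E) t *\<^sub>R \<psi> t)"
      by (rule integrable_mult_indicator [OF m \<psi>])
    moreover have "{0..d} \<inter> ivl E = {0..d}" using ivl_subset [OF d] by blast
    ultimately show ?thesis by simp
  qed
  then have "integrable lebesgue (\<lambda>t. indicat_real {0..d} t *\<^sub>R \<psi> t)"
    using ivl_sets by (subst (asm) integrable_restrict_space) (simp_all add: eq del: scaleR_scaleR)
  then show "integrable (lebesgue_on {0..d}) \<psi>"
    by (subst integrable_restrict_space) simp_all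
  show "(LINT t|lebesgue_on {0..d}. \<psi> t) = (LINT t|leb E. indicat_real {0..d} t *\<^sub>R \<psi> t)"
    using ivl_sets by (simp add: integral_restrict_space eq del: scaleR_scaleR)
qed

lemma integral_tendsto_endpoint:
  fixes \<psi> :: "real \<Rightarrow> complex"
  assumes \<psi>: "integrable (leb E) \<psi>" and int: "\<And>d. d \<in> ivl E \<Longrightarrow> (\<psi> has_integral \<phi> d - \<phi> 0) {0..d}"
  shows "((\<lambda>x. \<phi> (real_of_ereal x)) \<longlongrightarrow> \<phi> 0 + (LINT t|leb E. \<psi> t)) (at_left (endpt E))"
proof (rule tendsto_at_left_sequentially [OF ivl_cases(1)])
  fix S :: "nat \<Rightarrow> ereal"
  assume S: "\<And>m. S m < endpt E" "\<And>m. 0 < S m" "S \<longlonglongrightarrow> endpt E"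
  define s where "s m = real_of_ereal (S m)" for m
  have es: "ereal (s m) = S m" for m
  proof -
    have "\<bar>S m\<bar> \<noteq> \<infinity>" using S(1) [of m] S(2) [of m] by auto
    then show ?thesis by (simp add: s_def ereal_real)
  qed
  have s0: "0 < s m" for m using S(2) [of m] es [of m] by (metis ereal_less(2) zero_ereal_def)
  have sE: "s m \<in> ivl E" for m
    using ivl_cases(2) S(1) [of m] s0 [of m] by (elim disjE) (simp_all add: es less_imp_le)
  have eq: "\<phi> (s m) = \<phi> 0 + (LINT t|leb E. indicat_real {0..s m} t *\<^sub>R \<psi> t)" for m
    using integral_unique [OF int [OF sE [of m]]] integrable_lebesgue_on_subinterval [OF \<psi> sE [of m]]
      lebesgue_integral_eq_integral [OF integrable_lebesgue_on_subinterval(1) [OF \<psi> sE [of m]]]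
    by (simp add: diff_eq_eq add.commute)
  have "(\<lambda>m. LINT t|leb E. indicat_real {0..s m} t *\<^sub>R \<psi> t) \<longlonglongrightarrow> (LINT t|leb E. \<psi> t)"
  proof (rule integral_dominated_convergence)
    show "\<psi> \<in> borel_measurable (leb E)" using \<psi> by simp
    show "(\<lambda>t. indicat_real {0..s m} t *\<^sub>R \<psi> t) \<in> borel_measurable (leb E)" for m
      by (rule borel_measurable_integrable [OF integrable_lebesgue_on_subinterval(3) [OF \<psi> sE]])
    show "integrable (leb E) (\<lambda>t. norm (\<psi> t))" using \<psi> by simp
    show "AE t in leb E. norm (indicat_real {0..s m} t *\<^sub>R \<psi> t) \<le> norm (\<psi> t)" for m
      by (rule AE_I2) (simp add: indicator_def)
    show "AE t in leb E. (\<lambda>m. indicat_real {0..s m} t *\<^sub>R \<psi> t) \<longlonglongrightarrow> \<psi> t"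
      unfolding AE_ivl
    \<comment> \<open>The points \<open>s m\<close> stay below the endpoint, so a right end
      belonging to the interval is never reached; it is a null set. For an infinite endpoint the
      excluded point is 0, which is harmless.\<close>
    proof (intro exI [of _ "{real_of_ereal (endpt E)}"] conjI ballI)
      fix t assume t: "t \<in> ivl E - {real_of_ereal (endpt E)}"
      then have t0: "0 \<le> t" using ivl_nonneg by blast
      have "ereal t \<noteq> endpt E"
      proof
        assume "ereal t = endpt E"
        then have "real_of_ereal (endpt E) = t" by (simp add: eq_commute [of _ "endpt E"])
        then show False using t by blast
      qed
      then have "ereal t < endpt E" using t ivl_cases(2) by auto
      then have "\<forall>\<^sub>F m in sequentially. ereal t < S m" using S(3) by (rule order_tendstoD(1) [rotated])
      then have "\<forall>\<^sub>F m in sequentially. indicat_real {0..s m} t *\<^sub>R \<psi> t = \<psi> t"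
      proof eventually_elim
        case (elim m)
        then have "t \<le> s m" using es [of m] by (metis ereal_less_eq(3) less_imp_le)
        then show ?case using t0 by simp
      qed
      then show "(\<lambda>m. indicat_real {0..s m} t *\<^sub>R \<psi> t) \<longlonglongrightarrow> \<psi> t" by (rule tendsto_eventually)
    qed simp
  qed
  then show "(\<lambda>m. \<phi> (real_of_ereal (S m))) \<longlonglongrightarrow> \<phi> 0 + (LINT t|leb E. \<psi> t)"
    unfolding s_def [symmetric] eq by (intro tendsto_intros)
qed

lemma at_left_endpt_nontrivial: "at_left (endpt E) \<noteq> bot"
proof
  assume "at_left (endpt E) = bot"
  then have "eventually (\<lambda>_. False) (at_left (endpt E))" by simp
  then obtain b where b: "b < endpt E" "\<And>y. b < y \<Longrightarrow> \<not> y < endpt E"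
    unfolding eventually_at_left [OF ivl_cases(1)] by blast
  then show False using dense [OF b(1)] by blast
qed

text \<open>Green's formula on [0, d] with \<open>d\<close> tending to the endpoint; square
  integrability of \<open>y\<close>, \<open>z\<close> and their images makes the integral converge,
  so [y, z](b) exists for all pairs in the domain.\<close>

lemma bracket_tendsto:
  assumes y: "y \<in> maxdom E" and z: "z \<in> maxdom E"
  shows "((\<lambda>x. bracket E y z (real_of_ereal x)) \<longlongrightarrow>
    bform (st y 0) (st z 0) + (l2_inner E (l_expr E y) z - l2_inner E y (l_expr E z))) (at_left (endpt E))"
proof -
  have L: "y \<in> L2 E" "z \<in> L2 E" "l_expr E y \<in> L2 E" "l_expr E z \<in> L2 E"
    using y z by (auto simp: maxdom_def Let_def)
  define \<psi> where "\<psi> t = cinner (l_expr E y t) (z t) - cinner (y t) (l_expr E z t)" for t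
  have i: "integrable (leb E) \<psi>" "(LINT t|leb E. \<psi> t) = l2_inner E (l_expr E y) z - l2_inner E y (l_expr E z)"
    unfolding \<psi>_def l2_inner_def
    using integrable_cinner [OF L(3,2)] integrable_cinner [OF L(1,4)] by simp_all
  have p0: "prj0 (st u t) = u t" for u t
    using n_pos by (simp add: prj_st quasi_def)
  have "(\<psi> has_integral bform (st y d) (st z d) - bform (st y 0) (st z 0)) {0..d}" if "d \<in> ivl E" for d
    using green_local [OF sys_solution_maxdom [OF y] sys_solution_maxdom [OF z] that]
    unfolding p0 \<psi>_def .
  from integral_tendsto_endpoint [OF i(1) this]
  show ?thesis unfolding bracket_eq_bform i(2) .
qed

text \<open>Trades the limit at the endpoint for an identity between L2 products and initial
  values.\<close>

lemma bracket_vanishes_iff: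
  assumes "y \<in> maxdom E" "z \<in> maxdom E"
  shows "bracket_vanishes_b E y z \<longleftrightarrow>
    l2_inner E (l_expr E y) z - l2_inner E y (l_expr E z) = - bform (st y 0) (st z 0)"
proof -
  have "bracket_vanishes_b E y z \<longleftrightarrow>
      bform (st y 0) (st z 0) + (l2_inner E (l_expr E y) z - l2_inner E y (l_expr E z)) = 0"
    unfolding bracket_vanishes_b_def
    using bracket_tendsto [OF assms] tendsto_unique [OF at_left_endpt_nontrivial] by metis
  then show ?thesis by (simp add: eq_neg_iff_add_eq_0 add.commute)
qed

lemma sq_integrable_extension:
  assumes f: "f \<in> L2 E"
  shows "sq_integrable (\<lambda>t. if t \<in> ivl E then f t else 0)"
proof -
  have eq: "(\<lambda>t. if t \<in> ivl E then f t else 0) = (\<lambda>t. indicat_real (ivl E) t *\<^sub>R f t)"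
    "(\<lambda>t. (norm (if t \<in> ivl E then f t else 0))\<^sup>2) = (\<lambda>t. indicat_real (ivl E) t *\<^sub>R (norm (f t))\<^sup>2)"
    by (auto simp: indicator_def)
  have "(\<lambda>t. if t \<in> ivl E then f t else 0) \<in> borel_measurable lebesgue"
    unfolding eq(1) using L2_measurable [OF f] ivl_sets by (simp add: borel_measurable_restrict_space_iff)
  moreover have "integrable lebesgue (\<lambda>t. (norm (if t \<in> ivl E then f t else 0))\<^sup>2)"
    unfolding eq(2) using L2_integrable [OF f] ivl_sets by (simp add: integrable_restrict_space)
  ultimately show ?thesis unfolding sq_integrable_def by blast
qed

text \<open>Adding \<open>J\<close> times a primitive \<open>W\<close> of the right side removes the
  discontinuity: \<open>V = Y + J W\<close> solves \<open>V' = A V - A J W\<close>, whose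
  inhomogeneity is continuous.\<close>

lemma sys_solution_exists:
  assumes f: "f \<in> L2 E"
  shows "\<exists>Y. sys_solution Y f \<and> Y 0 = u"
proof -
  define F where "F t = (if t \<in> ivl E then f t else 0)" for t
  have F: "sq_integrable F" unfolding F_def by (rule sq_integrable_extension [OF f])
  define W where "W = primitive F"
  have Wac: "abs_continuous_on 0 d W" for d unfolding W_def by (rule abs_continuous_on_primitive [OF F])
  have Wc: "continuous_on (ivl E) W"
    by (rule continuous_on_initial_interval [OF ivl_initial abs_continuous_on_imp_continuous_on [OF Wac]])
  have W0: "W 0 = 0" by (simp add: W_def primitive_def set_lebesgue_integral_def)
  obtain N where N: "negligible N" "\<And>t. 0 \<le> t \<Longrightarrow> t \<notin> N \<Longrightarrow> (W has_vector_derivative F t) (at t within {0..})"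
    unfolding W_def using primitive_has_vector_derivative_AE [OF F] by blast
  have "continuous_on (ivl E) (\<lambda>t. - blinfun_apply (sysA t) (blinfun_apply J (W t)))"
    by (intro continuous_intros sysA_continuous Wc)
  from linear_ode_exists [OF ivl_initial sysA_continuous this, of u]
  obtain V where V: "V 0 = u" "\<And>t. t \<in> ivl E \<Longrightarrow>
      (V has_vector_derivative blinfun_apply (sysA t) (V t) + - blinfun_apply (sysA t) (blinfun_apply J (W t))) (at t within ivl E)"
    by blast
  have Vc: "continuous_on (ivl E) V"
    unfolding continuous_on_eq_continuous_within by (blast intro: has_vector_derivative_continuous V(2))
  define Y where "Y t = V t + - blinfun_apply J (W t)" for t
  have "sys_solution Y f"
    unfolding sys_solution_def
  proof (intro conjI ballI exI [of _ N] N(1))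
    fix d assume d: "d \<in> ivl E"
    have "abs_continuous_on 0 d V"
    proof (rule abs_continuous_on_C1)
      show "(V has_vector_derivative blinfun_apply (sysA t) (V t) + - blinfun_apply (sysA t) (blinfun_apply J (W t))) (at t within {0..d})"
        if "t \<in> {0..d}" for t
        using that ivl_subset [OF d] by (intro has_vector_derivative_within_subset [OF V(2)]) auto
      show "continuous_on {0..d} (\<lambda>t. blinfun_apply (sysA t) (V t) + - blinfun_apply (sysA t) (blinfun_apply J (W t)))"
        by (rule continuous_on_subset [OF _ ivl_subset [OF d]]) (intro continuous_intros sysA_continuous Wc Vc)
    qed
    then show "abs_continuous_on 0 d Y"
      unfolding Y_def
      by (intro abs_continuous_on_add abs_continuous_on_bounded_linear [OF bounded_linear_minus [OF blinfun.bounded_linear_right] Wac])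
  next
    fix t assume t: "t \<in> ivl E - N"
    then have t0: "0 \<le> t" using ivl_nonneg by blast
    have "ivl E \<subseteq> {0..}" using ivl_nonneg by auto
    then have "(W has_vector_derivative F t) (at t within ivl E)"
      using t t0 by (intro has_vector_derivative_within_subset [OF N(2)]) auto
    then have "(W has_vector_derivative f t) (at t within ivl E)" using t by (simp add: F_def)
    then have "((\<lambda>t. - blinfun_apply J (W t)) has_vector_derivative - blinfun_apply J (f t)) (at t within ivl E)"
      by (rule bounded_linear.has_vector_derivative [OF bounded_linear_minus [OF blinfun.bounded_linear_right]])
    from has_vector_derivative_add [OF V(2) this]
    show "(Y has_vector_derivative blinfun_apply (sysA t) (Y t) - blinfun_apply J (f t)) (at t within ivl E)"
      using t unfolding Y_def by (simp add: blinfun.add_right blinfun.diff_right)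
  qed
  moreover have "Y 0 = u" by (simp add: Y_def V W0)
  ultimately show ?thesis by blast
qed

end

section \<open>Fundamental solutions, observability and controllability\<close>

lemma uniformly_continuous_interval:
  fixes U :: "real \<Rightarrow> 'v :: real_normed_vector"
  assumes U: "continuous_on {0..c} U" and c: "0 < c" and e: "0 < e"
  obtains \<delta> where "0 < \<delta>" "2 * \<delta> \<le> c"
    "\<And>s t. s \<in> {0..c} \<Longrightarrow> t \<in> {0..c} \<Longrightarrow> \<bar>s - t\<bar> \<le> \<delta> \<Longrightarrow> norm (U s - U t) \<le> e"
proof -
  have "uniformly_continuous_on {0..c} U" by (rule compact_uniformly_continuous [OF U]) simp
  then obtain d where d: "0 < d" "\<And>s t. s \<in> {0..c} \<Longrightarrow> t \<in> {0..c} \<Longrightarrow> dist s t < d \<Longrightarrow> dist (U s) (U t) < e"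
    using e unfolding uniformly_continuous_on_def by (metis dist_commute)
  show ?thesis
  proof (rule that [of "min (d / 2) (c / 2)"])
    fix s t assume st: "s \<in> {0..c}" "t \<in> {0..c}" "\<bar>s - t\<bar> \<le> min (d / 2) (c / 2)"
    then have "dist s t < d" using d(1) by (simp add: dist_real_def)
    then show "norm (U s - U t) \<le> e" using d(2) [OF st(1,2)] by (simp add: dist_norm)
  qed (use d c in auto)
qed

text \<open>At every point of [0, c], the two ends included, there is room for an interval of length
  \<open>\<delta>\<close> on at least one side.\<close>

lemma inner_interval:
  assumes "0 < \<delta>" "2 * \<delta> \<le> c" "t \<in> {0..c :: real}"
  obtains a where "{a..a + \<delta>} \<subseteq> {0..c}" "t \<in> {a..a + \<delta>}" "t = a \<or> t = a + \<delta>"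
proof (cases "t + \<delta> \<le> c")
  case True
  then show ?thesis using assms by (intro that [of t]) auto
next
  case False
  then show ?thesis using assms by (intro that [of "t - \<delta>"]) auto
qed

text \<open>Uniform convergence to 0 on [0, c] along the sequence.\<close>

definition null_on :: "real \<Rightarrow> (nat \<Rightarrow> real \<Rightarrow> 'v :: real_normed_vector) \<Rightarrow> bool" where
  "null_on c X \<longleftrightarrow> (\<forall>e>0. \<forall>\<^sub>F m in sequentially. \<forall>t\<in>{0..c}. norm (X m t) < e)"

lemma null_onD: "null_on c X \<Longrightarrow> 0 < e \<Longrightarrow> \<forall>\<^sub>F m in sequentially. \<forall>t\<in>{0..c}. norm (X m t) < e"
  by (simp add: null_on_def)

lemma null_on_add:
  assumes "null_on c X" "null_on c Y"
  shows "null_on c (\<lambda>m t. X m t + Y m t)"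
  unfolding null_on_def
proof (intro allI impI)
  fix e :: real assume "0 < e"
  then have "0 < e / 2" by simp
  then have "\<forall>\<^sub>F m in sequentially. \<forall>t\<in>{0..c}. norm (X m t) < e / 2" "\<forall>\<^sub>F m in sequentially. \<forall>t\<in>{0..c}. norm (Y m t) < e / 2"
    by (rule null_onD [OF assms(1)], rule null_onD [OF assms(2)])
  then show "\<forall>\<^sub>F m in sequentially. \<forall>t\<in>{0..c}. norm (X m t + Y m t) < e"
  proof eventually_elim
    case (elim m)
    have "norm (X m t + Y m t) < e" if "t \<in> {0..c}" for t
      using bspec [OF elim(1) that] bspec [OF elim(2) that] norm_triangle_ineq [of "X m t" "Y m t"] by linarith
    then show ?case by blast
  qed
qed

lemma null_on_bounded:
  assumes X: "null_on c X" and le: "\<And>m t. t \<in> {0..c} \<Longrightarrow> norm (Y m t) \<le> K * norm (X m t)" and K: "0 \<le> K"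
  shows "null_on c Y"
  unfolding null_on_def
proof (intro allI impI)
  fix e :: real assume "0 < e"
  then have "0 < e / (K + 1)" using K by simp
  then have "\<forall>\<^sub>F m in sequentially. \<forall>t\<in>{0..c}. norm (X m t) < e / (K + 1)"
    using X unfolding null_on_def by blast
  then show "\<forall>\<^sub>F m in sequentially. \<forall>t\<in>{0..c}. norm (Y m t) < e"
  proof eventually_elim
    case (elim m)
    have "norm (Y m t) < e" if t: "t \<in> {0..c}" for t
    proof -
      have "norm (Y m t) \<le> (K + 1) * norm (X m t)" using le [OF t, of m] by (simp add: ring_distribs add_increasing2)
      also have "\<dots> < (K + 1) * (e / (K + 1))" using bspec [OF elim t] K by (intro mult_strict_left_mono) auto
      also have "\<dots> = e" using K by simp
      finally show ?thesis .
    qed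
    then show ?case by blast
  qed
qed

lemma null_on_minus: "null_on c X \<Longrightarrow> null_on c (\<lambda>m t. - X m t)"
  by (simp add: null_on_def)

lemma null_on_diff: "null_on c X \<Longrightarrow> null_on c Y \<Longrightarrow> null_on c (\<lambda>m t. X m t - Y m t)"
  using null_on_add [OF _ null_on_minus, of c X Y] by simp

lemma null_on_scaleC:
  "null_on c X \<Longrightarrow> null_on c (\<lambda>m t. a *\<^sub>C (X m t :: 'v :: complex_normed_vector))"
  by (rule null_on_bounded [of c X _ "cmod a"]) (simp_all add: norm_scaleC)

lemma null_on_apply:
  assumes X: "null_on c X" and B: "continuous_on {0..c} B"
  shows "null_on c (\<lambda>m t. blinfun_apply (B t) (X m t))"
proof -
  obtain K where K: "0 \<le> K" "\<forall>t\<in>{0..c}. norm (B t) \<le> K"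
    using bounded_on_compact_interval [OF B] by blast
  show ?thesis
  proof (rule null_on_bounded [OF X _ K(1)])
    fix m t assume "t \<in> {0..c}"
    then show "norm (blinfun_apply (B t) (X m t)) \<le> K * norm (X m t)"
      using norm_blinfun [of "B t" "X m t"] mult_right_mono [of "norm (B t)" K "norm (X m t)"] K(2) by fastforce
  qed
qed

text \<open>A value of at least \<open>e\<close> at one point persists as \<open>e / 2\<close> on an
  interval of length \<open>\<delta>\<close>. As \<open>norm (k m) = 1\<close>,
  \<open>\<delta>\<close> depends only on the modulus of continuity of \<open>U\<close>, not on
  \<open>m\<close>, and the integral is bounded below by
  \<open>(e / 2)^2 * \<delta>\<close>.\<close>

lemma null_on_of_square_integral:
  fixes U :: "real \<Rightarrow> 'v :: real_normed_vector \<Rightarrow>\<^sub>L 'w :: real_normed_vector"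
  assumes U: "continuous_on {0..c} U" and c: "0 < c" and k: "\<And>m. norm (k m) = 1"
    and lim: "(\<lambda>m. integral {0..c} (\<lambda>t. (norm (blinfun_apply (U t) (k m)))\<^sup>2)) \<longlonglongrightarrow> 0"
  shows "null_on c (\<lambda>m t. blinfun_apply (U t) (k m))"
  unfolding null_on_def
proof (intro allI impI)
  fix e :: real assume e: "0 < e"
  obtain \<delta> where \<delta>: "0 < \<delta>" "2 * \<delta> \<le> c"
    "\<And>s t. s \<in> {0..c} \<Longrightarrow> t \<in> {0..c} \<Longrightarrow> \<bar>s - t\<bar> \<le> \<delta> \<Longrightarrow> norm (U s - U t) \<le> e / 2"
    by (rule uniformly_continuous_interval [OF U c, of "e / 2"]) (use e in auto)
  have "\<forall>\<^sub>F m in sequentially. integral {0..c} (\<lambda>t. (norm (blinfun_apply (U t) (k m)))\<^sup>2) < (e / 2)\<^sup>2 * \<delta>"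
    using e \<delta>(1) by (intro order_tendstoD(2) [OF lim]) simp
  then show "\<forall>\<^sub>F m in sequentially. \<forall>t\<in>{0..c}. norm (blinfun_apply (U t) (k m)) < e"
  proof eventually_elim
    case (elim m)
    have cU: "continuous_on {0..c} (\<lambda>t. (norm (blinfun_apply (U t) (k m)))\<^sup>2)"
      by (intro continuous_intros U)
    have "norm (blinfun_apply (U t) (k m)) < e" if t: "t \<in> {0..c}" for t
    proof (rule ccontr)
      assume big: "\<not> norm (blinfun_apply (U t) (k m)) < e"
      obtain a where a: "{a..a + \<delta>} \<subseteq> {0..c}" "t \<in> {a..a + \<delta>}" "t = a \<or> t = a + \<delta>"
        by (rule inner_interval [OF \<delta>(1,2) t])
      have low: "(e / 2)\<^sup>2 \<le> (norm (blinfun_apply (U s) (k m)))\<^sup>2" if s: "s \<in> {a..a + \<delta>}" for s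
      proof -
        have "norm (U t - U s) \<le> e / 2" using a s t by (intro \<delta>(3)) auto
        then have "norm (blinfun_apply (U t - U s) (k m)) \<le> e / 2"
          using norm_blinfun [of "U t - U s" "k m"] k [of m] by simp
        then have "norm (blinfun_apply (U t) (k m)) - norm (blinfun_apply (U s) (k m)) \<le> e / 2"
          using norm_triangle_ineq2 [of "blinfun_apply (U t) (k m)" "blinfun_apply (U s) (k m)"]
          by (simp add: blinfun.diff_left)
        then show ?thesis using big e by (intro power_mono) auto
      qed
      have "(e / 2)\<^sup>2 * \<delta> = integral {a..a + \<delta>} (\<lambda>s. (e / 2)\<^sup>2)" using \<delta>(1) by simp
      also have "\<dots> \<le> integral {a..a + \<delta>} (\<lambda>s. (norm (blinfun_apply (U s) (k m)))\<^sup>2)"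
        by (intro integral_le integrable_continuous_interval continuous_on_const continuous_on_subset [OF cU a(1)] low)
      also have "\<dots> \<le> integral {0..c} (\<lambda>s. (norm (blinfun_apply (U s) (k m)))\<^sup>2)"
        by (intro integral_subset_le a(1) integrable_continuous_interval cU continuous_on_subset [OF cU a(1)]) simp
      finally show False using elim by simp
    qed
    then show ?case by blast
  qed
qed

text \<open>On an interval of length \<open>\<delta>\<close>, chosen from the modulus of continuity
  of \<open>U'\<close> and hence independent of \<open>m\<close>, the derivative is nearly the
  difference quotient, whose numerator tends to 0 uniformly.\<close>

lemma null_on_derivative:
  fixes U :: "real \<Rightarrow> 'v :: real_normed_vector \<Rightarrow>\<^sub>L 'w :: real_normed_vector"
  assumes U: "\<And>t. t \<in> {0..c} \<Longrightarrow> (U has_vector_derivative U' t) (at t within {0..c})"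
    and U': "continuous_on {0..c} U'" and c: "0 < c" and k: "\<And>m. norm (k m) = 1"
    and null: "null_on c (\<lambda>m t. blinfun_apply (U t) (k m))"
  shows "null_on c (\<lambda>m t. blinfun_apply (U' t) (k m))"
  unfolding null_on_def
proof (intro allI impI)
  fix e :: real assume e: "0 < e"
  obtain \<delta> where \<delta>: "0 < \<delta>" "2 * \<delta> \<le> c"
    "\<And>s t. s \<in> {0..c} \<Longrightarrow> t \<in> {0..c} \<Longrightarrow> \<bar>s - t\<bar> \<le> \<delta> \<Longrightarrow> norm (U' s - U' t) \<le> e / 2"
    by (rule uniformly_continuous_interval [OF U' c, of "e / 2"]) (use e in auto)
  \<comment> \<open>Two values below \<open>e * \<delta> / 8\<close> and the linearisation error
    \<open>\<delta> * (e / 2)\<close> add up to \<open>3 * e * \<delta> / 4\<close>, which stays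
    below \<open>e * \<delta>\<close>.\<close>
  have "\<forall>\<^sub>F m in sequentially. \<forall>t\<in>{0..c}. norm (blinfun_apply (U t) (k m)) < e * \<delta> / 8"
    by (rule null_onD [OF null]) (use e \<delta>(1) in simp)
  then show "\<forall>\<^sub>F m in sequentially. \<forall>t\<in>{0..c}. norm (blinfun_apply (U' t) (k m)) < e"
  proof eventually_elim
    case (elim m)
    have "norm (blinfun_apply (U' t) (k m)) < e" if t: "t \<in> {0..c}" for t
    proof -
      obtain a where a: "{a..a + \<delta>} \<subseteq> {0..c}" "t \<in> {a..a + \<delta>}" "t = a \<or> t = a + \<delta>"
        by (rule inner_interval [OF \<delta>(1,2) t])
      have in_c: "a \<in> {0..c}" "a + \<delta> \<in> {0..c}" using a(1) \<delta>(1) by auto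
      have "norm (U (a + \<delta>) - U a - (a + \<delta> - a) *\<^sub>R U' t) \<le> norm (a + \<delta> - a) * (e / 2)"
      proof (rule vector_differentiable_bound_linearization)
        show "(U has_vector_derivative U' x) (at x within {a..a + \<delta>})" if "x \<in> {a..a + \<delta>}" for x
          using that a(1) by (intro has_vector_derivative_within_subset [OF U]) auto
        show "closed_segment a (a + \<delta>) \<subseteq> {a..a + \<delta>}" using \<delta>(1) by (simp add: closed_segment_eq_real_ivl)
        show "norm (U' x - U' t) \<le> e / 2" if "x \<in> {a..a + \<delta>}" for x
          using that a t by (intro \<delta>(3)) auto
      qed (rule a(2))
      then have "norm (blinfun_apply (U (a + \<delta>) - U a - \<delta> *\<^sub>R U' t) (k m)) \<le> \<delta> * (e / 2)"
        using norm_blinfun [of "U (a + \<delta>) - U a - \<delta> *\<^sub>R U' t" "k m"] k [of m] \<delta>(1) by simp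
      then have *: "norm (blinfun_apply (U (a + \<delta>)) (k m) - blinfun_apply (U a) (k m) - \<delta> *\<^sub>R blinfun_apply (U' t) (k m)) \<le> \<delta> * (e / 2)"
        by (simp add: blinfun.diff_left blinfun.scaleR_left)
      have "\<delta> * norm (blinfun_apply (U' t) (k m)) = norm (\<delta> *\<^sub>R blinfun_apply (U' t) (k m))" using \<delta>(1) by simp
      also have "\<dots> \<le> norm (blinfun_apply (U (a + \<delta>)) (k m) - blinfun_apply (U a) (k m)) + \<delta> * (e / 2)"
        using norm_triangle_ineq3 [of "\<delta> *\<^sub>R blinfun_apply (U' t) (k m)" "blinfun_apply (U (a + \<delta>)) (k m) - blinfun_apply (U a) (k m)"] *
        by (simp add: norm_minus_commute)
      also have "norm (blinfun_apply (U (a + \<delta>)) (k m) - blinfun_apply (U a) (k m)) \<le> e * \<delta> / 8 + e * \<delta> / 8"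
        using bspec [OF elim in_c(1)] bspec [OF elim in_c(2)]
          norm_triangle_ineq4 [of "blinfun_apply (U (a + \<delta>)) (k m)" "blinfun_apply (U a) (k m)"] by linarith
      finally have "\<delta> * norm (blinfun_apply (U' t) (k m)) \<le> \<delta> * (3 * e / 4)" by (simp add: algebra_simps)
      then have "norm (blinfun_apply (U' t) (k m)) \<le> 3 * e / 4" using \<delta>(1) by simp
      then show ?thesis using e by simp
    qed
    then show ?case by blast
  qed
qed

context regular_expr
begin

section \<open>Fundamental solutions with a spectral parameter\<close>

lemma has_vector_derivative_imp_continuous_on:
  "(\<And>t. t \<in> S \<Longrightarrow> (f has_vector_derivative f' t) (at t within S)) \<Longrightarrow> continuous_on S f"
  unfolding continuous_on_eq_continuous_within by (blast intro: has_vector_derivative_continuous)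

text \<open>The homogeneous system of \<open>l[y] = \<zeta> y\<close>: the inhomogeneity is replaced
  by \<open>\<zeta>\<close> times the component of index 0.\<close>

definition sysZ :: "complex \<Rightarrow> real \<Rightarrow> ('h, 'n) state \<Rightarrow>\<^sub>L ('h, 'n) state" where
  "sysZ \<zeta> t = sysA t - (J o\<^sub>L (\<zeta> *\<^sub>C prj 0))"

lemma sysZ_apply: "blinfun_apply (sysZ \<zeta> t) u = blinfun_apply (sysA t) u - blinfun_apply J (\<zeta> *\<^sub>C prj0 u)"
  by (simp add: sysZ_def blinfun.diff_left)

lemma sysZ_continuous: "continuous_on (ivl E) (sysZ \<zeta>)"
  unfolding sysZ_def [abs_def] by (intro continuous_intros sysA_continuous)

lemma inc_clinear: "blinfun_apply (inc k) (c *\<^sub>C h) = c *\<^sub>C blinfun_apply (inc k) h"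
  by (simp add: inc_apply scaleC_prod_def scaleC_vec_def vec_eq_iff)

lemma sysZ_clinear:
  "t \<in> ivl E \<Longrightarrow> blinfun_apply (sysZ \<zeta> t) (c *\<^sub>C u) = c *\<^sub>C blinfun_apply (sysZ \<zeta> t) u"
  by (simp add: sysZ_apply sysA_clinear prj_clinear scaleC_scaleC mult.commute scaleC_diff_right
      inc_clinear [symmetric] del: inc_apply)

definition fsol :: "complex \<Rightarrow> real \<Rightarrow> ('h, 'n) state \<Rightarrow>\<^sub>L ('h, 'n) state" where
  "fsol \<zeta> = (SOME \<Phi>. \<Phi> 0 = id_blinfun \<and>
    (\<forall>t\<in>ivl E. (\<Phi> has_vector_derivative sysZ \<zeta> t o\<^sub>L \<Phi> t) (at t within ivl E)) \<and>
    (\<forall>t\<in>ivl E. surj (blinfun_apply (\<Phi> t))))"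

lemma fsol:
  shows fsol_0 [simp]: "fsol \<zeta> 0 = id_blinfun"
    and fsol_derivative: "t \<in> ivl E \<Longrightarrow> (fsol \<zeta> has_vector_derivative sysZ \<zeta> t o\<^sub>L fsol \<zeta> t) (at t within ivl E)"
    and fsol_surj: "t \<in> ivl E \<Longrightarrow> surj (blinfun_apply (fsol \<zeta> t))"
  using someI_ex [OF fundamental_solution_exists [OF ivl_initial sysZ_continuous [of \<zeta>]]]
  unfolding fsol_def [symmetric] by simp_all

lemma fsol_continuous: "continuous_on (ivl E) (fsol \<zeta>)"
  by (rule has_vector_derivative_imp_continuous_on [OF fsol_derivative])

lemma fsol_apply_derivative:
  assumes "t \<in> ivl E"
  shows "((\<lambda>t. blinfun_apply (fsol \<zeta> t) k) has_vector_derivative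
    blinfun_apply (sysZ \<zeta> t) (blinfun_apply (fsol \<zeta> t) k)) (at t within ivl E)"
  using bounded_linear.has_vector_derivative [OF blinfun.bounded_linear_left fsol_derivative [OF assms, of \<zeta>], of k] by simp

lemma fsol_unique:
  assumes "\<And>t. t \<in> ivl E \<Longrightarrow> (X has_vector_derivative blinfun_apply (sysZ \<zeta> t) (X t)) (at t within ivl E)"
    and t: "t \<in> ivl E"
  shows "X t = blinfun_apply (fsol \<zeta> t) (X 0)"
  by (rule linear_ode_unique [OF ivl_initial sysZ_continuous, where g = "\<lambda>_. 0", OF _ _ _ t])
    (use assms(1) fsol_apply_derivative in simp_all)

lemma fsol_clinear:
  assumes t: "t \<in> ivl E"
  shows "blinfun_apply (fsol \<zeta> t) (c *\<^sub>C k) = c *\<^sub>C blinfun_apply (fsol \<zeta> t) k"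
proof -
  have "c *\<^sub>C blinfun_apply (fsol \<zeta> t) k = blinfun_apply (fsol \<zeta> t) (c *\<^sub>C blinfun_apply (fsol \<zeta> 0) k)"
  proof (rule fsol_unique [OF _ t])
    fix t assume t: "t \<in> ivl E"
    show "((\<lambda>t. c *\<^sub>C blinfun_apply (fsol \<zeta> t) k) has_vector_derivative
        blinfun_apply (sysZ \<zeta> t) (c *\<^sub>C blinfun_apply (fsol \<zeta> t) k)) (at t within ivl E)"
      using has_vector_derivative_scaleC [OF fsol_apply_derivative [OF t]] by (simp add: sysZ_clinear [OF t])
  qed
  then show ?thesis by simp
qed

lemma sys_solution_fsol:
  "sys_solution (\<lambda>t. blinfun_apply (fsol \<zeta> t) k) (\<lambda>t. \<zeta> *\<^sub>C prj0 (blinfun_apply (fsol \<zeta> t) k))"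
  unfolding sys_solution_def
proof (intro conjI ballI exI [of _ "{}"])
  fix d assume d: "d \<in> ivl E"
  show "abs_continuous_on 0 d (\<lambda>t. blinfun_apply (fsol \<zeta> t) k)"
  proof (rule abs_continuous_on_C1)
    show "((\<lambda>t. blinfun_apply (fsol \<zeta> t) k) has_vector_derivative
        blinfun_apply (sysZ \<zeta> t) (blinfun_apply (fsol \<zeta> t) k)) (at t within {0..d})" if "t \<in> {0..d}" for t
      using that ivl_subset [OF d] by (intro has_vector_derivative_within_subset [OF fsol_apply_derivative]) auto
    show "continuous_on {0..d} (\<lambda>t. blinfun_apply (sysZ \<zeta> t) (blinfun_apply (fsol \<zeta> t) k))"
      by (rule continuous_on_subset [OF _ ivl_subset [OF d]]) (intro continuous_intros sysZ_continuous fsol_continuous)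
  qed
qed (use fsol_apply_derivative in \<open>auto simp: sysZ_apply\<close>)

lemma sys_solution_cong:
  assumes Y: "sys_solution Y f" and M: "negligible M" and eq: "\<And>t. t \<in> ivl E - M \<Longrightarrow> f t = g t"
  shows "sys_solution Y g"
proof -
  obtain N' where N': "negligible N'" "\<And>t. t \<in> ivl E - N' \<Longrightarrow>
      (Y has_vector_derivative blinfun_apply (sysA t) (Y t) - blinfun_apply J (f t)) (at t within ivl E)"
    using Y unfolding sys_solution_def by blast
  have "(Y has_vector_derivative blinfun_apply (sysA t) (Y t) - blinfun_apply J (g t)) (at t within ivl E)"
    if "t \<in> ivl E - (M \<union> N')" for t
    using N'(2) [of t] eq [of t] that by simp
  then show ?thesis using Y negligible_Un [OF M N'(1)] unfolding sys_solution_def by blast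
qed

text \<open>With the solution itself on the right the coefficients are continuous, so the equation
  holds everywhere and uniqueness for linear systems applies.\<close>

lemma sys_solution_eigen:
  assumes Y: "sys_solution Y (\<lambda>t. \<zeta> *\<^sub>C prj0 (Y t))" and t: "t \<in> ivl E"
  shows "Y t = blinfun_apply (fsol \<zeta> t) (Y 0)"
proof (rule fsol_unique [OF _ t])
  fix t assume t: "t \<in> ivl E"
  obtain N where N: "negligible N" "\<And>t. t \<in> ivl E - N \<Longrightarrow>
      (Y has_vector_derivative blinfun_apply (sysA t) (Y t) - blinfun_apply J (\<zeta> *\<^sub>C prj0 (Y t))) (at t within ivl E)"
    using Y unfolding sys_solution_def by blast
  show "(Y has_vector_derivative blinfun_apply (sysZ \<zeta> t) (Y t)) (at t within ivl E)"
  proof (rule abs_continuous_everywhere_derivative [OF ivl_initial _ N(1) _ _ t])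
    show "abs_continuous_on 0 d Y" if "d \<in> ivl E" for d using Y that unfolding sys_solution_def by blast
    show "(Y has_vector_derivative blinfun_apply (sysZ \<zeta> t) (Y t)) (at t within ivl E)" if "t \<in> ivl E - N" for t
      using N(2) [OF that] by (simp add: sysZ_apply)
    show "continuous_on (ivl E) (\<lambda>t. blinfun_apply (sysZ \<zeta> t) (Y t))"
      by (intro continuous_intros sysZ_continuous sys_solution_continuous [OF Y])
  qed
qed

abbreviation zs :: "('h, 'n) state \<Rightarrow> real \<Rightarrow> 'h" where
  "zs k t \<equiv> prj0 (blinfun_apply (fsol 0 t) k)"

lemma sys_solution_zs: "sys_solution (\<lambda>t. blinfun_apply (fsol 0 t) k) (\<lambda>t. 0)"
  using sys_solution_fsol [of 0 k] by simp

lemma zs_continuous: "continuous_on (ivl E) (zs k)"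
  by (intro continuous_intros fsol_continuous)

lemma prj0_st: "prj0 (st y t) = y t"
  using n_pos by (simp add: prj_st quasi_def)

text \<open>If no such constant existed, there would be unit vectors whose first components tend to
  0 in L2 on [0, c]. Uniform smallness then spreads from each quasi-derivative to the next, and at
  \<open>t = 0\<close> the state is the unit vector itself.\<close>

lemma observability:
  assumes c: "c \<in> ivl E" "0 < c"
  shows "\<exists>\<epsilon>>0. \<forall>k. \<epsilon> * (norm k)\<^sup>2 \<le> integral {0..c} (\<lambda>t. (norm (zs k t))\<^sup>2)"
proof (rule ccontr)
  assume neg: "\<not> ?thesis"
  have sub: "{0..c} \<subseteq> ivl E" by (rule ivl_subset [OF c(1)])
  have "\<exists>k. norm k = 1 \<and> integral {0..c} (\<lambda>t. (norm (zs k t))\<^sup>2) < 1 / real (Suc m)" for m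
  proof -
    have "\<exists>k. integral {0..c} (\<lambda>t. (norm (zs k t))\<^sup>2) < 1 / real (Suc m) * (norm k)\<^sup>2"
      using neg by (meson not_le zero_less_divide_1_iff of_nat_0_less_iff zero_less_Suc)
    then obtain k where k: "integral {0..c} (\<lambda>t. (norm (zs k t))\<^sup>2) < 1 / real (Suc m) * (norm k)\<^sup>2" by blast
    have "0 \<le> integral {0..c} (\<lambda>t. (norm (zs k t))\<^sup>2)"
      by (intro integral_nonneg integrable_continuous_interval continuous_intros continuous_on_subset [OF fsol_continuous sub]) simp
    then have k0: "k \<noteq> 0" using k by auto
    have "integral {0..c} (\<lambda>t. (norm (zs (k /\<^sub>R norm k) t))\<^sup>2) = integral {0..c} (\<lambda>t. (1 / (norm k)\<^sup>2) * (norm (zs k t))\<^sup>2)"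
      by (simp add: blinfun.scaleR_right power_mult_distrib power_divide divide_inverse power_inverse)
    also have "\<dots> = integral {0..c} (\<lambda>t. (norm (zs k t))\<^sup>2) / (norm k)\<^sup>2" by simp
    also have "\<dots> < 1 / real (Suc m)" using k k0 by (simp add: divide_less_eq)
    finally show ?thesis using k0 by (intro exI [of _ "k /\<^sub>R norm k"]) simp
  qed
  then obtain k where k: "\<And>m. norm (k m) = 1" "\<And>m. integral {0..c} (\<lambda>t. (norm (zs (k m) t))\<^sup>2) < 1 / real (Suc m)" by metis
  define U where "U j t = prj j o\<^sub>L fsol 0 t" for j t
  define U' where "U' j t = prj j o\<^sub>L (sysZ 0 t o\<^sub>L fsol 0 t)" for j t
  have Uc: "continuous_on {0..c} (U j)" "continuous_on {0..c} (U' j)" for j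
    unfolding U_def U'_def
    by (rule continuous_on_subset [OF _ sub], intro continuous_intros bounded_bilinear.continuous_on [OF bounded_bilinear_blinfun_compose] fsol_continuous sysZ_continuous)+
  have UU': "(U j has_vector_derivative U' j t) (at t within {0..c})" if "t \<in> {0..c}" for j t
  proof -
    have tE: "t \<in> ivl E" using that sub by blast
    have "(U j has_vector_derivative U' j t) (at t within ivl E)"
      unfolding U_def U'_def
      by (rule bounded_linear.has_vector_derivative [OF bounded_bilinear.bounded_linear_right [OF bounded_bilinear_blinfun_compose] fsol_derivative [OF tE]])
    then show ?thesis by (rule has_vector_derivative_within_subset [OF _ sub])
  qed
  define X where "X j m t = blinfun_apply (prj j) (blinfun_apply (fsol 0 t) (k m))" for j m t
  have XU: "X j = (\<lambda>m t. blinfun_apply (U j t) (k m))" for j by (simp add: X_def U_def fun_eq_iff)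
  define X' where "X' j m t = blinfun_apply (prj j) (blinfun_apply (sysA t) (blinfun_apply (fsol 0 t) (k m)))" for j m t
  have XU': "X' j = (\<lambda>m t. blinfun_apply (U' j t) (k m))" for j by (simp add: X'_def U'_def sysZ_apply fun_eq_iff)
  have null0: "null_on c (X 0)"
    unfolding XU
  proof (rule null_on_of_square_integral [OF Uc(1) c(2) k(1)])
    show "(\<lambda>m. integral {0..c} (\<lambda>t. (norm (blinfun_apply (U 0 t) (k m)))\<^sup>2)) \<longlonglongrightarrow> 0"
    proof (rule tendsto_sandwich [OF _ _ tendsto_const LIMSEQ_inverse_real_of_nat [unfolded inverse_eq_divide]])
      show "\<forall>\<^sub>F m in sequentially. integral {0..c} (\<lambda>t. (norm (blinfun_apply (U 0 t) (k m)))\<^sup>2) \<le> 1 / real (Suc m)"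
        using k(2) by (intro always_eventually allI) (simp add: U_def less_imp_le)
      show "\<forall>\<^sub>F m in sequentially. 0 \<le> integral {0..c} (\<lambda>t. (norm (blinfun_apply (U 0 t) (k m)))\<^sup>2)"
        by (intro always_eventually allI integral_nonneg integrable_continuous_interval continuous_intros Uc) simp
    qed
  qed
  have null': "null_on c (X' j)" if "null_on c (X j)" for j
    unfolding XU XU'
    by (rule null_on_derivative [where U = "U j", OF UU' Uc(2) c(2) k(1)]) (use that in \<open>simp_all add: XU\<close>)
  have X': "X' j m t = rhs blinfun_apply t j (\<lambda>i. X i m t)" if "Suc j < 2 * n" for j m t
    unfolding X'_def using that by (subst prj_sysA) (auto intro!: rhs_cong_less simp: X_def)
  have cc: "continuous_on {0..c} f" if "continuous_on (ivl E) f" for f :: "real \<Rightarrow> 'h \<Rightarrow>\<^sub>L 'h"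
    by (rule continuous_on_subset [OF that sub])
  \<comment> \<open>The j-th component is recovered from the derivative of the previous one, in the
    three cases of \<open>rhs_determines\<close>. At \<open>j = n\<close> the coefficient
    \<open>p 0\<close> is applied to the derivative to undo the inverse.\<close>
  have null: "null_on c (X j)" if "j < 2 * n" for j
    using that
  proof (induction j rule: less_induct)
    case (less j)
    show ?case
    proof (cases j)
      case 0
      then show ?thesis using null0 by simp
    next
      case (Suc i)
      have IH: "null_on c (X l)" if "l \<le> i" for l using less Suc that by auto
      have N': "null_on c (X' i)" by (rule null' [OF IH]) simp
      have Xi: "X' i m t = rhs blinfun_apply t i (\<lambda>l. X l m t)" for m t using X' [of i] less.prems Suc by simp
      consider "Suc i < n" | "Suc i = n" | "n \<le> i" by linarith
      then show ?thesis
      proof cases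
        case 1
        then have "X' i = X j" using Suc by (simp add: fun_eq_iff Xi rhs_def dcomp_def)
        then show ?thesis using N' by simp
      next
        case 2
        have i: "n - 1 = i" using 2 by simp
        have "null_on c (\<lambda>m t. blinfun_apply (p 0 t) (X' i m t) - (\<i> / 2) *\<^sub>C blinfun_apply (q 0 t) (X i m t))"
          using n_pos by (intro null_on_diff null_on_scaleC null_on_apply N' IH cc p_continuous q_continuous) auto
        then show ?thesis
        proof (rule null_on_bounded [where K = 1])
          fix m t assume "t \<in> {0..c}"
          then have "t \<in> ivl E" using sub by blast
          then have "X j m t = blinfun_apply (p 0 t) (X' i m t) - (\<i> / 2) *\<^sub>C blinfun_apply (q 0 t) (X i m t)"
            using 2 Suc by (simp add: Xi rhs_def dcomp_def i action_p0inv [OF action_apply])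
          then show "norm (X j m t) \<le> 1 * norm (blinfun_apply (p 0 t) (X' i m t) - (\<i> / 2) *\<^sub>C blinfun_apply (q 0 t) (X i m t))" by simp
        qed simp
      next
        case 3
        have i2: "Suc i < 2 * n" using less.prems Suc by simp
        have D: "null_on c (\<lambda>m t. dcomp blinfun_apply t (\<lambda>l. X l m t) (2 * n - i))"
        proof (cases "2 * n - i < n")
          case True
          then show ?thesis using 3 by (simp add: dcomp_def IH)
        next
          case False
          then have "null_on c (\<lambda>m t. blinfun_apply (p0inv t) (X n m t + (\<i> / 2) *\<^sub>C blinfun_apply (q 0 t) (X (n - 1) m t)))"
            using n_pos 3 by (intro null_on_apply null_on_add null_on_scaleC IH cc p0inv_continuous q_continuous) auto
          then show ?thesis using False by (simp add: dcomp_def)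
        qed
        have Q: "null_on c (\<lambda>m t. if Suc i < 2 * n then blinfun_apply (q (Suc i - n) t) (X (2 * n - 2 - i) m t) else 0)"
          using 3 i2 by (auto intro!: null_on_apply IH cc q_continuous)
        have qc: "continuous_on (ivl E) (\<lambda>t. cadjoint (q (i - n) t))"
          using 3 i2 by (intro continuous_on_cadjoint q_continuous q_clinear) auto
        have "null_on c (\<lambda>m t. - X' i m t + blinfun_apply (p (Suc i - n) t) (X (2 * n - 1 - i) m t)
            + (\<i> / 2) *\<^sub>C (blinfun_apply (cadjoint (q (i - n) t)) (dcomp blinfun_apply t (\<lambda>l. X l m t) (2 * n - i))
              - (if Suc i < 2 * n then blinfun_apply (q (Suc i - n) t) (X (2 * n - 2 - i) m t) else 0)))"
          using 3 i2 by (intro null_on_add null_on_minus null_on_scaleC null_on_diff null_on_apply N' IH D Q cc p_continuous qc) auto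
        then show ?thesis
          unfolding Xi using 3 Suc by (simp add: rhs_def)
      qed
    qed
  qed
  have "\<forall>\<^sub>F m in sequentially. \<forall>j<2 * n. norm (blinfun_apply (prj j) (k m)) < e" if "0 < e" for e
  proof -
    have "\<forall>\<^sub>F m in sequentially. norm (blinfun_apply (prj j) (k m)) < e" if "j < 2 * n" for j
      using null [OF that] \<open>0 < e\<close> unfolding null_on_def by (auto simp: X_def elim!: allE eventually_mono dest!: bspec [of _ _ 0] simp: c(2) less_imp_le)
    then show ?thesis by (simp add: eventually_ball_finite_distrib [of "{..<2 * n}", simplified Ball_def lessThan_iff])
  qed
  \<comment> \<open>With components below \<open>1 / S\<close> the vector has norm below
    \<open>(S - 1) / S < 1\<close>; the added 1 makes this strict and \<open>S\<close>
    positive.\<close>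
  moreover define S where "S = (\<Sum>j<2 * n. norm (inc j)) + 1"
  have S: "0 < S" unfolding S_def by (intro add_nonneg_pos sum_nonneg) auto
  ultimately have "\<forall>\<^sub>F m in sequentially. \<forall>j<2 * n. norm (blinfun_apply (prj j) (k m)) < 1 / S" by simp
  then obtain m where m: "\<And>j. j < 2 * n \<Longrightarrow> norm (blinfun_apply (prj j) (k m)) < 1 / S"
    by (auto simp: eventually_sequentially)
  have "1 = norm (\<Sum>j<2 * n. blinfun_apply (inc j) (blinfun_apply (prj j) (k m)))"
    using k(1) [of m] by (simp add: sum_inc_prj)
  also have "\<dots> \<le> (\<Sum>j<2 * n. norm (inc j) * (1 / S))"
  proof (rule sum_norm_le)
    fix j assume "j \<in> {..<2 * n}"
    then show "norm (blinfun_apply (inc j) (blinfun_apply (prj j) (k m))) \<le> norm (inc j) * (1 / S)"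
      using order_trans [OF norm_blinfun mult_left_mono [OF less_imp_le [OF m [of j]] norm_ge_zero]] by simp
  qed
  also have "\<dots> = (S - 1) * (1 / S)" by (simp only: S_def sum_distrib_right [symmetric] add_diff_cancel)
  also have "\<dots> < 1" using S by simp
  finally show False by simp
qed

section \<open>Steering a state to zero\<close>

lemma L2_of_continuous_support:
  assumes g: "continuous_on {0..c} g" and c: "c \<in> ivl E" and zero: "\<And>t. t \<in> ivl E \<Longrightarrow> c < t \<Longrightarrow> g t = 0"
    and B: "\<And>t. t \<in> {0..c} \<Longrightarrow> norm (g t) \<le> B" "0 \<le> B"
  shows "g \<in> L2 E" "l2_norm E g \<le> B * sqrt c"
proof -
  have sub: "{0..c} \<subseteq> ivl E" by (rule ivl_subset [OF c])
  have c0: "0 \<le> c" by (rule ivl_nonneg [OF c])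
  have S: "{0..c} \<in> sets (leb E)" using ivl_sets sub by (simp add: sets_restrict_space_iff)
  have geq: "g t = (if t \<in> {0..c} then g t else 0)" if "t \<in> ivl E" for t
    using that zero [OF that] ivl_nonneg [OF that] by auto
  have "(\<lambda>t. indicat_real {0..c} t *\<^sub>R g t) \<in> borel_measurable borel"
    by (rule borel_measurable_continuous_on_indicator [OF _ g]) simp
  then have "(\<lambda>t. indicat_real {0..c} t *\<^sub>R g t) \<in> borel_measurable lebesgue" 
    by (simp add: measurable_completion)
  then have "(\<lambda>t. indicat_real {0..c} t *\<^sub>R g t) \<in> borel_measurable (leb E)"
    by (rule measurable_restrict_space1)
  then have gm: "g \<in> borel_measurable (leb E)"
    by (rule measurable_lebesgue_on_spike [OF ivl_sets _ negligible_empty]) (use zero ivl_nonneg in \<open>auto simp: indicator_def not_le\<close>)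
  have em: "emeasure (leb E) {0..c} = ennreal c"
    using sub ivl_sets c0 by (subst emeasure_restrict_space) auto
  have int1: "integrable (leb E) (\<lambda>t. indicat_real {0..c} t * B\<^sup>2)"
    using S em by (intro integrable_mult_left) (simp add: integrable_indicator_iff Int_absorb2 [OF sub])
  have le: "(norm (g t))\<^sup>2 \<le> indicat_real {0..c} t * B\<^sup>2" if "t \<in> ivl E" for t
    using B zero [OF that] ivl_nonneg [OF that] by (auto simp: indicator_def not_le intro!: power_mono)
  have int2: "integrable (leb E) (\<lambda>t. (norm (g t))\<^sup>2)"
  proof (rule Bochner_Integration.integrable_bound [OF int1])
    show "(\<lambda>t. (norm (g t))\<^sup>2) \<in> borel_measurable (leb E)" using gm by measurable
    show "AE t in leb E. norm ((norm (g t))\<^sup>2) \<le> norm (indicat_real {0..c} t * B\<^sup>2)"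
      by (rule AE_I2) (use le in \<open>simp add: abs_of_nonneg\<close>)
  qed
  then show "g \<in> L2 E" using gm by (simp add: L2_def)
  have "(LINT t|leb E. (norm (g t))\<^sup>2) \<le> (LINT t|leb E. indicat_real {0..c} t * B\<^sup>2)"
    by (rule integral_mono [OF int2 int1]) (use le in simp)
  also have "\<dots> = c * B\<^sup>2"
    using S em c0 by (simp add: measure_def Int_absorb2 [OF sub])
  finally have "l2_norm E g \<le> sqrt (c * B\<^sup>2)" unfolding l2_norm_def by (rule real_sqrt_le_mono)
  then show "l2_norm E g \<le> B * sqrt c" using B(2) by (simp add: real_sqrt_mult mult.commute)
qed

text \<open>Every vector is the value at \<open>t\<close> of a solution of the homogeneous equation,
  since \<open>fsol 0 t\<close> is onto. Green's formula against that solution and the moment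
  condition \<open>orth\<close> give \<open>bform (Y t) v = 0\<close> for all \<open>v\<close>, and
  the form is nondegenerate.\<close>

lemma controlled_solution:
  assumes c: "c \<in> ivl E" and f: "f \<in> L2 E" and f0: "\<And>t. t \<in> ivl E \<Longrightarrow> c < t \<Longrightarrow> f t = 0"
    and orth: "\<And>k. integral {0..c} (\<lambda>t. cinner (f t) (zs k t)) = - bform h k"
  shows "\<exists>Y. sys_solution Y f \<and> Y 0 = h \<and> (\<forall>t\<in>ivl E. c \<le> t \<longrightarrow> Y t = 0)"
proof -
  obtain Y where Y: "sys_solution Y f" "Y 0 = h" using sys_solution_exists [OF f] by blast
  have "Y t = 0" if t: "t \<in> ivl E" "c \<le> t" for t
  proof (rule bform_nondegenerate)
    fix v
    obtain k where k: "blinfun_apply (fsol 0 t) k = v" using fsol_surj [OF t(1)] by (metis surj_def)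
    have "((\<lambda>t. cinner (f t) (zs k t)) has_integral bform (Y t) v - bform h k) {0..t}"
      using green_local [OF Y(1) sys_solution_zs [of k] t(1)] k Y(2) by simp
    then have "bform (Y t) v - bform h k = integral {0..t} (\<lambda>t. cinner (f t) (zs k t))"
      by (rule integral_unique [symmetric])
    also have "\<dots> = integral {0..t} (\<lambda>s. if s \<in> {0..c} then cinner (f s) (zs k s) else 0)"
    proof (rule integral_cong)
      fix s assume "s \<in> {0..t}"
      then have "s \<in> ivl E" using ivl_subset [OF t(1)] by blast
      then show "cinner (f s) (zs k s) = (if s \<in> {0..c} then cinner (f s) (zs k s) else 0)"
        using f0 [of s] \<open>s \<in> {0..t}\<close> by auto
    qed
    also have "\<dots> = integral {0..c} (\<lambda>s. cinner (f s) (zs k s))"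
      using t(2) by (simp add: integral_restrict_Int Int_absorb2 del: atLeastAtMost_iff)
    finally show "bform (Y t) v = 0" using orth [of k] by simp
  qed
  then show ?thesis using Y by blast
qed

lemma gram_form:
  assumes c: "c \<in> ivl E" "0 < c"
  defines "a \<equiv> \<lambda>k k'. integral {0..c} (\<lambda>t. cinner (zs k t) (zs k' t))"
  shows "bounded_bilinear a" "a k k' = cnj (a k' k)" "a k (\<i> *\<^sub>C k') = - \<i> * a k k'"
    "a k k = of_real (integral {0..c} (\<lambda>t. (norm (zs k t))\<^sup>2))"
proof -
  note sub = ivl_subset [OF c(1)]
  have zc: "continuous_on {0..c} (zs k)" for k by (rule continuous_on_subset [OF zs_continuous sub])
  have ic: "(\<lambda>t. cinner (zs k t) (zs k' t)) integrable_on {0..c}" for k k'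
    by (intro integrable_continuous_interval continuous_intros zc)
  obtain K where K: "0 \<le> K" "\<forall>t\<in>{0..c}. norm (prj 0 o\<^sub>L fsol 0 t) \<le> K"
    using bounded_on_compact_interval [of 0 c "\<lambda>t. prj 0 o\<^sub>L fsol 0 t"] continuous_on_subset [OF _ sub]
      bounded_bilinear.continuous_on [OF bounded_bilinear_blinfun_compose continuous_on_const fsol_continuous] by blast
  have zK: "norm (zs k t) \<le> K * norm k" if "t \<in> {0..c}" for k t
    using norm_blinfun [of "prj 0 o\<^sub>L fsol 0 t" k] mult_right_mono [OF bspec [OF K(2) that], of "norm k"] by simp
  show "bounded_bilinear a"
  proof
    show "a (k + k') l = a k l + a k' l" for k k' l
      unfolding a_def by (simp add: blinfun.add_right cinner_add_left Henstock_Kurzweil_Integration.integral_add ic)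
    show "a l (k + k') = a l k + a l k'" for k k' l
      unfolding a_def by (simp add: blinfun.add_right cinner_add_right Henstock_Kurzweil_Integration.integral_add ic)
    show "a (r *\<^sub>R k) l = r *\<^sub>R a k l" "a k (r *\<^sub>R l) = r *\<^sub>R a k l" for r k l
      unfolding a_def
      by (simp_all add: blinfun.scaleR_right bounded_bilinear.scaleR_left [OF bounded_bilinear_cinner]
          bounded_bilinear.scaleR_right [OF bounded_bilinear_cinner] del: scaleR_conv_of_real)
    show "\<exists>C. \<forall>k l. norm (a k l) \<le> norm k * norm l * C"
    proof (intro exI allI)
      fix k l
      have "norm (a k l) \<le> integral {0..c} (\<lambda>t. K * norm k * (K * norm l))"
        unfolding a_def
      proof (rule integral_norm_bound_integral [OF ic])
        fix t assume t: "t \<in> {0..c}"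
        show "norm (cinner (zs k t) (zs l t)) \<le> K * norm k * (K * norm l)"
          using K(1) by (intro order_trans [OF norm_cinner_le] mult_mono zK t) auto
      qed (rule integrable_continuous_interval [OF continuous_on_const])
      then show "norm (a k l) \<le> norm k * norm l * (K * K * c)" using c(2) by (simp add: mult.assoc mult.left_commute mult.commute)
    qed
  qed
  have "a k k' = integral {0..c} (\<lambda>t. cnj (cinner (zs k' t) (zs k t)))"
    unfolding a_def using cinner_commute by (intro integral_cong) auto
  then show "a k k' = cnj (a k' k)" unfolding a_def by (simp add: Henstock_Kurzweil_Integration.integral_cnj)
  have "a k (\<i> *\<^sub>C k') = integral {0..c} (\<lambda>t. - \<i> * cinner (zs k t) (zs k' t))"
    unfolding a_def using sub by (intro integral_cong) (auto simp: fsol_clinear prj_clinear cinner_scaleC_right)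
  then show "a k (\<i> *\<^sub>C k') = - \<i> * a k k'" unfolding a_def by simp
  have "((\<lambda>t. complex_of_real ((norm (zs k t))\<^sup>2)) has_integral of_real (integral {0..c} (\<lambda>t. (norm (zs k t))\<^sup>2))) {0..c}"
    by (intro has_integral_of_real integrable_integral integrable_continuous_interval continuous_intros zc)
  then show "a k k = of_real (integral {0..c} (\<lambda>t. (norm (zs k t))\<^sup>2))"
    unfolding a_def cinner_self by (rule integral_unique)
qed

text \<open>Solves the moment problem on [0, c] within the solutions of the homogeneous equation:
  observability is exactly coercivity of their Gram form.\<close>

lemma gram_represents:
  assumes c: "c \<in> ivl E" "0 < c" and \<phi>: "bounded_linear \<phi>" "\<And>x. \<phi> (\<i> *\<^sub>C x) = - \<i> * \<phi> x"
  shows "\<exists>k. \<forall>k'. integral {0..c} (\<lambda>t. cinner (zs k t) (zs k' t)) = \<phi> k'"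
proof -
  obtain \<epsilon> where \<epsilon>: "0 < \<epsilon>" "\<And>k. \<epsilon> * (norm k)\<^sup>2 \<le> integral {0..c} (\<lambda>t. (norm (zs k t))\<^sup>2)"
    using observability [OF c] by blast
  show ?thesis
    by (rule coercive_form_represents [where \<epsilon> = \<epsilon>, OF gram_form(1) [OF c] gram_form(2) [OF c] gram_form(3) [OF c] _ \<epsilon>(1) \<phi>])
      (use \<epsilon>(2) in \<open>simp add: gram_form(4) [OF c]\<close>)
qed

end

section \<open>The boundary form at the endpoint\<close>

context regular_expr
begin

lemma maxdom_L2: "y \<in> maxdom E \<Longrightarrow> y \<in> L2 E" "y \<in> maxdom E \<Longrightarrow> l_expr E y \<in> L2 E"
  and maxdom_outside: "y \<in> maxdom E \<Longrightarrow> t \<notin> ivl E \<Longrightarrow> y t = 0"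
  by (auto simp: maxdom_def Let_def)

lemma initial_interval_Icc: "0 \<le> c \<Longrightarrow> initial_interval {0..c}"
  by (auto simp: initial_interval_def)

lemma l2_norm_if_ivl: "l2_norm E (\<lambda>t. if t \<in> ivl E then f t else 0) = l2_norm E f"
  unfolding l2_norm_def by (intro arg_cong [where f = sqrt] Bochner_Integration.integral_cong) auto

text \<open>The control is itself a solution \<open>zs k\<close>, cut off at \<open>c\<close>, with
  \<open>k\<close> solving the moment problem for \<open>- bform h\<close>. The bounds linear in
  \<open>norm h\<close> are what later makes the \<gamma>-field and the Weyl function
  bounded.\<close>

lemma lift_exists:
  obtains c C where "c \<in> ivl E" "0 < c" "ereal c < endpt E" "0 \<le> C"
    "\<And>h. \<exists>y\<in>maxdom E. st y 0 = h \<and> (\<forall>t\<in>ivl E. c \<le> t \<longrightarrow> st y t = 0) \<and>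
      l2_norm E y \<le> C * norm h \<and> l2_norm E (l_expr E y) \<le> C * norm h"
proof -
  \<comment> \<open>\<open>c\<close> lies strictly before the endpoint, so that the lifts vanish on
    a left neighbourhood of it even when the endpoint belongs to the interval.\<close>
  obtain c where c: "0 < c" "c \<in> ivl E" "ereal c < endpt E" using ivl_positive by blast
  note sub = ivl_subset [OF c(2)]
  obtain \<epsilon> where \<epsilon>: "0 < \<epsilon>" "\<And>k. \<epsilon> * (norm k)\<^sup>2 \<le> integral {0..c} (\<lambda>t. (norm (zs k t))\<^sup>2)"
    using observability [OF c(2,1)] by blast
  obtain B where B: "0 \<le> B" "\<And>u v. norm (bform u v) \<le> norm u * norm v * B"
    using bounded_bilinear.nonneg_bounded [OF bounded_bilinear_bform] by blast
  obtain K0 where K0: "0 \<le> K0" "\<forall>t\<in>{0..c}. norm (fsol 0 t) \<le> K0"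
    using bounded_on_compact_interval [OF continuous_on_subset [OF fsol_continuous sub]] by blast
  obtain KA where KA: "0 \<le> KA" "\<forall>t\<in>{0..c}. norm (sysA t) \<le> KA"
    using bounded_on_compact_interval [OF continuous_on_subset [OF sysA_continuous sub]] by blast
  define K where "K = norm (prj 0) * K0"
  have K: "0 \<le> K" using K0 by (simp add: K_def)
  have zK: "norm (zs k t) \<le> K * norm k" if t: "t \<in> {0..c}" for k t
  proof -
    have "norm (zs k t) \<le> norm (prj 0) * norm (blinfun_apply (fsol 0 t) k)" by (rule norm_blinfun)
    also have "\<dots> \<le> norm (prj 0) * (norm (fsol 0 t) * norm k)" by (intro mult_left_mono norm_blinfun norm_ge_zero)
    also have "\<dots> \<le> norm (prj 0) * (K0 * norm k)" using K0 t by (intro mult_left_mono mult_right_mono) auto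
    finally show ?thesis by (simp add: K_def mult.assoc)
  qed
  \<comment> \<open>\<open>m * norm h\<close> bounds the inhomogeneity \<open>J f\<close>, using
    \<open>norm k \<le> B / \<epsilon> * norm h\<close> from coercivity. In \<open>C\<close> the
    first entry is the Gronwall bound for \<open>y\<close>, the second bounds
    \<open>l[y] = f\<close>.\<close>
  define m where "m = norm J * K * (B / \<epsilon>)"
  define C where "C = max (norm (prj 0) * ((1 + m * c) * exp (KA * c)) * sqrt c) (K * (B / \<epsilon>) * sqrt c)"
  have m: "0 \<le> m" using K B \<epsilon> by (simp add: m_def)
  have C0: "0 \<le> C" unfolding C_def using K B \<epsilon> c(1) by (intro max.coboundedI2) simp
  have "\<exists>y\<in>maxdom E. st y 0 = h \<and> (\<forall>t\<in>ivl E. c \<le> t \<longrightarrow> st y t = 0) \<and>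
      l2_norm E y \<le> C * norm h \<and> l2_norm E (l_expr E y) \<le> C * norm h" for h
  proof -
    have "bounded_linear (\<lambda>k'. - bform h k')"
      by (intro bounded_linear_minus bounded_bilinear.bounded_linear_right [OF bounded_bilinear_bform])
    then have "\<exists>k. \<forall>k'. integral {0..c} (\<lambda>t. cinner (zs k t) (zs k' t)) = - bform h k'"
      by (rule gram_represents [OF c(2,1)]) (simp add: bform_scaleC_right)
    then obtain k where k: "\<And>k'. integral {0..c} (\<lambda>t. cinner (zs k t) (zs k' t)) = - bform h k'" by blast
    have "\<epsilon> * (norm k)\<^sup>2 \<le> Re (- bform h k)"
      using \<epsilon>(2) [of k] gram_form(4) [OF c(2,1), of k] by (simp add: k)
    also have "\<dots> \<le> norm (bform h k)" using abs_Re_le_cmod [of "- bform h k"] by simp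
    also have "\<dots> \<le> norm h * norm k * B" by (rule B(2))
    finally have "norm k * (\<epsilon> * norm k) \<le> norm k * (norm h * B)" by (simp add: power2_eq_square mult_ac)
    then have "\<epsilon> * norm k \<le> norm h * B" using B(1) by (cases "k = 0") auto
    then have kh: "norm k \<le> B / \<epsilon> * norm h" using \<epsilon>(1) by (simp add: field_simps)
    define f where "f t = (if t \<le> c then zs k t else 0)" for t
    have fc: "continuous_on {0..c} f"
      by (rule continuous_on_eq [OF continuous_on_subset [OF zs_continuous sub, of k]]) (simp add: f_def)
    have f: "f \<in> L2 E" "l2_norm E f \<le> (K * norm k) * sqrt c"
    proof -
      have 1: "f t = 0" if "t \<in> ivl E" "c < t" for t using that by (simp add: f_def)
      have 2: "norm (f t) \<le> K * norm k" if "t \<in> {0..c}" for t using zK [OF that, of k] that by (simp add: f_def)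
      have 3: "0 \<le> K * norm k" using K by simp
      show "f \<in> L2 E" "l2_norm E f \<le> (K * norm k) * sqrt c"
        by (rule L2_of_continuous_support [OF fc c(2) 1 2 3], assumption+)+
    qed
    have orth: "integral {0..c} (\<lambda>t. cinner (f t) (zs k' t)) = - bform h k'" for k'
    proof -
      have "integral {0..c} (\<lambda>t. cinner (f t) (zs k' t)) = integral {0..c} (\<lambda>t. cinner (zs k t) (zs k' t))"
        by (rule integral_cong) (simp add: f_def)
      then show ?thesis by (simp add: k)
    qed
    have "\<exists>Y. sys_solution Y f \<and> Y 0 = h \<and> (\<forall>t\<in>ivl E. c \<le> t \<longrightarrow> Y t = 0)"
      by (rule controlled_solution [OF c(2) f(1) _ orth]) (simp add: f_def)
    then obtain Y where Y: "sys_solution Y f" "Y 0 = h" "\<And>t. t \<in> ivl E \<Longrightarrow> c \<le> t \<Longrightarrow> Y t = 0" by blast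
    have Yc: "continuous_on {0..c} Y" by (rule continuous_on_subset [OF sys_solution_continuous [OF Y(1)] sub])
    have Yd: "(Y has_vector_derivative blinfun_apply (sysA t) (Y t) - blinfun_apply J (f t)) (at t within {0..c})"
      if t: "t \<in> {0..c}" for t
    proof -
      obtain M where M: "negligible M" "\<And>t. t \<in> ivl E - M \<Longrightarrow>
          (Y has_vector_derivative blinfun_apply (sysA t) (Y t) - blinfun_apply J (f t)) (at t within ivl E)"
        using Y(1) unfolding sys_solution_def by blast
      show ?thesis
      proof (rule abs_continuous_everywhere_derivative [OF initial_interval_Icc _ M(1) _ _ t])
        show "abs_continuous_on 0 d Y" if "d \<in> {0..c}" for d
          using Y(1) that sub unfolding sys_solution_def by blast
        show "(Y has_vector_derivative blinfun_apply (sysA t) (Y t) - blinfun_apply J (f t)) (at t within {0..c})"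
          if "t \<in> {0..c} - M" for t
          using that sub by (intro has_vector_derivative_within_subset [OF M(2) sub]) auto
        show "continuous_on {0..c} (\<lambda>t. blinfun_apply (sysA t) (Y t) - blinfun_apply J (f t))"
          by (intro continuous_intros continuous_on_subset [OF sysA_continuous sub] Yc fc)
      qed (use c in simp)
    qed
    have Yb: "norm (Y t) \<le> (1 + m * c) * exp (KA * c) * norm h" if t: "t \<in> {0..c}" for t
    proof -
      have "norm (Y t) \<le> (norm (Y 0) + (m * norm h) * t) * exp (KA * t)"
      proof (rule gronwall [OF Yd _ KA(1) _ t])
        fix s assume s: "s \<in> {0..c}"
        have "norm (blinfun_apply (sysA s) (Y s) - blinfun_apply J (f s)) \<le> norm (blinfun_apply (sysA s) (Y s)) + norm (blinfun_apply J (f s))"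
          by (rule norm_triangle_ineq4)
        also have "norm (blinfun_apply (sysA s) (Y s)) \<le> KA * norm (Y s)"
          using KA s by (intro order_trans [OF norm_blinfun] mult_right_mono) auto
        also have "norm (blinfun_apply J (f s)) \<le> norm J * (K * (B / \<epsilon> * norm h))"
        proof -
          have "norm (f s) \<le> K * norm k" using zK [OF s, of k] s by (simp add: f_def)
          also have "\<dots> \<le> K * (B / \<epsilon> * norm h)" using kh K by (intro mult_left_mono) auto
          finally show ?thesis by (intro order_trans [OF norm_blinfun] mult_left_mono norm_ge_zero)
        qed
        finally show "norm (blinfun_apply (sysA s) (Y s) - blinfun_apply J (f s)) \<le> KA * norm (Y s) + m * norm h"
          by (simp add: m_def mult_ac)
      qed (use m in simp_all)
      also have "\<dots> \<le> (norm h + (m * norm h) * c) * exp (KA * c)"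
        using t m KA(1) Y(2) by (intro mult_mono add_mono mult_left_mono) (auto intro!: mult_left_mono mult_nonneg_nonneg add_nonneg_nonneg)
      finally show ?thesis by (simp add: algebra_simps)
    qed
    define b where "b = norm (prj 0) * ((1 + m * c) * exp (KA * c) * norm h)"
    have yc: "continuous_on {0..c} (\<lambda>t. prj0 (Y t))" by (intro continuous_intros Yc)
    have y: "(\<lambda>t. prj0 (Y t)) \<in> L2 E" "l2_norm E (\<lambda>t. prj0 (Y t)) \<le> b * sqrt c"
    proof -
      have 1: "prj0 (Y t) = 0" if "t \<in> ivl E" "c < t" for t using Y(3) [of t] that by simp
      have 2: "norm (prj0 (Y t)) \<le> b" if "t \<in> {0..c}" for t
        unfolding b_def using Yb [OF that] by (intro order_trans [OF norm_blinfun] mult_left_mono) auto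
      have 3: "0 \<le> b" unfolding b_def using m c by (intro mult_nonneg_nonneg add_nonneg_nonneg) auto
      show "(\<lambda>t. prj0 (Y t)) \<in> L2 E" "l2_norm E (\<lambda>t. prj0 (Y t)) \<le> b * sqrt c"
        by (rule L2_of_continuous_support [OF yc c(2) 1 2 3], assumption+)+
    qed
    define z where "z t = (if t \<in> ivl E then prj0 (Y t) else 0)" for t
    note z = maxdom_of_sys_solution [OF Y(1) f(1) y(1), folded z_def]
    show ?thesis
    proof (intro bexI [OF _ z(1)] conjI ballI impI)
      show "st z 0 = h" using z(2) [OF zero_in_ivl] Y(2) by simp
      show "st z t = 0" if "t \<in> ivl E" "c \<le> t" for t using z(2) [OF that(1)] Y(3) [OF that] by simp
      have "l2_norm E z = l2_norm E (\<lambda>t. prj0 (Y t))" unfolding z_def by (rule l2_norm_if_ivl)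
      also have "\<dots> \<le> b * sqrt c" by (rule y(2))
      also have "\<dots> = norm (prj 0) * ((1 + m * c) * exp (KA * c)) * sqrt c * norm h" by (simp add: b_def)
      also have "\<dots> \<le> C * norm h" unfolding C_def by (intro mult_right_mono max.cobounded1 norm_ge_zero)
      finally show "l2_norm E z \<le> C * norm h" .
      have "l2_norm E (l_expr E z) = l2_norm E f" by (rule l2_norm_cong_AE [OF z(3) maxdom_L2(2) [OF z(1)] f(1)])
      also have "\<dots> \<le> K * norm k * sqrt c" by (rule f(2))
      also have "\<dots> \<le> K * (B / \<epsilon> * norm h) * sqrt c" using K kh c(1) by (intro mult_right_mono mult_left_mono) auto
      also have "\<dots> = K * (B / \<epsilon>) * sqrt c * norm h" by simp
      also have "\<dots> \<le> C * norm h" unfolding C_def by (intro mult_right_mono max.cobounded2 norm_ge_zero)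
      finally show "l2_norm E (l_expr E z) \<le> C * norm h" .
    qed
  qed
  then show ?thesis using c C0 by (intro that [of c C]) auto
qed

text \<open>The quasi-derivatives of a combination are not computed directly: the combined state
  solves the system, and \<open>maxdom_of_sys_solution\<close> reads off the rest. Since both
  functions vanish outside the interval, the extension by zero is the combination itself.\<close>

lemma maxdom_lincomb:
  assumes y: "y \<in> maxdom E" and z: "z \<in> maxdom E"
  shows "(\<lambda>t. a *\<^sub>C y t + b *\<^sub>C z t) \<in> maxdom E" (is "?w \<in> _")
    "st (\<lambda>t. a *\<^sub>C y t + b *\<^sub>C z t) 0 = a *\<^sub>C st y 0 + b *\<^sub>C st z 0"
    "AE t in leb E. l_expr E (\<lambda>t. a *\<^sub>C y t + b *\<^sub>C z t) t = a *\<^sub>C l_expr E y t + b *\<^sub>C l_expr E z t"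
proof -
  define W where "W t = a *\<^sub>C st y t + b *\<^sub>C st z t" for t
  define f where "f t = a *\<^sub>C l_expr E y t + b *\<^sub>C l_expr E z t" for t
  have sW: "sys_solution W f"
  proof -
    obtain M1 where M1: "negligible M1" "\<And>t. t \<in> ivl E - M1 \<Longrightarrow>
        (st y has_vector_derivative blinfun_apply (sysA t) (st y t) - blinfun_apply J (l_expr E y t)) (at t within ivl E)"
      using sys_solution_maxdom [OF y] unfolding sys_solution_def by blast
    obtain M2 where M2: "negligible M2" "\<And>t. t \<in> ivl E - M2 \<Longrightarrow>
        (st z has_vector_derivative blinfun_apply (sysA t) (st z t) - blinfun_apply J (l_expr E z t)) (at t within ivl E)"
      using sys_solution_maxdom [OF z] unfolding sys_solution_def by blast
    have ac: "abs_continuous_on 0 d (st y)" "abs_continuous_on 0 d (st z)" if "d \<in> ivl E" for d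
      using sys_solution_maxdom [OF y] sys_solution_maxdom [OF z] that unfolding sys_solution_def by blast+
    show ?thesis
      unfolding sys_solution_def
    proof (intro conjI ballI exI [of _ "M1 \<union> M2"] negligible_Un M1(1) M2(1))
      fix d assume "d \<in> ivl E"
      then show "abs_continuous_on 0 d W"
        unfolding W_def [abs_def] by (intro abs_continuous_on_add abs_continuous_on_bounded_linear [OF bounded_linear_scaleC] ac)
    next
      fix t assume t: "t \<in> ivl E - (M1 \<union> M2)"
      then have tE: "t \<in> ivl E" by blast
      have "(W has_vector_derivative a *\<^sub>C (blinfun_apply (sysA t) (st y t) - blinfun_apply J (l_expr E y t))
          + b *\<^sub>C (blinfun_apply (sysA t) (st z t) - blinfun_apply J (l_expr E z t))) (at t within ivl E)"
        unfolding W_def [abs_def] using t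
        by (intro has_vector_derivative_add has_vector_derivative_scaleC M1(2) M2(2)) auto
      also have "a *\<^sub>C (blinfun_apply (sysA t) (st y t) - blinfun_apply J (l_expr E y t))
          + b *\<^sub>C (blinfun_apply (sysA t) (st z t) - blinfun_apply J (l_expr E z t)) =
          blinfun_apply (sysA t) (W t) - blinfun_apply J (f t)"
        by (simp add: W_def f_def blinfun.add_right sysA_clinear [OF tE] inc_clinear scaleC_diff_right)
      finally show "(W has_vector_derivative blinfun_apply (sysA t) (W t) - blinfun_apply J (f t)) (at t within ivl E)" .
    qed
  qed
  have pW: "prj0 (W t) = a *\<^sub>C y t + b *\<^sub>C z t" for t
    by (simp add: W_def blinfun.add_right prj_clinear prj0_st)
  have f: "f \<in> L2 E" unfolding f_def by (intro L2_lincomb maxdom_L2 y z)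
  have "(\<lambda>t. prj0 (W t)) \<in> L2 E" unfolding pW by (intro L2_lincomb maxdom_L2 y z)
  note w = maxdom_of_sys_solution [OF sW f this]
  have eq: "(\<lambda>t. if t \<in> ivl E then prj0 (W t) else 0) = ?w"
    using maxdom_outside [OF y] maxdom_outside [OF z] by (auto simp: pW)
  show "?w \<in> maxdom E" using w(1) unfolding eq .
  show "st ?w 0 = a *\<^sub>C st y 0 + b *\<^sub>C st z 0" using w(2) [OF zero_in_ivl] unfolding eq by (simp add: W_def)
  show "AE t in leb E. l_expr E ?w t = a *\<^sub>C l_expr E y t + b *\<^sub>C l_expr E z t" using w(3) unfolding eq f_def .
qed

text \<open>By \<open>bracket_tendsto\<close> this is [y, z](b), written without the limit.\<close>

definition boundary_defect :: "(real \<Rightarrow> 'h) \<Rightarrow> (real \<Rightarrow> 'h) \<Rightarrow> complex" where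
  "boundary_defect y z = l2_inner E (l_expr E y) z - l2_inner E y (l_expr E z) + bform (st y 0) (st z 0)"

lemma bracket_vanishes_boundary_defect:
  "y \<in> maxdom E \<Longrightarrow> z \<in> maxdom E \<Longrightarrow> bracket_vanishes_b E y z \<longleftrightarrow> boundary_defect y z = 0"
  by (simp add: bracket_vanishes_iff boundary_defect_def eq_neg_iff_add_eq_0)

lemma bform_commute: "bform u v = - cnj (bform v u)"
  by (simp add: bform_def cinner_commute [of "fst u"] cinner_commute [of "snd u"])

lemma boundary_defect_commute: "boundary_defect y z = - cnj (boundary_defect z y)"
  using l2_inner_commute [of E "l_expr E y" z] l2_inner_commute [of E y "l_expr E z"] bform_commute [of "st y 0" "st z 0"]
  by (simp add: boundary_defect_def)

lemma boundary_defect_lincomb: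
  assumes y: "y \<in> maxdom E" and z: "z \<in> maxdom E" and w: "w \<in> maxdom E"
  shows "boundary_defect (\<lambda>t. a *\<^sub>C y t + b *\<^sub>C z t) w = a * boundary_defect y w + b * boundary_defect z w"
proof -
  note L = maxdom_L2 [OF y] maxdom_L2 [OF z] maxdom_L2 [OF w]
  have "l2_inner E (l_expr E (\<lambda>t. a *\<^sub>C y t + b *\<^sub>C z t)) w = l2_inner E (\<lambda>t. a *\<^sub>C l_expr E y t + b *\<^sub>C l_expr E z t) w"
    by (rule l2_inner_cong_AE [OF maxdom_lincomb(3) [OF y z]])
      (auto intro: L maxdom_L2 maxdom_lincomb(1) [OF y z] L2_lincomb)
  moreover have "bform (a *\<^sub>C u + b *\<^sub>C v) x = a * bform u x + b * bform v x" for u v x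
    by (simp add: bform_def scaleC_prod_def cinner_algebra algebra_simps)
  ultimately show ?thesis
    unfolding boundary_defect_def
    by (simp add: l2_inner_lincomb_left L maxdom_lincomb(2) [OF y z] algebra_simps)
qed

text \<open>The bracket is 0 on a left neighbourhood of the endpoint, whatever \<open>z\<close>
  is.\<close>

lemma boundary_defect_compact:
  assumes y: "y \<in> maxdom E" and z: "z \<in> maxdom E" and c: "0 \<le> c" "ereal c < endpt E"
    and zero: "\<And>t. t \<in> ivl E \<Longrightarrow> c \<le> t \<Longrightarrow> st y t = 0"
  shows "boundary_defect y z = 0"
proof -
  have "\<forall>\<^sub>F x in at_left (endpt E). bracket E y z (real_of_ereal x) = 0"
    unfolding eventually_at_left [OF c(2)]
  proof (intro exI [of _ "ereal c"] conjI c(2) allI impI)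
    fix x assume x: "ereal c < x" "x < endpt E"
    then obtain r where r: "x = ereal r" by (cases x) auto
    have "r \<in> ivl E" using ivl_cases(2) x c(1) r by (elim disjE) (auto simp: less_imp_le)
    then show "bracket E y z (real_of_ereal x) = 0"
      using zero [of r] x r by (simp add: bracket_eq_bform bform_def)
  qed
  then have "bracket_vanishes_b E y z" unfolding bracket_vanishes_b_def by (rule tendsto_eventually)
  then show ?thesis by (simp add: bracket_vanishes_boundary_defect y z)
qed

text \<open>A selfadjoint relation is its own annihilator under \<open>bform\<close>; being an
  annihilator makes it linear, being contained in it makes it isotropic.\<close>

lemma bform_theta:
  assumes \<theta>: "selfadjoint_rel \<theta>"
  shows "u \<in> \<theta> \<Longrightarrow> v \<in> \<theta> \<Longrightarrow> bform u v = 0" "u \<in> \<theta> \<Longrightarrow> v \<in> \<theta> \<Longrightarrow> a *\<^sub>C u + b *\<^sub>C v \<in> \<theta>" "0 \<in> \<theta>"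
proof -
  have mem: "v \<in> \<theta> \<longleftrightarrow> (\<forall>u\<in>\<theta>. bform u v = 0)" for v
  proof -
    have "v \<in> \<theta> \<longleftrightarrow> v \<in> rel_adjoint \<theta>" using \<theta> by (simp add: selfadjoint_rel_def)
    then show ?thesis unfolding rel_adjoint_def by (cases v) (auto simp: bform_def split: prod.splits)
  qed
  show "u \<in> \<theta> \<Longrightarrow> v \<in> \<theta> \<Longrightarrow> bform u v = 0" using mem by blast
  have "bform w (a *\<^sub>C u + b *\<^sub>C v) = cnj a * bform w u + cnj b * bform w v" for w
    by (simp add: bounded_bilinear.add_right [OF bounded_bilinear_bform] bform_scaleC_right)
  note lin = this
  show "a *\<^sub>C u + b *\<^sub>C v \<in> \<theta>" if "u \<in> \<theta>" "v \<in> \<theta>"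
    unfolding mem [of "a *\<^sub>C u + b *\<^sub>C v"] lin
  proof
    fix w assume w: "w \<in> \<theta>"
    have "bform w u = 0" "bform w v = 0" using that w mem [of u] mem [of v] by blast+
    then show "cnj a * bform w u + cnj b * bform w v = 0" by simp
  qed
  show "0 \<in> \<theta>" unfolding mem [of 0] by (simp add: bform_def)
qed

text \<open>The dimension is a supremum over orthonormal families, and an element of nonzero norm
  would give one with a single member after normalisation.\<close>

lemma kernel_trivial_of_dim_zero:
  assumes dim: "l2_dim E (l2_kernel E (l2_adjoint E T) \<zeta>) = 0" and u: "u \<in> l2_kernel E (l2_adjoint E T) \<zeta>"
    and T: "T \<subseteq> L2 E \<times> L2 E"
  shows "l2_norm E u = 0"
proof (rule ccontr)
  assume nz: "l2_norm E u \<noteq> 0"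
  have uL: "u \<in> L2 E" using u by (simp add: l2_kernel_def l2_adjoint_def)
  define v where "v t = complex_of_real (1 / l2_norm E u) *\<^sub>C u t" for t
  have vL: "v \<in> L2 E" unfolding v_def by (rule L2_scaleC [OF uL])
  have "l2_norm E v = 1" using nz l2_norm_nonneg [of E u] unfolding v_def l2_norm_scaleC by (simp add: norm_divide)
  then have vv: "l2_inner E v v = 1" by (simp add: l2_inner_self)
  have zv: "(\<lambda>t. \<zeta> *\<^sub>C v t) = (\<lambda>t. complex_of_real (1 / l2_norm E u) *\<^sub>C (\<zeta> *\<^sub>C u t))"
    by (simp add: v_def scaleC_scaleC mult.commute)
  have "v \<in> l2_kernel E (l2_adjoint E T) \<zeta>"
    unfolding l2_kernel_def l2_adjoint_def
  proof (clarify, intro conjI vL L2_scaleC ballI)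
    fix x assume x: "x \<in> T"
    obtain w g where wg: "x = (w, g)" by (cases x)
    have L: "w \<in> L2 E" "g \<in> L2 E" using x wg T by auto
    have "l2_inner E g u = l2_inner E w (\<lambda>t. \<zeta> *\<^sub>C u t)"
      using u x wg by (auto simp: l2_kernel_def l2_adjoint_def)
    moreover have "l2_inner E g v = cnj (of_real (1 / l2_norm E u)) * l2_inner E g u"
      using l2_inner_lincomb_right [OF uL uL L(2), of "of_real (1 / l2_norm E u)" 0] by (simp add: v_def [abs_def])
    moreover have "l2_inner E w (\<lambda>t. \<zeta> *\<^sub>C v t) = cnj (of_real (1 / l2_norm E u)) * l2_inner E w (\<lambda>t. \<zeta> *\<^sub>C u t)"
      using l2_inner_lincomb_right [OF L2_scaleC [OF uL, of \<zeta>] L2_scaleC [OF uL, of \<zeta>] L(1), of "of_real (1 / l2_norm E u)" 0]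
      unfolding zv by simp
    ultimately show "case x of (w, g) \<Rightarrow> l2_inner E g v = l2_inner E w (\<lambda>t. \<zeta> *\<^sub>C v t)" by (simp add: wg)
  qed
  then have "enat (card {v}) \<in> {enat (card F) | F. finite F \<and> F \<subseteq> l2_kernel E (l2_adjoint E T) \<zeta> \<and>
     (\<forall>f\<in>F. \<forall>g\<in>F. l2_inner E f g = (if f = g then 1 else 0))}"
    using vv by (intro CollectI exI [of _ "{v}"]) simp
  then have "enat (card {v}) \<le> l2_dim E (l2_kernel E (l2_adjoint E T) \<zeta>)"
    unfolding l2_dim_def by (rule Sup_upper)
  then show False using dim by (simp add: zero_enat_def)
qed

lemma l2_inner_cong_left:
  "AE t in leb E. f t = f' t \<Longrightarrow> f \<in> L2 E \<Longrightarrow> f' \<in> L2 E \<Longrightarrow> g \<in> L2 E \<Longrightarrow> l2_inner E f g = l2_inner E f' g"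
  by (rule l2_inner_cong_AE) auto

text \<open>Elements of \<open>maxdom E\<close> with vanishing initial data belong to the domain of the adjoint of
  \<open>L_theta E \<theta>\<close>, which is symmetric if the deficiency indices vanish.\<close>

theorem boundary_defect_eq_zero:
  assumes ind: "deficiency_indices_b TYPE('n) E 0 0" and y: "y \<in> maxdom E" and z: "z \<in> maxdom E"
  shows "boundary_defect y z = 0"
proof -
  obtain \<theta> :: "(('h, 'n) vec \<times> ('h, 'n) vec) set" and \<zeta>p \<zeta>m where \<theta>: "selfadjoint_rel \<theta>" and \<zeta>: "0 < Im \<zeta>p" "Im \<zeta>m < 0"
    and dim: "l2_dim E (l2_kernel E (l2_adjoint E (L_theta E \<theta>)) \<zeta>p) = 0"
      "l2_dim E (l2_kernel E (l2_adjoint E (L_theta E \<theta>)) \<zeta>m) = 0"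
    using ind unfolding deficiency_indices_b_def by blast
  define T where "T = L_theta E \<theta>"
  obtain c C where c: "c \<in> ivl E" "0 < c" "ereal c < endpt E"
    and lift: "\<And>h. \<exists>y\<in>maxdom E. st y 0 = h \<and> (\<forall>t\<in>ivl E. c \<le> t \<longrightarrow> st y t = 0) \<and>
      l2_norm E y \<le> C * norm h \<and> l2_norm E (l_expr E y) \<le> C * norm h"
    by (rule lift_exists) blast
  have TE: "\<exists>w\<in>maxdom E. st w 0 \<in> \<theta> \<and> (\<forall>x\<in>maxdom E. boundary_defect w x = 0) \<and>
      (AE t in leb E. u t = w t) \<and> (AE t in leb E. f t = l_expr E w t) \<and> u \<in> L2 E \<and> f \<in> L2 E" if "(u, f) \<in> T" for u f
    using that unfolding T_def L_theta_def L_restr_def st_def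
    by (auto simp: bracket_vanishes_boundary_defect [symmetric])
  have TI: "(u, f) \<in> T" if "w \<in> maxdom E" "st w 0 \<in> \<theta>" "\<And>x. x \<in> maxdom E \<Longrightarrow> boundary_defect w x = 0"
      "AE t in leb E. u t = w t" "AE t in leb E. f t = l_expr E w t" "u \<in> L2 E" "f \<in> L2 E" for u f w
    using that unfolding T_def L_theta_def L_restr_def st_def
    by (auto simp: bracket_vanishes_boundary_defect)
  have TL: "T \<subseteq> L2 E \<times> L2 E" unfolding T_def L_theta_def L_restr_def by auto
  have TN: "T \<noteq> {}"
  proof -
    obtain w where w: "w \<in> maxdom E" "st w 0 = 0" "\<forall>t\<in>ivl E. c \<le> t \<longrightarrow> st w t = 0" using lift [of 0] by blast
    have "(w, l_expr E w) \<in> T"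
      by (rule TI [OF w(1)]) (use w c bform_theta(3) [OF \<theta>] maxdom_L2 [OF w(1)] boundary_defect_compact [OF w(1), of _ c] in auto)
    then show ?thesis by blast
  qed
  have Tlin: "((\<lambda>t. a *\<^sub>C u t + b *\<^sub>C v t), (\<lambda>t. a *\<^sub>C f t + b *\<^sub>C g t)) \<in> T"
    if uf: "(u, f) \<in> T" and vg: "(v, g) \<in> T" for u f v g a b
  proof -
    obtain w where w: "w \<in> maxdom E" "st w 0 \<in> \<theta>" "\<forall>x\<in>maxdom E. boundary_defect w x = 0"
      "AE t in leb E. u t = w t" "AE t in leb E. f t = l_expr E w t" "u \<in> L2 E" "f \<in> L2 E" using TE [OF uf] by blast
    obtain x where x: "x \<in> maxdom E" "st x 0 \<in> \<theta>" "\<forall>y\<in>maxdom E. boundary_defect x y = 0"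
      "AE t in leb E. v t = x t" "AE t in leb E. g t = l_expr E x t" "v \<in> L2 E" "g \<in> L2 E" using TE [OF vg] by blast
    note l = maxdom_lincomb [OF w(1) x(1), of a b]
    show ?thesis
    proof (rule TI [OF l(1)])
      show "st (\<lambda>t. a *\<^sub>C w t + b *\<^sub>C x t) 0 \<in> \<theta>" unfolding l(2) by (rule bform_theta(2) [OF \<theta> w(2) x(2)])
      show "boundary_defect (\<lambda>t. a *\<^sub>C w t + b *\<^sub>C x t) y = 0" if "y \<in> maxdom E" for y
        using w(3) x(3) that by (simp add: boundary_defect_lincomb w(1) x(1))
      show "AE t in leb E. a *\<^sub>C u t + b *\<^sub>C v t = a *\<^sub>C w t + b *\<^sub>C x t"
        using w(4) x(4) by eventually_elim simp
      show "AE t in leb E. a *\<^sub>C f t + b *\<^sub>C g t = l_expr E (\<lambda>t. a *\<^sub>C w t + b *\<^sub>C x t) t"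
        using w(5) x(5) l(3) by eventually_elim simp
    qed (intro L2_lincomb w x)+
  qed
  have inner_T: "l2_inner E f x = l2_inner E u (l_expr E x)"
    if uf: "(u, f) \<in> T" and x: "x \<in> maxdom E" and b: "\<And>w. st w 0 \<in> \<theta> \<Longrightarrow> bform (st w 0) (st x 0) = 0" for u f x
  proof -
    obtain w where w: "w \<in> maxdom E" "st w 0 \<in> \<theta>" "\<forall>x\<in>maxdom E. boundary_defect w x = 0"
      "AE t in leb E. u t = w t" "AE t in leb E. f t = l_expr E w t" "u \<in> L2 E" "f \<in> L2 E" using TE [OF uf] by blast
    have "l2_inner E (l_expr E w) x = l2_inner E w (l_expr E x)"
      using w(3) x b [OF w(2)] by (auto simp: boundary_defect_def)
    then show ?thesis
      using l2_inner_cong_left [OF w(5,7) maxdom_L2(2) [OF w(1)] maxdom_L2(1) [OF x]]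
        l2_inner_cong_left [OF w(4,6) maxdom_L2(1) [OF w(1)] maxdom_L2(2) [OF x]] by simp
  qed
  have Tsym: "l2_inner E f v = l2_inner E u g" if uf: "(u, f) \<in> T" and vg: "(v, g) \<in> T" for u f v g
  proof -
    obtain x where x: "x \<in> maxdom E" "st x 0 \<in> \<theta>" "\<forall>y\<in>maxdom E. boundary_defect x y = 0"
      "AE t in leb E. v t = x t" "AE t in leb E. g t = l_expr E x t" "v \<in> L2 E" "g \<in> L2 E" using TE [OF vg] by blast
    have L: "u \<in> L2 E" "f \<in> L2 E" using uf TL by auto
    have "l2_inner E f x = l2_inner E u (l_expr E x)"
      by (rule inner_T [OF uf x(1)]) (rule bform_theta(1) [OF \<theta> _ x(2)])
    moreover have "l2_inner E f v = l2_inner E f x"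
      by (rule l2_inner_cong_AE) (use x L maxdom_L2 [OF x(1)] in auto)
    moreover have "l2_inner E u g = l2_inner E u (l_expr E x)"
      by (rule l2_inner_cong_AE) (use x L maxdom_L2 [OF x(1)] in auto)
    ultimately show ?thesis by simp
  qed
  have adj: "(x, l_expr E x) \<in> l2_adjoint E T" if "x \<in> maxdom E" "st x 0 = 0" for x
    using inner_T [OF _ that(1)] that(2) maxdom_L2 [OF that(1)] by (auto simp: l2_adjoint_def bform_def)
  have ker: "\<And>u. u \<in> l2_kernel E (l2_adjoint E T) \<zeta>p \<Longrightarrow> l2_norm E u = 0"
    "\<And>u. u \<in> l2_kernel E (l2_adjoint E T) \<zeta>m \<Longrightarrow> l2_norm E u = 0"
    using kernel_trivial_of_dim_zero [OF _ _ TL] dim unfolding T_def by blast+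
  \<comment> \<open>Zero initial values put both functions into the domain of the adjoint of
    \<open>T\<close>, and they remove the term at 0; symmetry of the adjoint says that the rest is
    0.\<close>
  have zero_state: "boundary_defect x w = 0" if "x \<in> maxdom E" "st x 0 = 0" "w \<in> maxdom E" "st w 0 = 0" for x w
  proof -
    have "l2_inner E (l_expr E x) w = l2_inner E x (l_expr E w)"
      by (rule adjoint_symmetric [OF TL TN _ _ \<zeta> _ _ adj [OF that(1,2)] adj [OF that(3,4)]])
        (rule Tlin Tsym ker(1) ker(2); assumption)+
    then show ?thesis using that by (simp add: boundary_defect_def bform_def)
  qed
  \<comment> \<open>Subtracting lifts of the initial values leaves functions with zero initial
    values and does not change the form at the endpoint, near which the lifts vanish.\<close>
  obtain ry where ry: "ry \<in> maxdom E" "st ry 0 = st y 0" "\<forall>t\<in>ivl E. c \<le> t \<longrightarrow> st ry t = 0" using lift [of "st y 0"] by blast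
  obtain rz where rz: "rz \<in> maxdom E" "st rz 0 = st z 0" "\<forall>t\<in>ivl E. c \<le> t \<longrightarrow> st rz t = 0" using lift [of "st z 0"] by blast
  have ry0: "boundary_defect ry x = 0" if "x \<in> maxdom E" for x
    by (rule boundary_defect_compact [OF ry(1) that less_imp_le [OF c(2)] c(3)]) (use ry(3) in blast)
  have rz0: "boundary_defect rz x = 0" if "x \<in> maxdom E" for x
    by (rule boundary_defect_compact [OF rz(1) that less_imp_le [OF c(2)] c(3)]) (use rz(3) in blast)
  define y0 where "y0 t = 1 *\<^sub>C y t + (- 1) *\<^sub>C ry t" for t
  define z0 where "z0 t = 1 *\<^sub>C z t + (- 1) *\<^sub>C rz t" for t
  have y0: "y0 \<in> maxdom E" "st y0 0 = 0" "\<And>x. x \<in> maxdom E \<Longrightarrow> boundary_defect y0 x = boundary_defect y x"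
    unfolding y0_def using maxdom_lincomb(1,2) [OF y ry(1), of 1 "- 1"] boundary_defect_lincomb [OF y ry(1), of _ 1 "- 1"] ry ry0
    by (simp_all add: scaleC_minus_left)
  have z0: "z0 \<in> maxdom E" "st z0 0 = 0" "\<And>x. x \<in> maxdom E \<Longrightarrow> boundary_defect z0 x = boundary_defect z x"
    unfolding z0_def using maxdom_lincomb(1,2) [OF z rz(1), of 1 "- 1"] boundary_defect_lincomb [OF z rz(1), of _ 1 "- 1"] rz rz0
    by (simp_all add: scaleC_minus_left)
  have "boundary_defect y z = boundary_defect y0 z" using y0(3) [OF z] by simp
  also have "\<dots> = - cnj (boundary_defect z0 y0)" using z0(3) [OF y0(1)] boundary_defect_commute [of y0 z] by simp
  also have "\<dots> = 0" using zero_state [OF z0(1,2) y0(1,2)] by simp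
  finally show ?thesis .
qed

end

section \<open>Selfadjointness\<close>

context regular_expr
begin

lemma l2_inner_eq_integral:
  assumes d: "d \<in> ivl E" and f: "f \<in> L2 E" and g: "g \<in> L2 E"
    and zero: "\<And>t. t \<in> ivl E \<Longrightarrow> d < t \<Longrightarrow> f t = 0"
  shows "l2_inner E f g = integral {0..d} (\<lambda>t. cinner (f t) (g t))"
proof -
  have i: "integrable (leb E) (\<lambda>t. cinner (f t) (g t))" by (rule integrable_cinner [OF f g])
  have "l2_inner E f g = (LINT t|leb E. indicat_real {0..d} t *\<^sub>R cinner (f t) (g t))"
    unfolding l2_inner_def
    by (intro Bochner_Integration.integral_cong refl) (use zero ivl_nonneg in \<open>auto simp: indicator_def not_le\<close>)
  also have "\<dots> = (LINT t|lebesgue_on {0..d}. cinner (f t) (g t))"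
    by (rule integrable_lebesgue_on_subinterval(2) [OF i d, symmetric])
  also have "\<dots> = integral {0..d} (\<lambda>t. cinner (f t) (g t))"
    by (rule lebesgue_integral_eq_integral [OF integrable_lebesgue_on_subinterval(1) [OF i d]]) simp
  finally show ?thesis .
qed

lemma cut_continuous_L2:
  assumes d: "d \<in> ivl E" and g: "continuous_on {0..d} g" and B: "\<And>t. t \<in> {0..d} \<Longrightarrow> norm (g t) \<le> B" "0 \<le> B"
  shows "(\<lambda>t. if t \<le> d then g t else 0) \<in> L2 E" "l2_norm E (\<lambda>t. if t \<le> d then g t else 0) \<le> B * sqrt d"
proof -
  have c: "continuous_on {0..d} (\<lambda>t. if t \<le> d then g t else 0)"
    by (rule continuous_on_eq [OF g]) simp
  have 1: "(if t \<le> d then g t else 0) = 0" if "t \<in> ivl E" "d < t" for t using that by simp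
  have 2: "norm (if t \<le> d then g t else 0) \<le> B" if "t \<in> {0..d}" for t using B that by simp
  show "(\<lambda>t. if t \<le> d then g t else 0) \<in> L2 E" "l2_norm E (\<lambda>t. if t \<le> d then g t else 0) \<le> B * sqrt d"
    by (rule L2_of_continuous_support [OF c d 1 2 B(2)], assumption+)+
qed

lemma cut_L2:
  assumes g: "g \<in> L2 E"
  shows "(\<lambda>t. if t \<le> d then g t else 0) \<in> L2 E"
proof -
  have S: "{..d} \<inter> ivl E \<in> sets (leb E)" using ivl_sets by (auto simp: sets_restrict_space_iff)
  have eq: "indicat_real ({..d} \<inter> ivl E) t *\<^sub>R g t = (if t \<le> d then g t else 0)" if "t \<in> ivl E" for t
    using that by (simp add: indicator_def)
  have m: "(\<lambda>t. if t \<le> d then g t else 0) \<in> borel_measurable (leb E)"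
  proof (rule measurable_lebesgue_on_spike [OF ivl_sets _ negligible_empty])
    show "(\<lambda>t. indicat_real ({..d} \<inter> ivl E) t *\<^sub>R g t) \<in> borel_measurable (leb E)"
      by (intro borel_measurable_scaleR borel_measurable_indicator S L2_measurable g)
  qed (simp add: eq)
  moreover have "integrable (leb E) (\<lambda>t. (norm (if t \<le> d then g t else 0))\<^sup>2)"
  proof (rule Bochner_Integration.integrable_bound [OF L2_integrable [OF g]])
    show "(\<lambda>t. (norm (if t \<le> d then g t else 0))\<^sup>2) \<in> borel_measurable (leb E)"
      using m by measurable
  qed (rule AE_I2, simp)
  ultimately show ?thesis by (simp add: L2_def)
qed

lemma zs_cut:
  assumes d: "d \<in> ivl E"
  shows "(\<lambda>t. if t \<le> d then zs k t else 0) \<in> L2 E"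
    "\<exists>K\<ge>0. \<forall>k. l2_norm E (\<lambda>t. if t \<le> d then zs k t else 0) \<le> K * norm k"
proof -
  note sub = ivl_subset [OF d]
  obtain K0 where K0: "0 \<le> K0" "\<forall>t\<in>{0..d}. norm (fsol 0 t) \<le> K0"
    using bounded_on_compact_interval [OF continuous_on_subset [OF fsol_continuous sub]] by blast
  define K where "K = norm (prj 0) * K0"
  have K: "0 \<le> K" using K0 by (simp add: K_def)
  have zK: "norm (zs k t) \<le> K * norm k" if t: "t \<in> {0..d}" for k t
  proof -
    have "norm (zs k t) \<le> norm (prj 0) * norm (blinfun_apply (fsol 0 t) k)" by (rule norm_blinfun)
    also have "\<dots> \<le> norm (prj 0) * (norm (fsol 0 t) * norm k)" by (intro mult_left_mono norm_blinfun norm_ge_zero)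
    also have "\<dots> \<le> norm (prj 0) * (K0 * norm k)" using K0 t by (intro mult_left_mono mult_right_mono) auto
    finally show ?thesis by (simp add: K_def mult.assoc)
  qed
  have 1: "(\<lambda>t. if t \<le> d then zs k t else 0) \<in> L2 E" "l2_norm E (\<lambda>t. if t \<le> d then zs k t else 0) \<le> (K * norm k) * sqrt d" for k
    by (rule cut_continuous_L2 [OF d continuous_on_subset [OF zs_continuous sub]], erule zK, use K in simp)+
  show "(\<lambda>t. if t \<le> d then zs k t else 0) \<in> L2 E" by (rule 1(1))
  show "\<exists>K\<ge>0. \<forall>k. l2_norm E (\<lambda>t. if t \<le> d then zs k t else 0) \<le> K * norm k"
    using 1(2) K ivl_nonneg [OF d] by (intro exI [of _ "K * sqrt d"]) (simp add: mult_ac)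
qed

text \<open>A vector \<open>k\<close> is found whose solution has the same moments as
  \<open>g\<close> on [0, d]. Then \<open>f = g - zs k\<close>, cut off at \<open>d\<close>, is
  orthogonal to all solutions, so it steers 0 to 0 and is orthogonal to \<open>g\<close> as well;
  hence it is orthogonal to itself.\<close>

lemma orthogonal_to_controls:
  assumes d: "d \<in> ivl E" "0 < d" and g: "g \<in> L2 E"
    and orth: "\<And>Y f. f \<in> L2 E \<Longrightarrow> sys_solution Y f \<Longrightarrow> Y 0 = 0 \<Longrightarrow> (\<And>t. t \<in> ivl E \<Longrightarrow> d < t \<Longrightarrow> f t = 0) \<Longrightarrow>
      (\<And>t. t \<in> ivl E \<Longrightarrow> d \<le> t \<Longrightarrow> Y t = 0) \<Longrightarrow> l2_inner E f g = 0"
  shows "\<exists>k. AE t in leb E. t \<le> d \<longrightarrow> g t = zs k t"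
proof -
  define zc where "zc k t = (if t \<le> d then zs k t else 0)" for k t
  have zc: "zc k \<in> L2 E" for k unfolding zc_def by (rule zs_cut(1) [OF d(1)])
  obtain K where K: "0 \<le> K" "\<And>k. l2_norm E (zc k) \<le> K * norm k" using zs_cut(2) [OF d(1)] unfolding zc_def by blast
  have zclin: "zc (k + k') = (\<lambda>t. 1 *\<^sub>C zc k t + 1 *\<^sub>C zc k' t)" for k k'
    by (simp add: zc_def fun_eq_iff blinfun.add_right)
  have zcscale: "l2_inner E g (zc (c *\<^sub>C k)) = cnj c * l2_inner E g (zc k)" for c k
  proof -
    have "AE t in leb E. zc (c *\<^sub>C k) t = c *\<^sub>C zc k t"
      by (rule AE_I2) (simp add: zc_def fsol_clinear prj_clinear)
    then have "l2_inner E g (zc (c *\<^sub>C k)) = l2_inner E g (\<lambda>t. c *\<^sub>C zc k t)"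
      by (intro l2_inner_cong_AE g zc L2_scaleC) auto
    then show ?thesis using l2_inner_lincomb_right [OF zc zc g, of c k 0 k] by simp
  qed
  have "bounded_linear (\<lambda>k. l2_inner E g (zc k))"
  proof (rule bounded_linear_intro [where K = "l2_norm E g * K"])
    show "l2_inner E g (zc (k + k')) = l2_inner E g (zc k) + l2_inner E g (zc k')" for k k'
      unfolding zclin using l2_inner_lincomb_right [OF zc zc g, of 1 k 1 k'] by simp
    show "l2_inner E g (zc (r *\<^sub>R k)) = r *\<^sub>R l2_inner E g (zc k)" for r k
      using zcscale [of "of_real r" k] by (simp add: scaleR_scaleC scaleR_conv_of_real)
    show "norm (l2_inner E g (zc k)) \<le> norm k * (l2_norm E g * K)" for k
    proof -
      have "norm (l2_inner E g (zc k)) \<le> l2_norm E g * l2_norm E (zc k)" by (rule l2_cauchy_schwarz [OF g zc])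
      also have "\<dots> \<le> l2_norm E g * (K * norm k)" by (intro mult_left_mono K(2) l2_norm_nonneg)
      finally show ?thesis by (simp add: mult_ac)
    qed
  qed
  then have "\<exists>k. \<forall>k'. integral {0..d} (\<lambda>t. cinner (zs k t) (zs k' t)) = l2_inner E g (zc k')"
    by (rule gram_represents [OF d]) (simp add: zcscale)
  then obtain k where k: "\<And>k'. integral {0..d} (\<lambda>t. cinner (zs k t) (zs k' t)) = l2_inner E g (zc k')" by blast
  define gc where "gc t = (if t \<le> d then g t else 0)" for t
  have gc: "gc \<in> L2 E" unfolding gc_def by (rule cut_L2 [OF g])
  define f where "f t = gc t - zc k t" for t
  have f: "f \<in> L2 E" unfolding f_def by (rule L2_diff [OF gc zc])
  have f0: "f t = 0" if "t \<in> ivl E" "d < t" for t using that by (simp add: f_def gc_def zc_def)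
  have int: "l2_inner E f (zc k') = integral {0..d} (\<lambda>t. cinner (f t) (zs k' t))" for k'
  proof -
    have "l2_inner E f (zc k') = integral {0..d} (\<lambda>t. cinner (f t) (zc k' t))"
      by (rule l2_inner_eq_integral [OF d(1) f zc f0])
    also have "\<dots> = integral {0..d} (\<lambda>t. cinner (f t) (zs k' t))"
      by (rule integral_cong) (simp add: zc_def)
    finally show ?thesis .
  qed
  have fz: "l2_inner E f (zc k') = 0" for k'
  proof -
    have "l2_inner E (zc k) (zc k') = integral {0..d} (\<lambda>t. cinner (zc k t) (zc k' t))"
      by (rule l2_inner_eq_integral [OF d(1) zc zc]) (simp add: zc_def)
    also have "\<dots> = integral {0..d} (\<lambda>t. cinner (zs k t) (zs k' t))"
      by (rule integral_cong) (simp add: zc_def)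
    finally have 1: "l2_inner E (zc k) (zc k') = l2_inner E g (zc k')" by (simp add: k)
    have "l2_inner E gc (zc k') = l2_inner E g (zc k')"
      unfolding l2_inner_def by (intro Bochner_Integration.integral_cong) (simp_all add: gc_def zc_def)
    then show ?thesis
      using l2_inner_diff_left [OF gc zc zc, of 1 k k'] 1 by (simp add: f_def [abs_def])
  qed
  have orth0: "integral {0..d} (\<lambda>t. cinner (f t) (zs k' t)) = - bform 0 k'" for k'
    using fz [of k'] int [of k'] by (simp add: bform_def)
  have "\<exists>Y. sys_solution Y f \<and> Y 0 = 0 \<and> (\<forall>t\<in>ivl E. d \<le> t \<longrightarrow> Y t = 0)"
    by (rule controlled_solution [OF d(1) f f0 orth0])
  then obtain Y where Y: "sys_solution Y f" "Y 0 = 0" "\<And>t. t \<in> ivl E \<Longrightarrow> d \<le> t \<Longrightarrow> Y t = 0" by blast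
  have "l2_inner E f g = 0"
    by (rule orth [OF f Y(1,2)]) (rule f0 Y(3); assumption)+
  moreover have "l2_inner E f gc = l2_inner E f g"
    unfolding l2_inner_def by (intro Bochner_Integration.integral_cong) (auto simp: gc_def f_def zc_def)
  ultimately have "l2_inner E f f = 0"
    using l2_inner_diff_right [OF gc zc f, of 1 k] fz [of k] by (simp add: f_def [abs_def])
  then have "l2_norm E f = 0" by (simp add: l2_inner_self)
  then have "AE t in leb E. f t = 0" by (simp add: l2_norm_eq_zero_iff [OF f])
  then have "AE t in leb E. t \<le> d \<longrightarrow> g t = zs k t"
    by eventually_elim (auto simp: f_def gc_def zc_def split: if_splits)
  then show ?thesis by blast
qed

text \<open>Observability applied to the difference of the two initial vectors.\<close>

lemma zs_unique:
  assumes c: "c \<in> ivl E" "0 < c" and eq: "AE t in leb E. t \<le> c \<longrightarrow> zs k t = zs k' t"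
  shows "k = k'"
proof -
  obtain \<epsilon> where \<epsilon>: "0 < \<epsilon>" "\<And>k. \<epsilon> * (norm k)\<^sup>2 \<le> integral {0..c} (\<lambda>t. (norm (zs k t))\<^sup>2)"
    using observability [OF c] by blast
  obtain M where M: "negligible M" "\<And>t. t \<in> ivl E - M \<Longrightarrow> t \<le> c \<longrightarrow> zs k t = zs k' t"
    using eq unfolding AE_ivl by blast
  have "integral {0..c} (\<lambda>t. (norm (zs (k - k') t))\<^sup>2) = integral {0..c} (\<lambda>t. 0)"
  proof (rule integral_spike [OF M(1)])
    fix t assume "t \<in> {0..c} - M"
    then have "zs k t = zs k' t" using M(2) [of t] ivl_subset [OF c(1)] by auto
    then show "0 = (norm (zs (k - k') t))\<^sup>2" by (simp add: blinfun.diff_right)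
  qed
  then have "\<epsilon> * (norm (k - k'))\<^sup>2 \<le> 0" using \<epsilon>(2) [of "k - k'"] by simp
  then show ?thesis using \<epsilon>(1) by (simp add: mult_le_0_iff)
qed

text \<open>Rational bounds below the endpoint form a countable exhaustion, so the exceptional sets
  combine to a null set; an endpoint belonging to the interval is added to it.\<close>

lemma AE_exhaustion:
  assumes c: "c \<in> ivl E" "ereal c < endpt E"
    and P: "\<And>d. d \<in> ivl E \<Longrightarrow> c \<le> d \<Longrightarrow> ereal d < endpt E \<Longrightarrow> AE t in leb E. t \<le> d \<longrightarrow> P t"
  shows "AE t in leb E. P t"
proof -
  define Q where "Q r = (c \<le> of_rat r \<and> ereal (of_rat r) < endpt E)" for r :: rat
  have "AE t in leb E. Q r \<longrightarrow> t \<le> of_rat r \<longrightarrow> P t" for r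
  proof (cases "Q r")
    case True
    then have r: "c \<le> of_rat r" "ereal (of_rat r) < endpt E" by (auto simp: Q_def)
    have "0 \<le> (of_rat r :: real)" using r(1) ivl_nonneg [OF c(1)] by linarith
    then have "of_rat r \<in> ivl E" using ivl_cases(2) r(2) by (elim disjE) (simp_all add: less_imp_le)
    from P [OF this r] show ?thesis by (rule eventually_mono) simp
  qed simp
  then have "AE t in leb E. \<forall>r. Q r \<longrightarrow> t \<le> of_rat r \<longrightarrow> P t" by (simp add: AE_all_countable)
  then obtain M where M: "negligible M" "\<And>t. t \<in> ivl E - M \<Longrightarrow> \<forall>r. Q r \<longrightarrow> t \<le> of_rat r \<longrightarrow> P t"
    unfolding AE_ivl by blast
  have "P t" if t: "t \<in> ivl E - (M \<union> {real_of_ereal (endpt E)})" for t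
  proof -
    have "ereal t \<noteq> endpt E"
    proof
      assume "ereal t = endpt E"
      then have "real_of_ereal (endpt E) = t" by (simp add: eq_commute [of _ "endpt E"])
      then show False using t by blast
    qed
    then have "ereal t < endpt E" using t ivl_cases(2) by auto
    then have "ereal (max t c) < endpt E" using c(2) by (simp add: max_def)
    then obtain x where x: "ereal (max t c) < ereal x" "ereal x < endpt E"
      using ereal_dense2 by blast
    then obtain r where r: "max t c < of_rat r" "of_rat r < x"
      using of_rat_dense [of "max t c" x] by auto
    then have "ereal (of_rat r) < endpt E" using x(2) by (meson less_ereal.simps(1) less_trans)
    then have "Q r" using r by (simp add: Q_def)
    then show ?thesis using M(2) [of t] t r by auto
  qed
  then show ?thesis unfolding AE_ivl using M(1) by (intro exI [of _ "M \<union> {real_of_ereal (endpt E)}"]) auto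
qed

lemma sys_solution_add_fsol:
  assumes "sys_solution Y f"
  shows "sys_solution (\<lambda>t. Y t + blinfun_apply (fsol 0 t) k) f"
proof -
  obtain M1 where M1: "negligible M1" "\<And>t. t \<in> ivl E - M1 \<Longrightarrow>
      (Y has_vector_derivative blinfun_apply (sysA t) (Y t) - blinfun_apply J (f t)) (at t within ivl E)"
    using assms unfolding sys_solution_def by blast
  have ac: "abs_continuous_on 0 d Y" "abs_continuous_on 0 d (\<lambda>t. blinfun_apply (fsol 0 t) k)" if "d \<in> ivl E" for d
    using assms sys_solution_zs [of k] that unfolding sys_solution_def by blast+
  show ?thesis
    unfolding sys_solution_def
  proof (intro conjI ballI exI [of _ M1] M1(1))
    fix t assume t: "t \<in> ivl E - M1"
    then have "((\<lambda>t. blinfun_apply (fsol 0 t) k) has_vector_derivative blinfun_apply (sysA t) (blinfun_apply (fsol 0 t) k)) (at t within ivl E)"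
      using fsol_apply_derivative [of t 0 k] by (simp add: sysZ_apply)
    from has_vector_derivative_add [OF M1(2) [OF t] this]
    show "((\<lambda>t. Y t + blinfun_apply (fsol 0 t) k) has_vector_derivative
        blinfun_apply (sysA t) (Y t + blinfun_apply (fsol 0 t) k) - blinfun_apply J (f t)) (at t within ivl E)"
      by (simp add: blinfun.add_right algebra_simps)
  qed (intro abs_continuous_on_add ac)
qed

lemma snd_st: "snd (st y t) = bv2 E y t" and fst_st: "fst (st y t) = bv1 E y t"
  by (simp_all add: st_def)

text \<open>For \<open>(z, w)\<close> in the adjoint, \<open>z\<close> minus the solution
  \<open>Z0\<close> for the right side \<open>w\<close> is orthogonal to all controls between zero
  states, so it is a solution of the homogeneous equation. Thus \<open>z\<close> belongs to the
  maximal domain with \<open>l[z] = w\<close>, and only the boundary condition at 0 remains.\<close>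

theorem A_zero_selfadjoint:
  assumes defect: "\<And>y z. y \<in> maxdom E \<Longrightarrow> z \<in> maxdom E \<Longrightarrow> boundary_defect y z = 0"
  shows "l2_selfadjoint E (L_restr E {y \<in> maxdom E. bv2 E y 0 = (0 :: ('h, 'n) vec)})"
proof -
  define A where "A = L_restr E {y \<in> maxdom E. bv2 E y 0 = (0 :: ('h, 'n) vec)}"
  have AI: "(y, l_expr E y) \<in> A" if "y \<in> maxdom E" "snd (st y 0) = 0" for y
    using that maxdom_L2 [OF that(1)] by (auto simp: A_def L_restr_def snd_st)
  have "l2_adjoint E A \<subseteq> A"
  proof clarify
    fix z w assume zw: "(z, w) \<in> l2_adjoint E A"
    then have z: "z \<in> L2 E" and w: "w \<in> L2 E" and adj: "\<And>u f. (u, f) \<in> A \<Longrightarrow> l2_inner E f z = l2_inner E u w"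
      by (auto simp: l2_adjoint_def)
    obtain c C where c: "c \<in> ivl E" "0 < c" "ereal c < endpt E"
      and lift: "\<And>h. \<exists>y\<in>maxdom E. st y 0 = h \<and> (\<forall>t\<in>ivl E. c \<le> t \<longrightarrow> st y t = 0) \<and>
        l2_norm E y \<le> C * norm h \<and> l2_norm E (l_expr E y) \<le> C * norm h"
      by (rule lift_exists) blast
    obtain Z0 where Z0: "sys_solution Z0 w" "Z0 0 = 0" using sys_solution_exists [OF w] by blast
    note Z0c = sys_solution_continuous [OF Z0(1)]
    \<comment> \<open>The argument is local because \<open>Z0\<close> need not be square integrable
      up to the endpoint; it is cut off at \<open>d\<close> instead.\<close>
    have loc: "\<exists>k. AE t in leb E. t \<le> d \<longrightarrow> z t = prj0 (Z0 t) + zs k t" if d: "d \<in> ivl E" "c \<le> d" for d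
    proof -
      have d0: "0 < d" using c d by simp
      have zc: "continuous_on {0..d} (\<lambda>t. prj0 (Z0 t))"
        by (intro continuous_intros continuous_on_subset [OF Z0c ivl_subset [OF d(1)]])
      obtain B where B: "0 \<le> B" "\<forall>t\<in>{0..d}. norm (prj0 (Z0 t)) \<le> B" using bounded_on_compact_interval [OF zc] by blast
      define z0 where "z0 t = (if t \<le> d then prj0 (Z0 t) else 0)" for t
      have z0: "z0 \<in> L2 E" unfolding z0_def by (rule cut_continuous_L2(1) [OF d(1) zc _ B(1)]) (use B(2) in blast)
      have "\<exists>k. AE t in leb E. t \<le> d \<longrightarrow> z t - z0 t = zs k t"
      proof (rule orthogonal_to_controls [OF d(1) d0 L2_diff [OF z z0]])
        fix Y f
        assume f: "f \<in> L2 E" and Y: "sys_solution Y f" "Y 0 = 0" and f0: "\<And>t. t \<in> ivl E \<Longrightarrow> d < t \<Longrightarrow> f t = 0"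
          and Y0: "\<And>t. t \<in> ivl E \<Longrightarrow> d \<le> t \<Longrightarrow> Y t = 0"
        have pc: "continuous_on {0..d} (\<lambda>t. prj0 (Y t))"
          by (intro continuous_intros continuous_on_subset [OF sys_solution_continuous [OF Y(1)] ivl_subset [OF d(1)]])
        obtain B' where B': "0 \<le> B'" "\<forall>t\<in>{0..d}. norm (prj0 (Y t)) \<le> B'" using bounded_on_compact_interval [OF pc] by blast
        have pY0: "prj0 (Y t) = 0" if "t \<in> ivl E" "d < t" for t using Y0 [of t] that by simp
        have pL: "(\<lambda>t. prj0 (Y t)) \<in> L2 E"
          by (rule L2_of_continuous_support(1) [OF pc d(1) pY0 _ B'(1)]) (assumption | use B'(2) in blast)+
        define y where "y t = (if t \<in> ivl E then prj0 (Y t) else 0)" for t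
        note y = maxdom_of_sys_solution [OF Y(1) f pL, folded y_def]
        have yA: "(y, l_expr E y) \<in> A" by (rule AI [OF y(1)]) (simp add: y(2) [OF zero_in_ivl] Y)
        have "l2_inner E f z = l2_inner E (l_expr E y) z"
          by (rule l2_inner_cong_left) (use y(3) f z maxdom_L2 [OF y(1)] in \<open>auto elim: eventually_mono\<close>)
        also have "\<dots> = l2_inner E y w" by (rule adj [OF yA])
        also have "\<dots> = l2_inner E (\<lambda>t. prj0 (Y t)) w"
          by (rule l2_inner_cong_left) (auto intro!: AE_I2 simp: y_def [symmetric] w pL maxdom_L2 [OF y(1)], simp add: y_def)
        also have "\<dots> = integral {0..d} (\<lambda>t. cinner (prj0 (Y t)) (w t))"
          by (rule l2_inner_eq_integral [OF d(1) pL w pY0])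
        finally have 1: "l2_inner E f z = integral {0..d} (\<lambda>t. cinner (prj0 (Y t)) (w t))" .
        have 2: "l2_inner E f z0 = integral {0..d} (\<lambda>t. cinner (f t) (prj0 (Z0 t)))"
        proof -
          have "l2_inner E f z0 = integral {0..d} (\<lambda>t. cinner (f t) (z0 t))"
            by (rule l2_inner_eq_integral [OF d(1) f z0 f0])
          also have "\<dots> = integral {0..d} (\<lambda>t. cinner (f t) (prj0 (Z0 t)))"
            by (rule integral_cong) (simp add: z0_def)
          finally show ?thesis .
        qed
        have i1: "(\<lambda>t. cinner (f t) (prj0 (Z0 t))) integrable_on {0..d}"
        proof -
          have "(\<lambda>t. cinner (f t) (z0 t)) integrable_on {0..d}"
            by (rule integrable_on_lebesgue_on [OF integrable_lebesgue_on_subinterval(1) [OF integrable_cinner [OF f z0] d(1)]]) simp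
          then show ?thesis by (rule integrable_eq) (simp add: z0_def)
        qed
        have i2: "(\<lambda>t. cinner (prj0 (Y t)) (w t)) integrable_on {0..d}"
          by (rule integrable_on_lebesgue_on [OF integrable_lebesgue_on_subinterval(1) [OF integrable_cinner [OF pL w] d(1)]]) simp
        have "((\<lambda>t. cinner (f t) (prj0 (Z0 t)) - cinner (prj0 (Y t)) (w t)) has_integral 0) {0..d}"
          using green_local [OF Y(1) Z0(1) d(1)] Y0 [OF d(1)] Y(2) by (simp add: bform_def)
        then have "integral {0..d} (\<lambda>t. cinner (f t) (prj0 (Z0 t))) - integral {0..d} (\<lambda>t. cinner (prj0 (Y t)) (w t)) = 0"
          using Henstock_Kurzweil_Integration.integral_diff [OF i1 i2] by (simp add: integral_unique)
        then show "l2_inner E f (\<lambda>t. z t - z0 t) = 0"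
          using 1 2 l2_inner_diff_right [OF z z0 f, of 1] by simp
      qed
      then obtain k where k: "AE t in leb E. t \<le> d \<longrightarrow> z t - z0 t = zs k t" by blast
      have "AE t in leb E. t \<le> d \<longrightarrow> z t = prj0 (Z0 t) + zs k t"
        using k by eventually_elim (auto simp: z0_def algebra_simps)
      then show ?thesis by blast
    qed
    obtain k where k: "AE t in leb E. t \<le> c \<longrightarrow> z t = prj0 (Z0 t) + zs k t" using loc [OF c(1) order_refl] by blast
    \<comment> \<open>Solutions for different \<open>d\<close> agree almost everywhere on [0, c] and
      so have the same initial vector; the one found for \<open>c\<close> serves everywhere.\<close>
    have zAE: "AE t in leb E. z t = prj0 (Z0 t) + zs k t"
    proof (rule AE_exhaustion [OF c(1,3)])
      fix d assume d: "d \<in> ivl E" "c \<le> d"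
      obtain k' where k': "AE t in leb E. t \<le> d \<longrightarrow> z t = prj0 (Z0 t) + zs k' t" using loc [OF d] by blast
      have "AE t in leb E. t \<le> c \<longrightarrow> zs k t = zs k' t"
        using k k' by eventually_elim (use d(2) in auto)
      then have "k = k'" by (rule zs_unique [OF c(1,2)])
      then show "AE t in leb E. t \<le> d \<longrightarrow> z t = prj0 (Z0 t) + zs k t" using k' by simp
    qed
    define Z where "Z t = Z0 t + blinfun_apply (fsol 0 t) k" for t
    have sZ: "sys_solution Z w" unfolding Z_def by (rule sys_solution_add_fsol [OF Z0(1)])
    have pZ: "AE t in leb E. z t = prj0 (Z t)" using zAE by eventually_elim (simp add: Z_def blinfun.add_right)
    obtain M where M: "negligible M" "\<And>t. t \<in> ivl E - M \<Longrightarrow> z t = prj0 (Z t)" using pZ unfolding AE_ivl by blast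
    have ZL: "(\<lambda>t. prj0 (Z t)) \<in> L2 E"
    proof (rule L2_cong_AE [OF z _ pZ])
      show "(\<lambda>t. prj0 (Z t)) \<in> borel_measurable (leb E)"
        by (rule measurable_lebesgue_on_spike [OF ivl_sets L2_measurable [OF z] M(1)]) (simp add: M(2))
    qed
    define y where "y t = (if t \<in> ivl E then prj0 (Z t) else 0)" for t
    note y = maxdom_of_sys_solution [OF sZ w ZL, folded y_def]
    have zy: "AE t in leb E. z t = y t"
      unfolding AE_ivl using M by (intro exI [of _ M]) (auto simp: y_def)
    have wy: "AE t in leb E. w t = l_expr E y t" using y(3) by (auto elim: eventually_mono)
    have "snd (st y 0) = 0"
    proof -
      \<comment> \<open>This \<open>x\<close> satisfies the boundary condition of \<open>A\<close>,
        and \<open>bform (st x 0) (st y 0)\<close> is the squared norm of the second part of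
        \<open>st y 0\<close>.\<close>
      obtain x where x: "x \<in> maxdom E" "st x 0 = (snd (st y 0), 0)" using lift by blast
      have "l2_inner E (l_expr E x) z = l2_inner E x w" by (rule adj [OF AI [OF x(1)]]) (simp add: x(2))
      moreover have "l2_inner E (l_expr E x) z = l2_inner E (l_expr E x) y"
        by (rule l2_inner_cong_AE) (use zy z maxdom_L2 [OF x(1)] maxdom_L2 [OF y(1)] in auto)
      moreover have "l2_inner E x w = l2_inner E x (l_expr E y)"
        by (rule l2_inner_cong_AE) (use wy w maxdom_L2 [OF x(1)] maxdom_L2 [OF y(1)] in auto)
      ultimately have "bform (st x 0) (st y 0) = 0"
        using defect [OF x(1) y(1)] by (simp add: boundary_defect_def)
      then show ?thesis by (simp add: bform_def x(2) cinner_self)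
    qed
    then show "(z, w) \<in> A"
      unfolding A_def L_restr_def using z w zy wy y(1) by (auto simp: snd_st intro!: bexI [of _ y])
  qed
  moreover have "A \<subseteq> l2_adjoint E A"
  proof clarify
    fix u f assume uf: "(u, f) \<in> A"
    then obtain y where y: "y \<in> maxdom E" "snd (st y 0) = 0" "AE t in leb E. u t = y t" "AE t in leb E. f t = l_expr E y t"
      and ufL: "u \<in> L2 E" "f \<in> L2 E" by (auto simp: A_def L_restr_def snd_st)
    have "l2_inner E g u = l2_inner E v f" if vg: "(v, g) \<in> A" for v g
    proof -
      obtain x where x: "x \<in> maxdom E" "snd (st x 0) = 0" "AE t in leb E. v t = x t" "AE t in leb E. g t = l_expr E x t"
        and vgL: "v \<in> L2 E" "g \<in> L2 E" using vg by (auto simp: A_def L_restr_def snd_st)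
      have "l2_inner E g u = l2_inner E (l_expr E x) y"
        by (rule l2_inner_cong_AE [OF x(4) y(3)]) (use ufL vgL maxdom_L2 [OF x(1)] maxdom_L2 [OF y(1)] in auto)
      also have "\<dots> = l2_inner E x (l_expr E y)"
        using defect [OF x(1) y(1)] x(2) y(2) by (simp add: boundary_defect_def bform_def)
      also have "\<dots> = l2_inner E v f"
        by (rule l2_inner_cong_AE [symmetric, OF x(3) y(4)]) (use ufL vgL maxdom_L2 [OF x(1)] maxdom_L2 [OF y(1)] in auto)
      finally show ?thesis .
    qed
    then show "(u, f) \<in> l2_adjoint E A" using ufL by (auto simp: l2_adjoint_def)
  qed
  ultimately show ?thesis unfolding l2_selfadjoint_def A_def by blast
qed

end

section \<open>Operator solutions\<close>

lemma column_apply: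
  fixes A :: "'n :: finite \<Rightarrow> 'k :: complex_normed_vector \<Rightarrow>\<^sub>L 'h :: complex_normed_vector"
  shows "blinfun_apply (column A) x = (\<chi> i. blinfun_apply (A i) x)"
proof -
  have "bounded_linear (\<lambda>x. \<chi> i. blinfun_apply (A i) x)"
  proof (rule bounded_linear_intro [where K = "\<Sum>i\<in>UNIV. norm (A i)"])
    fix x
    have "norm (\<chi> i. blinfun_apply (A i) x) \<le> (\<Sum>i\<in>UNIV. norm ((\<chi> i. blinfun_apply (A i) x) $ i))"
      unfolding norm_vec_def by (rule L2_set_le_sum) simp
    also have "\<dots> \<le> (\<Sum>i\<in>UNIV. norm (A i) * norm x)" by (rule sum_mono) (simp add: norm_blinfun)
    finally show "norm (\<chi> i. blinfun_apply (A i) x) \<le> norm x * (\<Sum>i\<in>UNIV. norm (A i))"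
      by (simp add: sum_distrib_left mult.commute)
  qed (auto simp: vec_eq_iff blinfun.add_right blinfun.scaleR_right)
  then show ?thesis unfolding column_def by (simp add: bounded_linear_Blinfun_apply)
qed

context regular_expr
begin

lemma L2_cong_ivl:
  assumes f: "f \<in> L2 E" and eq: "\<And>t. t \<in> ivl E \<Longrightarrow> g t = f t"
  shows "g \<in> L2 E"
proof (rule L2_cong_AE [OF f])
  show "g \<in> borel_measurable (leb E)"
    by (rule measurable_lebesgue_on_spike [OF ivl_sets L2_measurable [OF f] negligible_empty]) (simp add: eq)
  show "AE t in leb E. f t = g t" by (rule AE_I2) (simp add: eq)
qed

text \<open>The operator solution with initial state \<open>K\<close>; the domain \<open>'k\<close>
  of \<open>K\<close> is left free so that the same construction gives \<open>c_sol\<close>,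
  \<open>s_sol\<close> and the square integrable solution.\<close>

definition osol :: "complex \<Rightarrow> ('k :: complex_normed_vector \<Rightarrow>\<^sub>L ('h, 'n) state) \<Rightarrow> real \<Rightarrow> 'k \<Rightarrow>\<^sub>L 'h" where
  "osol \<zeta> K t = (if t \<in> ivl E then prj 0 o\<^sub>L (fsol \<zeta> t o\<^sub>L K) else 0)"

lemma op_solution_osol:
  assumes K: "clinear_op K"
  shows "op_solution E \<zeta> (osol \<zeta> K)"
    and "k < 2 * n \<Longrightarrow> t \<in> ivl E \<Longrightarrow> op_qd E k (osol \<zeta> K) t = prj k o\<^sub>L (fsol \<zeta> t o\<^sub>L K)"
proof -
  define U where "U t = fsol \<zeta> t o\<^sub>L K" for t
  define x where "x k t = (if t \<in> ivl E then prj k o\<^sub>L U t else 0)" for k t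
  have x0: "osol \<zeta> K = x 0" by (simp add: osol_def x_def U_def fun_eq_iff)
  have xd: "(x k has_vector_derivative prj k o\<^sub>L (sysZ \<zeta> t o\<^sub>L U t)) (at t within ivl E)" if t: "t \<in> ivl E" for k t
  proof -
    have "(U has_vector_derivative (sysZ \<zeta> t o\<^sub>L fsol \<zeta> t) o\<^sub>L K) (at t within ivl E)"
      unfolding U_def [abs_def]
      by (rule bounded_linear.has_vector_derivative [OF bounded_bilinear.bounded_linear_left [OF bounded_bilinear_blinfun_compose] fsol_derivative [OF t]])
    then have "((\<lambda>t. prj k o\<^sub>L U t) has_vector_derivative prj k o\<^sub>L ((sysZ \<zeta> t o\<^sub>L fsol \<zeta> t) o\<^sub>L K)) (at t within ivl E)"
      by (rule bounded_linear.has_vector_derivative [OF bounded_bilinear.bounded_linear_right [OF bounded_bilinear_blinfun_compose]])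
    also have "prj k o\<^sub>L ((sysZ \<zeta> t o\<^sub>L fsol \<zeta> t) o\<^sub>L K) = prj k o\<^sub>L (sysZ \<zeta> t o\<^sub>L U t)"
      by (rule blinfun_eqI) (simp add: U_def)
    finally show ?thesis
      by (subst has_vector_derivative_cong_ivl [where g = "\<lambda>t. prj k o\<^sub>L U t"]) (use t in \<open>simp_all add: x_def\<close>)
  qed
  have sys: "prj k o\<^sub>L (sysZ \<zeta> t o\<^sub>L U t) = rhs (o\<^sub>L) t k ((\<lambda>i. x i t)(2 * n := \<zeta> *\<^sub>C x 0 t))"
    if t: "t \<in> ivl E" and k: "k < 2 * n" for k t
  proof (rule blinfun_eqI)
    fix v
    have "blinfun_apply (prj k o\<^sub>L (sysZ \<zeta> t o\<^sub>L U t)) v = rhs blinfun_apply t k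
        ((\<lambda>i. blinfun_apply (prj i) (blinfun_apply (U t) v))(2 * n := \<zeta> *\<^sub>C prj0 (blinfun_apply (U t) v)))"
      by (simp add: sysZ_apply prj_system [OF k])
    also have "\<dots> = rhs blinfun_apply t k (\<lambda>i. blinfun_apply (((\<lambda>i. x i t)(2 * n := \<zeta> *\<^sub>C x 0 t)) i) v)"
      by (rule rhs_cong [OF _ k]) (simp add: x_def t)
    finally show "blinfun_apply (prj k o\<^sub>L (sysZ \<zeta> t o\<^sub>L U t)) v =
        blinfun_apply (rhs (o\<^sub>L) t k ((\<lambda>i. x i t)(2 * n := \<zeta> *\<^sub>C x 0 t))) v"
      by (simp add: rhs_apply)
  qed
  have xder: "(x k has_vector_derivative rhs (o\<^sub>L) t k (\<lambda>i. x i t)) (at t within ivl E)"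
    if k: "Suc k < 2 * n" and t: "t \<in> ivl E" for k t
  proof -
    have "rhs (o\<^sub>L) t k ((\<lambda>i. x i t)(2 * n := \<zeta> *\<^sub>C x 0 t)) = rhs (o\<^sub>L) t k (\<lambda>i. x i t)"
      by (rule rhs_cong_less [OF _ k]) simp
    then show ?thesis using xd [OF t, of k] sys [OF t, of k] k by simp
  qed
  have qx: "op_qd E k (x 0) t = x k t" if "k < 2 * n" "t \<in> ivl E" for k t
    by (rule quasi_of_system [OF action_compose xder that])
  show "k < 2 * n \<Longrightarrow> t \<in> ivl E \<Longrightarrow> op_qd E k (osol \<zeta> K) t = prj k o\<^sub>L (fsol \<zeta> t o\<^sub>L K)"
    unfolding x0 using qx by (simp add: x_def U_def)
  show "op_solution E \<zeta> (osol \<zeta> K)"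
    unfolding op_solution_def x0
  proof (intro conjI allI impI ballI)
    show "x 0 t = 0" if "t \<notin> ivl E" for t using that by (simp add: x_def)
    show "clinear_op (x 0 t)" if "t \<in> ivl E" for t
      unfolding clinear_op_def using that by (simp add: x_def U_def clinear_op_scaleC [OF K] fsol_clinear prj_clinear)
    show "C1 E (op_qd E k (x 0))" if "k \<le> 2 * n - 1" for k
    proof -
      have k: "k < 2 * n" using that n_pos by simp
      have d: "(op_qd E k (x 0) has_vector_derivative prj k o\<^sub>L (sysZ \<zeta> t o\<^sub>L U t)) (at t within ivl E)" if t: "t \<in> ivl E" for t
        by (subst has_vector_derivative_cong_ivl [where g = "x k"]) (use qx k xd t in simp_all)
      have "continuous_on (ivl E) (\<lambda>t. prj k o\<^sub>L (sysZ \<zeta> t o\<^sub>L U t))"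
        unfolding U_def
        by (intro bounded_bilinear.continuous_on [OF bounded_bilinear_blinfun_compose] continuous_on_const sysZ_continuous fsol_continuous)
      moreover have "ddt E (op_qd E k (x 0)) t = prj k o\<^sub>L (sysZ \<zeta> t o\<^sub>L U t)" if "t \<in> ivl E" for t
        by (rule ddt_eqI [OF valid that d [OF that]])
      ultimately have "continuous_on (ivl E) (ddt E (op_qd E k (x 0)))" by (simp cong: continuous_on_cong)
      then show ?thesis using d unfolding C1_def by (blast intro: differentiableI_vector)
    qed
    show "op_qd E (2 * n) (x 0) t = \<zeta> *\<^sub>C x 0 t" if t: "t \<in> ivl E" for t
    proof (rule quasi_last_of_system [OF action_compose xder t])
      have "rhs (o\<^sub>L) t (2 * n - 1) ((\<lambda>i. x i t)(2 * n := \<zeta> *\<^sub>C x 0 t)) =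
          rhs (o\<^sub>L) t (2 * n - 1) ((\<lambda>i. x i t)(2 * n := 0)) - \<zeta> *\<^sub>C x 0 t"
        using rhs_last [of "(o\<^sub>L)" t "(\<lambda>i. x i t)(2 * n := \<zeta> *\<^sub>C x 0 t)"] by simp
      then show "(x (2 * n - 1) has_vector_derivative rhs (o\<^sub>L) t (2 * n - 1) ((\<lambda>i. x i t)(2 * n := 0)) - \<zeta> *\<^sub>C x 0 t) (at t within ivl E)"
        using xd [OF t, of "2 * n - 1"] sys [OF t, of "2 * n - 1"] n_pos by simp
    qed
  qed
qed

lemma op_bv_apply:
  "blinfun_apply (op_bv1 E Y t :: 'k :: complex_normed_vector \<Rightarrow>\<^sub>L ('h, 'n) vec) v = (\<chi> i. blinfun_apply (op_qd E (pos_of i) Y t) v)"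
  "blinfun_apply (op_bv2 E Y t :: 'k \<Rightarrow>\<^sub>L ('h, 'n) vec) v = (\<chi> i. blinfun_apply (op_qd E (2 * n - 1 - pos_of i) Y t) v)"
  by (simp_all add: op_bv1_def op_bv2_def column_apply)

lemma op_bv_osol:
  assumes K: "clinear_op K"
  shows "blinfun_apply (op_bv1 E (osol \<zeta> K) 0) v = fst (blinfun_apply K v)"
    "blinfun_apply (op_bv2 E (osol \<zeta> K) 0) v = snd (blinfun_apply K v)"
proof -
  have q: "blinfun_apply (op_qd E k (osol \<zeta> K) 0) v = blinfun_apply (prj k) (blinfun_apply K v)" if "k < 2 * n" for k
    using op_solution_osol(2) [OF K that zero_in_ivl, of \<zeta>] by simp
  have p: "pos_of i < 2 * n" "2 * n - 1 - pos_of i < 2 * n" "(2 * n - 1 - pos_of i < n) = False"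
    "2 * n - 1 - (2 * n - 1 - pos_of i) = pos_of i" for i :: 'n
    using pos_of_less [of i] by auto
  show "blinfun_apply (op_bv1 E (osol \<zeta> K) 0) v = fst (blinfun_apply K v)"
    "blinfun_apply (op_bv2 E (osol \<zeta> K) 0) v = snd (blinfun_apply K v)"
    unfolding op_bv_apply vec_eq_iff using pos_of_less p(3,4)
    by (simp_all only: q p(1,2) prj_apply if_True if_False vec_lambda_beta idx_pos simp_thms)
qed

text \<open>Applied to a fixed vector, \<open>Y\<close> yields a state whose components are
  differentiable everywhere; it solves the homogeneous system, so it is the fundamental solution
  applied to its initial value.\<close>

lemma op_solution_eq:
  fixes Y :: "real \<Rightarrow> 'k :: complex_normed_vector \<Rightarrow>\<^sub>L 'h"
  assumes Y: "op_solution E \<zeta> Y" and t: "t \<in> ivl E"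
  shows "blinfun_apply (Y t) v = prj0 (blinfun_apply (fsol \<zeta> t) (blinfun_apply (op_bv1 E Y 0) v, blinfun_apply (op_bv2 E Y 0) v))"
proof -
  define S where "S t = (\<Sum>k<2 * n. blinfun_apply (inc k) (blinfun_apply (op_qd E k Y t) v))" for t
  have pS: "blinfun_apply (prj k) (S t) = blinfun_apply (op_qd E k Y t) v" if "k < 2 * n" for k t
    unfolding S_def by (rule prj_sum_inc [OF that])
  have "S t = blinfun_apply (fsol \<zeta> t) (S 0)"
  proof (rule fsol_unique [OF _ t])
    fix t assume t: "t \<in> ivl E"
    have "(op_qd E k Y has_vector_derivative ddt E (op_qd E k Y) t) (at t within ivl E)" if "k < 2 * n" for k
      using Y t that unfolding op_solution_def C1_def by (intro has_vector_derivative_ddt) auto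
    then have d: "((\<lambda>t. blinfun_apply (op_qd E k Y t) v) has_vector_derivative blinfun_apply (ddt E (op_qd E k Y) t) v) (at t within ivl E)"
      if "k < 2 * n" for k
      using that by (intro bounded_linear.has_vector_derivative [OF blinfun.bounded_linear_left])
    have "(S has_vector_derivative (\<Sum>k<2 * n. blinfun_apply (inc k) (blinfun_apply (ddt E (op_qd E k Y) t) v))) (at t within ivl E)"
      unfolding S_def [abs_def]
      by (intro has_vector_derivative_sum bounded_linear.has_vector_derivative [OF blinfun.bounded_linear_right] d) simp
    also have "(\<Sum>k<2 * n. blinfun_apply (inc k) (blinfun_apply (ddt E (op_qd E k Y) t) v)) = blinfun_apply (sysZ \<zeta> t) (S t)"
    proof (rule state_eqI)
      fix k assume k: "k < 2 * n"
      have l: "op_qd E (2 * n) Y t = \<zeta> *\<^sub>C Y t" using Y t by (simp add: op_solution_def)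
      have y: "op_qd E 0 Y t = Y t" using n_pos by (simp add: quasi_def)
      have "blinfun_apply (prj k) (\<Sum>k<2 * n. blinfun_apply (inc k) (blinfun_apply (ddt E (op_qd E k Y) t) v)) =
          rhs blinfun_apply t k (\<lambda>i. blinfun_apply (op_qd E i Y t) v)"
        using ddt_quasi [OF action_compose t k, of Y] by (simp add: prj_sum_inc k rhs_apply)
      also have "\<dots> = rhs blinfun_apply t k ((\<lambda>i. blinfun_apply (prj i) (S t))(2 * n := \<zeta> *\<^sub>C prj0 (S t)))"
        using n_pos by (intro rhs_cong [OF _ k]) (auto simp: pS l y)
      also have "\<dots> = blinfun_apply (prj k) (blinfun_apply (sysZ \<zeta> t) (S t))"
        by (simp add: sysZ_apply prj_system [OF k])
      finally show "blinfun_apply (prj k) (\<Sum>k<2 * n. blinfun_apply (inc k) (blinfun_apply (ddt E (op_qd E k Y) t) v)) =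
          blinfun_apply (prj k) (blinfun_apply (sysZ \<zeta> t) (S t))" .
    qed
    finally show "(S has_vector_derivative blinfun_apply (sysZ \<zeta> t) (S t)) (at t within ivl E)" .
  qed
  moreover have "S 0 = (blinfun_apply (op_bv1 E Y 0) v, blinfun_apply (op_bv2 E Y 0) v)"
    by (rule state_eqI, subst pS) (auto simp: prj_apply op_bv_apply)
  moreover have "blinfun_apply (Y t) v = prj0 (S t)" using n_pos by (simp add: pS quasi_def)
  ultimately show ?thesis by simp
qed

lemma op_solution_unique:
  fixes Y Z :: "real \<Rightarrow> 'k :: complex_normed_vector \<Rightarrow>\<^sub>L 'h"
  assumes Y: "op_solution E \<zeta> Y" and Z: "op_solution E \<zeta> Z"
    and "op_bv1 E Y 0 = (op_bv1 E Z 0 :: 'k \<Rightarrow>\<^sub>L ('h, 'n) vec)" "op_bv2 E Y 0 = (op_bv2 E Z 0 :: 'k \<Rightarrow>\<^sub>L ('h, 'n) vec)"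
  shows "Y = Z"
proof
  fix t
  show "Y t = Z t"
  proof (cases "t \<in> ivl E")
    case True
    show ?thesis by (rule blinfun_eqI) (simp add: op_solution_eq [OF Y True] op_solution_eq [OF Z True] assms(3,4))
  next
    case False
    then show ?thesis using Y Z by (simp add: op_solution_def)
  qed
qed

text \<open>Existence by \<open>osol\<close> and uniqueness by the initial operators give the
  definite descriptions behind \<open>c_sol\<close> and \<open>s_sol\<close> their meaning.\<close>

lemma THE_op_solution:
  fixes A B :: "'k :: complex_normed_vector \<Rightarrow>\<^sub>L ('h, 'n) vec"
  assumes A: "clinear_op A" and B: "clinear_op B" and t: "t \<in> ivl E"
  shows "blinfun_apply ((THE Y. op_solution E \<zeta> Y \<and> op_bv1 E Y 0 = A \<and> op_bv2 E Y 0 = B) t) v =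
    prj0 (blinfun_apply (fsol \<zeta> t) (blinfun_apply A v, blinfun_apply B v))"
proof -
  define K where "K = Blinfun (\<lambda>v. (blinfun_apply A v, blinfun_apply B v))"
  have K: "blinfun_apply K v = (blinfun_apply A v, blinfun_apply B v)" for v
    unfolding K_def by (subst bounded_linear_Blinfun_apply) (intro bounded_linear_Pair blinfun.bounded_linear_right, rule refl)
  have Kc: "clinear_op K"
    unfolding clinear_op_def by (simp add: K scaleC_prod_def clinear_op_scaleC [OF A] clinear_op_scaleC [OF B])
  have "(THE Y. op_solution E \<zeta> Y \<and> op_bv1 E Y 0 = A \<and> op_bv2 E Y 0 = B) = osol \<zeta> K"
  proof (rule the_equality)
    show "op_solution E \<zeta> (osol \<zeta> K) \<and> op_bv1 E (osol \<zeta> K) 0 = A \<and> op_bv2 E (osol \<zeta> K) 0 = B"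
      by (intro conjI op_solution_osol(1) Kc blinfun_eqI) (simp_all add: op_bv_osol [OF Kc] K)
    then show "Y = osol \<zeta> K" if "op_solution E \<zeta> Y \<and> op_bv1 E Y 0 = A \<and> op_bv2 E Y 0 = B" for Y
      using that by (intro op_solution_unique) auto
  qed
  then show ?thesis using t by (simp add: osol_def K)
qed

lemma clinear_op_id: "clinear_op id_blinfun" and clinear_op_zero: "clinear_op 0"
  by (simp_all add: clinear_op_def)

lemma c_sol_apply: "t \<in> ivl E \<Longrightarrow> blinfun_apply (c_sol E \<zeta> t) v = prj0 (blinfun_apply (fsol \<zeta> t) (v, 0))"
  and s_sol_apply: "t \<in> ivl E \<Longrightarrow> blinfun_apply (s_sol E \<zeta> t) v = prj0 (blinfun_apply (fsol \<zeta> t) (0, v))"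
  unfolding c_sol_def s_sol_def by (simp_all add: THE_op_solution clinear_op_id clinear_op_zero)

section \<open>Boundary triplet and Weyl function\<close>

lemma defect_space_state:
  assumes y: "y \<in> defect_space E \<zeta>" and t: "t \<in> ivl E"
  shows "st y t = blinfun_apply (fsol \<zeta> t) (st y 0)" "y t = prj0 (blinfun_apply (fsol \<zeta> t) (st y 0))"
proof -
  have ym: "y \<in> maxdom E" and "AE t in leb E. l_expr E y t = \<zeta> *\<^sub>C y t" using y by (auto simp: defect_space_def)
  then obtain M where "negligible M" "\<And>t. t \<in> ivl E - M \<Longrightarrow> l_expr E y t = \<zeta> *\<^sub>C prj0 (st y t)"
    unfolding AE_ivl prj0_st by blast
  then have "sys_solution (st y) (\<lambda>t. \<zeta> *\<^sub>C prj0 (st y t))" by (rule sys_solution_cong [OF sys_solution_maxdom [OF ym]])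
  then show st: "st y t = blinfun_apply (fsol \<zeta> t) (st y 0)" by (rule sys_solution_eigen [OF _ t])
  show "y t = prj0 (blinfun_apply (fsol \<zeta> t) (st y 0))" unfolding st [symmetric] prj0_st ..
qed

lemma defect_space_of_fsol:
  assumes "(\<lambda>t. prj0 (blinfun_apply (fsol \<zeta> t) k)) \<in> L2 E"
  defines "y \<equiv> \<lambda>t. if t \<in> ivl E then prj0 (blinfun_apply (fsol \<zeta> t) k) else 0"
  shows "y \<in> defect_space E \<zeta>" "st y 0 = k"
proof -
  note y = maxdom_of_sys_solution [OF sys_solution_fsol L2_scaleC [OF assms(1)] assms(1), folded y_def]
  obtain M where M: "negligible M" "\<And>t. t \<in> ivl E - M \<Longrightarrow> l_expr E y t = \<zeta> *\<^sub>C prj0 (blinfun_apply (fsol \<zeta> t) k)"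
    using y(3) unfolding AE_ivl by blast
  then have "AE t in leb E. l_expr E y t = \<zeta> *\<^sub>C y t"
    unfolding AE_ivl by (intro exI [of _ M]) (auto simp: y_def)
  then show "y \<in> defect_space E \<zeta>" using y(1) by (simp add: defect_space_def)
  show "st y 0 = k" using y(2) [OF zero_in_ivl] by simp
qed

lemma bv_lincomb:
  assumes "y \<in> maxdom E" "z \<in> maxdom E"
  shows "bv1 E (\<lambda>t. a *\<^sub>C y t + b *\<^sub>C z t) 0 = a *\<^sub>C bv1 E y 0 + b *\<^sub>C (bv1 E z 0 :: ('h, 'n) vec)"
    "bv2 E (\<lambda>t. a *\<^sub>C y t + b *\<^sub>C z t) 0 = a *\<^sub>C bv2 E y 0 + b *\<^sub>C (bv2 E z 0 :: ('h, 'n) vec)"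
  using arg_cong [OF maxdom_lincomb(2) [OF assms, of a b], of fst] arg_cong [OF maxdom_lincomb(2) [OF assms, of a b], of snd]
  by (simp_all add: fst_st snd_st scaleC_prod_def)

lemma state_lift: "\<exists>y\<in>maxdom E. bv1 E y 0 = (u :: ('h, 'n) vec) \<and> bv2 E y 0 = (v :: ('h, 'n) vec)"
proof -
  obtain c C where lift: "\<And>h. \<exists>y\<in>maxdom E. st y 0 = h \<and> (\<forall>t\<in>ivl E. c \<le> t \<longrightarrow> st y t = 0) \<and>
      l2_norm E y \<le> C * norm h \<and> l2_norm E (l_expr E y) \<le> C * norm h"
    by (rule lift_exists) blast
  then obtain y where "y \<in> maxdom E" "st y 0 = (u, v)" by blast
  then show ?thesis by (auto simp: st_def)
qed

end

locale limit_point_expr = regular_expr E N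
  for E :: "'h :: {complex_hilbert, second_countable_topology} dexpr" and N :: "'n :: {finite, linorder} itself" +
  assumes indices: "deficiency_indices_b TYPE('n) E 0 0"
begin

lemmas defect_zero = boundary_defect_eq_zero [OF indices]

abbreviation \<Gamma>0 :: "(real \<Rightarrow> 'h) \<Rightarrow> ('h, 'n) vec" where "\<Gamma>0 \<equiv> \<lambda>y. bv2 E y 0"
abbreviation \<Gamma>1 :: "(real \<Rightarrow> 'h) \<Rightarrow> ('h, 'n) vec" where "\<Gamma>1 \<equiv> \<lambda>y. - bv1 E y 0"

lemma green:
  assumes "y \<in> maxdom E" "z \<in> maxdom E"
  shows "l2_inner E (l_expr E y) z - l2_inner E y (l_expr E z) = cinner (\<Gamma>1 y) (\<Gamma>0 z) - cinner (\<Gamma>0 y) (\<Gamma>1 z)"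
  using defect_zero [OF assms]
  by (simp add: boundary_defect_def bform_def fst_st snd_st cinner_algebra add_eq_0_iff2)

lemma clinear_\<Gamma>: "clinear_on_maxdom E \<Gamma>0" "clinear_on_maxdom E \<Gamma>1"
  by (simp_all add: clinear_on_maxdom_def bv_lincomb scaleC_minus_right)

lemma boundary_triplet_\<Gamma>: "boundary_triplet E \<Gamma>0 \<Gamma>1"
  unfolding boundary_triplet_def
proof (intro conjI clinear_\<Gamma> ballI green)
  have "(a, b) \<in> (\<lambda>y. (\<Gamma>0 y, \<Gamma>1 y)) ` maxdom E" for a b
    using state_lift [of "- b" a] by force
  then show "(\<lambda>y. (\<Gamma>0 y, \<Gamma>1 y)) ` maxdom E = UNIV" by auto
qed

lemma decomposing_triplet_\<Gamma>: "decomposing_triplet E (\<lambda>y. (\<Gamma>0 y, ())) (\<lambda>y. (\<Gamma>1 y, ()))"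
  unfolding decomposing_triplet_def boundary_triplet_def
proof (intro conjI ballI)
  show "clinear_on_maxdom E (\<lambda>y. (\<Gamma>0 y, ()))" "clinear_on_maxdom E (\<lambda>y. (\<Gamma>1 y, ()))"
    using clinear_\<Gamma> by (simp_all add: clinear_on_maxdom_def scaleC_prod_def)
  have "((a, ()), (b, ())) \<in> (\<lambda>y. ((\<Gamma>0 y, ()), (\<Gamma>1 y, ()))) ` maxdom E" for a b
    using state_lift [of "- b" a] by force
  then show "(\<lambda>y. ((\<Gamma>0 y, ()), (\<Gamma>1 y, ()))) ` maxdom E = UNIV" by auto
qed (simp_all add: green cinner_prod_def cinner_unit_def)

text \<open>By Green's formula for the initial values alone, the remaining boundary maps have a
  vanishing form. Elements with \<open>\<Psi>1 y = (0, x)\<close> and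
  \<open>\<Psi>0 z = (0, x)\<close>, other values zero, exist by surjectivity and force
  \<open>cinner x x = 0\<close>.\<close>

lemma decomposing_triplet_unique:
  fixes \<Psi>0 \<Psi>1 :: "(real \<Rightarrow> 'h) \<Rightarrow> ('h, 'n) vec \<times> 'k :: complex_hilbert"
  assumes \<Psi>: "decomposing_triplet E \<Psi>0 \<Psi>1"
  shows "(UNIV :: 'k set) = {0}" "y \<in> maxdom E \<Longrightarrow> \<Psi>0 y = (\<Gamma>0 y, 0) \<and> \<Psi>1 y = (\<Gamma>1 y, 0)"
proof -
  have fst: "fst (\<Psi>0 y) = \<Gamma>0 y" "fst (\<Psi>1 y) = \<Gamma>1 y" if "y \<in> maxdom E" for y
    using \<Psi> that by (simp_all add: decomposing_triplet_def)
  have snd: "cinner (snd (\<Psi>1 y)) (snd (\<Psi>0 z)) = cinner (snd (\<Psi>0 y)) (snd (\<Psi>1 z))"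
    if "y \<in> maxdom E" "z \<in> maxdom E" for y z
  proof -
    have "l2_inner E (l_expr E y) z - l2_inner E y (l_expr E z) = cinner (\<Psi>1 y) (\<Psi>0 z) - cinner (\<Psi>0 y) (\<Psi>1 z)"
      using \<Psi> that by (simp add: decomposing_triplet_def boundary_triplet_def)
    then show ?thesis unfolding green [OF that] cinner_prod_def fst [OF that(1)] fst [OF that(2)] by simp
  qed
  have surj: "\<exists>y\<in>maxdom E. \<Psi>0 y = a \<and> \<Psi>1 y = b" for a b
  proof -
    have "(a, b) \<in> (\<lambda>y. (\<Psi>0 y, \<Psi>1 y)) ` maxdom E"
      using \<Psi> by (simp add: decomposing_triplet_def boundary_triplet_def)
    then show ?thesis by auto
  qed
  have zero: "x = 0" for x :: 'k
  proof -
    obtain y where y: "y \<in> maxdom E" "\<Psi>0 y = 0" "\<Psi>1 y = (0, x)" using surj by blast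
    obtain z where z: "z \<in> maxdom E" "\<Psi>0 z = (0, x)" "\<Psi>1 z = 0" using surj by blast
    show ?thesis using snd [OF y(1) z(1)] by (simp add: y z cinner_self)
  qed
  then show "(UNIV :: 'k set) = {0}" by auto
  show "\<Psi>0 y = (\<Gamma>0 y, 0) \<and> \<Psi>1 y = (\<Gamma>1 y, 0)" if "y \<in> maxdom E"
    using fst [OF that] zero [of "snd (\<Psi>0 y)"] zero [of "snd (\<Psi>1 y)"] by (metis prod.collapse)
qed

lemma A_zero_\<Gamma>: "A_zero E \<Gamma>0 = L_restr E {y \<in> maxdom E. bv2 E y 0 = (0 :: ('h, 'n) vec)}"
  by (simp add: A_zero_def)

context
  fixes \<zeta> :: complex
  assumes \<zeta>: "\<zeta> \<in> l2_resolvent_set E (A_zero E \<Gamma>0)"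
begin

text \<open>The difference lies in the kernel of \<open>A_zero - \<zeta>\<close> and is null by the
  resolvent bound. This is equality almost everywhere; equality of functions follows once the
  initial states agree.\<close>

lemma defect_injective:
  assumes y: "y \<in> defect_space E \<zeta>" and z: "z \<in> defect_space E \<zeta>" and eq: "\<Gamma>0 y = \<Gamma>0 z"
  shows "y = z"
proof -
  have ym: "y \<in> maxdom E" "AE t in leb E. l_expr E y t = \<zeta> *\<^sub>C y t" and zm: "z \<in> maxdom E" "AE t in leb E. l_expr E z t = \<zeta> *\<^sub>C z t"
    using y z by (auto simp: defect_space_def)
  define x where "x t = 1 *\<^sub>C y t + (- 1) *\<^sub>C z t" for t
  note xl = maxdom_lincomb [OF ym(1) zm(1), of 1 "- 1", folded x_def [abs_def]]
  have xm: "x \<in> maxdom E" by (rule xl(1))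
  note L = maxdom_L2 [OF xm]
  have lx: "AE t in leb E. l_expr E x t = \<zeta> *\<^sub>C x t"
    using xl(3) ym(2) zm(2) by eventually_elim (simp add: x_def scaleC_minus_left scaleC_diff_right)
  have "snd (st x 0) = 0" using eq by (simp add: xl(2) scaleC_minus_left scaleC_prod_def snd_st)
  then have xA: "(x, l_expr E x) \<in> A_zero E \<Gamma>0"
    unfolding A_zero_\<Gamma> L_restr_def using L xm by (auto simp: snd_st)
  obtain C where C: "\<And>u f. (u, f) \<in> A_zero E \<Gamma>0 \<Longrightarrow> l2_norm E u \<le> C * l2_norm E (\<lambda>t. f t - \<zeta> *\<^sub>C u t)"
    using \<zeta> unfolding l2_resolvent_set_def by blast
  have "l2_norm E (\<lambda>t. l_expr E x t - \<zeta> *\<^sub>C x t) = 0"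
    using lx by (subst l2_norm_eq_zero_iff) (auto intro: L2_diff_scaleC L elim: eventually_mono)
  then have "l2_norm E x = 0" using C [OF xA] l2_norm_nonneg [of E x] by simp
  then have x0: "AE t in leb E. x t = 0" by (simp add: l2_norm_eq_zero_iff [OF L(1)])
  have lx0: "AE t in leb E. l_expr E x t = 0" using lx x0 by eventually_elim simp
  \<comment> \<open>Both L2 products in the boundary form vanish for a null function, so its initial
    state is orthogonal under \<open>bform\<close> to every state that a domain element can
    have.\<close>
  have "st x 0 = 0"
  proof (rule bform_nondegenerate)
    fix k :: "('h, 'n) state"
    obtain w where w: "w \<in> maxdom E" "st w 0 = k" using state_lift [of "fst k" "snd k"] by (auto simp: st_def)
    have "l2_inner E (l_expr E x) w = l2_inner E (\<lambda>t. 0) w"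
      by (rule l2_inner_cong_left [OF lx0 L(2) L2_zero maxdom_L2(1) [OF w(1)]])
    moreover have "l2_inner E x (l_expr E w) = l2_inner E (\<lambda>t. 0) (l_expr E w)"
      by (rule l2_inner_cong_left [OF x0 L(1) L2_zero maxdom_L2(2) [OF w(1)]])
    ultimately show "bform (st x 0) k = 0"
      using defect_zero [OF xm w(1)] by (simp add: boundary_defect_def w(2) l2_inner_def)
  qed
  then have st: "st y 0 = st z 0" by (simp add: xl(2) scaleC_minus_left)
  show "y = z"
  proof
    fix t show "y t = z t"
      using defect_space_state(2) [OF y, of t] defect_space_state(2) [OF z, of t] st
        maxdom_outside [OF ym(1), of t] maxdom_outside [OF zm(1), of t] by (cases "t \<in> ivl E") simp_all
  qed
qed

text \<open>A lift \<open>Y\<close> of the initial state \<open>(0, h)\<close> is corrected by the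
  resolvent applied to \<open>(L - \<zeta>) Y\<close>; the correction has vanishing second initial
  value, so \<open>h\<close> is kept.\<close>

lemma defect_surjective:
  "\<exists>C\<ge>0. \<forall>h. \<exists>y\<in>defect_space E \<zeta>. \<Gamma>0 y = h \<and> l2_norm E y \<le> C * norm h \<and> norm (bv1 E y 0 :: ('h, 'n) vec) \<le> C * norm h"
proof -
  obtain c C where C: "0 \<le> C" and lift: "\<And>h. \<exists>y\<in>maxdom E. st y 0 = h \<and> (\<forall>t\<in>ivl E. c \<le> t \<longrightarrow> st y t = 0) \<and>
      l2_norm E y \<le> C * norm h \<and> l2_norm E (l_expr E y) \<le> C * norm h"
    by (rule lift_exists) blast
  obtain R where R: "\<And>u f. (u, f) \<in> A_zero E \<Gamma>0 \<Longrightarrow> l2_norm E u \<le> R * l2_norm E (\<lambda>t. f t - \<zeta> *\<^sub>C u t)"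
    and onto: "\<And>g. g \<in> L2 E \<Longrightarrow> \<exists>u f. (u, f) \<in> A_zero E \<Gamma>0 \<and> (AE t in leb E. f t - \<zeta> *\<^sub>C u t = g t)"
    using \<zeta> unfolding l2_resolvent_set_def by blast
  \<comment> \<open>\<open>C1\<close> adds the lift and its resolvent correction; the modulus of
    \<open>R\<close> is taken because the bound in \<open>l2_resolvent_set\<close> may have any
    sign. \<open>C2\<close> comes from Green's formula below.\<close>
  define C1 where "C1 = C + \<bar>R\<bar> * (C + cmod \<zeta> * C)"
  define C2 where "C2 = (cmod \<zeta> * C + C) * C1"
  have C12: "0 \<le> C1" "0 \<le> C2" using C by (simp_all add: C1_def C2_def)
  have "\<exists>y\<in>defect_space E \<zeta>. \<Gamma>0 y = h \<and> l2_norm E y \<le> C1 * norm h \<and> norm (bv1 E y 0 :: ('h, 'n) vec) \<le> C2 * norm h" for h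
  proof -
    obtain Y where Y: "Y \<in> maxdom E" "st Y 0 = (0, h)" "l2_norm E Y \<le> C * norm h" "l2_norm E (l_expr E Y) \<le> C * norm h"
      using lift [of "(0, h)"] by (auto simp: norm_Pair)
    note LY = maxdom_L2 [OF Y(1)]
    obtain u f where uf: "(u, f) \<in> A_zero E \<Gamma>0" "AE t in leb E. f t - \<zeta> *\<^sub>C u t = l_expr E Y t - \<zeta> *\<^sub>C Y t"
      using onto [OF L2_diff_scaleC [OF LY(2,1)]] by blast
    obtain x where x: "x \<in> maxdom E" "snd (st x 0) = 0" "AE t in leb E. u t = x t" "AE t in leb E. f t = l_expr E x t"
      and L: "u \<in> L2 E" "f \<in> L2 E"
      using uf(1) unfolding A_zero_\<Gamma> L_restr_def by (auto simp: snd_st)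
    define y where "y t = 1 *\<^sub>C Y t + (- 1) *\<^sub>C x t" for t
    note yl = maxdom_lincomb [OF Y(1) x(1), of 1 "- 1", folded y_def [abs_def]]
    have ly: "AE t in leb E. l_expr E y t = \<zeta> *\<^sub>C y t"
      using yl(3) uf(2) x(3,4)
    proof eventually_elim
      case (elim t)
      then have "l_expr E Y t = l_expr E x t - \<zeta> *\<^sub>C x t + \<zeta> *\<^sub>C Y t" by simp
      then show ?case using elim(1) by (simp add: y_def scaleC_minus_left scaleC_diff_right)
    qed
    then have yd: "y \<in> defect_space E \<zeta>" using yl(1) by (simp add: defect_space_def)
    note Ly = maxdom_L2 [OF yl(1)]
    have y2: "\<Gamma>0 y = h" using x(2) by (simp add: snd_st [symmetric] yl(2) Y(2) scaleC_prod_def scaleC_minus_left)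
    have "l2_norm E (\<lambda>t. f t - \<zeta> *\<^sub>C u t) = l2_norm E (\<lambda>t. l_expr E Y t - \<zeta> *\<^sub>C Y t)"
      by (rule l2_norm_cong_AE [OF uf(2)]) (intro L2_diff_scaleC L LY)+
    also have "\<dots> \<le> l2_norm E (l_expr E Y) + l2_norm E (\<lambda>t. \<zeta> *\<^sub>C Y t)"
      by (rule l2_norm_triangle_diff [OF LY(2) L2_scaleC [OF LY(1)]])
    also have "\<dots> \<le> C * norm h + cmod \<zeta> * (C * norm h)"
      unfolding l2_norm_scaleC using Y by (intro add_mono mult_left_mono) auto
    finally have "l2_norm E (\<lambda>t. f t - \<zeta> *\<^sub>C u t) \<le> (C + cmod \<zeta> * C) * norm h" by (simp add: algebra_simps)
    then have "\<bar>R\<bar> * l2_norm E (\<lambda>t. f t - \<zeta> *\<^sub>C u t) \<le> \<bar>R\<bar> * ((C + cmod \<zeta> * C) * norm h)" by (rule mult_left_mono) simp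
    moreover have "R * l2_norm E (\<lambda>t. f t - \<zeta> *\<^sub>C u t) \<le> \<bar>R\<bar> * l2_norm E (\<lambda>t. f t - \<zeta> *\<^sub>C u t)"
      by (intro mult_right_mono l2_norm_nonneg) simp
    ultimately have "l2_norm E u \<le> \<bar>R\<bar> * ((C + cmod \<zeta> * C) * norm h)" using R [OF uf(1)] by linarith
    moreover have "l2_norm E x = l2_norm E u"
      by (rule l2_norm_cong_AE) (use x L maxdom_L2 [OF x(1)] in \<open>auto elim: eventually_mono\<close>)
    moreover have "l2_norm E y \<le> l2_norm E Y + l2_norm E x"
      using l2_norm_triangle_diff [OF LY(1) maxdom_L2(1) [OF x(1)]] by (simp add: y_def [abs_def] scaleC_minus_left)
    ultimately have ny: "l2_norm E y \<le> C1 * norm h" using Y(3) by (simp add: C1_def algebra_simps)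
    \<comment> \<open>To bound the first initial value \<open>b\<close> of \<open>y\<close>, Green's
      formula is applied with a lift \<open>w\<close> of \<open>(0, b)\<close>: the term at 0 is
      \<open>(norm b)^2\<close>, and both L2 products are at most a multiple of
      \<open>norm h * norm b\<close>.\<close>
    define b where "b = (bv1 E y 0 :: ('h, 'n) vec)"
    obtain w where w: "w \<in> maxdom E" "st w 0 = (0, b)" "l2_norm E w \<le> C * norm b" "l2_norm E (l_expr E w) \<le> C * norm b"
      using lift [of "(0, b)"] by (auto simp: norm_Pair)
    note Lw = maxdom_L2 [OF w(1)]
    have "l2_inner E (l_expr E y) w = \<zeta> * l2_inner E y w"
      using l2_inner_cong_left [OF ly Ly(2) L2_scaleC [OF Ly(1)] Lw(1)] l2_inner_lincomb_left [OF Ly(1) Ly(1) Lw(1), of \<zeta> 0] by simp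
    moreover have "bform (st y 0) (st w 0) = of_real ((norm b)\<^sup>2)"
      by (simp add: bform_def w(2) fst_st b_def [symmetric] cinner_self)
    ultimately have "complex_of_real ((norm b)\<^sup>2) = l2_inner E y (l_expr E w) - \<zeta> * l2_inner E y w"
      using defect_zero [OF yl(1) w(1)] by (simp add: boundary_defect_def add_eq_0_iff)
    then have "(norm b)\<^sup>2 = cmod (l2_inner E y (l_expr E w) - \<zeta> * l2_inner E y w)"
      by (metis norm_of_real abs_power2 abs_norm_cancel power2_abs)
    also have "\<dots> \<le> cmod (l2_inner E y (l_expr E w)) + cmod \<zeta> * cmod (l2_inner E y w)"
      using norm_triangle_ineq4 by (metis norm_mult)
    also have "\<dots> \<le> l2_norm E y * l2_norm E (l_expr E w) + cmod \<zeta> * (l2_norm E y * l2_norm E w)"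
      by (intro add_mono mult_left_mono l2_cauchy_schwarz Ly Lw) simp
    also have "\<dots> \<le> (C1 * norm h) * (C * norm b) + cmod \<zeta> * ((C1 * norm h) * (C * norm b))"
      using C12 C by (intro add_mono mult_left_mono mult_mono ny w l2_norm_nonneg) simp_all
    also have "\<dots> = (C2 * norm h) * norm b" by (simp add: C2_def algebra_simps)
    finally have "norm b * norm b \<le> (C2 * norm h) * norm b" by (simp add: power2_eq_square)
    then have "norm b \<le> C2 * norm h" using C12(2) by (cases "b = 0") auto
    then show ?thesis using yd y2 ny unfolding b_def by blast
  qed
  moreover have "C1 * r \<le> max C1 C2 * r" "C2 * r \<le> max C1 C2 * r" if "0 \<le> r" for r
    using that by (simp_all add: mult_right_mono)
  ultimately show ?thesis
    using C12 by (intro exI [of _ "max C1 C2"] conjI allI) (meson le_max_iff_disj, meson norm_ge_zero order_trans)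
qed

section \<open>The \<gamma>-field, the Weyl function and the m-function\<close>

lemma bij_\<Gamma>0: "bij_betw \<Gamma>0 (defect_space E \<zeta>) UNIV"
proof (rule bij_betw_imageI)
  show "inj_on \<Gamma>0 (defect_space E \<zeta>)" by (intro inj_onI defect_injective)
  have "\<exists>y\<in>defect_space E \<zeta>. \<Gamma>0 y = h" for h using defect_surjective by blast
  then show "\<Gamma>0 ` defect_space E \<zeta> = UNIV" by (auto simp: image_iff eq_commute)
qed

abbreviation \<gamma> where "\<gamma> \<equiv> gamma_field E \<Gamma>0 \<zeta>"

lemma \<gamma>_defect: "\<gamma> h \<in> defect_space E \<zeta>" and \<Gamma>0_\<gamma>: "\<Gamma>0 (\<gamma> h) = h"
  and \<gamma>_eq: "y \<in> defect_space E \<zeta> \<Longrightarrow> \<gamma> (\<Gamma>0 y) = y"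
proof -
  show "\<gamma> h \<in> defect_space E \<zeta>"
    unfolding gamma_field_def using bij_\<Gamma>0 by (intro the_inv_into_into) (auto simp: bij_betw_def)
  show "\<Gamma>0 (\<gamma> h) = h"
    unfolding gamma_field_def by (rule f_the_inv_into_f_bij_betw [OF bij_\<Gamma>0]) simp
  show "y \<in> defect_space E \<zeta> \<Longrightarrow> \<gamma> (\<Gamma>0 y) = y"
    unfolding gamma_field_def using bij_\<Gamma>0 by (intro the_inv_into_f_f) (auto simp: bij_betw_def)
qed

text \<open>The candidate for the Weyl function and for the m-function; the bound in
  \<open>defect_surjective\<close> makes it an operator, so that the definite description of
  \<open>weyl_function\<close> can be evaluated.\<close>

definition mop :: "('h, 'n) vec \<Rightarrow>\<^sub>L ('h, 'n) vec" where
  "mop = Blinfun (\<lambda>h. \<Gamma>1 (\<gamma> h))"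

lemma \<gamma>_bounded: "\<exists>C. \<forall>h. l2_norm E (\<gamma> h) \<le> C * norm h"
  and mop_apply: "blinfun_apply mop h = \<Gamma>1 (\<gamma> h)"
  and mop_clinear: "clinear_op mop"
proof -
  obtain C where C: "\<And>h. \<exists>y\<in>defect_space E \<zeta>. \<Gamma>0 y = h \<and> l2_norm E y \<le> C * norm h \<and> norm (bv1 E y 0 :: ('h, 'n) vec) \<le> C * norm h"
    using defect_surjective by blast
  have b: "l2_norm E (\<gamma> h) \<le> C * norm h" "norm (\<Gamma>1 (\<gamma> h)) \<le> C * norm h" for h
  proof -
    obtain y where y: "y \<in> defect_space E \<zeta>" "\<Gamma>0 y = h" "l2_norm E y \<le> C * norm h" "norm (bv1 E y 0 :: ('h, 'n) vec) \<le> C * norm h"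
      using C by blast
    have "\<gamma> h = y" using \<gamma>_eq [OF y(1)] y(2) by simp
    then show "l2_norm E (\<gamma> h) \<le> C * norm h" "norm (\<Gamma>1 (\<gamma> h)) \<le> C * norm h" using y by simp_all
  qed
  then show "\<exists>C. \<forall>h. l2_norm E (\<gamma> h) \<le> C * norm h" by blast
  have lin: "\<Gamma>1 (\<gamma> (a *\<^sub>C h + b *\<^sub>C k)) = a *\<^sub>C \<Gamma>1 (\<gamma> h) + b *\<^sub>C \<Gamma>1 (\<gamma> k)" for a b h k
  proof -
    have m: "\<gamma> h \<in> maxdom E" "\<gamma> k \<in> maxdom E" using \<gamma>_defect by (auto simp: defect_space_def)
    define y where "y t = a *\<^sub>C \<gamma> h t + b *\<^sub>C \<gamma> k t" for t
    note yl = maxdom_lincomb [OF m, of a b, folded y_def [abs_def]]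
    have d: "AE t in leb E. l_expr E (\<gamma> h) t = \<zeta> *\<^sub>C \<gamma> h t" "AE t in leb E. l_expr E (\<gamma> k) t = \<zeta> *\<^sub>C \<gamma> k t"
      using \<gamma>_defect by (auto simp: defect_space_def)
    have "AE t in leb E. l_expr E y t = \<zeta> *\<^sub>C y t"
      using yl(3) d by eventually_elim (simp add: y_def scaleC_add_right scaleC_scaleC mult.commute)
    then have "y \<in> defect_space E \<zeta>" using yl(1) by (simp add: defect_space_def)
    moreover have "\<Gamma>0 y = a *\<^sub>C h + b *\<^sub>C k" unfolding y_def bv_lincomb(2) [OF m] by (simp add: \<Gamma>0_\<gamma>)
    ultimately have "\<gamma> (a *\<^sub>C h + b *\<^sub>C k) = y" using \<gamma>_eq [of y] by simp
    then show ?thesis unfolding y_def bv_lincomb(1) [OF m] by (simp add: y_def bv_lincomb(1) [OF m] scaleC_minus_right)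
  qed
  have "bounded_linear (\<lambda>h. \<Gamma>1 (\<gamma> h))"
  proof (rule bounded_linear_intro [where K = C])
    show "\<Gamma>1 (\<gamma> (h + k)) = \<Gamma>1 (\<gamma> h) + \<Gamma>1 (\<gamma> k)" for h k using lin [of 1 h 1 k] by simp
    show "\<Gamma>1 (\<gamma> (r *\<^sub>R h)) = r *\<^sub>R \<Gamma>1 (\<gamma> h)" for r h
      using lin [of "of_real r" h 0 h] unfolding scaleR_scaleC by simp
    show "norm (\<Gamma>1 (\<gamma> h)) \<le> norm h * C" for h using b(2) [of h] by (simp add: mult.commute)
  qed
  then show app: "blinfun_apply mop h = \<Gamma>1 (\<gamma> h)" for h
    unfolding mop_def by (simp add: bounded_linear_Blinfun_apply)
  show "clinear_op mop" unfolding clinear_op_def using lin [of _ _ 0] by (simp add: app)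
qed

lemma st_\<gamma>: "st (\<gamma> h) 0 = (- blinfun_apply mop h, h)"
  by (simp add: st_def mop_apply \<Gamma>0_\<gamma>)

lemma \<gamma>_fsol: "t \<in> ivl E \<Longrightarrow> \<gamma> h t = prj0 (blinfun_apply (fsol \<zeta> t) (- blinfun_apply mop h, h))"
  using defect_space_state(2) [OF \<gamma>_defect, of t h] by (simp add: st_\<gamma>)

lemma \<gamma>_L2: "\<gamma> h \<in> L2 E"
  using \<gamma>_defect [of h] by (auto simp: defect_space_def maxdom_L2)

text \<open>A square integrable solution is the \<gamma>-field at its second initial value, which
  fixes its first initial value. Uniqueness of the square integrable operator solution and of
  \<open>m\<close> both reduce to this.\<close>

lemma fsol_L2_unique:
  assumes "(\<lambda>t. prj0 (blinfun_apply (fsol \<zeta> t) (a, h))) \<in> L2 E"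
  shows "a = - blinfun_apply mop h"
proof -
  define y where "y t = (if t \<in> ivl E then prj0 (blinfun_apply (fsol \<zeta> t) (a, h)) else 0)" for t
  note y = defect_space_of_fsol [OF assms, folded y_def]
  have "\<Gamma>0 y = h" using y(2) by (simp add: snd_st [symmetric])
  then have "\<gamma> h = y" using \<gamma>_eq [OF y(1)] by simp
  then have "(a, h) = (- blinfun_apply mop h, h)" using st_\<gamma> [of h] y(2) by simp
  then show ?thesis by simp
qed

lemma op_solution_L2:
  assumes v: "op_solution E \<zeta> v" "v \<in> op_L2 E" "op_bv2 E v 0 = (id_blinfun :: ('h, 'n) vec \<Rightarrow>\<^sub>L ('h, 'n) vec)"
  shows "op_bv1 E v 0 = - mop" "t \<in> ivl E \<Longrightarrow> blinfun_apply (v t) h = \<gamma> h t"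
proof -
  have eq: "blinfun_apply (v t) h = prj0 (blinfun_apply (fsol \<zeta> t) (blinfun_apply (op_bv1 E v 0) h, h))" if "t \<in> ivl E" for t h
    using op_solution_eq [OF v(1) that, of h] v(3) by simp
  have a: "blinfun_apply (op_bv1 E v 0) h = - blinfun_apply mop h" for h
  proof (rule fsol_L2_unique)
    have "(\<lambda>t. blinfun_apply (v t) h) \<in> L2 E" using v(2) by (simp add: op_L2_def)
    then show "(\<lambda>t. prj0 (blinfun_apply (fsol \<zeta> t) (blinfun_apply (op_bv1 E v 0) h, h))) \<in> L2 E"
      by (rule L2_cong_ivl) (simp add: eq)
  qed
  then show "op_bv1 E v 0 = - mop" by (intro blinfun_eqI) (simp add: blinfun.minus_left)
  show "t \<in> ivl E \<Longrightarrow> blinfun_apply (v t) h = \<gamma> h t" by (simp add: eq \<gamma>_fsol a)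
qed

lemma op_solution_L2_exists:
  "\<exists>!v. op_solution E \<zeta> v \<and> v \<in> op_L2 E \<and> op_bv2 E v 0 = (id_blinfun :: ('h, 'n) vec \<Rightarrow>\<^sub>L ('h, 'n) vec)"
proof (rule ex_ex1I)
  \<comment> \<open>The initial state is dictated by \<open>fsol_L2_unique\<close>; with it the
    operator solution applied to \<open>h\<close> is \<open>\<gamma> h\<close>.\<close>
  define K where "K = Blinfun (\<lambda>h. (- blinfun_apply mop h, h))"
  have K: "blinfun_apply K h = (- blinfun_apply mop h, h)" for h
    unfolding K_def by (subst bounded_linear_Blinfun_apply)
      (intro bounded_linear_Pair bounded_linear_minus blinfun.bounded_linear_right bounded_linear_ident, rule refl)
  have Kc: "clinear_op K"
    unfolding clinear_op_def by (simp add: K scaleC_prod_def clinear_op_scaleC [OF mop_clinear] scaleC_minus_right)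
  have s: "op_solution E \<zeta> (osol \<zeta> K)" by (rule op_solution_osol(1) [OF Kc])
  have "(\<lambda>t. blinfun_apply (osol \<zeta> K t) h) \<in> L2 E" for h
    by (rule L2_cong_ivl [OF \<gamma>_L2 [of h]]) (simp add: osol_def K \<gamma>_fsol)
  then have "osol \<zeta> K \<in> op_L2 E" using s by (simp add: op_L2_def op_solution_def)
  moreover have "op_bv2 E (osol \<zeta> K) 0 = id_blinfun"
    by (rule blinfun_eqI) (simp add: op_bv_osol [OF Kc] K)
  ultimately show "\<exists>v. op_solution E \<zeta> v \<and> v \<in> op_L2 E \<and> op_bv2 E v 0 = (id_blinfun :: ('h, 'n) vec \<Rightarrow>\<^sub>L ('h, 'n) vec)"
    using s by blast
next
  fix v w
  assume v: "op_solution E \<zeta> v \<and> v \<in> op_L2 E \<and> op_bv2 E v 0 = (id_blinfun :: ('h, 'n) vec \<Rightarrow>\<^sub>L ('h, 'n) vec)"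
    and w: "op_solution E \<zeta> w \<and> w \<in> op_L2 E \<and> op_bv2 E w 0 = (id_blinfun :: ('h, 'n) vec \<Rightarrow>\<^sub>L ('h, 'n) vec)"
  show "v = w" by (rule op_solution_unique [of \<zeta>]) (use v w op_solution_L2(1) in simp_all)
qed

lemma weyl_function_\<Gamma>: "weyl_function E \<Gamma>0 \<Gamma>1 \<zeta> = mop"
  unfolding weyl_function_def
proof (rule the_equality)
  have "\<Gamma>1 y = blinfun_apply mop (\<Gamma>0 y)" if "y \<in> defect_space E \<zeta>" for y
    by (simp add: mop_apply \<gamma>_eq [OF that])
  then show "clinear_op mop \<and> (\<forall>y\<in>defect_space E \<zeta>. \<Gamma>1 y = blinfun_apply mop (\<Gamma>0 y))"
    using mop_clinear by blast
  show "M = mop" if "clinear_op M \<and> (\<forall>y\<in>defect_space E \<zeta>. \<Gamma>1 y = blinfun_apply M (\<Gamma>0 y))" for M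
  proof (rule blinfun_eqI)
    fix h
    have "\<Gamma>1 (\<gamma> h) = blinfun_apply M (\<Gamma>0 (\<gamma> h))" using that \<gamma>_defect by blast
    then show "blinfun_apply M h = blinfun_apply mop h" by (simp add: \<Gamma>0_\<gamma> mop_apply)
  qed
qed

lemma m_function_\<Gamma>: "m_function E (\<lambda>y. (\<Gamma>0 y, ())) (\<lambda>y. (\<Gamma>1 y, ())) \<zeta> = mop"
proof -
  \<comment> \<open>On the boundary space enlarged by the zero space the Weyl function acts as
    \<open>mop\<close> on the first summand, so its upper left block is \<open>mop\<close>.\<close>
  define M where "M = Blinfun (\<lambda>x :: ('h, 'n) vec \<times> unit. (blinfun_apply mop (fst x), ()))"
  have "bounded_linear (\<lambda>x :: ('h, 'n) vec \<times> unit. (blinfun_apply mop (fst x), 0 :: unit))"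
    by (intro bounded_linear_Pair bounded_linear_compose [OF blinfun.bounded_linear_right bounded_linear_fst] bounded_linear_zero)
  then have M: "blinfun_apply M x = (blinfun_apply mop (fst x), ())" for x
    unfolding M_def by (simp add: bounded_linear_Blinfun_apply zero_unit_def)
  have "weyl_function E (\<lambda>y. (\<Gamma>0 y, ())) (\<lambda>y. (\<Gamma>1 y, ())) \<zeta> = M"
    unfolding weyl_function_def
  proof (rule the_equality)
    have "\<Gamma>1 y = blinfun_apply mop (\<Gamma>0 y)" if "y \<in> defect_space E \<zeta>" for y
      by (simp add: mop_apply \<gamma>_eq [OF that])
    then show "clinear_op M \<and> (\<forall>y\<in>defect_space E \<zeta>. (\<Gamma>1 y, ()) = blinfun_apply M (\<Gamma>0 y, ()))"
      by (simp add: clinear_op_def M scaleC_prod_def clinear_op_scaleC [OF mop_clinear])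
    show "M' = M" if M': "clinear_op M' \<and> (\<forall>y\<in>defect_space E \<zeta>. (\<Gamma>1 y, ()) = blinfun_apply M' (\<Gamma>0 y, ()))" for M'
    proof (rule blinfun_eqI)
      fix x :: "('h, 'n) vec \<times> unit"
      have "(\<Gamma>1 (\<gamma> (fst x)), ()) = blinfun_apply M' (\<Gamma>0 (\<gamma> (fst x)), ())" using M' \<gamma>_defect by blast
      then show "blinfun_apply M' x = blinfun_apply M x" by (cases x) (simp add: \<Gamma>0_\<gamma> M mop_apply)
    qed
  qed
  then show ?thesis by (simp add: m_function_def M blinfun_apply_inverse)
qed

text \<open>Applied to \<open>h\<close>, the combination is the solution with initial state
  \<open>(- blinfun_apply m' h, h)\<close>, which is square integrable for all \<open>h\<close>
  precisely when the first part is that of the \<gamma>-field.\<close>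

lemma c_s_L2_iff:
  assumes m': "clinear_op m'"
  shows "(\<lambda>t. - (c_sol E \<zeta> t o\<^sub>L m') + s_sol E \<zeta> t) \<in> op_L2 E \<longleftrightarrow> m' = mop"
proof -
  define V where "V t = - (c_sol E \<zeta> t o\<^sub>L m') + s_sol E \<zeta> t" for t
  have V: "blinfun_apply (V t) h = prj0 (blinfun_apply (fsol \<zeta> t) (- blinfun_apply m' h, h))" if "t \<in> ivl E" for t h
  proof -
    have "(- blinfun_apply m' h, h) = - (blinfun_apply m' h, 0) + (0, h)" by simp
    then have "blinfun_apply (fsol \<zeta> t) (- blinfun_apply m' h, h) =
        - blinfun_apply (fsol \<zeta> t) (blinfun_apply m' h, 0) + blinfun_apply (fsol \<zeta> t) (0, h)"
      by (simp only: blinfun.add_right blinfun.minus_right)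
    then show ?thesis
      using that by (simp add: V_def blinfun.add_left blinfun.minus_left blinfun.diff_left c_sol_apply s_sol_apply blinfun.diff_right)
  qed
  have cl: "clinear_op (V t)" if "t \<in> ivl E" for t
    unfolding clinear_op_def
  proof (intro allI)
    fix c h
    have "(- blinfun_apply m' (c *\<^sub>C h), c *\<^sub>C h) = c *\<^sub>C (- blinfun_apply m' h, h)"
      by (simp add: scaleC_prod_def clinear_op_scaleC [OF m'] scaleC_minus_right)
    then show "blinfun_apply (V t) (c *\<^sub>C h) = c *\<^sub>C blinfun_apply (V t) h"
      by (simp add: V [OF that] fsol_clinear [OF that] prj_clinear)
  qed
  have "V \<in> op_L2 E \<longleftrightarrow> m' = mop"
  proof
    assume "V \<in> op_L2 E"
    then have VL: "(\<lambda>t. blinfun_apply (V t) h) \<in> L2 E" for h by (simp add: op_L2_def)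
    show "m' = mop"
    proof (rule blinfun_eqI)
      fix h
      have "- blinfun_apply m' h = - blinfun_apply mop h"
        by (rule fsol_L2_unique, rule L2_cong_ivl [OF VL [of h]]) (simp add: V)
      then show "blinfun_apply m' h = blinfun_apply mop h" by simp
    qed
  next
    assume "m' = mop"
    then have "(\<lambda>t. blinfun_apply (V t) h) \<in> L2 E" for h
      by (intro L2_cong_ivl [OF \<gamma>_L2 [of h]]) (simp add: V \<gamma>_fsol)
    then show "V \<in> op_L2 E" using cl by (simp add: op_L2_def)
  qed
  then show ?thesis by (simp add: V_def [abs_def])
qed

end

end


text \<open>The boundary space H^n is seen as a decomposing one by adding the zero space
  \<open>unit\<close>, and uniqueness is asserted against an arbitrary second summand
  \<open>'k\<close>. The bijection and the bound in the second part say that the \<gamma>-field is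
  an inverse map in the proper sense and a bounded operator.\<close>

theorem proposition5p16:
  fixes E :: "'h :: {complex_hilbert, second_countable_topology} dexpr"
    and \<Gamma>0 \<Gamma>1 :: "(real \<Rightarrow> 'h) \<Rightarrow> ('h, 'n :: {finite, linorder}) vec"
    and \<Pi>0 \<Pi>1 :: "(real \<Rightarrow> 'h) \<Rightarrow> ('h, 'n) vec \<times> unit"
    and m :: "complex \<Rightarrow> ('h, 'n) vec \<Rightarrow>\<^sub>L ('h, 'n) vec"
  defines "\<Gamma>0 \<equiv> \<lambda>y. bv2 E y 0"
    and "\<Gamma>1 \<equiv> \<lambda>y. - bv1 E y 0"
    and "\<Pi>0 \<equiv> \<lambda>y. (\<Gamma>0 y, ())"
    and "\<Pi>1 \<equiv> \<lambda>y. (\<Gamma>1 y, ())"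
    and "m \<equiv> m_function E \<Pi>0 \<Pi>1"
  assumes expr: "valid_dexpr E"
    and order: "half_order E = CARD('n)"
    and indices: "deficiency_indices_b TYPE('n) E 0 0"
  shows
    "(boundary_triplet E \<Gamma>0 \<Gamma>1 \<and>
     decomposing_triplet E \<Pi>0 \<Pi>1 \<and>
     (\<forall>\<Psi>0 \<Psi>1 :: (real \<Rightarrow> 'h) \<Rightarrow> ('h, 'n) vec \<times> 'k :: complex_hilbert.
        decomposing_triplet E \<Psi>0 \<Psi>1 \<longrightarrow>
        (UNIV :: 'k set) = {0} \<and>
        (\<forall>y\<in>maxdom E. \<Psi>0 y = (\<Gamma>0 y, 0) \<and> \<Psi>1 y = (\<Gamma>1 y, 0))) \<and>
     A_zero E \<Gamma>0 = L_restr E {y \<in> maxdom E. bv2 E y 0 = (0 :: ('h, 'n) vec)} \<and>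
     l2_selfadjoint E (A_zero E \<Gamma>0))
    \<and>
    (\<forall>\<zeta>\<in>l2_resolvent_set E (A_zero E \<Gamma>0).
       bij_betw \<Gamma>0 (defect_space E \<zeta>) UNIV \<and>
       (\<exists>C. \<forall>h. l2_norm E (gamma_field E \<Gamma>0 \<zeta> h) \<le> C * norm h) \<and>
       (\<exists>!v. op_solution E \<zeta> v \<and> v \<in> op_L2 E \<and>
          op_bv2 E v 0 = (id_blinfun :: ('h, 'n) vec \<Rightarrow>\<^sub>L ('h, 'n) vec)) \<and>
       (\<forall>v. op_solution E \<zeta> v \<and> v \<in> op_L2 E \<and>
          op_bv2 E v 0 = (id_blinfun :: ('h, 'n) vec \<Rightarrow>\<^sub>L ('h, 'n) vec) \<longrightarrow>
          (\<forall>h. \<forall>t\<in>ivl E. gamma_field E \<Gamma>0 \<zeta> h t = blinfun_apply (v t) h)))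
    \<and>
    (\<forall>\<zeta>\<in>l2_resolvent_set E (A_zero E \<Gamma>0).
       clinear_op (m \<zeta>) \<and>
       (\<forall>m'. clinear_op m' \<longrightarrow>
          ((\<lambda>t. - (c_sol E \<zeta> t o\<^sub>L m') + s_sol E \<zeta> t) \<in> op_L2 E \<longleftrightarrow> m' = m \<zeta>)) \<and>
       (\<forall>v. op_solution E \<zeta> v \<and> v \<in> op_L2 E \<and>
          op_bv2 E v 0 = (id_blinfun :: ('h, 'n) vec \<Rightarrow>\<^sub>L ('h, 'n) vec) \<longrightarrow>
          m \<zeta> = - op_bv1 E v 0) \<and>
       weyl_function E \<Gamma>0 \<Gamma>1 \<zeta> = m \<zeta>)"
proof -
  interpret R: limit_point_expr E "TYPE('n)"
    using expr order indices by unfold_locales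
  note defs = \<Gamma>0_def \<Gamma>1_def \<Pi>0_def \<Pi>1_def m_def
  have triplet: "boundary_triplet E \<Gamma>0 \<Gamma>1" "decomposing_triplet E \<Pi>0 \<Pi>1"
    unfolding defs by (rule R.boundary_triplet_\<Gamma>, rule R.decomposing_triplet_\<Gamma>)
  have A0: "A_zero E \<Gamma>0 = L_restr E {y \<in> maxdom E. bv2 E y 0 = (0 :: ('h, 'n) vec)}"
    unfolding defs by (rule R.A_zero_\<Gamma>)
  have selfadjoint: "l2_selfadjoint E (A_zero E \<Gamma>0)"
    unfolding A0 by (rule R.A_zero_selfadjoint [OF R.defect_zero])
  show ?thesis
  proof (intro conjI ballI allI impI triplet A0 selfadjoint)
    fix \<Psi>0 \<Psi>1 :: "(real \<Rightarrow> 'h) \<Rightarrow> ('h, 'n) vec \<times> 'k" and y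
    assume \<Psi>: "decomposing_triplet E \<Psi>0 \<Psi>1"
    show "(UNIV :: 'k set) = {0}" by (rule R.decomposing_triplet_unique(1) [OF \<Psi>])
    assume "y \<in> maxdom E"
    note \<Psi>_y = R.decomposing_triplet_unique(2) [OF \<Psi> this]
    show "\<Psi>0 y = (\<Gamma>0 y, 0)" unfolding \<Gamma>0_def by (rule conjunct1 [OF \<Psi>_y])
    show "\<Psi>1 y = (\<Gamma>1 y, 0)" unfolding \<Gamma>1_def by (rule conjunct2 [OF \<Psi>_y])
  next
    fix \<zeta> assume "\<zeta> \<in> l2_resolvent_set E (A_zero E \<Gamma>0)"
    then have \<zeta>: "\<zeta> \<in> l2_resolvent_set E (A_zero E (\<lambda>y. bv2 E y 0 :: ('h, 'n) vec))" unfolding \<Gamma>0_def .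
    have m: "m \<zeta> = R.mop \<zeta>" unfolding defs by (rule R.m_function_\<Gamma> [OF \<zeta>])
    show "bij_betw \<Gamma>0 (defect_space E \<zeta>) UNIV" unfolding defs by (rule R.bij_\<Gamma>0 [OF \<zeta>])
    show "\<exists>C. \<forall>h. l2_norm E (gamma_field E \<Gamma>0 \<zeta> h) \<le> C * norm h" unfolding defs by (rule R.\<gamma>_bounded [OF \<zeta>])
    show "\<exists>!v. op_solution E \<zeta> v \<and> v \<in> op_L2 E \<and> op_bv2 E v 0 = (id_blinfun :: ('h, 'n) vec \<Rightarrow>\<^sub>L ('h, 'n) vec)"
      by (rule R.op_solution_L2_exists [OF \<zeta>])
    show "clinear_op (m \<zeta>)" unfolding m by (rule R.mop_clinear [OF \<zeta>])
    show "weyl_function E \<Gamma>0 \<Gamma>1 \<zeta> = m \<zeta>" unfolding m unfolding defs by (rule R.weyl_function_\<Gamma> [OF \<zeta>])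
    show "(\<lambda>t. - (c_sol E \<zeta> t o\<^sub>L m') + s_sol E \<zeta> t) \<in> op_L2 E \<longleftrightarrow> m' = m \<zeta>" if "clinear_op m'" for m'
      unfolding m by (rule R.c_s_L2_iff [OF \<zeta> that])
    fix v assume v: "op_solution E \<zeta> v \<and> v \<in> op_L2 E \<and> op_bv2 E v 0 = (id_blinfun :: ('h, 'n) vec \<Rightarrow>\<^sub>L ('h, 'n) vec)"
    then have v': "op_solution E \<zeta> v" "v \<in> op_L2 E" "op_bv2 E v 0 = (id_blinfun :: ('h, 'n) vec \<Rightarrow>\<^sub>L ('h, 'n) vec)"
      by blast+
    show "m \<zeta> = - op_bv1 E v 0" unfolding m by (simp add: R.op_solution_L2(1) [OF \<zeta> v'])
    show "gamma_field E \<Gamma>0 \<zeta> h t = blinfun_apply (v t) h" if "t \<in> ivl E" for h t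
      unfolding defs by (rule R.op_solution_L2(2) [OF \<zeta> v' that, symmetric])
  qed
qed

end
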